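(* Let $b>0$, $\sigma>0$, $x_0>0$ with $\sigma^2\le 2b$. For any $C>0$, the stochastic differential equation $$dX^C_t=(b-X^C_t\wedge C)\,dt+\sigma\sqrt{(X^C_t\vee 0)\wedge C}\,dW_t,\qquad X^C_0=x_0,\quad t\ge 0,$$ has a unique strong solution.
   Context: Here $x\wedge y=\min(x,y)$, $x\vee y=\max(x,y)$, and $W=(W_t)_{t\ge0}$ is a one-dimensional Wiener process adapted to the filtration of a complete filtered probability space $(\Omega,\mathcal{F},(\mathcal{F}_t)_{t\ge0},\mathsf{P})$. *)

theory Defs
  imports "HOL-Probability.Probability"
begin

text \<open>
  Stochastic processes are functions \<open>X :: real \<Rightarrow> 'a \<Rightarrow> real\<close> of which only the times \<open>t \<ge> 0\<close>
  matter. Likewise a filtration is a family \<open>F :: real \<Rightarrow> 'a measure\<close> of which only the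
  \<open>\<sigma>\<close>-algebras \<open>sets (F t)\<close> for \<open>t \<ge> 0\<close> matter; the library locale \<^locale>\<open>filtration\<close> is not used
  directly because it would also constrain negative times.
\<close>

text \<open>
  A filtered probability space is complete if the probability space is complete and \<open>F 0\<close>
  contains all null sets. Right-continuity of the filtration is not required.
\<close>

locale complete_filtered_prob_space = prob_space M + complete_measure M
  for M :: "'a measure" +
  fixes F :: "real \<Rightarrow> 'a measure"
  assumes space_filtration: "\<And>t. 0 \<le> t \<Longrightarrow> space (F t) = space M"
    and sets_filtration: "\<And>t. 0 \<le> t \<Longrightarrow> sets (F t) \<subseteq> sets M"
    and filtration_mono: "\<And>s t. 0 \<le> s \<Longrightarrow> s \<le> t \<Longrightarrow> sets (F s) \<subseteq> sets (F t)"
    and null_sets_filtration: "null_sets M \<subseteq> sets (F 0)"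

definition adapted :: "(real \<Rightarrow> 'a measure) \<Rightarrow> (real \<Rightarrow> 'a \<Rightarrow> real) \<Rightarrow> bool" where
  "adapted F X \<longleftrightarrow> (\<forall>t\<ge>0. X t \<in> borel_measurable (F t))"

definition progressive :: "(real \<Rightarrow> 'a measure) \<Rightarrow> (real \<Rightarrow> 'a \<Rightarrow> real) \<Rightarrow> bool" where
  "progressive F X \<longleftrightarrow>
    (\<forall>t\<ge>0. (\<lambda>(s, \<omega>). X s \<omega>) \<in> borel_measurable (restrict_space borel {0..t} \<Otimes>\<^sub>M F t))"

definition continuous_paths :: "'a measure \<Rightarrow> (real \<Rightarrow> 'a \<Rightarrow> real) \<Rightarrow> bool" where
  "continuous_paths M X \<longleftrightarrow> (AE \<omega> in M. continuous_on {0..} (\<lambda>t. X t \<omega>))"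

definition indistinguishable ::
    "'a measure \<Rightarrow> (real \<Rightarrow> 'a \<Rightarrow> real) \<Rightarrow> (real \<Rightarrow> 'a \<Rightarrow> real) \<Rightarrow> bool" where
  "indistinguishable M X Y \<longleftrightarrow> (AE \<omega> in M. \<forall>t\<ge>0. X t \<omega> = Y t \<omega>)"

definition tendsto_in_prob :: "'a measure \<Rightarrow> (nat \<Rightarrow> 'a \<Rightarrow> real) \<Rightarrow> ('a \<Rightarrow> real) \<Rightarrow> bool" where
  "tendsto_in_prob M Y Z \<longleftrightarrow>
    (\<forall>k. Y k \<in> borel_measurable M) \<and> Z \<in> borel_measurable M \<and>
    (\<forall>\<epsilon>>0. (\<lambda>k. measure M {\<omega> \<in> space M. \<epsilon> < \<bar>Y k \<omega> - Z \<omega>\<bar>}) \<longlonglongrightarrow> 0)"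

text \<open>
  A Wiener process relative to \<open>F\<close>: besides being adapted, its future increments are independent
  of \<open>F s\<close>, not merely of its own past. This is what makes the Ito integral of \<open>F\<close>-adapted
  integrands meaningful.
\<close>

definition wiener_process ::
    "'a measure \<Rightarrow> (real \<Rightarrow> 'a measure) \<Rightarrow> (real \<Rightarrow> 'a \<Rightarrow> real) \<Rightarrow> bool" where
  "wiener_process M F W \<longleftrightarrow>
    adapted F W \<and>
    continuous_paths M W \<and>
    (AE \<omega> in M. W 0 \<omega> = 0) \<and>
    (\<forall>s\<ge>0. \<forall>t>s.
      distributed M lborel (\<lambda>\<omega>. W t \<omega> - W s \<omega>) (\<lambda>x. ennreal (normal_density 0 (sqrt (t - s)) x)) \<and>
      prob_space.indep_set M (sets (F s))
        (sets (vimage_algebra (space M) (\<lambda>\<omega>. W t \<omega> - W s \<omega>) borel)))"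

text \<open>
  The data \<open>n\<close>, \<open>p\<close>, \<open>\<xi>\<close> represent the simple process
  \<open>\<xi> 0\<close> on \<open>(p 0, p 1]\<close>, \dots, \<open>\<xi> (n - 1)\<close> on \<open>(p (n - 1), p n]\<close>, and zero elsewhere.
\<close>

definition simple_process ::
    "'a measure \<Rightarrow> (real \<Rightarrow> 'a measure) \<Rightarrow> nat \<Rightarrow> (nat \<Rightarrow> real) \<Rightarrow> (nat \<Rightarrow> 'a \<Rightarrow> real) \<Rightarrow> bool" where
  "simple_process M F n p \<xi> \<longleftrightarrow>
    p 0 = 0 \<and> (\<forall>i<n. p i \<le> p (Suc i)) \<and>
    (\<forall>i<n. \<xi> i \<in> borel_measurable (F (p i))) \<and>
    (\<exists>B. \<forall>i<n. \<forall>\<omega>\<in>space M. \<bar>\<xi> i \<omega>\<bar> \<le> B)"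

definition simple_value ::
    "nat \<Rightarrow> (nat \<Rightarrow> real) \<Rightarrow> (nat \<Rightarrow> 'a \<Rightarrow> real) \<Rightarrow> real \<Rightarrow> 'a \<Rightarrow> real" where
  "simple_value n p \<xi> s \<omega> = (\<Sum>i<n. \<xi> i \<omega> * indicator {p i<..p (Suc i)} s)"

definition simple_integral ::
    "(real \<Rightarrow> 'a \<Rightarrow> real) \<Rightarrow> nat \<Rightarrow> (nat \<Rightarrow> real) \<Rightarrow> (nat \<Rightarrow> 'a \<Rightarrow> real) \<Rightarrow> real \<Rightarrow> 'a \<Rightarrow> real" where
  "simple_integral W n p \<xi> t \<omega> =
    (\<Sum>i<n. \<xi> i \<omega> * (W (min t (p (Suc i))) \<omega> - W (min t (p i)) \<omega>))"

text \<open>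
  The random variable \<open>Y\<close> is (a version of) the Ito integral of \<open>H\<close> over \<open>[0, t]\<close>. The integrand is
  progressively measurable with almost surely square integrable paths, and the integral is the
  limit in probability of the integrals of simple processes that approximate \<open>H\<close> in the sense
  that \<open>\<integral>\<^sub>0\<^sup>t (H\<^sup>k\<^sub>s - H\<^sub>s)\<^sup>2 ds \<rightarrow> 0\<close> in probability. The measurability and integrability conditions also
  ensure that the Bochner integral below never takes its default value, up to null sets.
\<close>

definition has_ito_integral ::
    "'a measure \<Rightarrow> (real \<Rightarrow> 'a measure) \<Rightarrow> (real \<Rightarrow> 'a \<Rightarrow> real) \<Rightarrow> (real \<Rightarrow> 'a \<Rightarrow> real) \<Rightarrow>
      real \<Rightarrow> ('a \<Rightarrow> real) \<Rightarrow> bool" where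
  "has_ito_integral M F W H t Y \<longleftrightarrow>
    progressive F H \<and>
    (AE \<omega> in M. set_integrable lborel {0..t} (\<lambda>s. (H s \<omega>)\<^sup>2)) \<and>
    (\<exists>n p \<xi>. (\<forall>k. simple_process M F (n k) (p k) (\<xi> k)) \<and>
      tendsto_in_prob M
        (\<lambda>k \<omega>. LBINT s:{0..t}. (simple_value (n k) (p k) (\<xi> k) s \<omega> - H s \<omega>)\<^sup>2) (\<lambda>\<omega>. 0) \<and>
      tendsto_in_prob M (\<lambda>k. simple_integral W (n k) (p k) (\<xi> k) t) Y)"

definition ito_integral_process ::
    "'a measure \<Rightarrow> (real \<Rightarrow> 'a measure) \<Rightarrow> (real \<Rightarrow> 'a \<Rightarrow> real) \<Rightarrow> (real \<Rightarrow> 'a \<Rightarrow> real) \<Rightarrow>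
      (real \<Rightarrow> 'a \<Rightarrow> real) \<Rightarrow> bool" where
  "ito_integral_process M F W H I \<longleftrightarrow>
    adapted F I \<and> continuous_paths M I \<and> (\<forall>t\<ge>0. has_ito_integral M F W H t (I t))"

text \<open>
  \<open>X\<close> solves \<open>dX\<^sub>t = \<mu>(X\<^sub>t) dt + \<tau>(X\<^sub>t) dW\<^sub>t\<close>, \<open>X\<^sub>0 = x\<^sub>0\<close>, for \<open>t \<ge> 0\<close>, with the given Wiener process \<open>W\<close>.
\<close>

definition sde_solution ::
    "'a measure \<Rightarrow> (real \<Rightarrow> 'a measure) \<Rightarrow> (real \<Rightarrow> 'a \<Rightarrow> real) \<Rightarrow> (real \<Rightarrow> real) \<Rightarrow> (real \<Rightarrow> real) \<Rightarrow>
      real \<Rightarrow> (real \<Rightarrow> 'a \<Rightarrow> real) \<Rightarrow> bool" where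
  "sde_solution M F W \<mu> \<tau> x\<^sub>0 X \<longleftrightarrow>
    adapted F X \<and>
    continuous_paths M X \<and>
    (AE \<omega> in M. X 0 \<omega> = x\<^sub>0) \<and>
    (AE \<omega> in M. \<forall>t\<ge>0. set_integrable lborel {0..t} (\<lambda>s. \<mu> (X s \<omega>))) \<and>
    (\<exists>I. ito_integral_process M F W (\<lambda>s \<omega>. \<tau> (X s \<omega>)) I \<and>
      (AE \<omega> in M. \<forall>t\<ge>0. X t \<omega> = x\<^sub>0 + (LBINT s:{0..t}. \<mu> (X s \<omega>)) + I t \<omega>))"

text \<open>The filtration generated by \<open>W\<close>, augmented by the null sets.\<close>

definition augmented_filtration ::
    "'a measure \<Rightarrow> (real \<Rightarrow> 'a \<Rightarrow> real) \<Rightarrow> real \<Rightarrow> 'a measure" where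
  "augmented_filtration M W t =
    sigma (space M) ({W s -` A \<inter> space M |s A. 0 \<le> s \<and> s \<le> t \<and> A \<in> sets borel} \<union> null_sets M)"

text \<open>
  A solution is strong if it is a functional of the driving noise, i.e. adapted to the augmented
  filtration of \<open>W\<close>. The equation has a unique strong solution if there is one and every solution
  (adapted to \<open>F\<close>, strong or not) driven by the same \<open>W\<close> is indistinguishable from it.
\<close>

definition strong_solution ::
    "'a measure \<Rightarrow> (real \<Rightarrow> 'a measure) \<Rightarrow> (real \<Rightarrow> 'a \<Rightarrow> real) \<Rightarrow> (real \<Rightarrow> real) \<Rightarrow> (real \<Rightarrow> real) \<Rightarrow>
      real \<Rightarrow> (real \<Rightarrow> 'a \<Rightarrow> real) \<Rightarrow> bool" where
  "strong_solution M F W \<mu> \<tau> x\<^sub>0 X \<longleftrightarrow>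
    sde_solution M F W \<mu> \<tau> x\<^sub>0 X \<and> adapted (augmented_filtration M W) X"

definition has_unique_strong_solution ::
    "'a measure \<Rightarrow> (real \<Rightarrow> 'a measure) \<Rightarrow> (real \<Rightarrow> 'a \<Rightarrow> real) \<Rightarrow> (real \<Rightarrow> real) \<Rightarrow> (real \<Rightarrow> real) \<Rightarrow>
      real \<Rightarrow> bool" where
  "has_unique_strong_solution M F W \<mu> \<tau> x\<^sub>0 \<longleftrightarrow>
    (\<exists>X. strong_solution M F W \<mu> \<tau> x\<^sub>0 X \<and>
      (\<forall>Y. sde_solution M F W \<mu> \<tau> x\<^sub>0 Y \<longrightarrow> indistinguishable M X Y))"

end

theory Submission
  imports Defs
begin

text \<open>
  The Euler polygons on the dyadic grids of mesh \<open>2\<^sup>-\<^sup>n\<close> are compared with each other, and with any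
  solution, through a smooth approximation \<open>\<phi>\<close> of \<open>\<bar>x\<bar>\<close> with \<open>\<phi>'' x * \<bar>x\<bar> \<le> \<delta>\<close> (Yamada and Watanabe).
  Taylor expansion over one grid cell replaces the Ito formula: since the drift is decreasing, its
  contribution has the right sign up to the oscillation within a cell, and since the diffusion
  coefficient is \<open>1/2\<close>-Hoelder, the second order term is at most a multiple of \<open>\<delta>\<close>. As nothing is
  left to absorb, no Gronwall argument is needed, and the difference tends to \<open>0\<close> in mean.
  Kolmogorov's maximal inequality makes the convergence locally uniform almost surely along a
  subsequence. The limit is a solution that is a functional of \<open>W\<close>. Conversely, the Ito integral of
  any solution is the mean square limit of its dyadic left-point sums, so that the same discrete
  estimates apply to the solution itself, which is therefore the limit of the Euler polygons.
\<close>

section \<open>Square integrable random variables and Wiener increments\<close>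

text \<open>The square root is not Lipschitz: for the distance Z of two solutions the second order
  term of Z^2 is only of size \<bar>Z\<bar>, and a mean square estimate does not close. Hence a
  function of Z whose second derivative is at most \<delta> / \<bar>Z\<bar>. In a cell of length h
  the errors beside \<open>G * \<delta> * h\<close> are of order \<open>h * sqrt h\<close> with a
  constant depending on \<delta>; over T / h cells they sum to a multiple of \<open>sqrt h\<close>.
  So \<delta> is fixed first and h tends to 0 afterwards. The order \<open>h * sqrt h\<close>
  dictates the tools: fourth moments for the cubic Taylor remainder, and the residual of a
  stochastic increment after its left-point approximation. \<open>ito_like\<close> collects the
  properties of stochastic integrals behind these estimates, and \<open>approx_solution\<close>
  covers finer Euler polygons and exact solutions alike, so convergence of the scheme and uniqueness
  come from one comparison. A solution comes without moment assumptions; monotonicity of the drift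
  bounds it pathwise in terms of its stochastic integral, which has moments since the diffusion
  coefficient is bounded.\<close>

definition partition_upto :: "nat \<Rightarrow> (nat \<Rightarrow> real) \<Rightarrow> bool" where
  "partition_upto n p \<longleftrightarrow> 0 \<le> p 0 \<and> (\<forall>i<n. p i \<le> p (Suc i))"

lemma partition_upto_SucD: "partition_upto (Suc n) p \<Longrightarrow> partition_upto n p \<and> p n \<le> p (Suc n)"
  by (auto simp: partition_upto_def)

lemma partition_upto_mono:
  assumes "partition_upto n p" "i \<le> j" "j \<le> n"
  shows "p i \<le> p j"
  using assms(2,3)
proof (induction j)
  case (Suc j)
  show ?case
  proof (cases "i = Suc j")
    case False
    then have "p i \<le> p j" using Suc by simp
    also have "p j \<le> p (Suc j)" using assms(1) Suc.prems by (auto simp: partition_upto_def)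
    finally show ?thesis .
  qed simp
qed simp

lemma partition_upto_nonneg: "partition_upto n p \<Longrightarrow> i \<le> n \<Longrightarrow> 0 \<le> p i"
  using partition_upto_mono[of n p 0 i] by (auto simp: partition_upto_def)

context prob_space
begin

definition sq_int :: "('a \<Rightarrow> real) \<Rightarrow> bool" where
  "sq_int f \<longleftrightarrow> f \<in> borel_measurable M \<and> integrable M (\<lambda>\<omega>. (f \<omega>)\<^sup>2)"

lemma sq_int_measurable: "sq_int f \<Longrightarrow> f \<in> borel_measurable M"
  by (simp add: sq_int_def)

lemma sq_int_square: "sq_int f \<Longrightarrow> integrable M (\<lambda>\<omega>. (f \<omega>)\<^sup>2)"
  by (simp add: sq_int_def)

lemma sq_int_integrable: "sq_int f \<Longrightarrow> integrable M f"
  unfolding sq_int_def by (elim conjE) (rule square_integrable_imp_integrable)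

lemma sq_int_mult_integrable:
  assumes "sq_int f" "sq_int g"
  shows "integrable M (\<lambda>\<omega>. f \<omega> * g \<omega>)"
proof (rule Bochner_Integration.integrable_bound)
  show "integrable M (\<lambda>\<omega>. (f \<omega>)\<^sup>2 + (g \<omega>)\<^sup>2)"
    using assms by (simp add: sq_int_def)
  show "(\<lambda>\<omega>. f \<omega> * g \<omega>) \<in> borel_measurable M"
    using assms by (auto simp: sq_int_def intro: borel_measurable_times)
  have "\<bar>f \<omega> * g \<omega>\<bar> \<le> (f \<omega>)\<^sup>2 + (g \<omega>)\<^sup>2" for \<omega>
  proof -
    have "2 * \<bar>f \<omega> * g \<omega>\<bar> \<le> (f \<omega>)\<^sup>2 + (g \<omega>)\<^sup>2"
      using sum_squares_bound[of "\<bar>f \<omega>\<bar>" "\<bar>g \<omega>\<bar>"] by (simp add: abs_mult)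
    then show ?thesis using abs_ge_zero[of "f \<omega> * g \<omega>"] by linarith
  qed
  then show "AE \<omega> in M. norm (f \<omega> * g \<omega>) \<le> norm ((f \<omega>)\<^sup>2 + (g \<omega>)\<^sup>2)"
    by (auto intro: order_trans)
qed

lemma sq_int_add:
  assumes "sq_int f" "sq_int g"
  shows "sq_int (\<lambda>\<omega>. f \<omega> + g \<omega>)"
  using assms sq_int_mult_integrable[OF assms]
  by (auto simp: sq_int_def power2_sum mult.assoc)

lemma sq_int_bdd_mult:
  assumes "sq_int f" and [measurable]: "g \<in> borel_measurable M"
    and B: "\<And>\<omega>. \<omega> \<in> space M \<Longrightarrow> \<bar>g \<omega>\<bar> \<le> B"
  shows "sq_int (\<lambda>\<omega>. g \<omega> * f \<omega>)"
  unfolding sq_int_def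
proof
  have [measurable]: "f \<in> borel_measurable M" using assms by (simp add: sq_int_def)
  show "(\<lambda>\<omega>. g \<omega> * f \<omega>) \<in> borel_measurable M" by measurable
  show "integrable M (\<lambda>\<omega>. (g \<omega> * f \<omega>)\<^sup>2)"
  proof (rule Bochner_Integration.integrable_bound)
    show "integrable M (\<lambda>\<omega>. B\<^sup>2 * (f \<omega>)\<^sup>2)"
      using assms by (simp add: sq_int_def)
    have "(g \<omega> * f \<omega>)\<^sup>2 \<le> B\<^sup>2 * (f \<omega>)\<^sup>2" if "\<omega> \<in> space M" for \<omega>
      using power_mono[OF B[OF that], of 2] by (auto simp: power_mult_distrib intro: mult_right_mono)
    then show "AE \<omega> in M. norm ((g \<omega> * f \<omega>)\<^sup>2) \<le> norm (B\<^sup>2 * (f \<omega>)\<^sup>2)"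
      by (auto intro: AE_I2)
  qed measurable
qed

lemma sq_int_bdd:
  assumes "f \<in> borel_measurable M" "\<And>\<omega>. \<omega> \<in> space M \<Longrightarrow> \<bar>f \<omega>\<bar> \<le> B"
  shows "sq_int f"
  using sq_int_bdd_mult[of "\<lambda>_. 1" f B] assms by (simp add: sq_int_def)

lemma sq_int_const: "sq_int (\<lambda>_. c)"
  by (rule sq_int_bdd[of _ "\<bar>c\<bar>"]) auto

lemma sq_int_cmult: "sq_int f \<Longrightarrow> sq_int (\<lambda>\<omega>. c * f \<omega>)"
  by (rule sq_int_bdd_mult[of _ _ "\<bar>c\<bar>"]) auto

lemma sq_int_uminus: "sq_int f \<Longrightarrow> sq_int (\<lambda>\<omega>. - f \<omega>)"
  by (simp add: sq_int_def)

lemma sq_int_diff: "sq_int f \<Longrightarrow> sq_int g \<Longrightarrow> sq_int (\<lambda>\<omega>. f \<omega> - g \<omega>)"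
  using sq_int_add[of f "\<lambda>\<omega>. - g \<omega>"] sq_int_uminus[of g] by simp

lemma sq_int_abs: "sq_int f \<Longrightarrow> sq_int (\<lambda>\<omega>. \<bar>f \<omega>\<bar>)"
  by (auto simp: sq_int_def intro: borel_measurable_abs)

lemma sq_int_sum:
  "(\<And>i. i \<in> I \<Longrightarrow> sq_int (f i)) \<Longrightarrow> sq_int (\<lambda>\<omega>. \<Sum>i\<in>I. f i \<omega>)"
  by (induction I rule: infinite_finite_induct) (auto intro: sq_int_add sq_int_const)

lemma sq_int_le:
  assumes "sq_int f" "g \<in> borel_measurable M" "\<And>\<omega>. \<omega> \<in> space M \<Longrightarrow> \<bar>g \<omega>\<bar> \<le> \<bar>f \<omega>\<bar>"
  shows "sq_int g"
  unfolding sq_int_def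
proof
  show "integrable M (\<lambda>\<omega>. (g \<omega>)\<^sup>2)"
  proof (rule Bochner_Integration.integrable_bound)
    show "integrable M (\<lambda>\<omega>. (f \<omega>)\<^sup>2)" using assms by (simp add: sq_int_def)
    show "AE \<omega> in M. norm ((g \<omega>)\<^sup>2) \<le> norm ((f \<omega>)\<^sup>2)"
      using assms(3) by (auto intro!: AE_I2 simp: abs_le_square_iff)
  qed (use assms in measurable)
qed fact

text \<open>Nonnegativity of the variance of \<bar>f\<bar>, expanded around its mean
  \<open>?m\<close>.\<close>

lemma expectation_abs_le_sqrt:
  assumes "sq_int f" shows "expectation (\<lambda>\<omega>. \<bar>f \<omega>\<bar>) \<le> sqrt (expectation (\<lambda>\<omega>. (f \<omega>)\<^sup>2))"
proof -
  let ?m = "expectation (\<lambda>\<omega>. \<bar>f \<omega>\<bar>)"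
  have i: "integrable M (\<lambda>\<omega>. \<bar>f \<omega>\<bar>)" using sq_int_integrable[OF assms] by simp
  have "0 \<le> expectation (\<lambda>\<omega>. (\<bar>f \<omega>\<bar> - ?m)\<^sup>2)" by (intro integral_nonneg_AE) auto
  also have "(\<lambda>\<omega>. (\<bar>f \<omega>\<bar> - ?m)\<^sup>2) = (\<lambda>\<omega>. (f \<omega>)\<^sup>2 - 2 * ?m * \<bar>f \<omega>\<bar> + ?m\<^sup>2)"
    by (auto simp: power2_diff)
  also have "expectation \<dots> = expectation (\<lambda>\<omega>. (f \<omega>)\<^sup>2) - 2 * ?m * ?m + ?m\<^sup>2"
    using i sq_int_square[OF assms] by (simp add: prob_space)
  finally show ?thesis by (intro real_le_rsqrt) (simp add: power2_eq_square)
qed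

lemma expectation_sq_add_le:
  assumes "sq_int f" "sq_int g"
  shows "expectation (\<lambda>\<omega>. (f \<omega> + g \<omega>)\<^sup>2) \<le>
    2 * expectation (\<lambda>\<omega>. (f \<omega>)\<^sup>2) + 2 * expectation (\<lambda>\<omega>. (g \<omega>)\<^sup>2)"
proof -
  have "expectation (\<lambda>\<omega>. (f \<omega> + g \<omega>)\<^sup>2) \<le> expectation (\<lambda>\<omega>. 2 * (f \<omega>)\<^sup>2 + 2 * (g \<omega>)\<^sup>2)"
  proof (rule integral_mono)
    show "(f \<omega> + g \<omega>)\<^sup>2 \<le> 2 * (f \<omega>)\<^sup>2 + 2 * (g \<omega>)\<^sup>2" for \<omega>
      using zero_le_power2[of "f \<omega> - g \<omega>"] by (simp add: power2_sum power2_diff)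
  qed (use assms sq_int_square[OF sq_int_add[OF assms]] in \<open>simp_all add: sq_int_square\<close>)
  then show ?thesis using assms by (simp add: sq_int_square)
qed

text \<open>Powers up to the fourth are dominated by \<open>1 + x ^ 4\<close>, so a finite fourth
  moment controls every mixed term of the binomial expansion in
  \<open>msum_fourth_moment\<close>.\<close>

lemma integrable_power_mult_bdd:
  fixes f g :: "'a \<Rightarrow> real"
  assumes [measurable]: "f \<in> borel_measurable M" "g \<in> borel_measurable M"
    and "integrable M (\<lambda>\<omega>. f \<omega> ^ 4)" "\<And>\<omega>. \<omega> \<in> space M \<Longrightarrow> \<bar>g \<omega>\<bar> \<le> B" "j \<le> 4"
  shows "integrable M (\<lambda>\<omega>. f \<omega> ^ j * g \<omega>)"
proof (rule Bochner_Integration.integrable_bound)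
  show "integrable M (\<lambda>\<omega>. B * (1 + f \<omega> ^ 4))" using assms by simp
  have *: "\<bar>x\<bar> ^ j \<le> 1 + x ^ 4" for x :: real
  proof (cases "\<bar>x\<bar> \<le> 1")
    case True
    then have "\<bar>x\<bar> ^ j \<le> 1" by (simp add: power_le_one)
    then show ?thesis by (meson add_increasing2 zero_le_even_power even_numeral)
  next
    case False
    then have "\<bar>x\<bar> ^ j \<le> \<bar>x\<bar> ^ 4" using \<open>j \<le> 4\<close> by (intro power_increasing) auto
    then show ?thesis by simp
  qed
  have "\<bar>f \<omega> ^ j * g \<omega>\<bar> \<le> \<bar>B * (1 + f \<omega> ^ 4)\<bar>" if "\<omega> \<in> space M" for \<omega>
  proof -
    have "\<bar>f \<omega> ^ j * g \<omega>\<bar> \<le> (1 + f \<omega> ^ 4) * B"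
      unfolding abs_mult power_abs using that assms(4)[OF that]
      by (intro mult_mono *) auto
    then show ?thesis by (simp add: mult.commute)
  qed
  then show "AE \<omega> in M. norm (f \<omega> ^ j * g \<omega>) \<le> norm (B * (1 + f \<omega> ^ 4))"
    by (auto intro: AE_I2)
qed measurable

end

locale wiener_space = complete_filtered_prob_space M F
  for M :: "'a measure" and F :: "real \<Rightarrow> 'a measure" +
  fixes W :: "real \<Rightarrow> 'a \<Rightarrow> real"
  assumes W: "wiener_process M F W"
begin

lemma F_measurable_mono:
  assumes "f \<in> borel_measurable (F s)" "0 \<le> s" "s \<le> t"
  shows "f \<in> borel_measurable (F t)"
proof (rule measurable_from_subalg)
  show "subalgebra (F t) (F s)"
    using assms by (auto simp: subalgebra_def space_filtration dest: subsetD[OF filtration_mono])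
qed fact

lemma F_measurable:
  assumes "f \<in> borel_measurable (F s)" "0 \<le> s"
  shows "f \<in> borel_measurable M"
proof (rule measurable_from_subalg)
  show "subalgebra M (F s)"
    using assms by (auto simp: subalgebra_def space_filtration dest: subsetD[OF sets_filtration])
qed fact

lemma W_measurable_F: "0 \<le> s \<Longrightarrow> s \<le> t \<Longrightarrow> W s \<in> borel_measurable (F t)"
  using W F_measurable_mono[of "W s" s t] by (auto simp: wiener_process_def adapted_def)

lemma W_measurable: "0 \<le> s \<Longrightarrow> W s \<in> borel_measurable M"
  using F_measurable[OF W_measurable_F] by blast

text \<open>Increments over a positive time are centred Gaussian. For \<open>s = t\<close> there is
  no density, so that case is split off in \<open>W_mult_integrable\<close> and
  \<open>W_mult_expectation\<close>.\<close>

lemma W_moments: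
  assumes "0 \<le> s" "s < t"
  shows "integrable M (\<lambda>\<omega>. (W t \<omega> - W s \<omega>) ^ j)"
    and "expectation (\<lambda>\<omega>. W t \<omega> - W s \<omega>) = 0"
    and "expectation (\<lambda>\<omega>. (W t \<omega> - W s \<omega>) ^ 2) = t - s"
    and "expectation (\<lambda>\<omega>. (W t \<omega> - W s \<omega>) ^ 3) = 0"
    and "expectation (\<lambda>\<omega>. (W t \<omega> - W s \<omega>) ^ 4) = 3 * (t - s)\<^sup>2"
proof -
  have D: "distributed M lborel (\<lambda>\<omega>. W t \<omega> - W s \<omega>) (\<lambda>x. ennreal (normal_density 0 (sqrt (t - s)) x))"
    using W assms by (auto simp: wiener_process_def)
  have s: "0 < sqrt (t - s)" using assms by simp
  show "integrable M (\<lambda>\<omega>. (W t \<omega> - W s \<omega>) ^ j)"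
    using distributed_integrable[OF D, of "\<lambda>x. x ^ j"] integrable_normal_moment[OF s, of 0 j] by simp
  show "expectation (\<lambda>\<omega>. W t \<omega> - W s \<omega>) = 0"
    using distributed_integral[OF D, of "\<lambda>x. x"] integral_normal_moment_odd[OF s, of 0 0] by simp
  show "expectation (\<lambda>\<omega>. (W t \<omega> - W s \<omega>) ^ 2) = t - s"
    using distributed_integral[OF D, of "\<lambda>x. x ^ 2"] integral_normal_moment_even[OF s, of 0 1] assms
    by (simp add: fact_numeral)
  show "expectation (\<lambda>\<omega>. (W t \<omega> - W s \<omega>) ^ 3) = 0"
    using distributed_integral[OF D, of "\<lambda>x. x ^ 3"] integral_normal_moment_odd[OF s, of 0 1] by simp
  show "expectation (\<lambda>\<omega>. (W t \<omega> - W s \<omega>) ^ 4) = 3 * (t - s)\<^sup>2"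
    using distributed_integral[OF D, of "\<lambda>x. x ^ 4"] integral_normal_moment_even[OF s, of 0 2] assms
    by (simp add: fact_numeral field_simps power2_eq_square)
qed

text \<open>The \<sigma>-algebra generated by f lies in \<open>F s\<close>, so f inherits
  independence of the increment, and a power of the increment is a function of it.\<close>

lemma W_indep_var:
  assumes "0 \<le> s" "s < t" "f \<in> borel_measurable (F s)"
  shows "indep_var borel f borel (\<lambda>\<omega>. (W t \<omega> - W s \<omega>) ^ j)"
proof -
  have ind: "indep_set (sets (F s)) (sets (vimage_algebra (space M) (\<lambda>\<omega>. W t \<omega> - W s \<omega>) borel))"
    using W assms by (auto simp: wiener_process_def)
  have m1: "f \<in> borel_measurable M" using F_measurable assms by auto
  have m2: "(\<lambda>\<omega>. W t \<omega> - W s \<omega>) \<in> borel_measurable M"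
    using W_measurable assms by auto
  have a: "sigma_sets (space M) {f -` A \<inter> space M |A. A \<in> sets borel} \<subseteq> sets (F s)"
  proof -
    have "{f -` A \<inter> space M |A. A \<in> sets borel} \<subseteq> sets (F s)"
      using measurable_sets[OF assms(3)] assms(1) by (auto simp: space_filtration)
    then show ?thesis
      using sets.sigma_sets_subset[of _ "F s"] assms(1) by (auto simp: space_filtration)
  qed
  have "indep_set (sigma_sets (space M) {f -` A \<inter> space M |A. A \<in> sets borel})
     (sigma_sets (space M) {(\<lambda>\<omega>. W t \<omega> - W s \<omega>) -` A \<inter> space M |A. A \<in> sets borel})"
    using indep_sets2_eq ind a by (auto simp: sets_vimage_algebra)
  then have "indep_var borel f borel (\<lambda>\<omega>. W t \<omega> - W s \<omega>)"
    unfolding indep_var_eq using m1 m2 by simp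
  from indep_var_compose[OF this, of "\<lambda>x. x" borel "\<lambda>x. x ^ j" borel]
  show ?thesis by (simp add: comp_def)
qed

text \<open>Independence makes the product of two integrable variables integrable; hence f may be
  unbounded, for instance an earlier martingale sum times a coefficient.\<close>

lemma W_mult_integrable:
  assumes "0 \<le> s" "s \<le> t" "f \<in> borel_measurable (F s)" "integrable M f"
  shows "integrable M (\<lambda>\<omega>. f \<omega> * (W t \<omega> - W s \<omega>) ^ j)"
proof (cases "s = t")
  case True
  then show ?thesis using assms by (cases j) auto
next
  case False
  with assms have "s < t" by simp
  from indep_var_integrable[OF W_indep_var[OF assms(1) this assms(3)] assms(4) W_moments(1)[OF assms(1) this]]
  show ?thesis .
qed

text \<open>Gaussian moments conditional on \<open>F s\<close> in weak form: testing against
  integrable \<open>F s\<close>-measurable f takes the place of a conditional expectation.\<close>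

lemma W_mult_expectation:
  assumes "0 \<le> s" "s \<le> t" "f \<in> borel_measurable (F s)" "integrable M f"
  shows "expectation (\<lambda>\<omega>. f \<omega> * (W t \<omega> - W s \<omega>)) = 0"
    and "expectation (\<lambda>\<omega>. f \<omega> * (W t \<omega> - W s \<omega>) ^ 2) = expectation f * (t - s)"
    and "expectation (\<lambda>\<omega>. f \<omega> * (W t \<omega> - W s \<omega>) ^ 3) = 0"
    and "expectation (\<lambda>\<omega>. f \<omega> * (W t \<omega> - W s \<omega>) ^ 4) = expectation f * (3 * (t - s)\<^sup>2)"
proof -
  have *: "expectation (\<lambda>\<omega>. f \<omega> * (W t \<omega> - W s \<omega>) ^ j) =
    expectation f * expectation (\<lambda>\<omega>. (W t \<omega> - W s \<omega>) ^ j)" if "s < t" for j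
    using indep_var_lebesgue_integral[OF W_indep_var[OF assms(1) that assms(3)] assms(4) W_moments(1)[OF assms(1) that]] .
  show "expectation (\<lambda>\<omega>. f \<omega> * (W t \<omega> - W s \<omega>)) = 0"
    using *[of 1] W_moments[OF assms(1), of t] assms(2) by (cases "s = t") auto
  show "expectation (\<lambda>\<omega>. f \<omega> * (W t \<omega> - W s \<omega>) ^ 2) = expectation f * (t - s)"
    using *[of 2] W_moments[OF assms(1), of t] assms(2) by (cases "s = t") auto
  show "expectation (\<lambda>\<omega>. f \<omega> * (W t \<omega> - W s \<omega>) ^ 3) = 0"
    using *[of 3] W_moments[OF assms(1), of t] assms(2) by (cases "s = t") auto
  show "expectation (\<lambda>\<omega>. f \<omega> * (W t \<omega> - W s \<omega>) ^ 4) = expectation f * (3 * (t - s)\<^sup>2)"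
    using *[of 4] W_moments[OF assms(1), of t] assms(2) by (cases "s = t") auto
qed

lemma W_mult_sq_int:
  assumes "0 \<le> s" "s \<le> t" "f \<in> borel_measurable (F s)" "sq_int f"
  shows "sq_int (\<lambda>\<omega>. f \<omega> * (W t \<omega> - W s \<omega>))"
proof -
  have [measurable]: "W t \<in> borel_measurable M" "W s \<in> borel_measurable M" "f \<in> borel_measurable M"
    using W_measurable F_measurable assms by auto
  have "integrable M (\<lambda>\<omega>. (f \<omega>)\<^sup>2 * (W t \<omega> - W s \<omega>) ^ 2)"
    using assms(3) sq_int_square[OF assms(4)] by (intro W_mult_integrable[OF assms(1,2)]) auto
  then show ?thesis by (simp add: sq_int_def power_mult_distrib)
qed

section \<open>Martingale transforms of Wiener increments\<close>

definition msum :: "(nat \<Rightarrow> real) \<Rightarrow> (nat \<Rightarrow> 'a \<Rightarrow> real) \<Rightarrow> nat \<Rightarrow> 'a \<Rightarrow> real" where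
  "msum p \<eta> n \<omega> = (\<Sum>i<n. \<eta> i \<omega> * (W (p (Suc i)) \<omega> - W (p i) \<omega>))"

lemma msum_0 [simp]: "msum p \<eta> 0 \<omega> = 0"
  and msum_Suc: "msum p \<eta> (Suc n) \<omega> = msum p \<eta> n \<omega> + \<eta> n \<omega> * (W (p (Suc n)) \<omega> - W (p n) \<omega>)"
  by (simp_all add: msum_def)

lemma msum_measurable_F:
  assumes "partition_upto n p" "\<And>i. i < n \<Longrightarrow> \<eta> i \<in> borel_measurable (F (p i))"
  shows "msum p \<eta> n \<in> borel_measurable (F (p n))"
proof -
  have "(\<lambda>\<omega>. \<eta> i \<omega> * (W (p (Suc i)) \<omega> - W (p i) \<omega>)) \<in> borel_measurable (F (p n))" if "i < n" for i
    using that F_measurable_mono[OF assms(2)[OF that] partition_upto_nonneg[OF assms(1)] partition_upto_mono[OF assms(1)], of n]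
      W_measurable_F[OF partition_upto_nonneg[OF assms(1)] partition_upto_mono[OF assms(1)], of "Suc i" n]
      W_measurable_F[OF partition_upto_nonneg[OF assms(1)] partition_upto_mono[OF assms(1)], of i n]
    by (auto intro!: borel_measurable_times borel_measurable_diff)
  then show ?thesis unfolding msum_def by (auto intro!: borel_measurable_sum)
qed

lemma msum_sq_int:
  assumes "partition_upto n p" "\<And>i. i < n \<Longrightarrow> \<eta> i \<in> borel_measurable (F (p i))"
    "\<And>i. i < n \<Longrightarrow> sq_int (\<eta> i)"
  shows "sq_int (msum p \<eta> n)"
proof -
  have "sq_int (\<lambda>\<omega>. \<eta> i \<omega> * (W (p (Suc i)) \<omega> - W (p i) \<omega>))" if "i < n" for i
    using that assms partition_upto_nonneg[OF assms(1), of i]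
    by (intro W_mult_sq_int) (auto simp: partition_upto_def)
  then show ?thesis unfolding msum_def[abs_def] by (intro sq_int_sum) auto
qed

text \<open>The martingale property relative to the start of the grid: the product of \<xi> and
  \<open>\<eta> i\<close> is known at time \<open>p i\<close>, before the i-th increment.\<close>

lemma msum_mult_mean:
  assumes p: "partition_upto n p" "\<And>i. i < n \<Longrightarrow> \<eta> i \<in> borel_measurable (F (p i))"
    "\<And>i. i < n \<Longrightarrow> sq_int (\<eta> i)"
    and \<xi>: "\<xi> \<in> borel_measurable (F (p 0))" "sq_int \<xi>"
  shows "expectation (\<lambda>\<omega>. \<xi> \<omega> * msum p \<eta> n \<omega>) = 0"
proof -
  have *: "integrable M (\<lambda>\<omega>. \<xi> \<omega> * (\<eta> i \<omega> * (W (p (Suc i)) \<omega> - W (p i) \<omega>)))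
     \<and> expectation (\<lambda>\<omega>. \<xi> \<omega> * (\<eta> i \<omega> * (W (p (Suc i)) \<omega> - W (p i) \<omega>))) = 0" if "i < n" for i
  proof -
    have "\<xi> \<in> borel_measurable (F (p i))"
      using \<xi>(1) partition_upto_nonneg[OF p(1)] partition_upto_mono[OF p(1)] that
      by (intro F_measurable_mono[OF \<xi>(1)]) auto
    then have 1: "(\<lambda>\<omega>. \<xi> \<omega> * \<eta> i \<omega>) \<in> borel_measurable (F (p i))"
      using p(2)[OF that] by (intro borel_measurable_times)
    have 2: "integrable M (\<lambda>\<omega>. \<xi> \<omega> * \<eta> i \<omega>)"
      using sq_int_mult_integrable \<xi>(2) p(3)[OF that] by blast
    have 3: "0 \<le> p i" "p i \<le> p (Suc i)"
      using that partition_upto_nonneg[OF p(1), of i] p(1) by (auto simp: partition_upto_def)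
    show ?thesis
      using W_mult_integrable[OF 3 1 2, of 1] W_mult_expectation(1)[OF 3 1 2] by (simp add: mult.assoc)
  qed
  show ?thesis unfolding msum_def sum_distrib_left
    using * by (subst Bochner_Integration.integral_sum) auto
qed

text \<open>The discrete Ito isometry. When a cell is added, the mixed term carries the new
  increment to the first power and has mean zero.\<close>

lemma msum_second_moment:
  assumes "partition_upto n p" "\<And>i. i < n \<Longrightarrow> \<eta> i \<in> borel_measurable (F (p i))"
    "\<And>i. i < n \<Longrightarrow> sq_int (\<eta> i)"
  shows "expectation (\<lambda>\<omega>. (msum p \<eta> n \<omega>)\<^sup>2) =
    (\<Sum>i<n. expectation (\<lambda>\<omega>. (\<eta> i \<omega>)\<^sup>2) * (p (Suc i) - p i))"
  using assms
proof (induction n)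
  case (Suc n)
  note p = partition_upto_SucD[OF Suc.prems(1)]
  let ?D = "\<lambda>\<omega>. W (p (Suc n)) \<omega> - W (p n) \<omega>"
  have p0: "0 \<le> p n" using p partition_upto_nonneg by blast
  have m: "msum p \<eta> n \<in> borel_measurable (F (p n))" using p Suc.prems by (intro msum_measurable_F) auto
  have s: "sq_int (msum p \<eta> n)" using p Suc.prems by (intro msum_sq_int) auto
  have \<eta>: "\<eta> n \<in> borel_measurable (F (p n))" "sq_int (\<eta> n)" using Suc.prems by auto
  have 1: "(\<lambda>\<omega>. 2 * msum p \<eta> n \<omega> * \<eta> n \<omega>) \<in> borel_measurable (F (p n))"
    "integrable M (\<lambda>\<omega>. 2 * msum p \<eta> n \<omega> * \<eta> n \<omega>)"
    using m \<eta> sq_int_mult_integrable[OF s \<eta>(2)] by (auto simp: mult.assoc intro!: borel_measurable_times)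
  have 2: "(\<lambda>\<omega>. (\<eta> n \<omega>)\<^sup>2) \<in> borel_measurable (F (p n))" "integrable M (\<lambda>\<omega>. (\<eta> n \<omega>)\<^sup>2)"
    using \<eta> sq_int_square by (auto intro!: borel_measurable_power)
  have pp: "p n \<le> p (Suc n)" using p by simp
  have "expectation (\<lambda>\<omega>. (msum p \<eta> (Suc n) \<omega>)\<^sup>2) = expectation (\<lambda>\<omega>. (msum p \<eta> n \<omega>)\<^sup>2 +
     2 * msum p \<eta> n \<omega> * \<eta> n \<omega> * ?D \<omega> + (\<eta> n \<omega>)\<^sup>2 * (?D \<omega>)^2)"
    by (rule Bochner_Integration.integral_cong) (auto simp: msum_Suc power2_eq_square algebra_simps)
  also have "\<dots> = expectation (\<lambda>\<omega>. (msum p \<eta> n \<omega>)\<^sup>2) + expectation (\<lambda>\<omega>. 2 * msum p \<eta> n \<omega> * \<eta> n \<omega> * ?D \<omega>)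
     + expectation (\<lambda>\<omega>. (\<eta> n \<omega>)\<^sup>2 * (?D \<omega>)^2)"
    using sq_int_square[OF s] W_mult_integrable[OF p0 pp 1, of 1] W_mult_integrable[OF p0 pp 2, of 2]
    by simp
  also have "\<dots> = (\<Sum>i<n. expectation (\<lambda>\<omega>. (\<eta> i \<omega>)\<^sup>2) * (p (Suc i) - p i)) +
      expectation (\<lambda>\<omega>. (\<eta> n \<omega>)\<^sup>2) * (p (Suc n) - p n)"
    using W_mult_expectation(1)[OF p0 pp 1] W_mult_expectation(2)[OF p0 pp 2] Suc.IH p Suc.prems by simp
  finally show ?case by simp
qed simp

text \<open>The Gaussian constant 3 propagates exactly: with a = \<open>p n - p 0\<close> and a new
  cell of length u, the three surviving terms are at most 3 B^4 a^2, 6 B^4 a u and 3 B^4 u^2, which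
  add up to 3 B^4 (a + u)^2.\<close>

lemma msum_fourth_moment:
  assumes "partition_upto n p" "\<And>i. i < n \<Longrightarrow> \<eta> i \<in> borel_measurable (F (p i))"
    "\<And>i \<omega>. i < n \<Longrightarrow> \<omega> \<in> space M \<Longrightarrow> \<bar>\<eta> i \<omega>\<bar> \<le> B"
  shows "integrable M (\<lambda>\<omega>. (msum p \<eta> n \<omega>) ^ 4) \<and>
    expectation (\<lambda>\<omega>. (msum p \<eta> n \<omega>) ^ 4) \<le> 3 * B ^ 4 * (p n - p 0)\<^sup>2"
  using assms
proof (induction n)
  case (Suc n)
  note p = partition_upto_SucD[OF Suc.prems(1)]
  let ?D = "\<lambda>\<omega>. W (p (Suc n)) \<omega> - W (p n) \<omega>" and ?M = "msum p \<eta> n"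
  define u where "u = p (Suc n) - p n"
  have p0: "0 \<le> p n" and pp: "p n \<le> p (Suc n)" and u: "0 \<le> u" and pn: "p 0 \<le> p n"
    using p partition_upto_nonneg[of n p n] partition_upto_mono[of n p 0 n] by (auto simp: u_def)
  have IH: "integrable M (\<lambda>\<omega>. (?M \<omega>) ^ 4)" "expectation (\<lambda>\<omega>. (?M \<omega>) ^ 4) \<le> 3 * B ^ 4 * (p n - p 0)\<^sup>2"
    using Suc.IH p Suc.prems by auto
  have m: "?M \<in> borel_measurable (F (p n))" using p Suc.prems by (intro msum_measurable_F) auto
  have \<eta>: "\<eta> n \<in> borel_measurable (F (p n))" and b: "\<And>\<omega>. \<omega> \<in> space M \<Longrightarrow> \<bar>\<eta> n \<omega>\<bar> \<le> B" using Suc.prems by auto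
  have mM: "?M \<in> borel_measurable M" "\<eta> n \<in> borel_measurable M"
    using F_measurable[OF m p0] F_measurable[OF \<eta> p0] by auto
  have bj: "\<bar>\<eta> n \<omega> ^ j\<bar> \<le> B ^ j" if "\<omega> \<in> space M" for \<omega> j
    using power_mono[OF b[OF that], of j] by (simp add: power_abs)
  \<comment> \<open>\<open>f j\<close> is the coefficient of the j-th power of the new increment in
    the binomial expansion; j = 1 and j = 3 drop out in expectation.\<close>
  define f where "f j \<omega> = real (4 choose j) * (?M \<omega> ^ (4 - j) * \<eta> n \<omega> ^ j)" for j \<omega>
  have f: "f j \<in> borel_measurable (F (p n))" "integrable M (f j)" for j
  proof -
    show "f j \<in> borel_measurable (F (p n))"
      unfolding f_def using m \<eta> by (intro borel_measurable_times borel_measurable_power) auto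
    have "integrable M (\<lambda>\<omega>. ?M \<omega> ^ (4 - j) * \<eta> n \<omega> ^ j)"
      using mM IH(1) bj by (intro integrable_power_mult_bdd) auto
    then show "integrable M (f j)" unfolding f_def by auto
  qed
  have f0: "f 0 = (\<lambda>\<omega>. ?M \<omega> ^ 4)" by (simp add: f_def fun_eq_iff)
  have eq: "(msum p \<eta> (Suc n) \<omega>) ^ 4 = f 0 \<omega> + f 1 \<omega> * ?D \<omega> + f 2 \<omega> * (?D \<omega>)^2 + f 3 \<omega> * (?D \<omega>)^3 + f 4 \<omega> * (?D \<omega>)^4" for \<omega>
    by (simp add: msum_Suc f_def binomial_ring numeral_eq_Suc atMost_Suc algebra_simps power_mult_distrib)
  have i: "integrable M (\<lambda>\<omega>. f j \<omega> * (?D \<omega>)^k)" for j k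
    using W_mult_integrable[OF p0 pp f] .
  have int: "integrable M (\<lambda>\<omega>. (msum p \<eta> (Suc n) \<omega>) ^ 4)"
    unfolding eq using i[of 1 1] i[of 2 2] i[of 3 3] i[of 4 4] f(2)[of 0] by simp
  have s: "i < n \<Longrightarrow> sq_int (\<eta> i)" for i
    using p Suc.prems by (intro sq_int_bdd[where B=B] F_measurable[of _ "p i"] partition_upto_nonneg[of n p]) auto
  have sq: "sq_int ?M" using p Suc.prems s by (intro msum_sq_int) auto
  have M2: "expectation (\<lambda>\<omega>. (?M \<omega>)\<^sup>2) \<le> B\<^sup>2 * (p n - p 0)"
  proof -
    have "expectation (\<lambda>\<omega>. (?M \<omega>)\<^sup>2) = (\<Sum>i<n. expectation (\<lambda>\<omega>. (\<eta> i \<omega>)\<^sup>2) * (p (Suc i) - p i))"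
      using p Suc.prems s by (intro msum_second_moment) auto
    also have "\<dots> \<le> (\<Sum>i<n. B\<^sup>2 * (p (Suc i) - p i))"
    proof (intro sum_mono mult_right_mono)
      fix i assume i: "i \<in> {..<n}"
      have "expectation (\<lambda>\<omega>. (\<eta> i \<omega>)\<^sup>2) \<le> expectation (\<lambda>\<omega>. B\<^sup>2)"
        using i s[of i] Suc.prems(3)[of i] power_mono[of "\<bar>\<eta> i _\<bar>" B 2]
        by (intro integral_mono) (auto simp: sq_int_square)
      then show "expectation (\<lambda>\<omega>. (\<eta> i \<omega>)\<^sup>2) \<le> B\<^sup>2" by (simp add: prob_space)
      show "0 \<le> p (Suc i) - p i" using i p by (auto simp: partition_upto_def)
    qed
    also have "\<dots> = B\<^sup>2 * (p n - p 0)" by (simp add: sum_distrib_left[symmetric] sum_lessThan_telescope)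
    finally show ?thesis .
  qed
  have f2: "expectation (f 2) \<le> 6 * (B\<^sup>2 * (B\<^sup>2 * (p n - p 0)))"
  proof -
    have "expectation (f 2) \<le> expectation (\<lambda>\<omega>. 6 * B\<^sup>2 * (?M \<omega>)\<^sup>2)"
    proof (rule integral_mono)
      fix \<omega> assume "\<omega> \<in> space M"
      then have "(?M \<omega>)\<^sup>2 * (\<eta> n \<omega>)\<^sup>2 \<le> (?M \<omega>)\<^sup>2 * B\<^sup>2"
        using bj[of \<omega> 2] by (intro mult_left_mono) auto
      then show "f 2 \<omega> \<le> 6 * B\<^sup>2 * (?M \<omega>)\<^sup>2"
        by (simp add: f_def choose_two mult.commute)
    qed (use f sq_int_square[OF sq] in auto)
    also have "\<dots> \<le> 6 * (B\<^sup>2 * (B\<^sup>2 * (p n - p 0)))"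
      using M2 mult_left_mono[OF M2, of "6 * B\<^sup>2"] by simp
    finally show ?thesis .
  qed
  have f4: "expectation (f 4) \<le> B ^ 4"
  proof -
    have "expectation (f 4) \<le> expectation (\<lambda>\<omega>. B ^ 4)"
      using bj[of _ 4] f(2)[of 4] by (intro integral_mono) (auto simp: f_def)
    then show ?thesis by (simp add: prob_space)
  qed
  have "expectation (\<lambda>\<omega>. (msum p \<eta> (Suc n) \<omega>) ^ 4) = expectation (\<lambda>\<omega>. ?M \<omega> ^ 4) + expectation (f 2) * u + expectation (f 4) * (3 * u\<^sup>2)"
    unfolding eq using i[of 1 1] i[of 2 2] i[of 3 3] i[of 4 4] f(2)[of 0]
      W_mult_expectation(1)[OF p0 pp f[of 1]] W_mult_expectation(2)[OF p0 pp f[of 2]]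
      W_mult_expectation(3)[OF p0 pp f[of 3]] W_mult_expectation(4)[OF p0 pp f[of 4]]
    by (simp add: u_def f0)
  also have "\<dots> \<le> 3 * B ^ 4 * (p n - p 0)\<^sup>2 + 6 * (B\<^sup>2 * (B\<^sup>2 * (p n - p 0))) * u + B ^ 4 * (3 * u\<^sup>2)"
    using IH(2) f2 f4 u by (intro add_mono mult_right_mono) auto
  also have "\<dots> = 3 * B ^ 4 * (p n - p 0 + u)\<^sup>2"
    by (simp add: power2_sum algebra_simps numeral_eq_Suc)
  also have "p n - p 0 + u = p (Suc n) - p 0" by (simp add: u_def)
  finally show ?case using int by simp
qed simp

text \<open>Kolmogorov's inequality. Switching the coefficients off after the first exceedance
  yields another martingale transform, whose final value still shows the exceedance; Chebyshev's
  inequality is then applied at the last index only.\<close>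

lemma msum_maximal:
  assumes p: "partition_upto n p" "\<And>i. i < n \<Longrightarrow> \<eta> i \<in> borel_measurable (F (p i))"
    "\<And>i. i < n \<Longrightarrow> sq_int (\<eta> i)" and \<epsilon>: "0 < \<epsilon>"
  shows "prob {\<omega> \<in> space M. \<exists>j\<le>n. \<epsilon> \<le> \<bar>msum p \<eta> j \<omega>\<bar>} \<le>
    (\<Sum>i<n. expectation (\<lambda>\<omega>. (\<eta> i \<omega>)\<^sup>2) * (p (Suc i) - p i)) / \<epsilon>\<^sup>2"
proof -
  \<comment> \<open>The test includes j = i, the sum at time \<open>p i\<close>, which is known when
    the i-th increment begins; so \<open>\<zeta> i\<close> stays measurable at
    \<open>p i\<close>.\<close>
  define \<zeta> where "\<zeta> i \<omega> = (if \<forall>j\<le>i. \<bar>msum p \<eta> j \<omega>\<bar> < \<epsilon> then 1 else 0) * \<eta> i \<omega>" for i \<omega>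
  have mj: "msum p \<eta> j \<in> borel_measurable (F (p i))" if "j \<le> i" "i \<le> n" for i j
  proof (rule F_measurable_mono[of _ "p j"])
    show "msum p \<eta> j \<in> borel_measurable (F (p j))"
      using p that by (intro msum_measurable_F) (auto simp: partition_upto_def)
  qed (use partition_upto_nonneg[OF p(1)] partition_upto_mono[OF p(1)] that in auto)
  have ind: "(\<lambda>\<omega>. (if \<forall>j\<le>i. \<bar>msum p \<eta> j \<omega>\<bar> < \<epsilon> then 1 else 0 :: real)) \<in> borel_measurable (F (p i))" if "i \<le> n" for i
  proof -
    have [measurable]: "j \<le> i \<Longrightarrow> msum p \<eta> j \<in> borel_measurable (F (p i))" for j using mj that by auto
    show ?thesis by measurable
  qed
  have \<zeta>m: "i < n \<Longrightarrow> \<zeta> i \<in> borel_measurable (F (p i))" for i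
    unfolding \<zeta>_def by (intro borel_measurable_times ind p(2)) simp_all
  have \<zeta>le: "\<bar>\<zeta> i \<omega>\<bar> \<le> \<bar>\<eta> i \<omega>\<bar>" for i \<omega> by (simp add: \<zeta>_def)
  have \<zeta>s: "sq_int (\<zeta> i)" if "i < n" for i
  proof (rule sq_int_le[of "\<eta> i"])
    show "\<zeta> i \<in> borel_measurable M"
      using that by (intro F_measurable[OF \<zeta>m] partition_upto_nonneg[OF p(1)]) auto
  qed (use that p(3) \<zeta>le in auto)
  have run: "(\<forall>j<i. \<bar>msum p \<eta> j \<omega>\<bar> < \<epsilon>) \<Longrightarrow> msum p \<zeta> i \<omega> = msum p \<eta> i \<omega>" for i \<omega>
  proof (induction i)
    case (Suc i)
    then have "\<zeta> i \<omega> = \<eta> i \<omega>" by (auto simp: \<zeta>_def)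
    then show ?case using Suc by (simp add: msum_Suc)
  qed simp
  have stop: "\<epsilon> \<le> \<bar>msum p \<zeta> n \<omega>\<bar>" if "j \<le> n" "\<epsilon> \<le> \<bar>msum p \<eta> j \<omega>\<bar>" for j \<omega>
  proof -
    \<comment> \<open>k is the first index with an exceedance. Up to k the two sums agree; from k on
      \<zeta> vanishes, so the switched sum keeps the value reached at k.\<close>
    define k where "k = (LEAST j. \<epsilon> \<le> \<bar>msum p \<eta> j \<omega>\<bar>)"
    have "\<epsilon> \<le> \<bar>msum p \<eta> k \<omega>\<bar>" unfolding k_def by (rule LeastI[of _ j]) fact
    moreover have "k \<le> j" unfolding k_def by (rule Least_le) fact
    moreover have "\<bar>msum p \<eta> i \<omega>\<bar> < \<epsilon>" if "i < k" for i
      using not_less_Least[OF that[unfolded k_def]] by simp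
    ultimately have k: "\<epsilon> \<le> \<bar>msum p \<eta> k \<omega>\<bar>" "k \<le> n" "\<And>i. i < k \<Longrightarrow> \<bar>msum p \<eta> i \<omega>\<bar> < \<epsilon>"
      using \<open>j \<le> n\<close> by auto
    have "msum p \<zeta> (k + i) \<omega> = msum p \<zeta> k \<omega>" for i
    proof (induction i)
      case (Suc i)
      have nb: "\<not> (\<forall>j\<le>k + i. \<bar>msum p \<eta> j \<omega>\<bar> < \<epsilon>)"
        using k(1) by (auto simp: not_less intro!: exI[of _ k])
      have "\<zeta> (k + i) \<omega> = 0" unfolding \<zeta>_def if_not_P[OF nb] by simp
      then show ?case using Suc by (simp add: msum_Suc)
    qed simp
    from this[of "n - k"] k run[of k \<omega>] show ?thesis by simp
  qed
  have sq: "sq_int (msum p \<zeta> n)" using p \<zeta>m \<zeta>s by (intro msum_sq_int) auto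
  have [measurable]: "j \<le> n \<Longrightarrow> msum p \<eta> j \<in> borel_measurable M" for j
    using F_measurable[OF mj[of j n]] partition_upto_nonneg[OF p(1)] by auto
  have [measurable]: "msum p \<zeta> n \<in> borel_measurable M" using sq sq_int_measurable by auto
  have "prob {\<omega> \<in> space M. \<exists>j\<le>n. \<epsilon> \<le> \<bar>msum p \<eta> j \<omega>\<bar>} \<le> prob {\<omega> \<in> space M. \<epsilon>\<^sup>2 \<le> (msum p \<zeta> n \<omega>)\<^sup>2}"
  proof (rule finite_measure_mono)
    show "{\<omega> \<in> space M. \<exists>j\<le>n. \<epsilon> \<le> \<bar>msum p \<eta> j \<omega>\<bar>} \<subseteq> {\<omega> \<in> space M. \<epsilon>\<^sup>2 \<le> (msum p \<zeta> n \<omega>)\<^sup>2}"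
    proof (intro subsetI CollectI conjI; elim CollectE conjE exE)
      fix \<omega> j assume "j \<le> n" "\<epsilon> \<le> \<bar>msum p \<eta> j \<omega>\<bar>"
      from power_mono[OF stop[OF this], of 2] \<epsilon> show "\<epsilon>\<^sup>2 \<le> (msum p \<zeta> n \<omega>)\<^sup>2" by simp
    qed
  qed measurable
  also have "\<dots> \<le> expectation (\<lambda>\<omega>. (msum p \<zeta> n \<omega>)\<^sup>2) / \<epsilon>\<^sup>2"
    using sq_int_square[OF sq] \<epsilon> by (intro integral_Markov_inequality_measure[where A="{}"]) auto
  also have "expectation (\<lambda>\<omega>. (msum p \<zeta> n \<omega>)\<^sup>2) = (\<Sum>i<n. expectation (\<lambda>\<omega>. (\<zeta> i \<omega>)\<^sup>2) * (p (Suc i) - p i))"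
    using p \<zeta>m \<zeta>s by (intro msum_second_moment) auto
  also have "\<dots> \<le> (\<Sum>i<n. expectation (\<lambda>\<omega>. (\<eta> i \<omega>)\<^sup>2) * (p (Suc i) - p i))"
  proof (intro sum_mono mult_right_mono integral_mono)
    fix i \<omega> assume "i \<in> {..<n}"
    then show "integrable M (\<lambda>\<omega>. (\<zeta> i \<omega>)\<^sup>2)" "integrable M (\<lambda>\<omega>. (\<eta> i \<omega>)\<^sup>2)" "0 \<le> p (Suc i) - p i"
      using p(1) \<zeta>s p(3) by (auto intro: sq_int_square simp: partition_upto_def)
    show "(\<zeta> i \<omega>)\<^sup>2 \<le> (\<eta> i \<omega>)\<^sup>2" using \<zeta>le by (simp add: abs_le_square_iff)
  qed
  finally show ?thesis using \<epsilon> by (simp add: divide_right_mono)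
qed

end

section \<open>Convergence in probability and Fatou's lemma\<close>

context prob_space
begin

text \<open>Convergence in probability implies convergence in mean of the distance truncated at 1,
  and convergence in mean has an almost surely convergent subsequence.\<close>

lemma tendsto_in_prob_AE_subseq:
  assumes "tendsto_in_prob M Y Z"
  obtains r :: "nat \<Rightarrow> nat" where "strict_mono r" "AE \<omega> in M. (\<lambda>k. Y (r k) \<omega>) \<longlonglongrightarrow> Z \<omega>"
proof -
  have [measurable]: "Y k \<in> borel_measurable M" "Z \<in> borel_measurable M" for k
    using assms by (auto simp: tendsto_in_prob_def)
  define f where "f k \<omega> = min 1 \<bar>Y k \<omega> - Z \<omega>\<bar>" for k \<omega>
  have [measurable]: "f k \<in> borel_measurable M" for k unfolding f_def by measurable
  have f01: "0 \<le> f k \<omega>" "f k \<omega> \<le> 1" for k \<omega> by (auto simp: f_def)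
  have i: "integrable M (f k)" for k
    using f01 by (intro integrable_const_bound[where B=1]) auto
  have le: "expectation (f k) \<le> \<epsilon> + prob {\<omega> \<in> space M. \<epsilon> < \<bar>Y k \<omega> - Z \<omega>\<bar>}" if "0 < \<epsilon>" for k \<epsilon>
  proof -
    let ?A = "{\<omega> \<in> space M. \<epsilon> < \<bar>Y k \<omega> - Z \<omega>\<bar>}"
    have A: "?A \<in> sets M" by measurable
    have "expectation (f k) \<le> expectation (\<lambda>\<omega>. \<epsilon> + indicator ?A \<omega>)"
    proof (rule integral_mono[OF i])
      show "integrable M (\<lambda>\<omega>. \<epsilon> + indicator ?A \<omega>)"
        using A by (intro Bochner_Integration.integrable_add integrable_const integrable_real_indicator) (auto simp: emeasure_eq_measure)
      show "f k \<omega> \<le> \<epsilon> + indicator ?A \<omega>" if "\<omega> \<in> space M" for \<omega>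
        using that \<open>0 < \<epsilon>\<close> by (auto simp: f_def indicator_def)
    qed
    also have "\<dots> = \<epsilon> + prob ?A"
      using A by (subst Bochner_Integration.integral_add) (auto simp: prob_space emeasure_eq_measure simp del: indicator_simps)
    finally show ?thesis .
  qed
  have "(\<lambda>k. expectation (f k)) \<longlonglongrightarrow> 0"
  proof (rule LIMSEQ_I)
    fix e :: real assume "0 < e"
    then have "(\<lambda>k. prob {\<omega> \<in> space M. e / 2 < \<bar>Y k \<omega> - Z \<omega>\<bar>}) \<longlonglongrightarrow> 0"
      using assms unfolding tendsto_in_prob_def by (meson half_gt_zero)
    from LIMSEQ_D[OF this, of "e / 2"] \<open>0 < e\<close> obtain N where
      N: "\<And>k. k \<ge> N \<Longrightarrow> prob {\<omega> \<in> space M. e / 2 < \<bar>Y k \<omega> - Z \<omega>\<bar>} < e / 2" by auto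
    have "expectation (f k) < e" if "k \<ge> N" for k
      using le[of "e/2" k] N[OF that] \<open>0 < e\<close> by simp
    moreover have "0 \<le> expectation (f k)" for k using f01 by (intro integral_nonneg_AE) auto
    ultimately show "\<exists>N. \<forall>k\<ge>N. norm (expectation (f k) - 0) < e" by auto
  qed
  then have "(\<lambda>k. expectation (\<lambda>\<omega>. norm (f k \<omega> - 0))) \<longlonglongrightarrow> 0"
    using f01 by simp
  then have "(\<lambda>k. \<integral>\<^sup>+\<omega>. norm (f k \<omega> - 0) \<partial>M) \<longlonglongrightarrow> 0"
    using i by (subst nn_integral_eq_integral) (auto simp: f01 intro: tendsto_ennrealI[where x=0, simplified])
  from tendsto_L1_AE_subseq[of M f] i \<open>(\<lambda>k. expectation (\<lambda>\<omega>. norm (f k \<omega> - 0))) \<longlonglongrightarrow> 0\<close>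
  obtain r :: "nat \<Rightarrow> nat" where r: "strict_mono r" "AE \<omega> in M. (\<lambda>k. f (r k) \<omega>) \<longlonglongrightarrow> 0"
    by auto
  \<comment> \<open>The bound \<open>min e 1\<close> keeps the truncated distance below 1, where it
    equals the distance itself.\<close>
  have *: "(\<lambda>k. Y (r k) \<omega>) \<longlonglongrightarrow> Z \<omega>" if "(\<lambda>k. f (r k) \<omega>) \<longlonglongrightarrow> 0" for \<omega>
  proof (rule LIMSEQ_I)
    fix e :: real assume "0 < e"
    from LIMSEQ_D[OF that, of "min e 1"] \<open>0 < e\<close> obtain N where
      N: "\<And>k. k \<ge> N \<Longrightarrow> \<bar>f (r k) \<omega>\<bar> < min e 1" by auto
    have "\<bar>Y (r k) \<omega> - Z \<omega>\<bar> < e" if "k \<ge> N" for k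
      using N[OF that] by (auto simp: f_def min_def split: if_splits)
    then show "\<exists>N. \<forall>k\<ge>N. norm (Y (r k) \<omega> - Z \<omega>) < e" by auto
  qed
  from r(2) have "AE \<omega> in M. (\<lambda>k. Y (r k) \<omega>) \<longlonglongrightarrow> Z \<omega>"
    by eventually_elim (rule *)
  with r(1) show ?thesis by (rule that)
qed

text \<open>Fatou's lemma along an almost surely convergent subsequence. The bounds
  \<open>c k\<close> vary with k and only their limit is kept. It is applied to squares, fourth
  powers and absolute values.\<close>

lemma fatou_in_prob:
  assumes V: "tendsto_in_prob M V U" and g: "continuous_on UNIV g" "\<And>x. 0 \<le> g x"
    and i: "\<And>k. integrable M (\<lambda>\<omega>. g (V k \<omega>))" and c: "\<And>k. expectation (\<lambda>\<omega>. g (V k \<omega>)) \<le> c k" "c \<longlonglongrightarrow> (l::real)"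
  shows "integrable M (\<lambda>\<omega>. g (U \<omega>))" and "expectation (\<lambda>\<omega>. g (U \<omega>)) \<le> l"
proof -
  have [measurable]: "V k \<in> borel_measurable M" "U \<in> borel_measurable M" for k
    using assms by (auto simp: tendsto_in_prob_def)
  have [measurable]: "g \<in> borel_measurable borel" using g(1) by (rule borel_measurable_continuous_onI)
  obtain r :: "nat \<Rightarrow> nat" where r: "strict_mono r" "AE \<omega> in M. (\<lambda>k. V (r k) \<omega>) \<longlonglongrightarrow> U \<omega>"
    using tendsto_in_prob_AE_subseq[OF V] .
  have c0: "0 \<le> c k" for k using order_trans[OF integral_nonneg_AE c(1)[of k]] g(2) by auto
  have l0: "0 \<le> l" using c0 c(2) by (intro LIMSEQ_le_const) auto
  have "(\<integral>\<^sup>+\<omega>. ennreal (g (U \<omega>)) \<partial>M) = (\<integral>\<^sup>+\<omega>. liminf (\<lambda>k. ennreal (g (V (r k) \<omega>))) \<partial>M)"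
  proof (rule nn_integral_cong_AE, use r(2) in eventually_elim)
    case (elim \<omega>)
    have "(\<lambda>k. g (V (r k) \<omega>)) \<longlonglongrightarrow> g (U \<omega>)"
      using g(1) elim by (auto simp: continuous_on_def intro: tendsto_compose)
    then have "(\<lambda>k. ennreal (g (V (r k) \<omega>))) \<longlonglongrightarrow> ennreal (g (U \<omega>))" by (rule tendsto_ennrealI)
    from lim_imp_Liminf[OF _ this] show ?case by simp
  qed
  also have "\<dots> \<le> liminf (\<lambda>k. \<integral>\<^sup>+\<omega>. ennreal (g (V (r k) \<omega>)) \<partial>M)"
    by (rule nn_integral_liminf) measurable
  also have "\<dots> \<le> liminf (\<lambda>k. ennreal (c (r k)))"
    using c(1) c0 g(2) by (intro Liminf_mono always_eventually allI)
      (auto simp: nn_integral_eq_integral[OF i] intro!: ennreal_leI)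
  also have "\<dots> = ennreal l"
    using LIMSEQ_subseq_LIMSEQ[OF c(2) r(1)] by (intro lim_imp_Liminf tendsto_ennrealI) (auto simp: comp_def)
  finally have *: "(\<integral>\<^sup>+\<omega>. ennreal (g (U \<omega>)) \<partial>M) \<le> ennreal l" .
  show int: "integrable M (\<lambda>\<omega>. g (U \<omega>))"
    using g(2) * by (intro integrableI_bounded) (auto intro: le_less_trans)
  show "expectation (\<lambda>\<omega>. g (U \<omega>)) \<le> l"
    using * l0 g(2) by (simp add: nn_integral_eq_integral[OF int])
qed

lemma tendsto_in_prob_sq:
  assumes m: "\<And>k. V k \<in> borel_measurable M" "U \<in> borel_measurable M"
    and i: "\<And>k. integrable M (\<lambda>\<omega>. (V k \<omega> - U \<omega>)\<^sup>2)" and lim: "(\<lambda>k. expectation (\<lambda>\<omega>. (V k \<omega> - U \<omega>)\<^sup>2)) \<longlonglongrightarrow> 0"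
  shows "tendsto_in_prob M V U"
  unfolding tendsto_in_prob_def
proof (intro conjI allI impI m)
  fix \<epsilon> :: real assume \<epsilon>: "0 < \<epsilon>"
  have [measurable]: "\<And>k. V k \<in> borel_measurable M" "U \<in> borel_measurable M" using m by auto
  have "prob {\<omega> \<in> space M. \<epsilon> < \<bar>V k \<omega> - U \<omega>\<bar>} \<le> expectation (\<lambda>\<omega>. (V k \<omega> - U \<omega>)\<^sup>2) / \<epsilon>\<^sup>2" for k
  proof -
    have "prob {\<omega> \<in> space M. \<epsilon> < \<bar>V k \<omega> - U \<omega>\<bar>} \<le> prob {\<omega> \<in> space M. \<epsilon>\<^sup>2 \<le> (V k \<omega> - U \<omega>)\<^sup>2}"
      using \<epsilon> by (intro finite_measure_mono) (auto simp: abs_le_square_iff[symmetric])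
    also have "\<dots> \<le> expectation (\<lambda>\<omega>. (V k \<omega> - U \<omega>)\<^sup>2) / \<epsilon>\<^sup>2"
      using i \<epsilon> by (intro integral_Markov_inequality_measure[where A="{}"]) auto
    finally show ?thesis .
  qed
  moreover have "(\<lambda>k. expectation (\<lambda>\<omega>. (V k \<omega> - U \<omega>)\<^sup>2) / \<epsilon>\<^sup>2) \<longlonglongrightarrow> 0"
    using tendsto_divide[OF lim tendsto_const[of "\<epsilon>\<^sup>2"]] \<epsilon> by simp
  ultimately show "(\<lambda>k. prob {\<omega> \<in> space M. \<epsilon> < \<bar>V k \<omega> - U \<omega>\<bar>}) \<longlonglongrightarrow> 0"
    by (rule_tac tendsto_sandwich[OF _ _ tendsto_const]) auto
qed

lemma tendsto_in_prob_AE: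
  assumes m: "\<And>k. V k \<in> borel_measurable M" "U \<in> borel_measurable M"
    and lim: "AE \<omega> in M. (\<lambda>k. V k \<omega>) \<longlonglongrightarrow> U \<omega>"
  shows "tendsto_in_prob M V U"
  unfolding tendsto_in_prob_def
proof (intro conjI allI impI m)
  fix \<epsilon> :: real assume \<epsilon>: "0 < \<epsilon>"
  have [measurable]: "\<And>k. V k \<in> borel_measurable M" "U \<in> borel_measurable M" using m by auto
  let ?i = "\<lambda>k. indicator {\<omega> \<in> space M. \<epsilon> < \<bar>V k \<omega> - U \<omega>\<bar>} :: 'a \<Rightarrow> real"
  have "(\<lambda>k. expectation (?i k)) \<longlonglongrightarrow> expectation (\<lambda>\<omega>. 0)"
  proof (rule integral_dominated_convergence[where w="\<lambda>_. 1"])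
    show "AE \<omega> in M. (\<lambda>k. ?i k \<omega>) \<longlonglongrightarrow> 0"
      using lim
    proof eventually_elim
      case (elim \<omega>)
      from LIMSEQ_D[OF elim \<epsilon>] have "eventually (\<lambda>k. ?i k \<omega> = 0) sequentially"
        by (auto simp: eventually_sequentially indicator_def not_less intro: less_imp_le)
      then show ?case by (rule tendsto_eventually)
    qed
  qed (auto simp: indicator_def)
  then show "(\<lambda>k. prob {\<omega> \<in> space M. \<epsilon> < \<bar>V k \<omega> - U \<omega>\<bar>}) \<longlonglongrightarrow> 0" by simp
qed

lemma tendsto_in_prob_diff_const:
  assumes "tendsto_in_prob M V U" "Z \<in> borel_measurable M"
  shows "tendsto_in_prob M (\<lambda>k \<omega>. V k \<omega> - Z \<omega>) (\<lambda>\<omega>. U \<omega> - Z \<omega>)"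
  using assms unfolding tendsto_in_prob_def by (auto intro: borel_measurable_diff)

end

lemma integral_indicator_Ioc_mult:
  fixes a b c d :: real
  assumes "a \<le> b" "c \<le> d"
  shows "integrable lborel (\<lambda>s. indicator {a<..b} s * indicator {c<..d} s :: real)"
    and "(\<integral>s. indicator {a<..b} s * indicator {c<..d} s \<partial>lborel) = max 0 (min b d - max a c)"
proof -
  have *: "(\<lambda>s. indicator {a<..b} s * indicator {c<..d} s :: real) = indicator {max a c<..min b d}"
    by (auto simp: indicator_def fun_eq_iff)
  show "integrable lborel (\<lambda>s. indicator {a<..b} s * indicator {c<..d} s :: real)"
    unfolding * by (cases "max a c \<le> min b d") auto
  show "(\<integral>s. indicator {a<..b} s * indicator {c<..d} s \<partial>lborel) = max 0 (min b d - max a c)"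
    unfolding * by (cases "max a c \<le> min b d") (auto simp: max_def)
qed

context wiener_space
begin

section \<open>Dyadic sums and the Ito integral\<close>

text \<open>Intervals may overlap and come in any order, so that steps on unrelated grids can be
  compared. Measurability at the left end is demanded of nonempty intervals only: cutting a grid off
  at time t collapses its later cells to the point t, while their coefficients may be known only
  after t.\<close>

definition adapted_steps :: "nat \<Rightarrow> (nat \<Rightarrow> real) \<Rightarrow> (nat \<Rightarrow> real) \<Rightarrow> (nat \<Rightarrow> 'a \<Rightarrow> real) \<Rightarrow> bool" where
  "adapted_steps n a b \<xi> \<longleftrightarrow> (\<forall>i<n. 0 \<le> a i \<and> a i \<le> b i \<and> \<xi> i \<in> borel_measurable M \<and>
     (a i < b i \<longrightarrow> \<xi> i \<in> borel_measurable (F (a i))) \<and> (\<exists>B. \<forall>\<omega>\<in>space M. \<bar>\<xi> i \<omega>\<bar> \<le> B))"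

definition step_value :: "nat \<Rightarrow> (nat \<Rightarrow> real) \<Rightarrow> (nat \<Rightarrow> real) \<Rightarrow> (nat \<Rightarrow> 'a \<Rightarrow> real) \<Rightarrow> 'a \<Rightarrow> real \<Rightarrow> real" where
  "step_value n a b \<xi> \<omega> s = (\<Sum>i<n. \<xi> i \<omega> * indicator {a i<..b i} s)"

definition step_integral :: "nat \<Rightarrow> (nat \<Rightarrow> real) \<Rightarrow> (nat \<Rightarrow> real) \<Rightarrow> (nat \<Rightarrow> 'a \<Rightarrow> real) \<Rightarrow> 'a \<Rightarrow> real" where
  "step_integral n a b \<xi> \<omega> = (\<Sum>i<n. \<xi> i \<omega> * (W (b i) \<omega> - W (a i) \<omega>))"

text \<open>Only the overlap of the two intervals contributes. The part of the first interval before
  c is known when the second one starts, the overlap contributes its Gaussian variance, and what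
  lies beyond the overlap is independent of everything before. Ordering the left ends by
  \<open>a \<le> c\<close> is no loss, by symmetry.\<close>

lemma W_increments_product:
  assumes ab: "0 \<le> a" "a \<le> b" and cd: "c \<le> d" and ac: "a \<le> c"
    and \<xi>: "a < b \<Longrightarrow> \<xi> \<in> borel_measurable (F a)" "\<xi> \<in> borel_measurable M" "\<And>\<omega>. \<omega> \<in> space M \<Longrightarrow> \<bar>\<xi> \<omega>\<bar> \<le> B"
    and \<eta>: "c < d \<Longrightarrow> \<eta> \<in> borel_measurable (F c)" "\<eta> \<in> borel_measurable M" "\<And>\<omega>. \<omega> \<in> space M \<Longrightarrow> \<bar>\<eta> \<omega>\<bar> \<le> B'"
  shows "expectation (\<lambda>\<omega>. (\<xi> \<omega> * (W b \<omega> - W a \<omega>)) * (\<eta> \<omega> * (W d \<omega> - W c \<omega>))) =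
    expectation (\<lambda>\<omega>. \<xi> \<omega> * \<eta> \<omega>) * max 0 (min b d - max a c)"
proof (cases "a = b \<or> c = d")
  case True
  then show ?thesis using ac ab cd by (auto simp: max_def min_def)
next
  case False
  then have ab': "a < b" and cd': "c < d" using ab cd by auto
  note \<xi>a = \<xi>(1)[OF ab'] and \<eta>c = \<eta>(1)[OF cd']
  have c0: "0 \<le> c" using ab ac by simp
  have \<xi>c: "\<xi> \<in> borel_measurable (F c)" using F_measurable_mono[OF \<xi>a] ab ac by auto
  have \<xi>\<eta>: "(\<lambda>\<omega>. \<xi> \<omega> * \<eta> \<omega>) \<in> borel_measurable (F c)" using \<xi>c \<eta>c by (rule borel_measurable_times)
  have s\<xi>: "sq_int \<xi>" using \<xi> by (intro sq_int_bdd)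
  have s\<eta>: "sq_int \<eta>" using \<eta> by (intro sq_int_bdd)
  have i\<xi>\<eta>: "integrable M (\<lambda>\<omega>. \<xi> \<omega> * \<eta> \<omega>)" using sq_int_mult_integrable[OF s\<xi> s\<eta>] .
  \<comment> \<open>The part of (a, b] before c ends at e, whether or not b reaches c.\<close>
  define e where "e = min b c"
  have e: "a \<le> e" "e \<le> c" "0 \<le> e" "e \<le> b" using ab ac ab' by (auto simp: e_def)
  have fm: "(\<lambda>\<omega>. \<xi> \<omega> * (W e \<omega> - W a \<omega>) * \<eta> \<omega>) \<in> borel_measurable (F c)"
    using \<xi>c \<eta>c W_measurable_F[of e c] W_measurable_F[of a c] e ab ac
    by (intro borel_measurable_times borel_measurable_diff) auto
  have fi: "integrable M (\<lambda>\<omega>. \<xi> \<omega> * (W e \<omega> - W a \<omega>) * \<eta> \<omega>)"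
    using W_mult_sq_int[OF ab(1) e(1) \<xi>a s\<xi>] s\<eta> by (rule sq_int_mult_integrable)
  have z: "expectation (\<lambda>\<omega>. \<xi> \<omega> * (W e \<omega> - W a \<omega>) * \<eta> \<omega> * (W d \<omega> - W c \<omega>)) = 0"
    using W_mult_expectation(1)[OF c0 cd fm fi] .
  show ?thesis
  proof (cases "b \<le> c")
    case True
    then show ?thesis using z ab' cd' by (simp add: e_def min_absorb1 mult.assoc)
  next
    case False
    then have e': "e = c" and bc: "c \<le> b" by (auto simp: e_def)
    \<comment> \<open>The overlap is (c, m], and (m, k] is the excess of whichever interval ends
      later; thus one identity serves both orders of b and d.\<close>
    define m where "m = min b d"
    define k where "k = max b d"
    have m: "c \<le> m" "m \<le> k" "0 \<le> m" using bc cd c0 by (auto simp: m_def k_def)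
    have g: "(\<lambda>\<omega>. \<xi> \<omega> * \<eta> \<omega> * (W m \<omega> - W c \<omega>)) \<in> borel_measurable (F m)"
      using W_measurable_F[of m m] W_measurable_F[of c m] m c0
      by (intro borel_measurable_times[OF F_measurable_mono[OF \<xi>\<eta> c0 m(1)]] borel_measurable_diff) auto
    have gi: "integrable M (\<lambda>\<omega>. \<xi> \<omega> * \<eta> \<omega> * (W m \<omega> - W c \<omega>))"
      using W_mult_integrable[OF c0 m(1) \<xi>\<eta> i\<xi>\<eta>, of 1] by simp
    have "(\<xi> \<omega> * (W b \<omega> - W a \<omega>)) * (\<eta> \<omega> * (W d \<omega> - W c \<omega>)) =
      \<xi> \<omega> * (W e \<omega> - W a \<omega>) * \<eta> \<omega> * (W d \<omega> - W c \<omega>) + (\<xi> \<omega> * \<eta> \<omega> * (W m \<omega> - W c \<omega>)^2 +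
       \<xi> \<omega> * \<eta> \<omega> * (W m \<omega> - W c \<omega>) * (W k \<omega> - W m \<omega>))" for \<omega>
      unfolding e' by (cases "b \<le> d") (simp_all add: m_def k_def min_def max_def algebra_simps power2_eq_square)
    then have "expectation (\<lambda>\<omega>. (\<xi> \<omega> * (W b \<omega> - W a \<omega>)) * (\<eta> \<omega> * (W d \<omega> - W c \<omega>))) =
      0 + (expectation (\<lambda>\<omega>. \<xi> \<omega> * \<eta> \<omega>) * (m - c) + 0)"
      using z W_mult_expectation(2)[OF c0 m(1) \<xi>\<eta> i\<xi>\<eta>] W_mult_expectation(1)[OF m(3,2) g gi]
        W_mult_integrable[OF c0 m(1) \<xi>\<eta> i\<xi>\<eta>, of 2] W_mult_integrable[OF m(3,2) g gi, of 1]
        W_mult_integrable[OF c0 cd fm fi, of 1]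
      by simp
    then show ?thesis using ac m by (simp add: m_def max_absorb2)
  qed
qed

lemma adapted_steps_sq_int:
  assumes "adapted_steps n a b \<xi>" "i < n" shows "sq_int (\<xi> i)"
proof -
  obtain B where "\<forall>\<omega>\<in>space M. \<bar>\<xi> i \<omega>\<bar> \<le> B" using assms unfolding adapted_steps_def by blast
  then show ?thesis using assms by (intro sq_int_bdd[of _ B]) (auto simp: adapted_steps_def)
qed

lemma step_value_product_integral:
  assumes "adapted_steps n a b \<xi>" "adapted_steps m c d \<eta>"
  shows "integrable lborel (\<lambda>s. step_value n a b \<xi> \<omega> s * step_value m c d \<eta> \<omega> s)"
    and "(\<integral>s. step_value n a b \<xi> \<omega> s * step_value m c d \<eta> \<omega> s \<partial>lborel) =
      (\<Sum>i<n. \<Sum>j<m. \<xi> i \<omega> * \<eta> j \<omega> * max 0 (min (b i) (d j) - max (a i) (c j)))"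
proof -
  have *: "step_value n a b \<xi> \<omega> s * step_value m c d \<eta> \<omega> s = (\<Sum>i<n. \<Sum>j<m. (\<xi> i \<omega> * \<eta> j \<omega>) *
      (indicator {a i<..b i} s * indicator {c j<..d j} s))" for s
    unfolding step_value_def sum_product by (intro sum.cong refl) (simp only: mult_ac)
  have i: "integrable lborel (\<lambda>s. (\<xi> i \<omega> * \<eta> j \<omega>) * (indicator {a i<..b i} s * indicator {c j<..d j} s))"
    if "i < n" "j < m" for i j
    using integral_indicator_Ioc_mult(1)[of "a i" "b i" "c j" "d j"] assms that by (simp add: adapted_steps_def)
  show "integrable lborel (\<lambda>s. step_value n a b \<xi> \<omega> s * step_value m c d \<eta> \<omega> s)"
    unfolding * using i by (intro Bochner_Integration.integrable_sum) auto
  show "(\<integral>s. step_value n a b \<xi> \<omega> s * step_value m c d \<eta> \<omega> s \<partial>lborel) =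
      (\<Sum>i<n. \<Sum>j<m. \<xi> i \<omega> * \<eta> j \<omega> * max 0 (min (b i) (d j) - max (a i) (c j)))"
    unfolding * using i integral_indicator_Ioc_mult assms
    by (subst Bochner_Integration.integral_sum, force intro!: Bochner_Integration.integrable_sum)
       (intro sum.cong refl, subst Bochner_Integration.integral_sum, auto simp: adapted_steps_def)
qed

lemma step_integral_sq_int:
  assumes "adapted_steps n a b \<xi>" shows "sq_int (step_integral n a b \<xi>)"
proof -
  have "sq_int (\<lambda>\<omega>. \<xi> i \<omega> * (W (b i) \<omega> - W (a i) \<omega>))" if "i < n" for i
  proof (cases "a i < b i")
    case True
    then show ?thesis using assms that adapted_steps_sq_int[OF assms that]
      by (intro W_mult_sq_int) (auto simp: adapted_steps_def)
  next
    case False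
    then have "a i = b i" using assms that by (auto simp: adapted_steps_def)
    then show ?thesis by (simp add: sq_int_const)
  qed
  then show ?thesis unfolding step_integral_def[abs_def] by (intro sq_int_sum) auto
qed

text \<open>The polarised Ito isometry. Summing over overlaps of pairs of intervals takes the place
  of a common refinement of the two grids.\<close>

lemma step_integral_product:
  assumes "adapted_steps n a b \<xi>" "adapted_steps m c d \<eta>"
  shows "integrable M (\<lambda>\<omega>. \<integral>s. step_value n a b \<xi> \<omega> s * step_value m c d \<eta> \<omega> s \<partial>lborel)"
    and "expectation (\<lambda>\<omega>. step_integral n a b \<xi> \<omega> * step_integral m c d \<eta> \<omega>) =
      expectation (\<lambda>\<omega>. \<integral>s. step_value n a b \<xi> \<omega> s * step_value m c d \<eta> \<omega> s \<partial>lborel)"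
proof -
  have s: "sq_int (\<xi> i)" if "i < n" for i using adapted_steps_sq_int assms that by blast
  have s': "sq_int (\<eta> i)" if "i < m" for i using adapted_steps_sq_int assms that by blast
  have si: "integrable M (\<lambda>\<omega>. \<xi> i \<omega> * \<eta> j \<omega>)" if "i < n" "j < m" for i j
    using s s' that by (intro sq_int_mult_integrable)
  show "integrable M (\<lambda>\<omega>. \<integral>s. step_value n a b \<xi> \<omega> s * step_value m c d \<eta> \<omega> s \<partial>lborel)"
    unfolding step_value_product_integral[OF assms] using si
    by (intro Bochner_Integration.integrable_sum integrable_mult_left) auto
  have w: "sq_int (\<lambda>\<omega>. \<xi> i \<omega> * (W (b i) \<omega> - W (a i) \<omega>))" if "i < n" for i
    using step_integral_sq_int[of 1 "\<lambda>_. a i" "\<lambda>_. b i" "\<lambda>_. \<xi> i"] assms that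
    by (auto simp: adapted_steps_def step_integral_def[abs_def])
  have w': "sq_int (\<lambda>\<omega>. \<eta> i \<omega> * (W (d i) \<omega> - W (c i) \<omega>))" if "i < m" for i
    using step_integral_sq_int[of 1 "\<lambda>_. c i" "\<lambda>_. d i" "\<lambda>_. \<eta> i"] assms that
    by (auto simp: adapted_steps_def step_integral_def[abs_def])
  have e: "expectation (\<lambda>\<omega>. (\<xi> i \<omega> * (W (b i) \<omega> - W (a i) \<omega>)) * (\<eta> j \<omega> * (W (d j) \<omega> - W (c j) \<omega>))) =
    expectation (\<lambda>\<omega>. \<xi> i \<omega> * \<eta> j \<omega>) * max 0 (min (b i) (d j) - max (a i) (c j))" if ij: "i < n" "j < m" for i j
  proof -
    obtain B where B: "\<And>\<omega>. \<omega> \<in> space M \<Longrightarrow> \<bar>\<xi> i \<omega>\<bar> \<le> B" using assms ij unfolding adapted_steps_def by blast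
    obtain B' where B': "\<And>\<omega>. \<omega> \<in> space M \<Longrightarrow> \<bar>\<eta> j \<omega>\<bar> \<le> B'" using assms ij unfolding adapted_steps_def by blast
    show ?thesis
    proof (cases "a i \<le> c j")
      case True
      show ?thesis
        by (rule W_increments_product[OF _ _ _ True _ _ B _ _ B'])
           (use assms ij in \<open>auto simp: adapted_steps_def\<close>)
    next
      case False
      then have "expectation (\<lambda>\<omega>. (\<eta> j \<omega> * (W (d j) \<omega> - W (c j) \<omega>)) * (\<xi> i \<omega> * (W (b i) \<omega> - W (a i) \<omega>))) =
        expectation (\<lambda>\<omega>. \<eta> j \<omega> * \<xi> i \<omega>) * max 0 (min (d j) (b i) - max (c j) (a i))"
        by (intro W_increments_product[OF _ _ _ _ _ _ B' _ _ B])
           (use assms ij in \<open>auto simp: adapted_steps_def\<close>)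
      then show ?thesis by (simp add: mult.commute min.commute max.commute)
    qed
  qed
  have "expectation (\<lambda>\<omega>. step_integral n a b \<xi> \<omega> * step_integral m c d \<eta> \<omega>) =
    (\<Sum>i<n. \<Sum>j<m. expectation (\<lambda>\<omega>. (\<xi> i \<omega> * (W (b i) \<omega> - W (a i) \<omega>)) * (\<eta> j \<omega> * (W (d j) \<omega> - W (c j) \<omega>))))"
    unfolding step_integral_def sum_product using w w'
    by (subst Bochner_Integration.integral_sum, force intro!: Bochner_Integration.integrable_sum sq_int_mult_integrable)
       (intro sum.cong refl Bochner_Integration.integral_sum sq_int_mult_integrable, auto)
  also have "\<dots> = (\<Sum>i<n. \<Sum>j<m. expectation (\<lambda>\<omega>. \<xi> i \<omega> * \<eta> j \<omega>) * max 0 (min (b i) (d j) - max (a i) (c j)))"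
    using e by (intro sum.cong refl) auto
  also have "\<dots> = expectation (\<lambda>\<omega>. \<integral>s. step_value n a b \<xi> \<omega> s * step_value m c d \<eta> \<omega> s \<partial>lborel)"
    unfolding step_value_product_integral[OF assms] using si
    by (subst Bochner_Integration.integral_sum, force intro!: Bochner_Integration.integrable_sum)
       (intro sum.cong refl, subst Bochner_Integration.integral_sum, auto)
  finally show "expectation (\<lambda>\<omega>. step_integral n a b \<xi> \<omega> * step_integral m c d \<eta> \<omega>) =
      expectation (\<lambda>\<omega>. \<integral>s. step_value n a b \<xi> \<omega> s * step_value m c d \<eta> \<omega> s \<partial>lborel)" .
qed

lemma step_integral_isometry:
  assumes "adapted_steps n a b \<xi>" "adapted_steps m c d \<eta>"
  shows "expectation (\<lambda>\<omega>. (step_integral n a b \<xi> \<omega> - step_integral m c d \<eta> \<omega>)\<^sup>2) =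
      expectation (\<lambda>\<omega>. \<integral>s. (step_value n a b \<xi> \<omega> s - step_value m c d \<eta> \<omega> s)\<^sup>2 \<partial>lborel)"
proof -
  let ?J = "step_integral n a b \<xi>" and ?K = "step_integral m c d \<eta>"
  let ?H = "step_value n a b \<xi>" and ?G = "step_value m c d \<eta>"
  note s = step_integral_sq_int[OF assms(1)] step_integral_sq_int[OF assms(2)]
  have "expectation (\<lambda>\<omega>. (?J \<omega> - ?K \<omega>)\<^sup>2) = expectation (\<lambda>\<omega>. ?J \<omega> * ?J \<omega> - 2 * (?J \<omega> * ?K \<omega>) + ?K \<omega> * ?K \<omega>)"
    by (simp add: power2_eq_square algebra_simps)
  also have "\<dots> = expectation (\<lambda>\<omega>. ?J \<omega> * ?J \<omega>) - 2 * expectation (\<lambda>\<omega>. ?J \<omega> * ?K \<omega>) + expectation (\<lambda>\<omega>. ?K \<omega> * ?K \<omega>)"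
    using sq_int_mult_integrable[OF s(1) s(1)] sq_int_mult_integrable[OF s] sq_int_mult_integrable[OF s(2) s(2)] by simp
  also have "\<dots> = expectation (\<lambda>\<omega>. (\<integral>s. ?H \<omega> s * ?H \<omega> s \<partial>lborel) - 2 * (\<integral>s. ?H \<omega> s * ?G \<omega> s \<partial>lborel) + (\<integral>s. ?G \<omega> s * ?G \<omega> s \<partial>lborel))"
    using step_integral_product[OF assms] step_integral_product[OF assms(1) assms(1)]
      step_integral_product[OF assms(2) assms(2)] by simp
  also have "\<dots> = expectation (\<lambda>\<omega>. \<integral>s. (?H \<omega> s - ?G \<omega> s)\<^sup>2 \<partial>lborel)"
  proof (rule Bochner_Integration.integral_cong[OF refl])
    fix \<omega>
    note i = step_value_product_integral(1)[OF assms, of \<omega>] step_value_product_integral(1)[OF assms(1) assms(1), of \<omega>]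
      step_value_product_integral(1)[OF assms(2) assms(2), of \<omega>]
    have "(\<integral>s. (?H \<omega> s - ?G \<omega> s)\<^sup>2 \<partial>lborel) = (\<integral>s. ?H \<omega> s * ?H \<omega> s - 2 * (?H \<omega> s * ?G \<omega> s) + ?G \<omega> s * ?G \<omega> s \<partial>lborel)"
      by (simp add: power2_eq_square algebra_simps)
    then show "(\<integral>s. ?H \<omega> s * ?H \<omega> s \<partial>lborel) - 2 * (\<integral>s. ?H \<omega> s * ?G \<omega> s \<partial>lborel) + (\<integral>s. ?G \<omega> s * ?G \<omega> s \<partial>lborel) =
       (\<integral>s. (?H \<omega> s - ?G \<omega> s)\<^sup>2 \<partial>lborel)" using i by simp
  qed
  finally show ?thesis .
qed

end

section \<open>Dyadic grids\<close>

definition dyadic_left :: "nat \<Rightarrow> real \<Rightarrow> real" where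
  "dyadic_left l s = real (nat (\<lceil>s * 2 ^ l\<rceil> - 1)) / 2 ^ l"

text \<open>The number of cells that meet (0, t]; the last one may reach beyond t.\<close>

definition dyadic_count :: "nat \<Rightarrow> real \<Rightarrow> nat" where
  "dyadic_count l t = nat \<lceil>t * 2 ^ l\<rceil>"

text \<open>Cells are open on the left and closed on the right, as for simple processes: a positive
  grid point belongs to the cell that ends there, so \<open>dyadic_left\<close> moves it one step
  down. At time 0 the conversion by \<open>nat\<close> sends the index -1 to 0.\<close>

lemma dyadic_left_eq:
  assumes "real i / 2 ^ l < s" "s \<le> real (Suc i) / 2 ^ l"
  shows "dyadic_left l s = real i / 2 ^ l"
proof -
  have "\<lceil>s * 2 ^ l\<rceil> = int i + 1"
    using assms by (intro ceiling_unique) (auto simp: field_simps)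
  then show ?thesis by (simp add: dyadic_left_def)
qed

lemma dyadic_left_0 [simp]: "dyadic_left l 0 = 0"
  by (simp add: dyadic_left_def)

lemma dyadic_left_cell:
  assumes "0 < s"
  obtains i where "real i / 2 ^ l < s" "s \<le> real (Suc i) / 2 ^ l" "dyadic_left l s = real i / 2 ^ l"
proof -
  define i where "i = nat (\<lceil>s * 2 ^ l\<rceil> - 1)"
  have "0 < \<lceil>s * 2 ^ l\<rceil>" using assms by simp
  then have "real i = of_int \<lceil>s * 2 ^ l\<rceil> - 1" by (simp add: i_def)
  then have "real i < s * 2 ^ l" "s * 2 ^ l \<le> real (Suc i)" by linarith+
  then have "real i / 2 ^ l < s" "s \<le> real (Suc i) / 2 ^ l" by (simp_all add: field_simps)
  with dyadic_left_eq[OF this] show ?thesis using that by blast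
qed

lemma dyadic_left_bounds:
  assumes "0 \<le> s"
  shows "0 \<le> dyadic_left l s" "dyadic_left l s \<le> s" "s - 1 / 2 ^ l \<le> dyadic_left l s"
proof -
  show "0 \<le> dyadic_left l s" by (simp add: dyadic_left_def)
  have "dyadic_left l s \<le> s \<and> s - 1 / 2 ^ l \<le> dyadic_left l s"
  proof (cases "s = 0")
    case False
    then have "0 < s" using assms by simp
    from dyadic_left_cell[OF this, of l] obtain i where
      i: "real i / 2 ^ l < s" "s \<le> real (Suc i) / 2 ^ l" "dyadic_left l s = real i / 2 ^ l" by blast
    have "real (Suc i) / 2 ^ l = real i / 2 ^ l + 1 / 2 ^ l" by (simp add: add_divide_distrib)
    then show ?thesis using i by linarith
  qed simp
  then show "dyadic_left l s \<le> s" "s - 1 / 2 ^ l \<le> dyadic_left l s" by auto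
qed

lemma half_power_tendsto_0: "(\<lambda>l. c / 2 ^ l) \<longlonglongrightarrow> (0::real)"
  using LIMSEQ_divide_realpow_zero[of 2 c] by simp

lemma dyadic_left_tendsto:
  assumes "0 \<le> s" shows "(\<lambda>l. dyadic_left l s) \<longlonglongrightarrow> s"
proof (rule tendsto_sandwich[of "\<lambda>l. s - 1 / 2 ^ l" _ _ "\<lambda>l. s"])
  show "(\<lambda>l. s - 1 / 2 ^ l) \<longlonglongrightarrow> s"
    using tendsto_diff[OF tendsto_const half_power_tendsto_0[of 1], of s] by simp
qed (use dyadic_left_bounds[OF assms] in auto)

lemma dyadic_refine:
  assumes "n \<le> m"
  shows "real k / 2 ^ n = real (k * 2 ^ (m - n)) / 2 ^ m"
proof -
  have "(2::real) ^ m = 2 ^ n * 2 ^ (m - n)" using assms by (simp add: power_add[symmetric])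
  then show ?thesis by (simp add: field_simps)
qed

text \<open>A coarse grid point is also a fine grid point, and it lies strictly before s; the last
  fine grid point strictly before s is therefore no earlier.\<close>

lemma dyadic_left_ge:
  assumes "n \<le> m" "real k / 2 ^ n < s"
  shows "real k / 2 ^ n \<le> dyadic_left m s"
proof -
  have "0 < s" using assms(2) by (smt (verit) divide_nonneg_nonneg of_nat_0_le_iff zero_le_power)
  from dyadic_left_cell[OF this, of m] obtain i where
    i: "s \<le> real (Suc i) / 2 ^ m" "dyadic_left m s = real i / 2 ^ m" by blast
  have "real (k * 2 ^ (m - n)) / 2 ^ m < real (Suc i) / 2 ^ m"
    using i(1) assms dyadic_refine[OF assms(1), of k] by linarith
  then have "k * 2 ^ (m - n) < Suc i" by (simp add: divide_less_cancel del: of_nat_mult of_nat_Suc)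
  then show ?thesis unfolding i dyadic_refine[OF assms(1), of k]
    by (intro divide_right_mono) (auto simp: less_Suc_eq_le simp del: of_nat_mult)
qed

lemma dyadic_count_less:
  assumes "i < dyadic_count l t" shows "real i / 2 ^ l < t"
proof -
  have "int i < \<lceil>t * 2 ^ l\<rceil>" using assms by (simp add: dyadic_count_def zless_nat_eq_int_zless)
  then have "real i < t * 2 ^ l" by (simp add: less_ceiling_iff)
  then show ?thesis by (simp add: field_simps)
qed

lemma dyadic_count_ge:
  assumes "dyadic_count l t \<le> i" shows "t \<le> real i / 2 ^ l"
proof -
  have "t * 2 ^ l \<le> real i" using assms by (simp add: dyadic_count_def)
  then show ?thesis by (simp add: field_simps)
qed

lemma dyadic_count_dyadic:
  assumes "n \<le> m" shows "dyadic_count m (real k / 2 ^ n) = k * 2 ^ (m - n)"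
  unfolding dyadic_count_def dyadic_refine[OF assms] by (simp del: of_nat_mult)

section \<open>Simple processes cut off at a fixed time\<close>

context wiener_space
begin

text \<open>Cut off at t, a simple process becomes a step process whose \<open>step_integral\<close>
  is the \<open>simple_integral\<close> up to t; cells after t shrink to points.\<close>

definition simple_on :: "nat \<Rightarrow> (nat \<Rightarrow> real) \<Rightarrow> (nat \<Rightarrow> 'a \<Rightarrow> real) \<Rightarrow> real \<Rightarrow> 'a \<Rightarrow> real \<Rightarrow> real" where
  "simple_on n p \<xi> t = step_value n (\<lambda>i. min t (p i)) (\<lambda>i. min t (p (Suc i))) \<xi>"

lemma simple_on_eq:
  assumes "partition_upto n p"
  shows "simple_on n p \<xi> t \<omega> s = indicator {0<..t} s * simple_value n p \<xi> s \<omega>"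
  unfolding simple_on_def step_value_def simple_value_def sum_distrib_left
proof (rule sum.cong[OF refl])
  fix i assume i: "i \<in> {..<n}"
  have "0 \<le> p i" using partition_upto_nonneg[OF assms, of i] i by auto
  then show "\<xi> i \<omega> * indicator {min t (p i)<..min t (p (Suc i))} s =
    indicator {0<..t} s * (\<xi> i \<omega> * indicator {p i<..p (Suc i)} s)"
    by (auto simp: indicator_def)
qed

lemma simple_integral_eq_step:
  "simple_integral W n p \<xi> t = step_integral n (\<lambda>i. min t (p i)) (\<lambda>i. min t (p (Suc i))) \<xi>"
  by (simp add: simple_integral_def[abs_def] step_integral_def[abs_def])

lemma partition_upto_min:
  "partition_upto n p \<Longrightarrow> 0 \<le> t \<Longrightarrow> partition_upto n (\<lambda>i. min t (p i))"
  by (auto simp: partition_upto_def)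

lemma simple_process_partition: "simple_process M F n p \<xi> \<Longrightarrow> partition_upto n p"
  by (auto simp: simple_process_def partition_upto_def)

lemma simple_process_adapted_steps:
  assumes "simple_process M F n p \<xi>" "0 \<le> t"
  shows "adapted_steps n (\<lambda>i. min t (p i)) (\<lambda>i. min t (p (Suc i))) \<xi>"
  unfolding adapted_steps_def
proof (intro allI impI conjI)
  fix i assume i: "i < n"
  have p0: "0 \<le> p i" using partition_upto_nonneg[OF simple_process_partition[OF assms(1)], of i] i by simp
  show "0 \<le> min t (p i)" "min t (p i) \<le> min t (p (Suc i))" "\<xi> i \<in> borel_measurable M"
    using assms i p0 F_measurable[OF _ p0, of "\<xi> i"] by (auto simp: simple_process_def)
  show "\<exists>B. \<forall>\<omega>\<in>space M. \<bar>\<xi> i \<omega>\<bar> \<le> B"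
    using assms(1) i unfolding simple_process_def by blast
  assume "min t (p i) < min t (p (Suc i))"
  then have "min t (p i) = p i" by auto
  then show "\<xi> i \<in> borel_measurable (F (min t (p i)))" using assms i by (simp add: simple_process_def)
qed

lemma step_value_measurable:
  assumes "\<And>i. i < n \<Longrightarrow> \<xi> i \<in> borel_measurable N"
  shows "(\<lambda>(\<omega>, s). step_value n a b \<xi> \<omega> s) \<in> borel_measurable (N \<Otimes>\<^sub>M lborel)"
proof -
  have [measurable]: "i \<in> {..<n} \<Longrightarrow> \<xi> i \<in> borel_measurable N" for i using assms by auto
  show ?thesis unfolding step_value_def by measurable
qed

lemma step_value_measurable_path: "step_value n a b \<xi> \<omega> \<in> borel_measurable borel"
  unfolding step_value_def[abs_def] by measurable

lemma step_value_bounded: "\<bar>step_value n a b \<xi> \<omega> s\<bar> \<le> (\<Sum>i<n. \<bar>\<xi> i \<omega>\<bar>)"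
  unfolding step_value_def by (rule order_trans[OF sum_abs]) (auto intro!: sum_mono simp: indicator_def)

lemma simple_on_square_integral:
  assumes "partition_upto n p" "0 \<le> t"
  shows "(\<integral>s. (simple_on n p \<xi> t \<omega> s)\<^sup>2 \<partial>lborel) = (\<Sum>i<n. (\<xi> i \<omega>)\<^sup>2 * (min t (p (Suc i)) - min t (p i)))"
proof -
  note q = partition_upto_min[OF assms]
  have c: "(indicator {min t (p i)<..min t (p (Suc i))} s * indicator {min t (p j)<..min t (p (Suc j))} s :: real) = 0"
    if "i < n" "j < n" "i \<noteq> j" for i j s
    using that partition_upto_mono[OF q, of "Suc i" j] partition_upto_mono[OF q, of "Suc j" i]
    by (cases "i < j") (auto simp: indicator_def)
  have sq: "(simple_on n p \<xi> t \<omega> s)\<^sup>2 = (\<Sum>i<n. (\<xi> i \<omega>)\<^sup>2 * indicator {min t (p i)<..min t (p (Suc i))} s)" for s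
  proof -
    have "(simple_on n p \<xi> t \<omega> s)\<^sup>2 = (\<Sum>i<n. \<Sum>j<n. (\<xi> i \<omega> * \<xi> j \<omega>) *
       (indicator {min t (p i)<..min t (p (Suc i))} s * indicator {min t (p j)<..min t (p (Suc j))} s))"
      unfolding simple_on_def step_value_def power2_eq_square sum_product by (intro sum.cong refl) (simp only: mult_ac)
    also have "\<dots> = (\<Sum>i<n. \<Sum>j<n. if i = j then (\<xi> i \<omega>)\<^sup>2 * indicator {min t (p i)<..min t (p (Suc i))} s else 0)"
      using c by (intro sum.cong refl) (auto simp: power2_eq_square indicator_def)
    finally show ?thesis by simp
  qed
  have "(\<integral>s. (simple_on n p \<xi> t \<omega> s)\<^sup>2 \<partial>lborel) =
    (\<Sum>i<n. (\<integral>s. (\<xi> i \<omega>)\<^sup>2 * indicator {min t (p i)<..min t (p (Suc i))} s \<partial>lborel))"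
    unfolding sq using q by (subst Bochner_Integration.integral_sum) (auto simp: partition_upto_def)
  also have "\<dots> = (\<Sum>i<n. (\<xi> i \<omega>)\<^sup>2 * (min t (p (Suc i)) - min t (p i)))"
    using q by (intro sum.cong refl) (auto simp: partition_upto_def)
  finally show ?thesis .
qed

text \<open>The energy spent up to the end of cell i involves only coefficients of index at most i,
  all known at \<open>p i\<close>. Setting a coefficient to zero when this energy would pass
  \<delta> therefore keeps the process simple, and it changes nothing on paths of total energy at
  most \<delta>. Such a uniform bound is what upgrades convergence in probability to convergence in
  mean.\<close>

lemma stopped_simple:
  fixes \<xi> :: "nat \<Rightarrow> 'a \<Rightarrow> real"
  assumes \<xi>: "simple_process M F n p \<xi>" and t: "0 \<le> t" and \<delta>: "0 \<le> \<delta>"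
  obtains \<eta> where "simple_process M F n p \<eta>"
    "\<And>\<omega>. (\<Sum>i<n. (\<eta> i \<omega>)\<^sup>2 * (min t (p (Suc i)) - min t (p i))) \<le> \<delta>"
    "\<And>\<omega> i. (\<Sum>i<n. (\<xi> i \<omega>)\<^sup>2 * (min t (p (Suc i)) - min t (p i))) \<le> \<delta> \<Longrightarrow> i < n \<Longrightarrow> \<eta> i \<omega> = \<xi> i \<omega>"
proof -
  note q = partition_upto_min[OF simple_process_partition[OF \<xi>] t]
  define V where "V m \<omega> = (\<Sum>i<m. (\<xi> i \<omega>)\<^sup>2 * (min t (p (Suc i)) - min t (p i)))" for m \<omega>
  define \<eta> where "\<eta> i \<omega> = indicator {\<omega>. V (Suc i) \<omega> \<le> \<delta>} \<omega> * \<xi> i \<omega>" for i \<omega>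
  have Vmono: "V m \<omega> \<le> V m' \<omega>" if "m \<le> m'" "m' \<le> n" for m m' \<omega>
    unfolding V_def using that q by (intro sum_mono2) (auto simp: partition_upto_def)
  have 1: "simple_process M F n p \<eta>"
    unfolding simple_process_def
  proof (intro conjI allI impI)
    show "p 0 = 0" "\<And>i. i < n \<Longrightarrow> p i \<le> p (Suc i)" using \<xi> by (auto simp: simple_process_def)
    fix i assume i: "i < n"
    have m: "\<xi> j \<in> borel_measurable (F (p i))" if "j \<le> i" for j
      using \<xi> that i partition_upto_nonneg[OF simple_process_partition[OF \<xi>]] partition_upto_mono[OF simple_process_partition[OF \<xi>]]
      by (intro F_measurable_mono[of "\<xi> j" "p j" "p i"]) (auto simp: simple_process_def)
    then have Vm: "V (Suc i) \<in> borel_measurable (F (p i))"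
      unfolding V_def by (intro borel_measurable_sum borel_measurable_times borel_measurable_power) auto
    have "(\<lambda>\<omega>. (if V (Suc i) \<omega> \<le> \<delta> then 1 else 0) * \<xi> i \<omega>) \<in> borel_measurable (F (p i))"
      using Vm m[of i] by measurable
    also have "(\<lambda>\<omega>. (if V (Suc i) \<omega> \<le> \<delta> then 1 else 0) * \<xi> i \<omega>) = \<eta> i" by (auto simp: \<eta>_def fun_eq_iff)
    finally show "\<eta> i \<in> borel_measurable (F (p i))" .
  next
    obtain B where B: "\<forall>i<n. \<forall>\<omega>\<in>space M. \<bar>\<xi> i \<omega>\<bar> \<le> B" using \<xi> unfolding simple_process_def by blast
    have "\<bar>\<eta> i \<omega>\<bar> \<le> \<bar>\<xi> i \<omega>\<bar>" for i \<omega> by (simp add: \<eta>_def indicator_def)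
    then show "\<exists>B. \<forall>i<n. \<forall>\<omega>\<in>space M. \<bar>\<eta> i \<omega>\<bar> \<le> B" using B by (meson order_trans)
  qed
  \<comment> \<open>The minimum carries the induction: the bound by V serves as long as the energy
    is at most \<delta>, the bound by \<delta> after the cut.\<close>
  have "m \<le> n \<Longrightarrow> (\<Sum>i<m. (\<eta> i \<omega>)\<^sup>2 * (min t (p (Suc i)) - min t (p i))) \<le> min \<delta> (V m \<omega>)" for m \<omega>
  proof (induction m)
    case (Suc m)
    have d: "0 \<le> min t (p (Suc m)) - min t (p m)" using q Suc.prems by (simp add: partition_upto_def)
    have VS: "V (Suc m) \<omega> = V m \<omega> + (\<xi> m \<omega>)\<^sup>2 * (min t (p (Suc m)) - min t (p m))" by (simp add: V_def)
    show ?case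
    proof (cases "V (Suc m) \<omega> \<le> \<delta>")
      case True
      then show ?thesis using Suc VS by (simp add: \<eta>_def)
    next
      case False
      have "\<eta> m \<omega> = 0" using False by (simp add: \<eta>_def)
      moreover have "V m \<omega> \<le> V (Suc m) \<omega>" using Suc.prems by (intro Vmono) auto
      ultimately show ?thesis using Suc False by simp
    qed
  qed (use \<delta> in \<open>simp add: V_def\<close>)
  then have 2: "(\<Sum>i<n. (\<eta> i \<omega>)\<^sup>2 * (min t (p (Suc i)) - min t (p i))) \<le> \<delta>" for \<omega> by fastforce
  have 3: "\<eta> i \<omega> = \<xi> i \<omega>" if "(\<Sum>i<n. (\<xi> i \<omega>)\<^sup>2 * (min t (p (Suc i)) - min t (p i))) \<le> \<delta>" "i < n" for i \<omega>
    using that Vmono[of "Suc i" n \<omega>] by (simp add: \<eta>_def V_def)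
  show ?thesis using that[OF 1 2 3] by blast
qed

text \<open>Progressive measurability speaks of times in [0, t] only. Clamping s maps the whole line
  into [0, t], and the indicator hides the change.\<close>

lemma progressive_measurable:
  assumes "progressive F H" "0 \<le> t"
  shows "(\<lambda>(\<omega>, s). indicator {0..t} s * H s \<omega>) \<in> borel_measurable (F t \<Otimes>\<^sub>M lborel)"
proof -
  have H: "(\<lambda>(s, \<omega>). H s \<omega>) \<in> borel_measurable (restrict_space borel {0..t} \<Otimes>\<^sub>M F t)"
    using assms by (simp add: progressive_def)
  have c: "(\<lambda>s. max 0 (min t s)) \<in> borel \<rightarrow>\<^sub>M restrict_space borel {0..t}"
    using assms(2) by (intro measurable_restrict_space2) auto
  have "(\<lambda>(\<omega>, s). (max 0 (min t s), \<omega>)) \<in> F t \<Otimes>\<^sub>M lborel \<rightarrow>\<^sub>M restrict_space borel {0..t} \<Otimes>\<^sub>M F t"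
    using measurable_compose[OF measurable_snd, of "\<lambda>s. max 0 (min t s)" lborel _ "F t"] c
    by (intro measurable_pair) (auto simp: comp_def split_beta')
  from measurable_compose[OF this H]
  have [measurable]: "(\<lambda>(\<omega>, s). H (max 0 (min t s)) \<omega>) \<in> borel_measurable (F t \<Otimes>\<^sub>M lborel)"
    by (simp add: split_beta')
  have "(\<lambda>(\<omega>, s). indicator {0..t} s * H (max 0 (min t s)) \<omega>) \<in> borel_measurable (F t \<Otimes>\<^sub>M lborel)"
    by measurable
  then show ?thesis
    by (rule measurable_cong[THEN iffD1, rotated]) (auto simp: indicator_def)
qed

lemma measurable_pair_F:
  assumes "f \<in> borel_measurable (F t \<Otimes>\<^sub>M lborel)" "0 \<le> t"
  shows "f \<in> borel_measurable (M \<Otimes>\<^sub>M lborel)"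
proof -
  have "(\<lambda>x. x) \<in> M \<rightarrow>\<^sub>M F t"
    using assms(2) sets_filtration[of t] space_filtration[of t] by (intro measurableI) (auto dest: sets.sets_into_space)
  then have "(\<lambda>(\<omega>, s). (\<omega>, s)) \<in> M \<Otimes>\<^sub>M lborel \<rightarrow>\<^sub>M F t \<Otimes>\<^sub>M lborel"
    using measurable_compose[OF measurable_fst] by (intro measurable_pair) (auto simp: comp_def split_beta')
  from measurable_compose[OF this assms(1)] show ?thesis by simp
qed

end

lemma bdd_supp_integrable:
  fixes f :: "real \<Rightarrow> real"
  assumes "f \<in> borel_measurable borel" "\<And>s. \<bar>f s\<bar> \<le> c * indicator {0..t} s"
  shows "integrable lborel f"
proof (rule Bochner_Integration.integrable_bound)
  show "integrable lborel (\<lambda>s. c * indicator {0..t} s)" by (cases "0 \<le> t") auto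
  show "AE s in lborel. norm (f s) \<le> norm (c * indicator {0..t} s)"
    using assms(2) by (auto intro: order_trans[OF _ abs_ge_self])
qed (use assms in simp)

lemma bdd_supp_integral_le:
  fixes f :: "real \<Rightarrow> real"
  assumes "f \<in> borel_measurable borel" "\<And>s. \<bar>f s\<bar> \<le> c * indicator {0..t} s" "0 \<le> t"
  shows "integral\<^sup>L lborel f \<le> c * t"
proof -
  have "integral\<^sup>L lborel f \<le> (\<integral>s. c * indicator {0..t} s \<partial>lborel)"
    using assms by (intro integral_mono bdd_supp_integrable[OF assms(1,2)]) (auto intro: order_trans[OF abs_ge_self])
  then show ?thesis using assms(3) by simp
qed

lemma integral_square_add_le:
  fixes f g :: "real \<Rightarrow> real"
  assumes [measurable]: "f \<in> borel_measurable borel" "g \<in> borel_measurable borel"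
    and "integrable lborel (\<lambda>s. (f s)\<^sup>2)" "integrable lborel (\<lambda>s. (g s)\<^sup>2)"
  shows "(\<integral>s. (f s + g s)\<^sup>2 \<partial>lborel) \<le> 2 * (\<integral>s. (f s)\<^sup>2 \<partial>lborel) + 2 * (\<integral>s. (g s)\<^sup>2 \<partial>lborel)"
proof -
  have le: "(f s + g s)\<^sup>2 \<le> 2 * (f s)\<^sup>2 + 2 * (g s)\<^sup>2" for s
    using zero_le_power2[of "f s - g s"] by (simp add: power2_sum power2_diff)
  have i: "integrable lborel (\<lambda>s. 2 * (f s)\<^sup>2 + 2 * (g s)\<^sup>2)" using assms by simp
  have "(\<integral>s. (f s + g s)\<^sup>2 \<partial>lborel) \<le> (\<integral>s. 2 * (f s)\<^sup>2 + 2 * (g s)\<^sup>2 \<partial>lborel)"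
    by (intro integral_mono Bochner_Integration.integrable_bound[OF i] i le) (auto intro!: AE_I2 order_trans[OF le])
  then show ?thesis using assms by simp
qed

lemma sum_lessThan_split: "(\<Sum>i<a + N. f i) = (\<Sum>i<a. f i) + (\<Sum>i<N::nat. f (a + i) :: real)"
  by (induction N) auto

section \<open>Left-point sums converge to the Ito integral in mean square\<close>

context wiener_space
begin

definition dyadic_integral :: "nat \<Rightarrow> (real \<Rightarrow> 'a \<Rightarrow> real) \<Rightarrow> real \<Rightarrow> 'a \<Rightarrow> real" where
  "dyadic_integral l H t = simple_integral W (dyadic_count l t) (\<lambda>i. real i / 2 ^ l) (\<lambda>i. H (real i / 2 ^ l)) t"

lemma dyadic_simple_process:
  assumes "adapted F H" "\<And>s \<omega>. 0 \<le> s \<Longrightarrow> \<omega> \<in> space M \<Longrightarrow> \<bar>H s \<omega>\<bar> \<le> B"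
  shows "simple_process M F n (\<lambda>i. real i / 2 ^ l) (\<lambda>i. H (real i / 2 ^ l))"
  using assms unfolding simple_process_def adapted_def
  by (auto simp: divide_right_mono intro!: exI[of _ B])

lemma simple_value_dyadic:
  assumes "real i / 2 ^ l < s" "s \<le> real (Suc i) / 2 ^ l" "s \<le> t"
  shows "simple_value (dyadic_count l t) (\<lambda>i. real i / 2 ^ l) \<xi> s \<omega> = \<xi> i \<omega>"
proof -
  have i: "i < dyadic_count l t"
    using dyadic_count_ge[of l t i] assms by (meson leD leI less_le_trans)
  have "indicator {real j / 2 ^ l<..real (Suc j) / 2 ^ l} s = (if j = i then 1 else 0 :: real)" for j
  proof (cases "s \<in> {real j / 2 ^ l<..real (Suc j) / 2 ^ l}")
    case True
    then have "real j / 2 ^ l = real i / 2 ^ l"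
      using dyadic_left_eq[of j l s] dyadic_left_eq[of i l s] assms by auto
    then show ?thesis using True by simp
  qed (use assms in auto)
  then show ?thesis using i by (simp add: simple_value_def if_distrib[of "\<lambda>x. _ * x"] cong: if_cong)
qed

text \<open>The definition of the Ito integral provides some approximating simple processes,
  converging in probability. Cut off at a fixed energy, they converge to H in mean square, and their
  integrals still tend to Y in probability. The isometry compares them with the dyadic left-point
  sums. Letting the approximation index go to infinity by Fatou leaves the mean square distance
  between H and its left-point version, which vanishes by continuity of the paths.\<close>

lemma ito_integral_dyadic_limit:
  assumes H: "adapted F H" and B: "\<And>s \<omega>. 0 \<le> s \<Longrightarrow> \<omega> \<in> space M \<Longrightarrow> \<bar>H s \<omega>\<bar> \<le> B"
    and cont: "continuous_paths M H" and t: "0 \<le> t"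
    and ito: "has_ito_integral M F W H t Y"
  shows "sq_int (\<lambda>\<omega>. dyadic_integral l H t \<omega> - Y \<omega>)"
    and "(\<lambda>l. expectation (\<lambda>\<omega>. (dyadic_integral l H t \<omega> - Y \<omega>)\<^sup>2)) \<longlonglongrightarrow> 0"
proof -
  obtain \<omega>0 where "\<omega>0 \<in> space M" using not_empty by blast
  then have B0: "0 \<le> B" using B[of 0 \<omega>0] by simp
  have prog: "progressive F H" using ito by (simp add: has_ito_integral_def)
  obtain n p \<xi> where sp: "\<And>k. simple_process M F (n k) (p k) (\<xi> k)"
    and Q: "tendsto_in_prob M (\<lambda>k \<omega>. LBINT s:{0..t}. (simple_value (n k) (p k) (\<xi> k) s \<omega> - H s \<omega>)\<^sup>2) (\<lambda>\<omega>. 0)"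
    and J: "tendsto_in_prob M (\<lambda>k. simple_integral W (n k) (p k) (\<xi> k) t) Y"
    using ito unfolding has_ito_integral_def by blast
  \<comment> \<open>Dropping time 0 matches the left-open cells of simple processes.\<close>
  define h where "h \<omega> s = indicator {0<..t} s * H s \<omega>" for \<omega> s
  have hm: "(\<lambda>(\<omega>, s). h \<omega> s) \<in> borel_measurable (M \<Otimes>\<^sub>M lborel)"
  proof -
    have [measurable]: "(\<lambda>(\<omega>, s). indicator {0..t} s * H s \<omega>) \<in> borel_measurable (M \<Otimes>\<^sub>M lborel)"
      using measurable_pair_F[OF progressive_measurable[OF prog t] t] .
    have "(\<lambda>(\<omega>, s). indicator {0<..t} s * (indicator {0..t} s * H s \<omega>)) \<in> borel_measurable (M \<Otimes>\<^sub>M lborel)"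
      by measurable
    then show ?thesis by (rule measurable_cong[THEN iffD1, rotated]) (auto simp: h_def indicator_def)
  qed
  have hp: "h \<omega> \<in> borel_measurable borel" if "\<omega> \<in> space M" for \<omega>
    using measurable_compose[OF measurable_Pair1'[OF that] hm] by simp
  have hB: "\<bar>h \<omega> s\<bar> \<le> B * indicator {0..t} s" if "\<omega> \<in> space M" for \<omega> s
    using B[OF _ that, of s] by (auto simp: h_def indicator_def)
  have sqB: "\<bar>(f s :: real)\<^sup>2\<bar> \<le> c\<^sup>2 * indicator {0..t} s" if "\<And>s. \<bar>f s\<bar> \<le> c * indicator {0..t} s" for f c s
    using power_mono[OF that[of s], of 2] by (auto simp: indicator_def split: if_splits)
  have h2: "integrable lborel (\<lambda>s. (h \<omega> s)\<^sup>2)" "(\<integral>s. (h \<omega> s)\<^sup>2 \<partial>lborel) \<le> B\<^sup>2 * t" if "\<omega> \<in> space M" for \<omega>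
    using hp[OF that] sqB[OF hB[OF that]] t
    by (auto intro!: bdd_supp_integrable[where t=t and c="B\<^sup>2"] bdd_supp_integral_le)

  define G where "G l = simple_on (dyadic_count l t) (\<lambda>i. real i / 2 ^ l) (\<lambda>i. H (real i / 2 ^ l)) t" for l
  have dp: "simple_process M F (dyadic_count l t) (\<lambda>i. real i / 2 ^ l) (\<lambda>i. H (real i / 2 ^ l))" for l
    by (rule dyadic_simple_process[OF H B])
  have G: "G l \<omega> s = indicator {0<..t} s * H (dyadic_left l s) \<omega>" for l \<omega> s
  proof (cases "s \<in> {0<..t}")
    case True
    then obtain i where i: "real i / 2 ^ l < s" "s \<le> real (Suc i) / 2 ^ l" "dyadic_left l s = real i / 2 ^ l"
      using dyadic_left_cell[of s l] by auto
    then show ?thesis using True simple_value_dyadic[OF i(1,2), of t "\<lambda>i. H (real i / 2 ^ l)" \<omega>]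
      by (simp add: G_def simple_on_eq[OF simple_process_partition[OF dp]])
  qed (simp add: G_def simple_on_eq[OF simple_process_partition[OF dp]])
  have son: "(\<lambda>(\<omega>, s). simple_on (n' :: nat) q \<zeta> t \<omega> s) \<in> borel_measurable (M \<Otimes>\<^sub>M lborel)"
    "simple_on n' q \<zeta> t \<omega> \<in> borel_measurable borel"
    "\<And>s. \<bar>simple_on n' q \<zeta> t \<omega> s\<bar> \<le> (\<Sum>i<n'. \<bar>\<zeta> i \<omega>\<bar>) * indicator {0..t} s"
    if s: "simple_process M F n' q \<zeta>" for n' q \<zeta> \<omega>
  proof -
    note a = simple_process_adapted_steps[OF s t]
    show "(\<lambda>(\<omega>, s). simple_on n' q \<zeta> t \<omega> s) \<in> borel_measurable (M \<Otimes>\<^sub>M lborel)"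
      unfolding simple_on_def using a by (intro step_value_measurable) (auto simp: adapted_steps_def)
    show "simple_on n' q \<zeta> t \<omega> \<in> borel_measurable borel"
      unfolding simple_on_def by (rule step_value_measurable_path)
    fix s
    show "\<bar>simple_on n' q \<zeta> t \<omega> s\<bar> \<le> (\<Sum>i<n'. \<bar>\<zeta> i \<omega>\<bar>) * indicator {0..t} s"
    proof (cases "s \<in> {0<..t}")
      case True
      then show ?thesis using step_value_bounded[of n' _ _ \<zeta> \<omega> s] by (simp add: simple_on_def)
    next
      case False
      then have "simple_on n' q \<zeta> t \<omega> s = 0" by (simp add: simple_on_eq[OF simple_process_partition[OF s]])
      then show ?thesis by (simp add: sum_nonneg)
    qed
  qed
  have son2: "integrable lborel (\<lambda>s. (simple_on n' q \<zeta> t \<omega> s)\<^sup>2)"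
    if s: "simple_process M F n' q \<zeta>" for n' q \<zeta> \<omega>
    using son(2)[OF s, of \<omega>] sqB[OF son(3)[OF s, of \<omega>]] by (auto intro!: bdd_supp_integrable[where t=t])
  have sonh: "(\<lambda>\<omega>. \<integral>s. (simple_on n' q \<zeta> t \<omega> s - h \<omega> s)\<^sup>2 \<partial>lborel) \<in> borel_measurable M"
    "\<omega> \<in> space M \<Longrightarrow> integrable lborel (\<lambda>s. (simple_on n' q \<zeta> t \<omega> s - h \<omega> s)\<^sup>2)"
    if s: "simple_process M F n' q \<zeta>" for n' q \<zeta> \<omega>
  proof -
    have [measurable]: "(\<lambda>x. simple_on n' q \<zeta> t (fst x) (snd x)) \<in> borel_measurable (M \<Otimes>\<^sub>M lborel)"
      "(\<lambda>x. h (fst x) (snd x)) \<in> borel_measurable (M \<Otimes>\<^sub>M lborel)"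
      using son(1)[OF s] hm by (simp_all add: split_beta')
    show "(\<lambda>\<omega>. \<integral>s. (simple_on n' q \<zeta> t \<omega> s - h \<omega> s)\<^sup>2 \<partial>lborel) \<in> borel_measurable M"
      by (rule lborel.borel_measurable_lebesgue_integral) (simp add: split_beta')
    assume \<omega>: "\<omega> \<in> space M"
    have "\<bar>simple_on n' q \<zeta> t \<omega> s - h \<omega> s\<bar> \<le> ((\<Sum>i<n'. \<bar>\<zeta> i \<omega>\<bar>) + B) * indicator {0..t} s" for s
      using son(3)[OF s, of \<omega> s] hB[OF \<omega>, of s] by (simp add: distrib_right)
    then show "integrable lborel (\<lambda>s. (simple_on n' q \<zeta> t \<omega> s - h \<omega> s)\<^sup>2)"
      using son(2)[OF s, of \<omega>] hp[OF \<omega>]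
      by (intro bdd_supp_integrable[where t=t and c="((\<Sum>i<n'. \<bar>\<zeta> i \<omega>\<bar>) + B)\<^sup>2"] sqB) auto
  qed

  \<comment> \<open>The squared distance in time between H and its left-point version. It is bounded
    by \<open>(2 * B)\<^sup>2 * t\<close> and tends to 0 on continuous paths, hence tends to 0 in
    mean.\<close>
  define D where "D l \<omega> = (\<integral>s. (G l \<omega> s - h \<omega> s)\<^sup>2 \<partial>lborel)" for l \<omega>
  have Dm: "D l \<in> borel_measurable M" for l
    unfolding D_def G_def using sonh(1)[OF dp] by simp
  have Gh: "\<bar>G l \<omega> s - h \<omega> s\<bar> \<le> (2 * B) * indicator {0..t} s" if "\<omega> \<in> space M" for l \<omega> s
    unfolding G h_def using B[OF _ that, of s] B[OF dyadic_left_bounds(1) that, of s l]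
    by (auto simp: indicator_def abs_le_iff)
  have D0: "0 \<le> D l \<omega>" for l \<omega> unfolding D_def by (intro integral_nonneg_AE) auto
  have DB: "D l \<omega> \<le> (2 * B)\<^sup>2 * t" if "\<omega> \<in> space M" for l \<omega>
    unfolding D_def using son(2)[OF dp[of l], of \<omega>] hp[OF that] t
    by (intro bdd_supp_integral_le sqB Gh that) (auto simp: G_def)
  have Di: "integrable M (D l)" for l
    using DB D0 Dm by (intro integrable_const_bound[where B="(2 * B)\<^sup>2 * t"]) (auto intro!: AE_I2)
  have "AE \<omega> in M. (\<lambda>l. D l \<omega>) \<longlonglongrightarrow> 0"
    using cont unfolding continuous_paths_def
  proof (rule AE_mp, intro AE_I2 impI)
    fix \<omega> assume \<omega>: "\<omega> \<in> space M" and c: "continuous_on {0..} (\<lambda>t. H t \<omega>)"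
    have "(\<lambda>l. D l \<omega>) \<longlonglongrightarrow> integral\<^sup>L lborel (\<lambda>s::real. 0)"
      unfolding D_def
    proof (rule integral_dominated_convergence[where s="\<lambda>l s. (G l \<omega> s - h \<omega> s)\<^sup>2" and w="\<lambda>s. (2 * B)\<^sup>2 * indicator {0..t} s"])
      show "integrable lborel (\<lambda>s. (2 * B)\<^sup>2 * indicator {0..t} s)" using t by simp
      show "AE s in lborel. (\<lambda>l. (G l \<omega> s - h \<omega> s)\<^sup>2) \<longlonglongrightarrow> 0"
      proof (intro AE_I2)
        fix s :: real
        show "(\<lambda>l. (G l \<omega> s - h \<omega> s)\<^sup>2) \<longlonglongrightarrow> 0"
        proof (cases "s \<in> {0<..t}")
          case True
          then have s: "0 \<le> s" by simp
          have "(\<lambda>l. H (dyadic_left l s) \<omega>) \<longlonglongrightarrow> H s \<omega>"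
            using continuous_on_tendsto_compose[OF c dyadic_left_tendsto[OF s]] s dyadic_left_bounds(1)[OF s] by auto
          then have "(\<lambda>l. (H (dyadic_left l s) \<omega> - H s \<omega>)\<^sup>2) \<longlonglongrightarrow> (H s \<omega> - H s \<omega>)\<^sup>2"
            by (intro tendsto_power tendsto_diff tendsto_const)
          then show ?thesis using True by (simp add: G h_def)
        qed (simp add: G h_def)
      qed
      show "AE s in lborel. norm ((G l \<omega> s - h \<omega> s)\<^sup>2) \<le> (2 * B)\<^sup>2 * indicator {0..t} s" for l
        unfolding real_norm_def by (intro AE_I2 sqB[OF Gh[OF \<omega>, of l]])
    qed (use son(2)[OF dp] hp[OF \<omega>] in \<open>auto simp: G_def\<close>)
    then show "(\<lambda>l. D l \<omega>) \<longlonglongrightarrow> 0" by simp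
  qed
  then have ED: "(\<lambda>l. expectation (D l)) \<longlonglongrightarrow> expectation (\<lambda>\<omega>. 0)"
    using DB D0 by (intro integral_dominated_convergence[where w="\<lambda>_. (2 * B)\<^sup>2 * t"]) (auto intro!: AE_I2 simp: Dm)

  \<comment> \<open>Where the squared distance \<open>q k\<close> of the k-th approximation from H
    is at most 1, the energy of the approximation is at most 2 * 1 + 2 * (B^2 t) = \<delta>, so the
    cut leaves it unchanged.\<close>
  define \<delta> where "\<delta> = 2 * B\<^sup>2 * t + 2"
  have \<delta>: "0 \<le> \<delta>" using t by (simp add: \<delta>_def)
  define P where "P k \<zeta> \<longleftrightarrow> simple_process M F (n k) (p k) \<zeta> \<and>
    (\<forall>\<omega>. (\<Sum>i<n k. (\<zeta> i \<omega>)\<^sup>2 * (min t (p k (Suc i)) - min t (p k i))) \<le> \<delta>) \<and>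
    (\<forall>\<omega> i. (\<Sum>i<n k. (\<xi> k i \<omega>)\<^sup>2 * (min t (p k (Suc i)) - min t (p k i))) \<le> \<delta> \<longrightarrow> i < n k \<longrightarrow> \<zeta> i \<omega> = \<xi> k i \<omega>)" for k \<zeta>
  have "\<exists>\<zeta>. P k \<zeta>" for k
    by (rule stopped_simple[OF sp[of k] t \<delta>]) (rule exI, unfold P_def, intro conjI allI impI)
  then obtain \<eta> where P: "\<And>k. P k (\<eta> k)" using choice[of P] by auto
  have \<eta>: "simple_process M F (n k) (p k) (\<eta> k)" for k using P[of k] by (simp add: P_def)
  have \<eta>\<delta>: "(\<Sum>i<n k. (\<eta> k i \<omega>)\<^sup>2 * (min t (p k (Suc i)) - min t (p k i))) \<le> \<delta>" for k \<omega>
    using P[of k] unfolding P_def by blast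
  have \<eta>\<xi>: "\<eta> k i \<omega> = \<xi> k i \<omega>"
    if "(\<Sum>i<n k. (\<xi> k i \<omega>)\<^sup>2 * (min t (p k (Suc i)) - min t (p k i))) \<le> \<delta>" "i < n k" for k \<omega> i
    using P[of k] that unfolding P_def by blast
  define q where "q k \<omega> = (\<integral>s. (simple_on (n k) (p k) (\<xi> k) t \<omega> s - h \<omega> s)\<^sup>2 \<partial>lborel)" for k \<omega>
  define q' where "q' k \<omega> = (\<integral>s. (simple_on (n k) (p k) (\<eta> k) t \<omega> s - h \<omega> s)\<^sup>2 \<partial>lborel)" for k \<omega>
  have qm[measurable]: "q k \<in> borel_measurable M" "q' k \<in> borel_measurable M" for k
    unfolding q_def q'_def using sonh(1) sp \<eta> by auto
  have qQ: "(LBINT s:{0..t}. (simple_value (n k) (p k) (\<xi> k) s \<omega> - H s \<omega>)\<^sup>2) = q k \<omega>" if \<omega>: "\<omega> \<in> space M" for k \<omega>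
  proof -
    note m1 = son(2)[OF sp[of k], of \<omega>] and m2 = hp[OF \<omega>]
    have "(LBINT s:{0..t}. (simple_value (n k) (p k) (\<xi> k) s \<omega> - H s \<omega>)\<^sup>2) =
      (LBINT s:{0<..t}. (simple_value (n k) (p k) (\<xi> k) s \<omega> - H s \<omega>)\<^sup>2)"
      unfolding set_lebesgue_integral_def
    proof (rule integral_discrete_difference[where X="{0}"])
      show "\<And>s. s \<notin> {0} \<Longrightarrow> indicat_real {0..t} s *\<^sub>R (simple_value (n k) (p k) (\<xi> k) s \<omega> - H s \<omega>)\<^sup>2 =
         indicat_real {0<..t} s *\<^sub>R (simple_value (n k) (p k) (\<xi> k) s \<omega> - H s \<omega>)\<^sup>2"
        by (auto simp: indicator_def)
    qed auto
    also have "\<dots> = q k \<omega>"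
      unfolding q_def set_lebesgue_integral_def
      by (intro Bochner_Integration.integral_cong refl)
        (auto simp: simple_on_eq[OF simple_process_partition[OF sp]] h_def indicator_def)
    finally show ?thesis .
  qed
  have q0: "0 \<le> q k \<omega>" "0 \<le> q' k \<omega>" for k \<omega>
    unfolding q_def q'_def by (auto intro!: integral_nonneg_AE)
  have qP: "(\<lambda>k. prob {\<omega> \<in> space M. e < q k \<omega>}) \<longlonglongrightarrow> 0" if "0 < e" for e
  proof -
    have *: "{\<omega> \<in> space M. e < \<bar>(LBINT s:{0..t}. (simple_value (n k) (p k) (\<xi> k) s \<omega> - H s \<omega>)\<^sup>2) - 0\<bar>} =
      {\<omega> \<in> space M. e < q k \<omega>}" for k
      using q0 by (intro Collect_cong conj_cong refl) (simp add: qQ)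
    show ?thesis using Q that unfolding tendsto_in_prob_def * [symmetric] by blast
  qed
  have eq: "\<eta> k i \<omega> = \<xi> k i \<omega>" if \<omega>: "\<omega> \<in> space M" and q1: "q k \<omega> \<le> 1" and i: "i < n k" for k i \<omega>
  proof (rule \<eta>\<xi>[OF _ i])
    let ?S = "simple_on (n k) (p k) (\<xi> k) t \<omega>"
    have "(\<integral>s. (?S s)\<^sup>2 \<partial>lborel) = (\<integral>s. ((?S s - h \<omega> s) + h \<omega> s)\<^sup>2 \<partial>lborel)" by simp
    also have "\<dots> \<le> 2 * q k \<omega> + 2 * (\<integral>s. (h \<omega> s)\<^sup>2 \<partial>lborel)"
      unfolding q_def using son(2)[OF sp[of k], of \<omega>] hp[OF \<omega>] h2(1)[OF \<omega>] sonh(2)[OF sp[of k] \<omega>]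
      by (intro integral_square_add_le) auto
    also have "\<dots> \<le> \<delta>" using q1 h2(2)[OF \<omega>] by (simp add: \<delta>_def)
    finally show "(\<Sum>i<n k. (\<xi> k i \<omega>)\<^sup>2 * (min t (p k (Suc i)) - min t (p k i))) \<le> \<delta>"
      by (simp add: simple_on_square_integral[OF simple_process_partition[OF sp] t])
  qed
  have q'q: "q' k \<omega> = q k \<omega>" if "\<omega> \<in> space M" "q k \<omega> \<le> 1" for k \<omega>
    unfolding q_def q'_def simple_on_def step_value_def using eq[OF that] by simp
  \<comment> \<open>R bounds \<open>q' k\<close> at every sample point, which turns convergence in
    probability into convergence in mean.\<close>
  define R where "R = 2 * \<delta> + 2 * (B\<^sup>2 * t)"
  have R0: "0 \<le> R" using \<delta> t by (simp add: R_def)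
  have q'R: "q' k \<omega> \<le> R" if \<omega>: "\<omega> \<in> space M" for k \<omega>
  proof -
    have "q' k \<omega> = (\<integral>s. (simple_on (n k) (p k) (\<eta> k) t \<omega> s + - h \<omega> s)\<^sup>2 \<partial>lborel)" by (simp add: q'_def)
    also have "\<dots> \<le> 2 * (\<integral>s. (simple_on (n k) (p k) (\<eta> k) t \<omega> s)\<^sup>2 \<partial>lborel) + 2 * (\<integral>s. (- h \<omega> s)\<^sup>2 \<partial>lborel)"
      using son(2)[OF \<eta>[of k], of \<omega>] hp[OF \<omega>] h2(1)[OF \<omega>] son2[OF \<eta>[of k], of \<omega>] by (intro integral_square_add_le) auto
    also have "\<dots> \<le> R"
      using h2(2)[OF \<omega>] \<eta>\<delta>[of k \<omega>] by (simp add: R_def simple_on_square_integral[OF simple_process_partition[OF \<eta>] t])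
    finally show ?thesis .
  qed
  have q'i: "integrable M (q' k)" for k
    using q'R q0 by (intro integrable_const_bound[where B=R]) (auto intro!: AE_I2)
  have Eq': "(\<lambda>k. expectation (q' k)) \<longlonglongrightarrow> 0"
  proof (rule LIMSEQ_I)
    fix e :: real assume e: "0 < e"
    define e' where "e' = min 1 (e / 2)"
    have e': "0 < e'" "e' \<le> 1" "e' \<le> e / 2" using e by (auto simp: e'_def)
    have le: "expectation (q' k) \<le> e' + R * prob {\<omega> \<in> space M. e' < q k \<omega>}" for k
    proof -
      let ?A = "{\<omega> \<in> space M. e' < q k \<omega>}"
      have A: "?A \<in> sets M" by measurable
      have i: "integrable M (\<lambda>\<omega>. e' + R * indicator ?A \<omega>)"
        using A by (intro Bochner_Integration.integrable_add integrable_const integrable_mult_right integrable_real_indicator) (auto simp: emeasure_eq_measure)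
      have "expectation (q' k) \<le> expectation (\<lambda>\<omega>. e' + R * indicator ?A \<omega>)"
      proof (rule integral_mono[OF q'i i])
        fix \<omega> assume \<omega>: "\<omega> \<in> space M"
        show "q' k \<omega> \<le> e' + R * indicator ?A \<omega>"
        proof (cases "e' < q k \<omega>")
          case True
          then show ?thesis using q'R[OF \<omega>, of k] e' \<omega> by simp
        next
          case False
          then show ?thesis using q'q[OF \<omega>, of k] e' by simp
        qed
      qed
      also have "\<dots> = e' + R * prob ?A"
        using A by (subst Bochner_Integration.integral_add) (auto simp: prob_space emeasure_eq_measure simp del: indicator_simps intro!: integrable_mult_right integrable_real_indicator)
      finally show ?thesis .
    qed
    have "(\<lambda>k. R * prob {\<omega> \<in> space M. e' < q k \<omega>}) \<longlonglongrightarrow> 0"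
      using tendsto_mult_right_zero[OF qP[OF e'(1)]] .
    from LIMSEQ_D[OF this, of "e / 2"] e obtain N where
      N: "\<And>k. k \<ge> N \<Longrightarrow> \<bar>R * prob {\<omega> \<in> space M. e' < q k \<omega>}\<bar> < e / 2" by auto
    have "\<bar>expectation (q' k)\<bar> < e" if "k \<ge> N" for k
    proof -
      have "0 \<le> expectation (q' k)" using q0 by (intro integral_nonneg_AE) auto
      then show ?thesis using le[of k] N[OF that] e' by linarith
    qed
    then show "\<exists>N. \<forall>k\<ge>N. norm (expectation (q' k) - 0) < e" by auto
  qed
  have Jm: "simple_integral W (n k) (p k) (\<eta> k) t \<in> borel_measurable M" for k
    unfolding simple_integral_eq_step
    by (rule sq_int_measurable[OF step_integral_sq_int[OF simple_process_adapted_steps[OF \<eta> t]]])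
  \<comment> \<open>The integrals before and after the cut can differ only on the event
    \<open>1 < q k\<close>, whose probability tends to 0.\<close>
  have J': "tendsto_in_prob M (\<lambda>k. simple_integral W (n k) (p k) (\<eta> k) t) Y"
    unfolding tendsto_in_prob_def
  proof (intro conjI allI impI Jm)
    show Ym: "Y \<in> borel_measurable M" using J by (simp add: tendsto_in_prob_def)
    fix e :: real assume e: "0 < e"
    have [measurable]: "simple_integral W (n k) (p k) (\<xi> k) t \<in> borel_measurable M" for k
      using J by (simp add: tendsto_in_prob_def)
    note Jm[measurable] Ym[measurable]
    have le: "prob {\<omega> \<in> space M. e < \<bar>simple_integral W (n k) (p k) (\<eta> k) t \<omega> - Y \<omega>\<bar>} \<le>
      prob {\<omega> \<in> space M. e < \<bar>simple_integral W (n k) (p k) (\<xi> k) t \<omega> - Y \<omega>\<bar>} + prob {\<omega> \<in> space M. 1 < q k \<omega>}" for k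
    proof -
      have "simple_integral W (n k) (p k) (\<eta> k) t \<omega> = simple_integral W (n k) (p k) (\<xi> k) t \<omega>"
        if "\<omega> \<in> space M" "q k \<omega> \<le> 1" for \<omega>
        unfolding simple_integral_def using eq[OF that] by simp
      then have "{\<omega> \<in> space M. e < \<bar>simple_integral W (n k) (p k) (\<eta> k) t \<omega> - Y \<omega>\<bar>} \<subseteq>
        {\<omega> \<in> space M. e < \<bar>simple_integral W (n k) (p k) (\<xi> k) t \<omega> - Y \<omega>\<bar>} \<union> {\<omega> \<in> space M. 1 < q k \<omega>}"
        by (intro subsetI) (metis (mono_tags, lifting) CollectD CollectI UnCI not_le)
      then have "prob {\<omega> \<in> space M. e < \<bar>simple_integral W (n k) (p k) (\<eta> k) t \<omega> - Y \<omega>\<bar>} \<le>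
        prob ({\<omega> \<in> space M. e < \<bar>simple_integral W (n k) (p k) (\<xi> k) t \<omega> - Y \<omega>\<bar>} \<union> {\<omega> \<in> space M. 1 < q k \<omega>})"
        by (rule finite_measure_mono) measurable
      also have "\<dots> \<le> prob {\<omega> \<in> space M. e < \<bar>simple_integral W (n k) (p k) (\<xi> k) t \<omega> - Y \<omega>\<bar>} + prob {\<omega> \<in> space M. 1 < q k \<omega>}"
        by (rule measure_Un_le) measurable
      finally show ?thesis .
    qed
    have "(\<lambda>k. prob {\<omega> \<in> space M. e < \<bar>simple_integral W (n k) (p k) (\<xi> k) t \<omega> - Y \<omega>\<bar>} + prob {\<omega> \<in> space M. 1 < q k \<omega>}) \<longlonglongrightarrow> 0 + 0"
    proof (rule tendsto_add)
      show "(\<lambda>k. prob {\<omega> \<in> space M. e < \<bar>simple_integral W (n k) (p k) (\<xi> k) t \<omega> - Y \<omega>\<bar>}) \<longlonglongrightarrow> 0"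
        using J e unfolding tendsto_in_prob_def by blast
    qed (rule qP, simp)
    from this[unfolded add_0_left]
    show "(\<lambda>k. prob {\<omega> \<in> space M. e < \<bar>simple_integral W (n k) (p k) (\<eta> k) t \<omega> - Y \<omega>\<bar>}) \<longlonglongrightarrow> 0"
      by (rule tendsto_sandwich[OF _ _ tendsto_const, rotated 2]) (simp_all add: le)
  qed

  let ?S = "\<lambda>l. dyadic_integral l H t" and ?J = "\<lambda>k. simple_integral W (n k) (p k) (\<eta> k) t"
  have Sa: "?S l = step_integral (dyadic_count l t) (\<lambda>i. min t (real i / 2 ^ l)) (\<lambda>i. min t (real (Suc i) / 2 ^ l)) (\<lambda>i. H (real i / 2 ^ l))" for l
    unfolding dyadic_integral_def simple_integral_eq_step ..
  have Ssq: "sq_int (?S l)" for l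
    unfolding Sa by (rule step_integral_sq_int[OF simple_process_adapted_steps[OF dp t]])
  have Jsq: "sq_int (?J k)" for k
    unfolding simple_integral_eq_step
    by (rule step_integral_sq_int[OF simple_process_adapted_steps[OF \<eta> t]])
  have iso: "expectation (\<lambda>\<omega>. (?J k \<omega> - ?S l \<omega>)\<^sup>2) \<le> 2 * expectation (q' k) + 2 * expectation (D l)" for k l
  proof -
    let ?X = "simple_on (n k) (p k) (\<eta> k) t"
    have "expectation (\<lambda>\<omega>. (?J k \<omega> - ?S l \<omega>)\<^sup>2) = expectation (\<lambda>\<omega>. \<integral>s. (?X \<omega> s - G l \<omega> s)\<^sup>2 \<partial>lborel)"
      unfolding Sa simple_integral_eq_step G_def simple_on_def
      by (rule step_integral_isometry[OF simple_process_adapted_steps[OF \<eta> t] simple_process_adapted_steps[OF dp t]])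
    also have "\<dots> \<le> expectation (\<lambda>\<omega>. 2 * q' k \<omega> + 2 * D l \<omega>)"
    proof (rule integral_mono')
      show "integrable M (\<lambda>\<omega>. 2 * q' k \<omega> + 2 * D l \<omega>)" using q'i Di by simp
      fix \<omega> assume \<omega>: "\<omega> \<in> space M"
      show "0 \<le> 2 * q' k \<omega> + 2 * D l \<omega>" using q0 D0 by simp
      have "(\<integral>s. (?X \<omega> s - G l \<omega> s)\<^sup>2 \<partial>lborel) = (\<integral>s. ((?X \<omega> s - h \<omega> s) + (h \<omega> s - G l \<omega> s))\<^sup>2 \<partial>lborel)" by simp
      also have "\<dots> \<le> 2 * q' k \<omega> + 2 * (\<integral>s. (h \<omega> s - G l \<omega> s)\<^sup>2 \<partial>lborel)"
        unfolding q'_def using son(2)[OF \<eta>[of k], of \<omega>] hp[OF \<omega>] son(2)[OF dp[of l], of \<omega>] sonh(2)[OF \<eta>[of k] \<omega>] sonh(2)[OF dp[of l] \<omega>]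
        by (intro integral_square_add_le) (auto simp: G_def power2_commute[of "h \<omega> _"])
      finally show "(\<integral>s. (?X \<omega> s - G l \<omega> s)\<^sup>2 \<partial>lborel) \<le> 2 * q' k \<omega> + 2 * D l \<omega>"
        by (simp add: D_def power2_commute[of "h \<omega> _"])
    qed
    also have "\<dots> = 2 * expectation (q' k) + 2 * expectation (D l)" using q'i Di by simp
    finally show ?thesis .
  qed
  have lim: "(\<lambda>k. 2 * expectation (q' k) + 2 * expectation (D l)) \<longlonglongrightarrow> 2 * 0 + 2 * expectation (D l)" for l
    by (intro tendsto_add tendsto_mult tendsto_const Eq')
  \<comment> \<open>Fatou in k with l held fixed; the contribution of \<open>q' k\<close> disappears
    in the limit.\<close>
  have f: "integrable M (\<lambda>\<omega>. (Y \<omega> - ?S l \<omega>)\<^sup>2) \<and>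
    expectation (\<lambda>\<omega>. (Y \<omega> - ?S l \<omega>)\<^sup>2) \<le> 2 * 0 + 2 * expectation (D l)" for l
  proof -
    note tp = tendsto_in_prob_diff_const[OF J' sq_int_measurable[OF Ssq[of l]]]
    have c: "continuous_on UNIV (\<lambda>x::real. x\<^sup>2)" by (intro continuous_intros)
    have i: "integrable M (\<lambda>\<omega>. (?J k \<omega> - ?S l \<omega>)\<^sup>2)" for k
      by (rule sq_int_square[OF sq_int_diff[OF Jsq Ssq]])
    show ?thesis
      using fatou_in_prob(1)[OF tp c zero_le_power2 i iso lim] fatou_in_prob(2)[OF tp c zero_le_power2 i iso lim] by blast
  qed
  have Ym: "Y \<in> borel_measurable M" using J by (simp add: tendsto_in_prob_def)
  show "sq_int (\<lambda>\<omega>. ?S l \<omega> - Y \<omega>)"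
    unfolding sq_int_def
  proof
    show "(\<lambda>\<omega>. ?S l \<omega> - Y \<omega>) \<in> borel_measurable M"
      by (rule borel_measurable_diff[OF sq_int_measurable[OF Ssq] Ym])
    show "integrable M (\<lambda>\<omega>. (?S l \<omega> - Y \<omega>)\<^sup>2)"
      using f[of l] by (simp add: power2_commute[of "?S l _"])
  qed
  have "(\<lambda>l. 2 * 0 + 2 * expectation (D l)) \<longlonglongrightarrow> 2 * 0 + 2 * 0"
    using ED by (intro tendsto_add tendsto_mult tendsto_const) simp
  then have u: "(\<lambda>l. 2 * 0 + 2 * expectation (D l)) \<longlonglongrightarrow> 0" by simp
  show "(\<lambda>l. expectation (\<lambda>\<omega>. (?S l \<omega> - Y \<omega>)\<^sup>2)) \<longlonglongrightarrow> 0"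
  proof (rule tendsto_sandwich[OF _ _ tendsto_const u])
    show "\<forall>\<^sub>F l in sequentially. 0 \<le> expectation (\<lambda>\<omega>. (?S l \<omega> - Y \<omega>)\<^sup>2)"
      by (intro always_eventually allI integral_nonneg_AE) simp
    show "\<forall>\<^sub>F l in sequentially. expectation (\<lambda>\<omega>. (?S l \<omega> - Y \<omega>)\<^sup>2) \<le> 2 * 0 + 2 * expectation (D l)"
      using f by (intro always_eventually allI) (simp add: power2_commute[of "?S _ _"])
  qed
qed

text \<open>The interface between stochastic integrals and the cell estimates. Left ends s run
  through the grid of mesh \<open>1 / 2 ^ n\<close>, right ends are arbitrary. The residual clause
  says that on [s, t] the increment of I is \<zeta> times that of W, up to a mean square error
  governed by the distance of H from \<zeta>; one bound c for all times in [s, t) is a form that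
  survives Fatou unchanged.\<close>

definition ito_like :: "nat \<Rightarrow> real \<Rightarrow> (real \<Rightarrow> 'a \<Rightarrow> real) \<Rightarrow> (real \<Rightarrow> 'a \<Rightarrow> real) \<Rightarrow> bool" where
  "ito_like n B H I \<longleftrightarrow> adapted F I \<and>
    (\<forall>k t. let s = real k / 2 ^ n in s \<le> t \<longrightarrow>
      integrable M (\<lambda>\<omega>. (I t \<omega> - I s \<omega>) ^ 4) \<and>
      expectation (\<lambda>\<omega>. (I t \<omega> - I s \<omega>) ^ 4) \<le> 3 * B ^ 4 * (t - s)\<^sup>2 \<and>
      (\<forall>\<xi>. \<xi> \<in> borel_measurable (F s) \<longrightarrow> sq_int \<xi> \<longrightarrow> expectation (\<lambda>\<omega>. \<xi> \<omega> * (I t \<omega> - I s \<omega>)) = 0) \<and>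
      (\<forall>\<zeta> K c. \<zeta> \<in> borel_measurable (F s) \<longrightarrow> (\<forall>\<omega>\<in>space M. \<bar>\<zeta> \<omega>\<bar> \<le> K) \<longrightarrow>
        (\<forall>r. s \<le> r \<longrightarrow> r < t \<longrightarrow> expectation (\<lambda>\<omega>. (H r \<omega> - \<zeta> \<omega>)\<^sup>2) \<le> c) \<longrightarrow>
        sq_int (\<lambda>\<omega>. I t \<omega> - I s \<omega> - \<zeta> \<omega> * (W t \<omega> - W s \<omega>)) \<and>
        expectation (\<lambda>\<omega>. (I t \<omega> - I s \<omega> - \<zeta> \<omega> * (W t \<omega> - W s \<omega>))\<^sup>2) \<le> c * (t - s)))"

text \<open>The left end lies on the finer grid as well, so no cell straddles it and the sum splits
  there. The cut-off at t only shortens the last cell.\<close>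

lemma dyadic_integral_increment:
  assumes nl: "n \<le> l" and st: "real k / 2 ^ n \<le> t"
  obtains N a where
    "dyadic_integral l H t = (\<lambda>\<omega>. dyadic_integral l H (real k / 2 ^ n) \<omega> +
       msum (\<lambda>i. min t (real (a + i) / 2 ^ l)) (\<lambda>i. H (real (a + i) / 2 ^ l)) N \<omega>)"
    "real a / 2 ^ l = real k / 2 ^ n" "min t (real (a + N) / 2 ^ l) = t"
    "\<And>i. i < N \<Longrightarrow> real (a + i) / 2 ^ l < t"
proof -
  define s where "s = real k / 2 ^ n"
  define a where "a = k * 2 ^ (l - n)"
  have sa: "s = real a / 2 ^ l" unfolding s_def a_def by (rule dyadic_refine[OF nl])
  have ca: "dyadic_count l s = a" unfolding s_def a_def by (rule dyadic_count_dyadic[OF nl])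
  have "dyadic_count l s \<le> dyadic_count l t"
    unfolding dyadic_count_def s_def using mult_right_mono[OF st, of "2 ^ l"]
    by (intro nat_mono ceiling_mono) simp
  then have "a \<le> dyadic_count l t" by (simp add: ca)
  then obtain N where N: "dyadic_count l t = a + N" using le_Suc_ex by blast
  have i: "min t (real i / 2 ^ l) = min s (real i / 2 ^ l)" if "i \<le> a" for i
  proof -
    have "real i / 2 ^ l \<le> s" unfolding sa using that by (simp add: divide_right_mono)
    then show ?thesis using st by (simp add: s_def)
  qed
  have "dyadic_integral l H t \<omega> = dyadic_integral l H s \<omega> +
       msum (\<lambda>i. min t (real (a + i) / 2 ^ l)) (\<lambda>i. H (real (a + i) / 2 ^ l)) N \<omega>" for \<omega>
    unfolding dyadic_integral_def simple_integral_def ca N sum_lessThan_split msum_def using i by (simp del: of_nat_Suc)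
  then have 1: "dyadic_integral l H t = (\<lambda>\<omega>. dyadic_integral l H s \<omega> +
       msum (\<lambda>i. min t (real (a + i) / 2 ^ l)) (\<lambda>i. H (real (a + i) / 2 ^ l)) N \<omega>)" by blast
  show ?thesis
  proof (rule that[OF 1[unfolded s_def]])
    show "real a / 2 ^ l = real k / 2 ^ n" using sa s_def by simp
    show "min t (real (a + N) / 2 ^ l) = t" using dyadic_count_ge[of l t "a + N"] N by simp
    show "\<And>i. i < N \<Longrightarrow> real (a + i) / 2 ^ l < t" using dyadic_count_less[of _ l t] N by (simp del: of_nat_add)
  qed
qed

lemma dyadic_integral_measurable_F:
  assumes H: "adapted F H" and t: "0 \<le> t"
  shows "dyadic_integral l H t \<in> borel_measurable (F t)"
proof -
  have "(\<lambda>\<omega>. H (real i / 2 ^ l) \<omega> * (W (min t (real (Suc i) / 2 ^ l)) \<omega> - W (min t (real i / 2 ^ l)) \<omega>)) \<in> borel_measurable (F t)"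
    if "i < dyadic_count l t" for i
  proof (intro borel_measurable_times borel_measurable_diff W_measurable_F)
    show "H (real i / 2 ^ l) \<in> borel_measurable (F t)"
      using H dyadic_count_less[OF that] by (intro F_measurable_mono[of _ "real i / 2 ^ l" t]) (auto simp: adapted_def)
  qed (use t in auto)
  then show ?thesis unfolding dyadic_integral_def simple_integral_def[abs_def]
    by (intro borel_measurable_sum) auto
qed

lemma dyadic_integral_sq_int:
  assumes "adapted F H" "\<And>s \<omega>. 0 \<le> s \<Longrightarrow> \<omega> \<in> space M \<Longrightarrow> \<bar>H s \<omega>\<bar> \<le> B" "0 \<le> t"
  shows "sq_int (dyadic_integral l H t)"
  unfolding dyadic_integral_def simple_integral_eq_step
  by (rule step_integral_sq_int[OF simple_process_adapted_steps[OF dyadic_simple_process[OF assms(1,2)] assms(3)]])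

text \<open>Each clause concerns a martingale transform started at s. For the residual, the
  increment of W is telescoped over the same cells, so that \<zeta> is subtracted from every
  coefficient.\<close>

lemma dyadic_integral_ito_like:
  assumes H: "adapted F H" and B: "\<And>s \<omega>. 0 \<le> s \<Longrightarrow> \<omega> \<in> space M \<Longrightarrow> \<bar>H s \<omega>\<bar> \<le> B" and nl: "n \<le> l"
  shows "ito_like n B H (dyadic_integral l H)"
  unfolding ito_like_def Let_def
proof (intro conjI allI impI)
  show "adapted F (dyadic_integral l H)"
    unfolding adapted_def using dyadic_integral_measurable_F[OF H] by blast
next
  fix k t assume st: "real k / 2 ^ n \<le> t"
  define s where "s = real k / 2 ^ n"
  obtain a N where I: "dyadic_integral l H t = (\<lambda>\<omega>. dyadic_integral l H (real k / 2 ^ n) \<omega> +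
       msum (\<lambda>i. min t (real (a + i) / 2 ^ l)) (\<lambda>i. H (real (a + i) / 2 ^ l)) N \<omega>)"
    and a: "real a / 2 ^ l = real k / 2 ^ n" and N: "min t (real (a + N) / 2 ^ l) = t"
    and less: "\<And>i. i < N \<Longrightarrow> real (a + i) / 2 ^ l < t"
    by (rule dyadic_integral_increment[OF nl st, of H]) (rule that)
  note I = I[folded s_def] and a = a[folded s_def]
  define p where "p i = min t (real (a + i) / 2 ^ l)" for i
  define \<eta> where "\<eta> i = H (real (a + i) / 2 ^ l)" for i
  have I': "dyadic_integral l H t \<omega> - dyadic_integral l H s \<omega> = msum p \<eta> N \<omega>" for \<omega>
    using I by (simp add: p_def[abs_def] \<eta>_def[abs_def])
  have st': "s \<le> t" using st by (simp add: s_def)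
  have p0: "p 0 = s" and pN: "p N = t" using a N st' by (auto simp: p_def)
  have p: "partition_upto N p"
    unfolding partition_upto_def p0
  proof (intro conjI allI impI)
    show "0 \<le> s" by (simp add: s_def)
    have "real (a + i) / 2 ^ l \<le> real (a + Suc i) / 2 ^ l" for i by (simp add: divide_right_mono)
    then show "p i \<le> p (Suc i)" for i unfolding p_def by (meson min.mono order_refl)
  qed
  have pi: "p i = real (a + i) / 2 ^ l" if "i < N" for i using less[OF that] by (simp add: p_def)
  have \<eta>: "\<eta> i \<in> borel_measurable (F (p i))" if "i < N" for i
    using H unfolding pi[OF that] \<eta>_def by (simp add: adapted_def)
  have \<eta>B: "\<bar>\<eta> i \<omega>\<bar> \<le> B" if "\<omega> \<in> space M" for i \<omega> using B that by (simp add: \<eta>_def)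
  have \<eta>s: "sq_int (\<eta> i)" if "i < N" for i
    using F_measurable[OF \<eta>[OF that]] partition_upto_nonneg[OF p] that \<eta>B by (intro sq_int_bdd) auto
  show "integrable M (\<lambda>\<omega>. (dyadic_integral l H t \<omega> - dyadic_integral l H (real k / 2 ^ n) \<omega>) ^ 4)"
    "expectation (\<lambda>\<omega>. (dyadic_integral l H t \<omega> - dyadic_integral l H (real k / 2 ^ n) \<omega>) ^ 4) \<le> 3 * B ^ 4 * (t - real k / 2 ^ n)\<^sup>2"
    using msum_fourth_moment[OF p \<eta> \<eta>B] unfolding s_def[symmetric] I' p0 pN by auto
  show "expectation (\<lambda>\<omega>. \<xi> \<omega> * (dyadic_integral l H t \<omega> - dyadic_integral l H (real k / 2 ^ n) \<omega>)) = 0"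
    if "\<xi> \<in> borel_measurable (F (real k / 2 ^ n))" "sq_int \<xi>" for \<xi>
    using msum_mult_mean[OF p \<eta> \<eta>s, of \<xi>] that unfolding s_def[symmetric] I' p0 pN by auto
  fix \<zeta> K c assume \<zeta>: "\<zeta> \<in> borel_measurable (F (real k / 2 ^ n))" "\<forall>\<omega>\<in>space M. \<bar>\<zeta> \<omega>\<bar> \<le> K"
    and c: "\<forall>r. real k / 2 ^ n \<le> r \<longrightarrow> r < t \<longrightarrow> expectation (\<lambda>\<omega>. (H r \<omega> - \<zeta> \<omega>)\<^sup>2) \<le> c"
  define \<theta> where "\<theta> i \<omega> = \<eta> i \<omega> - \<zeta> \<omega>" for i \<omega>
  have s0: "0 \<le> s" by (simp add: s_def)
  have \<zeta>s: "\<zeta> \<in> borel_measurable (F s)" "sq_int \<zeta>"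
    using \<zeta> F_measurable[OF \<zeta>(1)] by (auto simp: s_def intro!: sq_int_bdd[of _ K])
  have ps: "s \<le> p i" if "i < N" for i using partition_upto_mono[OF p, of 0 i] that p0 by simp
  have \<theta>: "\<theta> i \<in> borel_measurable (F (p i))" "sq_int (\<theta> i)" if "i < N" for i
    unfolding \<theta>_def[abs_def] using that \<eta> \<eta>s \<zeta>s F_measurable_mono[OF \<zeta>s(1) s0 ps]
    by (auto intro!: borel_measurable_diff sq_int_diff)
  have tel: "(\<Sum>i<N. W (p (Suc i)) \<omega> - W (p i) \<omega>) = W t \<omega> - W s \<omega>" for \<omega>
    using sum_lessThan_telescope[of "\<lambda>i. W (p i) \<omega>" N] by (simp add: p0 pN)
  have eq: "dyadic_integral l H t \<omega> - dyadic_integral l H s \<omega> - \<zeta> \<omega> * (W t \<omega> - W s \<omega>) = msum p \<theta> N \<omega>" for \<omega>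
    unfolding I' tel[symmetric] sum_distrib_left msum_def \<theta>_def sum_subtractf[symmetric]
    by (intro sum.cong refl) (simp add: left_diff_distrib)
  have "expectation (\<lambda>\<omega>. (msum p \<theta> N \<omega>)\<^sup>2) = (\<Sum>i<N. expectation (\<lambda>\<omega>. (\<theta> i \<omega>)\<^sup>2) * (p (Suc i) - p i))"
    using msum_second_moment[OF p \<theta>] .
  also have "\<dots> \<le> (\<Sum>i<N. c * (p (Suc i) - p i))"
  proof (intro sum_mono mult_right_mono)
    fix i assume "i \<in> {..<N}"
    then have i: "i < N" by simp
    show "0 \<le> p (Suc i) - p i" using p i by (simp add: partition_upto_def)
    show "expectation (\<lambda>\<omega>. (\<theta> i \<omega>)\<^sup>2) \<le> c"
      using c[rule_format, of "p i"] less[OF i] ps[OF i] unfolding \<theta>_def \<eta>_def pi[OF i] by (simp add: s_def)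
  qed
  also have "\<dots> = c * (t - s)"
    unfolding sum_distrib_left[symmetric] sum_lessThan_telescope p0 pN ..
  finally have "expectation (\<lambda>\<omega>. (msum p \<theta> N \<omega>)\<^sup>2) \<le> c * (t - s)" .
  then show "expectation (\<lambda>\<omega>. (dyadic_integral l H t \<omega> - dyadic_integral l H (real k / 2 ^ n) \<omega> - \<zeta> \<omega> * (W t \<omega> - W (real k / 2 ^ n) \<omega>))\<^sup>2) \<le> c * (t - real k / 2 ^ n)"
    unfolding s_def[symmetric] eq .
  show "sq_int (\<lambda>\<omega>. dyadic_integral l H t \<omega> - dyadic_integral l H (real k / 2 ^ n) \<omega> - \<zeta> \<omega> * (W t \<omega> - W (real k / 2 ^ n) \<omega>))"
    unfolding s_def[symmetric] eq using msum_sq_int[OF p \<theta>] by simp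
qed

text \<open>The moment bounds pass to the limit by Fatou. The vanishing mean is an equality and is
  obtained from mean square convergence instead: the mean is bounded by a small multiple of the
  second moment of \<xi> plus a vanishing error.\<close>

lemma ito_like_limit:
  assumes H: "adapted F H" and B: "\<And>s \<omega>. 0 \<le> s \<Longrightarrow> \<omega> \<in> space M \<Longrightarrow> \<bar>H s \<omega>\<bar> \<le> B"
    and I: "adapted F I"
    and d: "\<And>t l. 0 \<le> t \<Longrightarrow> sq_int (\<lambda>\<omega>. dyadic_integral l H t \<omega> - I t \<omega>)"
    and lim: "\<And>t. 0 \<le> t \<Longrightarrow> (\<lambda>l. expectation (\<lambda>\<omega>. (dyadic_integral l H t \<omega> - I t \<omega>)\<^sup>2)) \<longlonglongrightarrow> 0"
  shows "ito_like n B H I"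
  unfolding ito_like_def Let_def
proof (intro conjI allI impI I)
  fix k t assume st: "real k / 2 ^ n \<le> t"
  define s where "s = real k / 2 ^ n"
  have "0 \<le> s" "s \<le> t" using st by (auto simp: s_def)
  then have s: "0 \<le> s" "s \<le> t" "0 \<le> t" by auto
  \<comment> \<open>The shift by n makes every sum live on a grid at least as fine as mesh
    \<open>1 / 2 ^ n\<close>, as \<open>dyadic_integral_ito_like\<close> requires.\<close>
  define V where "V l \<omega> = dyadic_integral (l + n) H t \<omega> - dyadic_integral (l + n) H s \<omega>" for l \<omega>
  define U where "U \<omega> = I t \<omega> - I s \<omega>" for \<omega>
  have L: "ito_like n B H (dyadic_integral (l + n) H)" for l
    by (rule dyadic_integral_ito_like[OF H B]) auto
  have Vm: "V l \<in> borel_measurable M" for l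
    unfolding V_def using F_measurable[OF dyadic_integral_measurable_F[OF H]] s by (intro borel_measurable_diff) auto
  have Im: "I t \<in> borel_measurable M" "I s \<in> borel_measurable M"
    using I s F_measurable[of "I t" t] F_measurable[of "I s" s] by (auto simp: adapted_def)
  have Um: "U \<in> borel_measurable M"
    unfolding U_def using Im by (intro borel_measurable_diff) auto
  have VU: "V l \<omega> - U \<omega> = (dyadic_integral (l + n) H t \<omega> - I t \<omega>) + - (dyadic_integral (l + n) H s \<omega> - I s \<omega>)" for l \<omega>
    by (simp add: V_def U_def)
  have VUs: "sq_int (\<lambda>\<omega>. V l \<omega> - U \<omega>)" for l
    unfolding VU by (intro sq_int_add sq_int_uminus d s)
  have le: "expectation (\<lambda>\<omega>. (V l \<omega> - U \<omega>)\<^sup>2) \<le>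
    2 * expectation (\<lambda>\<omega>. (dyadic_integral (l + n) H t \<omega> - I t \<omega>)\<^sup>2) + 2 * expectation (\<lambda>\<omega>. (dyadic_integral (l + n) H s \<omega> - I s \<omega>)\<^sup>2)" for l
    unfolding VU using expectation_sq_add_le[OF d[OF s(3), of "l + n"] sq_int_uminus[OF d[OF s(1), of "l + n"]]]
    by (simp only: power2_minus)
  have "(\<lambda>l. 2 * expectation (\<lambda>\<omega>. (dyadic_integral (l + n) H t \<omega> - I t \<omega>)\<^sup>2) + 2 * expectation (\<lambda>\<omega>. (dyadic_integral (l + n) H s \<omega> - I s \<omega>)\<^sup>2)) \<longlonglongrightarrow> 2 * 0 + 2 * 0"
    using LIMSEQ_ignore_initial_segment[OF lim[OF s(3)], of n] LIMSEQ_ignore_initial_segment[OF lim[OF s(1)], of n]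
    by (intro tendsto_add tendsto_mult tendsto_const)
  then have u: "(\<lambda>l. 2 * expectation (\<lambda>\<omega>. (dyadic_integral (l + n) H t \<omega> - I t \<omega>)\<^sup>2) + 2 * expectation (\<lambda>\<omega>. (dyadic_integral (l + n) H s \<omega> - I s \<omega>)\<^sup>2)) \<longlonglongrightarrow> 0" by simp
  have EVU: "(\<lambda>l. expectation (\<lambda>\<omega>. (V l \<omega> - U \<omega>)\<^sup>2)) \<longlonglongrightarrow> 0"
  proof (rule tendsto_sandwich[OF _ _ tendsto_const u])
    show "\<forall>\<^sub>F l in sequentially. 0 \<le> expectation (\<lambda>\<omega>. (V l \<omega> - U \<omega>)\<^sup>2)"
      by (intro always_eventually allI integral_nonneg_AE) simp
  qed (use le in auto)
  have VUp: "tendsto_in_prob M V U"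
    by (rule tendsto_in_prob_sq[OF Vm Um sq_int_square[OF VUs] EVU])
  have c4: "continuous_on UNIV (\<lambda>x::real. x ^ 4)" "continuous_on UNIV (\<lambda>x::real. x\<^sup>2)" by (intro continuous_intros)+
  have V4: "integrable M (\<lambda>\<omega>. V l \<omega> ^ 4)" "expectation (\<lambda>\<omega>. V l \<omega> ^ 4) \<le> 3 * B ^ 4 * (t - s)\<^sup>2" for l
    using L[of l] st unfolding ito_like_def Let_def V_def s_def by blast+
  show "integrable M (\<lambda>\<omega>. (I t \<omega> - I (real k / 2 ^ n) \<omega>) ^ 4)"
    "expectation (\<lambda>\<omega>. (I t \<omega> - I (real k / 2 ^ n) \<omega>) ^ 4) \<le> 3 * B ^ 4 * (t - real k / 2 ^ n)\<^sup>2"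
    using fatou_in_prob[OF VUp c4(1) _ V4 tendsto_const] unfolding s_def[symmetric] U_def by auto
  { fix \<zeta> K c assume \<zeta>: "\<zeta> \<in> borel_measurable (F (real k / 2 ^ n))" "\<forall>\<omega>\<in>space M. \<bar>\<zeta> \<omega>\<bar> \<le> K"
      and c: "\<forall>r. real k / 2 ^ n \<le> r \<longrightarrow> r < t \<longrightarrow> expectation (\<lambda>\<omega>. (H r \<omega> - \<zeta> \<omega>)\<^sup>2) \<le> c"
    let ?Z = "\<lambda>\<omega>. \<zeta> \<omega> * (W t \<omega> - W s \<omega>)"
    have Vz: "sq_int (\<lambda>\<omega>. V l \<omega> - ?Z \<omega>)" "expectation (\<lambda>\<omega>. (V l \<omega> - ?Z \<omega>)\<^sup>2) \<le> c * (t - s)" for l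
      using L[of l] st \<zeta> c unfolding ito_like_def Let_def V_def s_def by blast+
    have Zm: "?Z \<in> borel_measurable M"
      using F_measurable[OF \<zeta>(1)] W_measurable s by (intro borel_measurable_times borel_measurable_diff) auto
    note f = fatou_in_prob[OF tendsto_in_prob_diff_const[OF VUp Zm] c4(2) zero_le_power2 sq_int_square[OF Vz(1)] Vz(2) tendsto_const]
    show "expectation (\<lambda>\<omega>. (I t \<omega> - I (real k / 2 ^ n) \<omega> - \<zeta> \<omega> * (W t \<omega> - W (real k / 2 ^ n) \<omega>))\<^sup>2) \<le> c * (t - real k / 2 ^ n)"
      using f(2) unfolding s_def[symmetric] U_def .
    have "(\<lambda>\<omega>. U \<omega> - ?Z \<omega>) \<in> borel_measurable M" using Um Zm by (rule borel_measurable_diff)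
    then show "sq_int (\<lambda>\<omega>. I t \<omega> - I (real k / 2 ^ n) \<omega> - \<zeta> \<omega> * (W t \<omega> - W (real k / 2 ^ n) \<omega>))"
      using f(1) unfolding s_def[symmetric] U_def sq_int_def by blast }
  fix \<xi> assume \<xi>: "\<xi> \<in> borel_measurable (F (real k / 2 ^ n))" "sq_int \<xi>"
  have Vz: "expectation (\<lambda>\<omega>. \<xi> \<omega> * V l \<omega>) = 0" for l
    using L[of l] st \<xi> unfolding ito_like_def Let_def V_def s_def by blast
  have Vs: "sq_int (V l)" for l
    unfolding V_def using s by (intro sq_int_diff dyadic_integral_sq_int[OF H B])
  \<comment> \<open>Young's inequality with weight e in the role of Cauchy-Schwarz: for each fixed e
    the second term vanishes as l grows.\<close>
  have b: "\<bar>expectation (\<lambda>\<omega>. \<xi> \<omega> * U \<omega>)\<bar> \<le> e * expectation (\<lambda>\<omega>. (\<xi> \<omega>)\<^sup>2)" if e: "0 < e" for e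
  proof (rule LIMSEQ_le_const)
    have "(\<lambda>l. e * expectation (\<lambda>\<omega>. (\<xi> \<omega>)\<^sup>2) + expectation (\<lambda>\<omega>. (V l \<omega> - U \<omega>)\<^sup>2) / e) \<longlonglongrightarrow>
      e * expectation (\<lambda>\<omega>. (\<xi> \<omega>)\<^sup>2) + 0 / e"
      using e by (intro tendsto_add tendsto_divide tendsto_const EVU) auto
    then show "(\<lambda>l. e * expectation (\<lambda>\<omega>. (\<xi> \<omega>)\<^sup>2) + expectation (\<lambda>\<omega>. (V l \<omega> - U \<omega>)\<^sup>2) / e) \<longlonglongrightarrow>
      e * expectation (\<lambda>\<omega>. (\<xi> \<omega>)\<^sup>2)" by simp
    have "\<bar>expectation (\<lambda>\<omega>. \<xi> \<omega> * U \<omega>)\<bar> \<le> e * expectation (\<lambda>\<omega>. (\<xi> \<omega>)\<^sup>2) + expectation (\<lambda>\<omega>. (V l \<omega> - U \<omega>)\<^sup>2) / e" for l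
    proof -
      have "expectation (\<lambda>\<omega>. \<xi> \<omega> * U \<omega>) = expectation (\<lambda>\<omega>. \<xi> \<omega> * V l \<omega> - \<xi> \<omega> * (V l \<omega> - U \<omega>))"
        by (simp add: algebra_simps)
      also have "\<dots> = - expectation (\<lambda>\<omega>. \<xi> \<omega> * (V l \<omega> - U \<omega>))"
        using sq_int_mult_integrable[OF \<xi>(2) Vs] sq_int_mult_integrable[OF \<xi>(2) VUs] Vz
        by (subst Bochner_Integration.integral_diff) auto
      finally have "\<bar>expectation (\<lambda>\<omega>. \<xi> \<omega> * U \<omega>)\<bar> = \<bar>expectation (\<lambda>\<omega>. \<xi> \<omega> * (V l \<omega> - U \<omega>))\<bar>" by simp
      also have "\<dots> \<le> expectation (\<lambda>\<omega>. \<bar>\<xi> \<omega> * (V l \<omega> - U \<omega>)\<bar>)" by (rule integral_abs_bound)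
      also have "\<dots> \<le> expectation (\<lambda>\<omega>. e * (\<xi> \<omega>)\<^sup>2 + (V l \<omega> - U \<omega>)\<^sup>2 / e)"
      proof (rule integral_mono)
        fix \<omega>
        have "2 * (sqrt e * \<bar>\<xi> \<omega>\<bar>) * (\<bar>V l \<omega> - U \<omega>\<bar> / sqrt e) \<le> (sqrt e * \<bar>\<xi> \<omega>\<bar>)\<^sup>2 + (\<bar>V l \<omega> - U \<omega>\<bar> / sqrt e)\<^sup>2"
          by (rule sum_squares_bound)
        then have "2 * \<bar>\<xi> \<omega> * (V l \<omega> - U \<omega>)\<bar> \<le> e * (\<xi> \<omega>)\<^sup>2 + (V l \<omega> - U \<omega>)\<^sup>2 / e"
          using e by (simp add: power_mult_distrib power_divide abs_mult)
        then show "\<bar>\<xi> \<omega> * (V l \<omega> - U \<omega>)\<bar> \<le> e * (\<xi> \<omega>)\<^sup>2 + (V l \<omega> - U \<omega>)\<^sup>2 / e"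
          using abs_ge_zero[of "\<xi> \<omega> * (V l \<omega> - U \<omega>)"] by linarith
      qed (use sq_int_mult_integrable[OF \<xi>(2) VUs] sq_int_square[OF \<xi>(2)] sq_int_square[OF VUs] in auto)
      also have "\<dots> = e * expectation (\<lambda>\<omega>. (\<xi> \<omega>)\<^sup>2) + expectation (\<lambda>\<omega>. (V l \<omega> - U \<omega>)\<^sup>2) / e"
        using sq_int_square[OF \<xi>(2)] sq_int_square[OF VUs] by simp
      finally show ?thesis .
    qed
    then show "\<exists>N. \<forall>l\<ge>N. \<bar>expectation (\<lambda>\<omega>. \<xi> \<omega> * U \<omega>)\<bar> \<le> e * expectation (\<lambda>\<omega>. (\<xi> \<omega>)\<^sup>2) + expectation (\<lambda>\<omega>. (V l \<omega> - U \<omega>)\<^sup>2) / e" by blast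
  qed
  have "\<bar>expectation (\<lambda>\<omega>. \<xi> \<omega> * U \<omega>)\<bar> \<le> 0"
  proof (rule field_le_epsilon)
    fix e :: real assume e: "0 < e"
    define m where "m = expectation (\<lambda>\<omega>. (\<xi> \<omega>)\<^sup>2)"
    have m: "0 \<le> m" unfolding m_def by (intro integral_nonneg_AE) auto
    \<comment> \<open>The denominator \<open>m + 1\<close> also covers m = 0.\<close>
    have p: "0 < e / (m + 1)" using e m by simp
    have "\<bar>expectation (\<lambda>\<omega>. \<xi> \<omega> * U \<omega>)\<bar> \<le> e / (m + 1) * m"
      using b[OF p] unfolding m_def .
    also have "\<dots> \<le> e" using e m by (simp add: field_simps)
    finally show "\<bar>expectation (\<lambda>\<omega>. \<xi> \<omega> * U \<omega>)\<bar> \<le> 0 + e" by simp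
  qed
  then show "expectation (\<lambda>\<omega>. \<xi> \<omega> * (I t \<omega> - I (real k / 2 ^ n) \<omega>)) = 0"
    unfolding s_def[symmetric] U_def by simp
qed

lemma ito_like_D:
  assumes "ito_like n B H I" "s = real k / 2 ^ n" "s \<le> t"
  shows "integrable M (\<lambda>\<omega>. (I t \<omega> - I s \<omega>) ^ 4)"
    "expectation (\<lambda>\<omega>. (I t \<omega> - I s \<omega>) ^ 4) \<le> 3 * B ^ 4 * (t - s)\<^sup>2"
    "\<xi> \<in> borel_measurable (F s) \<Longrightarrow> sq_int \<xi> \<Longrightarrow> expectation (\<lambda>\<omega>. \<xi> \<omega> * (I t \<omega> - I s \<omega>)) = 0"
  using assms unfolding ito_like_def Let_def by blast+

lemma ito_like_residual:
  assumes "ito_like n B H I" "s = real k / 2 ^ n" "s \<le> t"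
    and "\<zeta> \<in> borel_measurable (F s)" "\<And>\<omega>. \<omega> \<in> space M \<Longrightarrow> \<bar>\<zeta> \<omega>\<bar> \<le> K"
    and "\<And>r. s \<le> r \<Longrightarrow> r < t \<Longrightarrow> expectation (\<lambda>\<omega>. (H r \<omega> - \<zeta> \<omega>)\<^sup>2) \<le> c"
  shows "sq_int (\<lambda>\<omega>. I t \<omega> - I s \<omega> - \<zeta> \<omega> * (W t \<omega> - W s \<omega>))"
    "expectation (\<lambda>\<omega>. (I t \<omega> - I s \<omega> - \<zeta> \<omega> * (W t \<omega> - W s \<omega>))\<^sup>2) \<le> c * (t - s)"
  using assms unfolding ito_like_def Let_def by blast+

text \<open>The residual clause with \<zeta> = 0, where the mean square distance of H from \<zeta>
  is at most B^2.\<close>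

lemma ito_like_sq:
  assumes "ito_like n B H I" "s = real k / 2 ^ n" "s \<le> t"
    and "\<And>r \<omega>. 0 \<le> r \<Longrightarrow> \<omega> \<in> space M \<Longrightarrow> \<bar>H r \<omega>\<bar> \<le> B"
  shows "sq_int (\<lambda>\<omega>. I t \<omega> - I s \<omega>)" "expectation (\<lambda>\<omega>. (I t \<omega> - I s \<omega>)\<^sup>2) \<le> B\<^sup>2 * (t - s)"
proof -
  have c: "expectation (\<lambda>\<omega>. (H r \<omega> - 0)\<^sup>2) \<le> B\<^sup>2" if "s \<le> r" "r < t" for r
  proof -
    have "0 \<le> r" using that(1) assms(2) by (smt (verit) divide_nonneg_nonneg of_nat_0_le_iff zero_le_power)
    then have "(H r \<omega>)\<^sup>2 \<le> B\<^sup>2" if "\<omega> \<in> space M" for \<omega> using power_mono[OF assms(4)[OF _ that], of r 2] by simp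
    then have "expectation (\<lambda>\<omega>. (H r \<omega> - 0)\<^sup>2) \<le> expectation (\<lambda>\<omega>. B\<^sup>2)"
      by (intro integral_mono') auto
    then show ?thesis by (simp add: prob_space)
  qed
  show "sq_int (\<lambda>\<omega>. I t \<omega> - I s \<omega>)" "expectation (\<lambda>\<omega>. (I t \<omega> - I s \<omega>)\<^sup>2) \<le> B\<^sup>2 * (t - s)"
    using ito_like_residual[OF assms(1,2,3), of "\<lambda>_. 0" 0 "B\<^sup>2", OF _ _ c] by auto
qed

end

section \<open>Yamada--Watanabe functions\<close>

text \<open>Free of any order between x and y; the intermediate point is located by its distance
  from x, which is the form that Lipschitz bounds consume.\<close>

lemma mvt_real:
  fixes f f' :: "real \<Rightarrow> real"
  assumes "\<And>x. (f has_real_derivative f' x) (at x)"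
  obtains z where "\<bar>z - x\<bar> \<le> \<bar>y - x\<bar>" "f y - f x = (y - x) * f' z"
proof (cases x y rule: linorder_cases)
  case less
  from MVT2[OF less assms] obtain z where "x < z" "z < y" "f y - f x = (y - x) * f' z" by auto
  then show ?thesis by (intro that[of z]) auto
next
  case greater
  from MVT2[OF greater assms] obtain z where "y < z" "z < x" "f x - f y = (x - y) * f' z" by auto
  then show ?thesis by (intro that[of z]) (auto simp: algebra_simps)
qed (auto intro: that[of x])

text \<open>\<phi> with its first two derivatives. Of the three constants only \<delta> has to be
  small: Q bounds the second derivative and L is its Lipschitz constant, and both may grow as
  \<delta> shrinks, since they only meet factors that vanish with the mesh.\<close>

definition yamada_function ::
  "real \<Rightarrow> real \<Rightarrow> real \<Rightarrow> (real \<Rightarrow> real) \<Rightarrow> (real \<Rightarrow> real) \<Rightarrow> (real \<Rightarrow> real) \<Rightarrow> bool" where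
  "yamada_function \<delta> Q L \<phi> \<phi>1 \<phi>2 \<longleftrightarrow> 0 \<le> Q \<and> 0 \<le> L \<and> \<phi> 0 = 0 \<and> \<phi>1 0 = 0 \<and>
    (\<forall>x. (\<phi> has_real_derivative \<phi>1 x) (at x)) \<and> (\<forall>x. (\<phi>1 has_real_derivative \<phi>2 x) (at x)) \<and>
    (\<forall>x. 0 \<le> \<phi>2 x \<and> \<phi>2 x \<le> Q \<and> \<phi>2 x * \<bar>x\<bar> \<le> \<delta>) \<and> (\<forall>x y. \<bar>\<phi>2 x - \<phi>2 y\<bar> \<le> L * \<bar>x - y\<bar>)"

text \<open>The triangle inequality in the plane, for the points (x, e) and (y, e).\<close>

lemma sqrt_add_square_lipschitz: "\<bar>sqrt (x\<^sup>2 + e\<^sup>2) - sqrt (y\<^sup>2 + e\<^sup>2)\<bar> \<le> \<bar>x - y\<bar>" for x y e :: real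
proof -
  have "sqrt (a\<^sup>2 + e\<^sup>2) \<le> sqrt (b\<^sup>2 + e\<^sup>2) + \<bar>a - b\<bar>" for a b
    using real_sqrt_sum_squares_triangle_ineq[of b "a - b" e 0] by simp
  from this[of x y] this[of y x] show ?thesis by (simp add: abs_le_iff)
qed

text \<open>The second derivative \<open>\<delta> / sqrt (x\<^sup>2 + \<epsilon>\<^sup>2)\<close> satisfies \<open>\<phi>'' x * \<bar>x\<bar> \<le> \<delta>\<close>, while its integral
  over \<open>[0, \<eta>]\<close> reaches 1 once \<open>\<epsilon> = \<eta> / sinh (1 / \<delta>)\<close>.\<close>

lemma yamada_function_exists:
  assumes \<delta>: "0 < \<delta>" and \<eta>: "0 < \<eta>"
  obtains Q L \<phi> \<phi>1 \<phi>2 where "yamada_function \<delta> Q L \<phi> \<phi>1 \<phi>2" "\<And>x. \<bar>x\<bar> \<le> \<phi> x + \<eta>"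
proof -
  define e where "e = \<eta> / sinh (1 / \<delta>)"
  have sh: "0 < sinh (1 / \<delta>)" using \<delta> by simp
  have e: "0 < e" unfolding e_def using \<eta> sh by (rule divide_pos_pos)
  \<comment> \<open>\<phi>2 integrated twice from 0; the summand e makes \<phi> vanish at 0.\<close>
  define \<phi> where "\<phi> x = \<delta> * (x * arsinh (x / e) - sqrt (x\<^sup>2 + e\<^sup>2) + e)" for x
  define \<phi>1 where "\<phi>1 x = \<delta> * arsinh (x / e)" for x
  define \<phi>2 where "\<phi>2 x = \<delta> / sqrt (x\<^sup>2 + e\<^sup>2)" for x
  have r: "e * sqrt ((x / e)\<^sup>2 + 1) = sqrt (x\<^sup>2 + e\<^sup>2)" for x
  proof -
    have "sqrt (x\<^sup>2 + e\<^sup>2) = sqrt (e\<^sup>2 * ((x / e)\<^sup>2 + 1))" using e by (simp add: field_simps)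
    then show ?thesis using e by (simp add: real_sqrt_mult)
  qed
  have rp: "0 < sqrt (x\<^sup>2 + e\<^sup>2)" for x using e by (simp add: add_nonneg_pos)
  have re: "e \<le> sqrt (x\<^sup>2 + e\<^sup>2)" for x using e by (intro real_le_rsqrt) simp
  have rx: "\<bar>x\<bar> \<le> sqrt (x\<^sup>2 + e\<^sup>2)" for x by (intro real_le_rsqrt) simp
  have da: "((\<lambda>x. arsinh (x / e)) has_real_derivative 1 / sqrt (x\<^sup>2 + e\<^sup>2)) (at x)" for x
  proof -
    have "((\<lambda>x. x / e) has_real_derivative 1 / e) (at x)" using e by (auto intro!: derivative_eq_intros)
    from DERIV_chain2[OF arsinh_real_has_field_derivative this] show ?thesis
      using e by (simp add: r[symmetric] mult.commute)
  qed
  have dr: "((\<lambda>x. sqrt (x\<^sup>2 + e\<^sup>2)) has_real_derivative x / sqrt (x\<^sup>2 + e\<^sup>2)) (at x)" for x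
    using rp[of x] by (auto intro!: derivative_eq_intros simp: field_simps)
  have d1: "(\<phi> has_real_derivative \<phi>1 x) (at x)" for x
    unfolding \<phi>_def[abs_def] \<phi>1_def by (rule derivative_eq_intros da dr refl | simp)+
  have d2: "(\<phi>1 has_real_derivative \<phi>2 x) (at x)" for x
    unfolding \<phi>1_def[abs_def] \<phi>2_def by (rule derivative_eq_intros da refl | simp)+
  have Q: "0 \<le> \<phi>2 x" "\<phi>2 x \<le> \<delta> / e" "\<phi>2 x * \<bar>x\<bar> \<le> \<delta>" for x
    using \<delta> e rp[of x] divide_left_mono[OF re[of x], of \<delta>] mult_left_mono[OF rx[of x], of \<delta>]
    by (auto simp: \<phi>2_def divide_le_eq)
  have L: "\<bar>\<phi>2 x - \<phi>2 y\<bar> \<le> \<delta> / e\<^sup>2 * \<bar>x - y\<bar>" for x y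
  proof -
    have q: "\<delta> / a - \<delta> / b = \<delta> * (b - a) / (a * b)" if "0 < a" "0 < b" for a b
      using that by (simp add: field_simps)
    have "\<phi>2 x - \<phi>2 y = \<delta> * (sqrt (y\<^sup>2 + e\<^sup>2) - sqrt (x\<^sup>2 + e\<^sup>2)) / (sqrt (x\<^sup>2 + e\<^sup>2) * sqrt (y\<^sup>2 + e\<^sup>2))"
      unfolding \<phi>2_def by (rule q[OF rp rp])
    then have "\<bar>\<phi>2 x - \<phi>2 y\<bar> = \<delta> * \<bar>sqrt (y\<^sup>2 + e\<^sup>2) - sqrt (x\<^sup>2 + e\<^sup>2)\<bar> / (sqrt (x\<^sup>2 + e\<^sup>2) * sqrt (y\<^sup>2 + e\<^sup>2))"
      using \<delta> rp[of x] rp[of y] by (simp add: abs_mult)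
    also have "\<dots> \<le> \<delta> * \<bar>x - y\<bar> / (e * e)"
      using \<delta> e re sqrt_add_square_lipschitz[of y e x]
      by (intro frac_le mult_mono mult_pos_pos) (auto simp: abs_minus_commute)
    finally show ?thesis by (simp add: power2_eq_square)
  qed
  have pos: "0 \<le> \<phi> x" for x
  proof -
    obtain z where z: "\<bar>z - 0\<bar> \<le> \<bar>x - 0\<bar>" "\<phi>1 x - \<phi>1 0 = (x - 0) * \<phi>2 z" using mvt_real[OF d2] .
    have "0 \<le> x * \<phi>1 x" for x
    proof -
      obtain z where "\<bar>z - 0\<bar> \<le> \<bar>x - 0\<bar>" "\<phi>1 x - \<phi>1 0 = (x - 0) * \<phi>2 z" using mvt_real[OF d2] .
      then have "x * \<phi>1 x = x\<^sup>2 * \<phi>2 z" by (simp add: \<phi>1_def power2_eq_square)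
      then show ?thesis using Q(1)[of z] by simp
    qed
    then have mono: "0 \<le> \<phi>1 x" if "0 < x" for x using that by (metis zero_le_mult_iff less_le_not_le)
    have "0 \<le> \<phi> x" if "0 \<le> x" for x
    proof (cases "x = 0")
      case False
      then have "0 < x" using that by simp
      from MVT2[OF this d1] obtain z where "0 < z" "\<phi> x - \<phi> 0 = (x - 0) * \<phi>1 z" by auto
      then show ?thesis using mono[of z] that e by (simp add: \<phi>_def)
    qed (use e in \<open>simp add: \<phi>_def\<close>)
    moreover have "\<phi> x = \<phi> \<bar>x\<bar>" by (simp add: \<phi>_def abs_if)
    ultimately show ?thesis by (metis abs_ge_zero)
  qed
  \<comment> \<open>Up to \<eta> nonnegativity of \<phi> suffices; beyond \<eta> the slope of \<phi>
    is at least 1 by the choice of e.\<close>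
  have low: "\<bar>x\<bar> \<le> \<phi> x + \<eta>" for x
  proof (cases "\<bar>x\<bar> \<le> \<eta>")
    case True
    then show ?thesis using pos[of x] by linarith
  next
    case False
    then have "\<eta> < \<bar>x\<bar>" by simp
    from MVT2[OF this d1] obtain z where z: "\<eta> < z" "\<phi> \<bar>x\<bar> - \<phi> \<eta> = (\<bar>x\<bar> - \<eta>) * \<phi>1 z" by auto
    have "\<eta> / e = sinh (1 / \<delta>)" using \<eta> sh by (simp add: e_def)
    then have "sinh (1 / \<delta>) \<le> z / e" using z(1) e by (metis divide_right_mono less_imp_le)
    then have "arsinh (sinh (1 / \<delta>)) \<le> arsinh (z / e)" by (meson arsinh_less_iff_real not_le)
    then have "1 / \<delta> \<le> arsinh (z / e)" by (simp add: arsinh_sinh_real)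
    then have "1 \<le> \<phi>1 z" using \<delta> by (simp add: \<phi>1_def field_simps)
    then have "(\<bar>x\<bar> - \<eta>) * 1 \<le> (\<bar>x\<bar> - \<eta>) * \<phi>1 z" using False by (intro mult_left_mono) auto
    moreover have "\<phi> x = \<phi> \<bar>x\<bar>" by (simp add: \<phi>_def abs_if)
    ultimately show ?thesis using z(2) pos[of \<eta>] by simp
  qed
  show ?thesis
  proof (rule that[of "\<delta> / e" "\<delta> / e\<^sup>2" \<phi> \<phi>1 \<phi>2, OF _ low])
    show "yamada_function \<delta> (\<delta> / e) (\<delta> / e\<^sup>2) \<phi> \<phi>1 \<phi>2"
      unfolding yamada_function_def using \<delta> e d1 d2 Q L by (auto simp: \<phi>_def \<phi>1_def)
  qed
qed

text \<open>The last clause, by which \<open>\<phi>1 x\<close> has the sign of x, is where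
  monotonicity of the drift will enter.\<close>

lemma yamada_first_derivative:
  assumes "yamada_function \<delta> Q L \<phi> \<phi>1 \<phi>2"
  shows "\<bar>\<phi>1 x - \<phi>1 y\<bar> \<le> Q * \<bar>x - y\<bar>" "\<bar>\<phi>1 x\<bar> \<le> Q * \<bar>x\<bar>" "0 \<le> x * \<phi>1 x"
proof -
  have d: "\<And>x. (\<phi>1 has_real_derivative \<phi>2 x) (at x)" and q: "\<And>x. 0 \<le> \<phi>2 x" "\<And>x. \<phi>2 x \<le> Q" and 0: "\<phi>1 0 = 0"
    using assms by (auto simp: yamada_function_def)
  have *: "\<bar>\<phi>1 x - \<phi>1 y\<bar> \<le> Q * \<bar>x - y\<bar>" for x y
  proof -
    obtain z where "\<phi>1 x - \<phi>1 y = (x - y) * \<phi>2 z" using mvt_real[OF d] .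
    then have "\<bar>\<phi>1 x - \<phi>1 y\<bar> = \<phi>2 z * \<bar>x - y\<bar>" using q(1)[of z] by (simp add: abs_mult mult.commute)
    then show ?thesis using q(2)[of z] by (simp add: mult_right_mono)
  qed
  then show "\<bar>\<phi>1 x - \<phi>1 y\<bar> \<le> Q * \<bar>x - y\<bar>" .
  show "\<bar>\<phi>1 x\<bar> \<le> Q * \<bar>x\<bar>" using *[of x 0] 0 by simp
  obtain z where "\<phi>1 x - \<phi>1 0 = (x - 0) * \<phi>2 z" using mvt_real[OF d] .
  then have "x * \<phi>1 x = x\<^sup>2 * \<phi>2 z" using 0 by (simp add: power2_eq_square)
  then show "0 \<le> x * \<phi>1 x" using q(1)[of z] by simp
qed

lemma yamada_bounds:
  assumes "yamada_function \<delta> Q L \<phi> \<phi>1 \<phi>2"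
  shows "0 \<le> \<phi> x" "\<phi> x \<le> Q * x\<^sup>2"
proof -
  have d: "\<And>x. (\<phi> has_real_derivative \<phi>1 x) (at x)" and 0: "\<phi> 0 = 0" and Q: "0 \<le> Q"
    using assms by (auto simp: yamada_function_def)
  note f = yamada_first_derivative[OF assms]
  have "0 \<le> \<phi> x \<and> \<phi> x \<le> Q * x\<^sup>2"
  proof (cases x "0::real" rule: linorder_cases)
    case less
    from MVT2[OF less d] obtain z where z: "x < z" "z < 0" "\<phi> 0 - \<phi> x = (0 - x) * \<phi>1 z" by auto
    have "\<phi>1 z \<le> 0" using f(3)[of z] z by (simp add: zero_le_mult_iff)
    moreover have "- \<phi>1 z \<le> Q * (- x)"
      using f(2)[of z] z Q mult_left_mono[of "- z" "- x" Q] by linarith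
    ultimately show ?thesis using z 0 less mult_left_mono[of "- \<phi>1 z" "Q * (- x)" "- x"]
      by (auto simp: power2_eq_square mult_nonpos_nonpos algebra_simps)
  next
    case greater
    from MVT2[OF greater d] obtain z where z: "0 < z" "z < x" "\<phi> x - \<phi> 0 = (x - 0) * \<phi>1 z" by auto
    have "0 \<le> \<phi>1 z" using f(3)[of z] z by (simp add: zero_le_mult_iff)
    moreover have "\<phi>1 z \<le> Q * x"
      using f(2)[of z] z Q mult_left_mono[of z x Q] by linarith
    ultimately show ?thesis using z 0 greater mult_left_mono[of "\<phi>1 z" "Q * x" x]
      by (auto simp: power2_eq_square algebra_simps)
  qed (simp add: 0)
  then show "0 \<le> \<phi> x" "\<phi> x \<le> Q * x\<^sup>2" by auto
qed

text \<open>A stands for a drift increment of order h and D for a noise increment of order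
  \<open>sqrt h\<close>; expanding A to first and D to second order leaves errors of order
  \<open>h * sqrt h\<close>. A is split off first, at the price of moving \<phi>1 from an
  intermediate point back to z.\<close>

lemma yamada_taylor:
  assumes "yamada_function \<delta> Q L \<phi> \<phi>1 \<phi>2"
  shows "\<phi> (z + A + D) \<le> \<phi> z + \<phi>1 z * A + \<phi>1 z * D + \<phi>2 z * D\<^sup>2 / 2 + L * \<bar>D\<bar> ^ 3 + Q * (\<bar>A\<bar> * \<bar>D\<bar> + A\<^sup>2)"
proof -
  have d: "\<And>x. (\<phi> has_real_derivative \<phi>1 x) (at x)" "\<And>x. (\<phi>1 has_real_derivative \<phi>2 x) (at x)"
    and L: "\<And>x y. \<bar>\<phi>2 x - \<phi>2 y\<bar> \<le> L * \<bar>x - y\<bar>" "0 \<le> L" and Q: "0 \<le> Q"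
    using assms by (auto simp: yamada_function_def)
  have 1: "\<phi> (z + D + A) \<le> \<phi> (z + D) + \<phi>1 z * A + Q * (\<bar>A\<bar> * \<bar>D\<bar> + A\<^sup>2)"
  proof -
    obtain \<theta> where \<theta>: "\<bar>\<theta> - (z + D)\<bar> \<le> \<bar>(z + D + A) - (z + D)\<bar>" "\<phi> (z + D + A) - \<phi> (z + D) = ((z + D + A) - (z + D)) * \<phi>1 \<theta>"
      using mvt_real[OF d(1)] .
    have "\<bar>\<phi>1 \<theta> - \<phi>1 z\<bar> \<le> Q * \<bar>\<theta> - z\<bar>" by (rule yamada_first_derivative[OF assms])
    also have "\<dots> \<le> Q * (\<bar>D\<bar> + \<bar>A\<bar>)" using \<theta>(1) Q by (intro mult_left_mono) auto
    finally have "\<bar>A * (\<phi>1 \<theta> - \<phi>1 z)\<bar> \<le> \<bar>A\<bar> * (Q * (\<bar>D\<bar> + \<bar>A\<bar>))"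
      unfolding abs_mult by (rule mult_left_mono) simp
    moreover have "\<bar>A\<bar> * (Q * (\<bar>D\<bar> + \<bar>A\<bar>)) = Q * (\<bar>A\<bar> * \<bar>D\<bar> + A\<^sup>2)"
      by (simp add: algebra_simps power2_eq_square)
    moreover have "\<phi> (z + D + A) = \<phi> (z + D) + \<phi>1 z * A + A * (\<phi>1 \<theta> - \<phi>1 z)"
      using \<theta>(2) by (simp add: algebra_simps)
    ultimately show ?thesis by (simp add: abs_le_iff)
  qed
  \<comment> \<open>The second order Taylor remainder in D. Its derivative is at most L u^2 in
    absolute value because \<phi>2 is Lipschitz.\<close>
  define g where "g u = \<phi> (z + u) - \<phi> z - \<phi>1 z * u - \<phi>2 z * u\<^sup>2 / 2" for u
  have dg: "(g has_real_derivative \<phi>1 (z + u) - \<phi>1 z - \<phi>2 z * u) (at u)" for u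
    unfolding g_def[abs_def] by (rule derivative_eq_intros DERIV_chain'[OF _ d(1)] refl | simp)+
  have g': "\<bar>\<phi>1 (z + u) - \<phi>1 z - \<phi>2 z * u\<bar> \<le> L * u\<^sup>2" for u
  proof -
    obtain \<theta> where \<theta>: "\<bar>\<theta> - z\<bar> \<le> \<bar>(z + u) - z\<bar>" "\<phi>1 (z + u) - \<phi>1 z = ((z + u) - z) * \<phi>2 \<theta>"
      using mvt_real[OF d(2)] .
    then have "\<phi>1 (z + u) - \<phi>1 z - \<phi>2 z * u = u * (\<phi>2 \<theta> - \<phi>2 z)" by (simp add: algebra_simps)
    then have "\<bar>\<phi>1 (z + u) - \<phi>1 z - \<phi>2 z * u\<bar> = \<bar>u\<bar> * \<bar>\<phi>2 \<theta> - \<phi>2 z\<bar>" by (simp add: abs_mult)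
    also have "\<dots> \<le> \<bar>u\<bar> * (L * \<bar>u\<bar>)"
      using order_trans[OF L(1) mult_left_mono[OF \<theta>(1) L(2)]] by (intro mult_left_mono) auto
    finally show ?thesis by (simp add: power2_eq_square mult.left_commute)
  qed
  obtain \<theta> where \<theta>: "\<bar>\<theta> - 0\<bar> \<le> \<bar>D - 0\<bar>" "g D - g 0 = (D - 0) * (\<phi>1 (z + \<theta>) - \<phi>1 z - \<phi>2 z * \<theta>)"
    using mvt_real[OF dg] .
  have "\<theta>\<^sup>2 \<le> D\<^sup>2" using \<theta>(1) by (simp add: abs_le_square_iff)
  then have "\<bar>D\<bar> * \<bar>\<phi>1 (z + \<theta>) - \<phi>1 z - \<phi>2 z * \<theta>\<bar> \<le> \<bar>D\<bar> * (L * D\<^sup>2)"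
    using order_trans[OF g' mult_left_mono[OF _ L(2)]] by (intro mult_left_mono) auto
  moreover have "\<bar>D\<bar> * (L * D\<^sup>2) = L * \<bar>D\<bar> ^ 3" by (simp add: power2_eq_square power3_eq_cube)
  moreover have "g D = D * (\<phi>1 (z + \<theta>) - \<phi>1 z - \<phi>2 z * \<theta>)" using \<theta>(2) by (simp add: g_def)
  ultimately have "g D \<le> L * \<bar>D\<bar> ^ 3" by (metis abs_mult abs_ge_self order_trans)
  then have "\<phi> (z + D) \<le> \<phi> z + \<phi>1 z * D + \<phi>2 z * D\<^sup>2 / 2 + L * \<bar>D\<bar> ^ 3" by (simp add: g_def)
  with 1 show ?thesis by (simp add: add.assoc add.left_commute add.commute)
qed

section \<open>Second moments of time integrals\<close>

lemma time_integral_square_le: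
  fixes f :: "real \<Rightarrow> real"
  assumes [measurable]: "f \<in> borel_measurable borel" and f: "\<And>u. \<bar>f u\<bar> \<le> c * indicator {s<..t} u" and st: "s \<le> t"
  shows "(integral\<^sup>L lborel f)\<^sup>2 \<le> (t - s) * integral\<^sup>L lborel (\<lambda>u. (f u)\<^sup>2)"
    and "integrable lborel (\<lambda>u. (f u)\<^sup>2)"
proof -
  let ?m = "integral\<^sup>L lborel f / (t - s)" and ?i = "indicator {s<..t} :: real \<Rightarrow> real"
  have i0: "integrable lborel (\<lambda>u. c * ?i u)" "integrable lborel (\<lambda>u. c\<^sup>2 * ?i u)" using st by auto
  have i1: "integrable lborel f"
    by (rule Bochner_Integration.integrable_bound[OF i0(1)]) (use f in \<open>auto intro: order_trans[OF _ abs_ge_self]\<close>)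
  have "\<bar>(f u)\<^sup>2\<bar> \<le> c\<^sup>2 * ?i u" for u
    using power_mono[OF f[of u], of 2] by (auto simp: indicator_def split: if_splits)
  then show i2: "integrable lborel (\<lambda>u. (f u)\<^sup>2)"
    by (intro Bochner_Integration.integrable_bound[OF i0(2)]) (auto intro: order_trans[OF _ abs_ge_self])
  show "(integral\<^sup>L lborel f)\<^sup>2 \<le> (t - s) * integral\<^sup>L lborel (\<lambda>u. (f u)\<^sup>2)"
  proof (cases "s = t")
    case True
    then have "f = (\<lambda>_. 0)" using f by (auto simp: fun_eq_iff)
    then show ?thesis using True by simp
  next
    case False
    then have ts: "0 < t - s" using st by simp
    have q: "- 2 * (J / d) * J + (J / d)\<^sup>2 * d = - (J\<^sup>2 / d)" if "0 < d" for J d :: real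
      using that by (simp add: field_simps power2_eq_square)
    have eq: "(f u - ?m * ?i u)\<^sup>2 = (f u)\<^sup>2 - 2 * ?m * f u + ?m\<^sup>2 * ?i u" for u
      using f[of u] by (auto simp: indicator_def power2_diff)
    \<comment> \<open>Cauchy-Schwarz as nonnegativity of the variance of f around its time mean
      \<open>?m\<close>.\<close>
    have "0 \<le> integral\<^sup>L lborel (\<lambda>u. (f u - ?m * ?i u)\<^sup>2)" by (intro integral_nonneg_AE) auto
    also have "\<dots> = integral\<^sup>L lborel (\<lambda>u. (f u)\<^sup>2) - 2 * ?m * integral\<^sup>L lborel f + ?m\<^sup>2 * (t - s)"
      unfolding eq using i1 i2 st by simp
    also have "\<dots> = integral\<^sup>L lborel (\<lambda>u. (f u)\<^sup>2) - (integral\<^sup>L lborel f)\<^sup>2 / (t - s)"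
      using q[OF ts, of "integral\<^sup>L lborel f"] by linarith
    finally show ?thesis using ts by (simp add: field_simps)
  qed
qed

context prob_space
begin

text \<open>Cauchy-Schwarz in time on each path, then Tonelli to exchange time and expectation. The
  path bound K may depend on \<omega> and keeps each path integrable, while c bounds the second
  moment uniformly in time.\<close>

lemma time_integral_sq_int:
  fixes f :: "'a \<Rightarrow> real \<Rightarrow> real"
  assumes m: "(\<lambda>(\<omega>, u). f \<omega> u) \<in> borel_measurable (M \<Otimes>\<^sub>M lborel)" and st: "s \<le> t"
    and b: "\<And>\<omega>. \<omega> \<in> space M \<Longrightarrow> \<exists>K. \<forall>u. \<bar>f \<omega> u\<bar> \<le> K * indicator {s<..t} u"
    and c: "\<And>u. s < u \<Longrightarrow> u \<le> t \<Longrightarrow> sq_int (\<lambda>\<omega>. f \<omega> u) \<and> expectation (\<lambda>\<omega>. (f \<omega> u)\<^sup>2) \<le> c" and c0: "0 \<le> c"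
  shows "sq_int (\<lambda>\<omega>. integral\<^sup>L lborel (f \<omega>))"
    and "expectation (\<lambda>\<omega>. (integral\<^sup>L lborel (f \<omega>))\<^sup>2) \<le> (t - s)\<^sup>2 * c"
proof -
  interpret P: pair_sigma_finite M lborel ..
  have m': "(\<lambda>x. f (fst x) (snd x)) \<in> borel_measurable (M \<Otimes>\<^sub>M lborel)"
    using m by (simp add: split_beta')
  have mp: "f \<omega> \<in> borel_measurable borel" if "\<omega> \<in> space M" for \<omega>
    using measurable_compose[OF measurable_Pair1'[OF that] m] by simp
  have im: "(\<lambda>\<omega>. integral\<^sup>L lborel (f \<omega>)) \<in> borel_measurable M"
    using lborel.borel_measurable_lebesgue_integral[OF m] by simp
  have m2: "(\<lambda>x. ennreal ((f (fst x) (snd x))\<^sup>2)) \<in> borel_measurable (M \<Otimes>\<^sub>M lborel)"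
    using m' by measurable
  have p: "ennreal ((integral\<^sup>L lborel (f \<omega>))\<^sup>2) \<le> ennreal (t - s) * (\<integral>\<^sup>+u. ennreal ((f \<omega> u)\<^sup>2) \<partial>lborel)" if \<omega>: "\<omega> \<in> space M" for \<omega>
  proof -
    from b[OF \<omega>] obtain K where K: "\<forall>u. \<bar>f \<omega> u\<bar> \<le> K * indicator {s<..t} u" ..
    note l = time_integral_square_le[OF mp[OF \<omega>] K[rule_format] st]
    have "ennreal ((integral\<^sup>L lborel (f \<omega>))\<^sup>2) \<le> ennreal ((t - s) * integral\<^sup>L lborel (\<lambda>u. (f \<omega> u)\<^sup>2))"
      using l(1) by (rule ennreal_leI)
    also have "\<dots> = ennreal (t - s) * (\<integral>\<^sup>+u. ennreal ((f \<omega> u)\<^sup>2) \<partial>lborel)"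
      using st by (simp add: nn_integral_eq_integral[OF l(2)] ennreal_mult')
    finally show ?thesis .
  qed
  have z: "f \<omega> u = 0" if "\<omega> \<in> space M" "\<not> (s < u \<and> u \<le> t)" for \<omega> u
  proof -
    from b[OF that(1)] obtain K where "\<forall>u. \<bar>f \<omega> u\<bar> \<le> K * indicator {s<..t} u" ..
    with that(2) show ?thesis by (auto dest: spec[of _ u])
  qed
  have "(\<integral>\<^sup>+\<omega>. ennreal ((integral\<^sup>L lborel (f \<omega>))\<^sup>2) \<partial>M) \<le> (\<integral>\<^sup>+\<omega>. ennreal (t - s) * (\<integral>\<^sup>+u. ennreal ((f \<omega> u)\<^sup>2) \<partial>lborel) \<partial>M)"
    using p by (rule nn_integral_mono)
  also have "\<dots> = ennreal (t - s) * (\<integral>\<^sup>+\<omega>. \<integral>\<^sup>+u. ennreal ((f \<omega> u)\<^sup>2) \<partial>lborel \<partial>M)"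
    using lborel.borel_measurable_nn_integral_fst[OF m2] by (intro nn_integral_cmult) simp
  also have "(\<integral>\<^sup>+\<omega>. \<integral>\<^sup>+u. ennreal ((f \<omega> u)\<^sup>2) \<partial>lborel \<partial>M) = (\<integral>\<^sup>+u. \<integral>\<^sup>+\<omega>. ennreal ((f \<omega> u)\<^sup>2) \<partial>M \<partial>lborel)"
    using P.Fubini[OF m2] by simp
  also have "\<dots> \<le> (\<integral>\<^sup>+u. ennreal c * indicator {s<..t} u \<partial>lborel)"
  proof (rule nn_integral_mono)
    fix u :: real
    show "(\<integral>\<^sup>+\<omega>. ennreal ((f \<omega> u)\<^sup>2) \<partial>M) \<le> ennreal c * indicator {s<..t} u"
    proof (cases "s < u \<and> u \<le> t")
      case True
      then have "integrable M (\<lambda>\<omega>. (f \<omega> u)\<^sup>2)" "expectation (\<lambda>\<omega>. (f \<omega> u)\<^sup>2) \<le> c" using c[of u] sq_int_square by auto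
      then show ?thesis using True by (simp add: nn_integral_eq_integral ennreal_leI)
    next
      case False
      then have "(\<integral>\<^sup>+\<omega>. ennreal ((f \<omega> u)\<^sup>2) \<partial>M) = (\<integral>\<^sup>+\<omega>. 0 \<partial>M)" using z by (intro nn_integral_cong) simp
      then show ?thesis by simp
    qed
  qed
  also have "\<dots> = ennreal (c * (t - s))" using st c0 by (simp add: nn_integral_cmult_indicator ennreal_mult')
  also have "ennreal (t - s) * ennreal (c * (t - s)) = ennreal ((t - s)\<^sup>2 * c)"
    using st c0 by (simp add: ennreal_mult[symmetric] power2_eq_square mult.commute mult.left_commute)
  finally have *: "(\<integral>\<^sup>+\<omega>. ennreal ((integral\<^sup>L lborel (f \<omega>))\<^sup>2) \<partial>M) \<le> ennreal ((t - s)\<^sup>2 * c)"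
    by (simp add: mult_left_mono)
  have i: "integrable M (\<lambda>\<omega>. (integral\<^sup>L lborel (f \<omega>))\<^sup>2)"
    using im * by (intro integrableI_bounded) (auto intro: le_less_trans)
  then show "sq_int (\<lambda>\<omega>. integral\<^sup>L lborel (f \<omega>))" using im by (simp add: sq_int_def)
  show "expectation (\<lambda>\<omega>. (integral\<^sup>L lborel (f \<omega>))\<^sup>2) \<le> (t - s)\<^sup>2 * c"
    using * c0 by (simp add: nn_integral_eq_integral[OF i])
qed

end

text \<open>The features of the equation on which the method rests: a decreasing Lipschitz drift and
  a bounded diffusion coefficient that is Hoelder of exponent 1/2, written as a square in
  \<open>\<tau>_holder\<close>. One constant G serves for all bounds.\<close>

locale monotone_sde = wiener_space M F W
  for M :: "'a measure" and F :: "real \<Rightarrow> 'a measure" and W :: "real \<Rightarrow> 'a \<Rightarrow> real" +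
  fixes \<mu> \<tau> :: "real \<Rightarrow> real" and G x\<^sub>0 :: real
  assumes \<mu>_antimono: "x \<le> y \<Longrightarrow> \<mu> y \<le> \<mu> x"
    and \<mu>_lipschitz: "\<bar>\<mu> x - \<mu> y\<bar> \<le> G * \<bar>x - y\<bar>"
    and \<mu>_zero: "\<bar>\<mu> 0\<bar> \<le> G"
    and \<tau>_holder: "(\<tau> x - \<tau> y)\<^sup>2 \<le> G * \<bar>x - y\<bar>"
    and \<tau>_bounded: "\<bar>\<tau> x\<bar> \<le> G"
    and G_ge_1: "1 \<le> G"
begin

lemma \<mu>_continuous: "continuous_on A \<mu>"
proof (rule continuous_on_subset[of UNIV], unfold continuous_on_iff, intro ballI allI impI)
  fix x e :: real assume "0 < e"
  have "dist (\<mu> y) (\<mu> x) < e" if "dist y x < e / G" for y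
  proof -
    have "\<bar>\<mu> y - \<mu> x\<bar> \<le> G * \<bar>y - x\<bar>" by (rule \<mu>_lipschitz)
    also have "\<dots> < e" using that G_ge_1 by (simp add: dist_real_def field_simps)
    finally show ?thesis by (simp add: dist_real_def)
  qed
  then show "\<exists>d>0. \<forall>y\<in>UNIV. dist y x < d \<longrightarrow> dist (\<mu> y) (\<mu> x) < e"
    using \<open>0 < e\<close> G_ge_1 by (intro exI[of _ "e / G"]) auto
qed simp

lemma \<tau>_continuous: "continuous_on A \<tau>"
proof (rule continuous_on_subset[of UNIV], unfold continuous_on_iff, intro ballI allI impI)
  fix x e :: real assume e: "0 < e"
  have "dist (\<tau> y) (\<tau> x) < e" if "dist y x < e\<^sup>2 / G" for y
  proof -
    have "(\<tau> y - \<tau> x)\<^sup>2 \<le> G * \<bar>y - x\<bar>" by (rule \<tau>_holder)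
    also have "\<dots> < e\<^sup>2" using that G_ge_1 by (simp add: dist_real_def field_simps)
    finally have "\<bar>\<tau> y - \<tau> x\<bar>\<^sup>2 < e\<^sup>2" by simp
    then have "\<bar>\<tau> y - \<tau> x\<bar> < e" using e by (rule power2_less_imp_less[OF _ less_imp_le])
    then show ?thesis using e by (simp add: dist_real_def)
  qed
  then show "\<exists>d>0. \<forall>y\<in>UNIV. dist y x < d \<longrightarrow> dist (\<tau> y) (\<tau> x) < e"
    using e G_ge_1 by (intro exI[of _ "e\<^sup>2 / G"]) auto
qed simp

lemma \<mu>_measurable [measurable]: "\<mu> \<in> borel_measurable borel"
  and \<tau>_measurable [measurable]: "\<tau> \<in> borel_measurable borel"
  using \<mu>_continuous \<tau>_continuous by (auto intro: borel_measurable_continuous_onI)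

lemma \<mu>_square_le: "(\<mu> x)\<^sup>2 \<le> 2 * G\<^sup>2 * (1 + x\<^sup>2)"
proof -
  have "\<bar>\<mu> x\<bar> \<le> G + G * \<bar>x\<bar>" using \<mu>_lipschitz[of x 0] \<mu>_zero by simp
  then have "\<bar>\<mu> x\<bar>\<^sup>2 \<le> (G * (1 + \<bar>x\<bar>))\<^sup>2" by (intro power_mono) (auto simp: algebra_simps)
  also have "\<dots> \<le> G\<^sup>2 * (2 * (1 + x\<^sup>2))"
    unfolding power_mult_distrib using zero_le_power2[of "1 - \<bar>x\<bar>"]
    by (intro mult_left_mono) (auto simp: power2_sum power2_diff)
  finally show ?thesis by (simp add: algebra_simps)
qed

lemma \<mu>_sq_int:
  assumes "sq_int f" shows "sq_int (\<lambda>\<omega>. \<mu> (f \<omega>))" "expectation (\<lambda>\<omega>. (\<mu> (f \<omega>))\<^sup>2) \<le> 2 * G\<^sup>2 * (1 + expectation (\<lambda>\<omega>. (f \<omega>)\<^sup>2))"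
proof -
  have i: "integrable M (\<lambda>\<omega>. 2 * G\<^sup>2 * (1 + (f \<omega>)\<^sup>2))" using sq_int_square[OF assms] by simp
  have m: "(\<lambda>\<omega>. \<mu> (f \<omega>)) \<in> borel_measurable M" using sq_int_measurable[OF assms] by measurable
  have i2: "integrable M (\<lambda>\<omega>. (\<mu> (f \<omega>))\<^sup>2)"
    using m \<mu>_square_le by (intro Bochner_Integration.integrable_bound[OF i]) (auto intro: order_trans[OF _ abs_ge_self])
  show "sq_int (\<lambda>\<omega>. \<mu> (f \<omega>))" using i2 m by (simp add: sq_int_def)
  have "expectation (\<lambda>\<omega>. (\<mu> (f \<omega>))\<^sup>2) \<le> expectation (\<lambda>\<omega>. 2 * G\<^sup>2 * (1 + (f \<omega>)\<^sup>2))"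
    by (rule integral_mono[OF i2 i \<mu>_square_le])
  then show "expectation (\<lambda>\<omega>. (\<mu> (f \<omega>))\<^sup>2) \<le> 2 * G\<^sup>2 * (1 + expectation (\<lambda>\<omega>. (f \<omega>)\<^sup>2))"
    using sq_int_square[OF assms] by (simp add: prob_space)
qed

lemma \<tau>_sq_int: "f \<in> borel_measurable M \<Longrightarrow> sq_int (\<lambda>\<omega>. \<tau> (f \<omega>))"
  using \<tau>_bounded by (intro sq_int_bdd[of _ G]) auto

text \<open>One cell, pathwise: y moves by a drift a and a noise d, while x makes an Euler step with
  increment w. The linear term in \<open>d - \<tau> x * w\<close> will have mean zero and
  \<open>G * \<delta> * w\<^sup>2\<close> is the term of order h. Young's inequality with weights
  \<open>h * r\<close> and r, where r will be \<open>sqrt h\<close>, turns all other products into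
  powers with means of order \<open>h * sqrt h\<close>.\<close>

lemma yamada_pointwise:
  assumes y: "yamada_function \<delta> Q L \<phi> \<phi>1 \<phi>2" and h: "0 < h" and r: "0 < r"
  shows "\<phi> ((y + a + d) - (x + \<mu> x * h + \<tau> x * w)) \<le> \<phi> (y - x) + \<phi>1 (y - x) * (d - \<tau> x * w) + G * \<delta> * w\<^sup>2
     + Q * (d - \<tau> y * w)\<^sup>2 + Q * (h * r * (y - x)\<^sup>2 + (a - \<mu> y * h)\<^sup>2 / (h * r)) / 2
     + L * (r * (d - \<tau> x * w)\<^sup>2 + (d - \<tau> x * w) ^ 4 / r) / 2
     + Q * ((a - \<mu> x * h)\<^sup>2 / r + r * (d - \<tau> x * w)\<^sup>2) / 2 + Q * (a - \<mu> x * h)\<^sup>2"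
proof -
  define z where "z = y - x"
  define A where "A = a - \<mu> x * h"
  define D where "D = d - \<tau> x * w"
  have Q: "0 \<le> Q" "0 \<le> L" and \<phi>2: "0 \<le> \<phi>2 z" "\<phi>2 z \<le> Q" "\<phi>2 z * \<bar>z\<bar> \<le> \<delta>"
    using y by (auto simp: yamada_function_def)
  have amgm: "2 * (u * v) \<le> k * u\<^sup>2 + v\<^sup>2 / k" if "0 < k" for u v k :: real
  proof -
    have "2 * (sqrt k * u) * (v / sqrt k) \<le> (sqrt k * u)\<^sup>2 + (v / sqrt k)\<^sup>2" by (rule sum_squares_bound)
    then show ?thesis using that by (simp add: power_mult_distrib power_divide)
  qed
  have t: "\<phi> (z + A + D) \<le> \<phi> z + \<phi>1 z * A + \<phi>1 z * D + \<phi>2 z * D\<^sup>2 / 2 + L * \<bar>D\<bar> ^ 3 + Q * (\<bar>A\<bar> * \<bar>D\<bar> + A\<^sup>2)"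
    by (rule yamada_taylor[OF y])
  have 1: "\<phi>1 z * A \<le> Q * (h * r * z\<^sup>2 + (a - \<mu> y * h)\<^sup>2 / (h * r)) / 2"
  proof -
    \<comment> \<open>\<open>\<phi>1 z\<close> has the sign of \<open>y - x\<close>, while a
      decreasing drift gives \<open>\<mu> y - \<mu> x\<close> the opposite sign.\<close>
    have s: "\<phi>1 z * (\<mu> y - \<mu> x) \<le> 0"
    proof (cases z "0::real" rule: linorder_cases)
      case less
      then have "\<phi>1 z \<le> 0" using yamada_first_derivative(3)[OF y, of z] by (simp add: zero_le_mult_iff)
      moreover have "\<mu> x \<le> \<mu> y" using \<mu>_antimono[of y x] less by (simp add: z_def)
      ultimately show ?thesis by (simp add: mult_nonpos_nonneg)
    next
      case greater
      then have "0 \<le> \<phi>1 z" using yamada_first_derivative(3)[OF y, of z] by (simp add: zero_le_mult_iff)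
      moreover have "\<mu> y \<le> \<mu> x" using \<mu>_antimono[of x y] greater by (simp add: z_def)
      ultimately show ?thesis by (simp add: mult_nonneg_nonpos)
    qed (use y in \<open>simp add: yamada_function_def\<close>)
    have "\<phi>1 z * A = \<phi>1 z * (\<mu> y - \<mu> x) * h + \<phi>1 z * (a - \<mu> y * h)" by (simp add: A_def algebra_simps)
    also have "\<dots> \<le> 0 + \<bar>\<phi>1 z\<bar> * \<bar>a - \<mu> y * h\<bar>"
    proof (rule add_mono)
      show "\<phi>1 z * (\<mu> y - \<mu> x) * h \<le> 0" using s h by (simp add: mult_nonpos_nonneg)
      show "\<phi>1 z * (a - \<mu> y * h) \<le> \<bar>\<phi>1 z\<bar> * \<bar>a - \<mu> y * h\<bar>" by (simp add: abs_mult[symmetric])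
    qed
    also have "\<dots> \<le> (Q * \<bar>z\<bar>) * \<bar>a - \<mu> y * h\<bar>"
      using yamada_first_derivative(2)[OF y, of z] by (simp add: mult_right_mono)
    also have "\<dots> = Q * (2 * (\<bar>z\<bar> * \<bar>a - \<mu> y * h\<bar>)) / 2" by simp
    also have "\<dots> \<le> Q * (h * r * z\<^sup>2 + (a - \<mu> y * h)\<^sup>2 / (h * r)) / 2"
      using amgm[of "h * r" "\<bar>z\<bar>" "\<bar>a - \<mu> y * h\<bar>"] h r Q by (intro divide_right_mono mult_left_mono) auto
    finally show ?thesis .
  qed
  \<comment> \<open>The squared difference of the diffusion coefficients is at most
    \<open>G * \<bar>z\<bar>\<close>, which the factor \<open>\<phi>2 z\<close> reduces to
    \<open>G * \<delta>\<close>; what remains is the residual of d against the coefficient at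
    y.\<close>
  have 2: "\<phi>2 z * D\<^sup>2 / 2 \<le> G * \<delta> * w\<^sup>2 + Q * (d - \<tau> y * w)\<^sup>2"
  proof -
    define R where "R = d - \<tau> y * w"
    have D: "D = (\<tau> y - \<tau> x) * w + R" by (simp add: D_def R_def algebra_simps)
    have "D\<^sup>2 \<le> 2 * ((\<tau> y - \<tau> x)\<^sup>2 * w\<^sup>2) + 2 * R\<^sup>2"
      using zero_le_power2[of "(\<tau> y - \<tau> x) * w - R"] unfolding D power_mult_distrib[symmetric]
      by (simp add: power2_sum power2_diff)
    then have "\<phi>2 z * D\<^sup>2 / 2 \<le> \<phi>2 z * (2 * ((\<tau> y - \<tau> x)\<^sup>2 * w\<^sup>2) + 2 * R\<^sup>2) / 2"
      using \<phi>2 by (intro divide_right_mono mult_left_mono) auto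
    also have "\<dots> = \<phi>2 z * (\<tau> y - \<tau> x)\<^sup>2 * w\<^sup>2 + \<phi>2 z * R\<^sup>2" by (simp add: algebra_simps)
    also have "\<dots> \<le> G * \<delta> * w\<^sup>2 + Q * R\<^sup>2"
    proof (intro add_mono mult_right_mono)
      have "\<phi>2 z * (\<tau> y - \<tau> x)\<^sup>2 \<le> \<phi>2 z * (G * \<bar>z\<bar>)"
        using \<tau>_holder[of y x] \<phi>2 by (intro mult_left_mono) (auto simp: z_def)
      also have "\<dots> \<le> G * \<delta>" using \<phi>2(3) G_ge_1 mult_left_mono[of "\<phi>2 z * \<bar>z\<bar>" \<delta> G] by (simp add: mult.left_commute)
      finally show "\<phi>2 z * (\<tau> y - \<tau> x)\<^sup>2 \<le> G * \<delta>" .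
    qed (use \<phi>2 in auto)
    finally show ?thesis by (simp add: R_def)
  qed
  have 3: "L * \<bar>D\<bar> ^ 3 \<le> L * (r * D\<^sup>2 + D ^ 4 / r) / 2"
  proof -
    have "2 * (\<bar>D\<bar> * D\<^sup>2) \<le> r * \<bar>D\<bar>\<^sup>2 + (D\<^sup>2)\<^sup>2 / r" using r by (rule amgm)
    moreover have "\<bar>D\<bar> * D\<^sup>2 = \<bar>D\<bar> ^ 3" by (simp add: power3_eq_cube power2_eq_square)
    ultimately have "2 * \<bar>D\<bar> ^ 3 \<le> r * D\<^sup>2 + D ^ 4 / r" by simp
    from mult_left_mono[OF this Q(2)] show ?thesis by simp
  qed
  have 4: "Q * (\<bar>A\<bar> * \<bar>D\<bar> + A\<^sup>2) \<le> Q * (A\<^sup>2 / r + r * D\<^sup>2) / 2 + Q * A\<^sup>2"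
  proof -
    have "2 * (\<bar>D\<bar> * \<bar>A\<bar>) \<le> r * \<bar>D\<bar>\<^sup>2 + \<bar>A\<bar>\<^sup>2 / r" using r by (rule amgm)
    then have "\<bar>A\<bar> * \<bar>D\<bar> + A\<^sup>2 \<le> (A\<^sup>2 / r + r * D\<^sup>2) / 2 + A\<^sup>2" by (simp add: mult.commute)
    from mult_left_mono[OF this Q(1)] show ?thesis by (simp add: distrib_left)
  qed
  have e: "(y + a + d) - (x + \<mu> x * h + \<tau> x * w) = z + A + D" by (simp add: z_def A_def D_def)
  show ?thesis unfolding e using t 1 2 3 4 unfolding z_def[symmetric] D_def[symmetric] A_def[symmetric] by linarith
qed

end

context prob_space
begin

lemma expectation_sq_diff_le:
  assumes "sq_int f" "sq_int g"
  shows "expectation (\<lambda>\<omega>. (f \<omega> - g \<omega>)\<^sup>2) \<le>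
    2 * expectation (\<lambda>\<omega>. (f \<omega>)\<^sup>2) + 2 * expectation (\<lambda>\<omega>. (g \<omega>)\<^sup>2)"
  using expectation_sq_add_le[OF assms(1) sq_int_uminus[OF assms(2)]] by simp

end

section \<open>Expected growth of the distance over one cell\<close>

context monotone_sde
begin

text \<open>The coefficient of \<open>h * sqrt h\<close> in \<open>one_step\<close>, with its
  summands in the order of the error terms of \<open>yamada_pointwise\<close>.\<close>

definition step_const :: "real \<Rightarrow> real \<Rightarrow> real \<Rightarrow> real" where
  "step_const K Q L = Q * K + Q * (5 * K) / 2 + L * ((2 * K + 2 * G\<^sup>2) + (8 * K + 24 * G ^ 4)) / 2 +
    Q * ((2 * K + 4 * G\<^sup>2 * (1 + K)) + (2 * K + 2 * G\<^sup>2)) / 2 + Q * (2 * K + 4 * G\<^sup>2 * (1 + K))"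

lemma yamada_measurable:
  assumes y: "yamada_function \<delta> Q L \<phi> \<phi>1 \<phi>2"
  shows "\<phi> \<in> borel_measurable borel" "\<phi>1 \<in> borel_measurable borel"
proof -
  have d: "\<And>x. (\<phi> has_real_derivative \<phi>1 x) (at x)" "\<And>x. (\<phi>1 has_real_derivative \<phi>2 x) (at x)"
    using y by (auto simp: yamada_function_def)
  show "\<phi> \<in> borel_measurable borel"
    by (intro borel_measurable_continuous_onI continuous_at_imp_continuous_on ballI DERIV_isCont[OF d(1)])
  show "\<phi>1 \<in> borel_measurable borel"
    by (intro borel_measurable_continuous_onI continuous_at_imp_continuous_on ballI DERIV_isCont[OF d(2)])
qed

lemma yamada_sq_int:
  assumes y: "yamada_function \<delta> Q L \<phi> \<phi>1 \<phi>2" and f: "sq_int f"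
  shows "integrable M (\<lambda>\<omega>. \<phi> (f \<omega>))" "sq_int (\<lambda>\<omega>. \<phi>1 (f \<omega>))"
proof -
  have Q: "0 \<le> Q" using y by (simp add: yamada_function_def)
  note m = yamada_measurable[OF y]
  note fm = sq_int_measurable[OF f]
  have i: "integrable M (\<lambda>\<omega>. Q * (f \<omega>)\<^sup>2)" using sq_int_square[OF f] by simp
  show "integrable M (\<lambda>\<omega>. \<phi> (f \<omega>))"
  proof (rule Bochner_Integration.integrable_bound[OF i measurable_compose[OF fm m(1)]], intro AE_I2)
    show "norm (\<phi> (f \<omega>)) \<le> norm (Q * (f \<omega>)\<^sup>2)" for \<omega>
      using yamada_bounds[OF y, of "f \<omega>"] by simp
  qed
  show "sq_int (\<lambda>\<omega>. \<phi>1 (f \<omega>))"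
  proof (rule sq_int_le[OF sq_int_cmult[OF f, of Q] measurable_compose[OF fm m(2)]])
    show "\<bar>\<phi>1 (f \<omega>)\<bar> \<le> \<bar>Q * f \<omega>\<bar>" for \<omega>
      using yamada_first_derivative(2)[OF y, of "f \<omega>"] Q by (simp add: abs_mult)
  qed
qed

text \<open>The expectation of \<open>yamada_pointwise\<close> with r = \<open>sqrt h\<close>. The
  hypotheses on a and d are the moments typical of a cell of length h: drift of size h, noise of
  size \<open>sqrt h\<close>, and residuals smaller than these by h^(1/2) for the drift and by
  h^(1/4) for the noise.\<close>

lemma one_step:
  assumes ya: "yamada_function \<delta> Q L \<phi> \<phi>1 \<phi>2" and s: "0 \<le> s" and h: "0 < h" "h \<le> 1"
    and x: "x \<in> borel_measurable (F s)" "sq_int x" "expectation (\<lambda>\<omega>. (x \<omega>)\<^sup>2) \<le> K"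
    and y: "y \<in> borel_measurable (F s)" "sq_int y" "expectation (\<lambda>\<omega>. (y \<omega>)\<^sup>2) \<le> K"
    and a: "sq_int a" "expectation (\<lambda>\<omega>. (a \<omega>)\<^sup>2) \<le> K * h\<^sup>2" "expectation (\<lambda>\<omega>. (a \<omega> - \<mu> (y \<omega>) * h)\<^sup>2) \<le> K * h ^ 3"
    and d: "sq_int d" "expectation (\<lambda>\<omega>. (d \<omega>)\<^sup>2) \<le> K * h" "integrable M (\<lambda>\<omega>. d \<omega> ^ 4)" "expectation (\<lambda>\<omega>. d \<omega> ^ 4) \<le> K * h\<^sup>2"
    and mean: "\<And>\<xi>. \<xi> \<in> borel_measurable (F s) \<Longrightarrow> sq_int \<xi> \<Longrightarrow> expectation (\<lambda>\<omega>. \<xi> \<omega> * d \<omega>) = 0"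
    and res: "expectation (\<lambda>\<omega>. (d \<omega> - \<tau> (y \<omega>) * (W (s + h) \<omega> - W s \<omega>))\<^sup>2) \<le> K * (h * sqrt h)"
    and y': "y' \<in> borel_measurable M" "AE \<omega> in M. y' \<omega> = y \<omega> + a \<omega> + d \<omega>"
    and x': "\<And>\<omega>. x' \<omega> = x \<omega> + \<mu> (x \<omega>) * h + \<tau> (x \<omega>) * (W (s + h) \<omega> - W s \<omega>)"
  shows "expectation (\<lambda>\<omega>. \<phi> (y' \<omega> - x' \<omega>)) \<le> expectation (\<lambda>\<omega>. \<phi> (y \<omega> - x \<omega>)) + G * \<delta> * h + step_const K Q L * (h * sqrt h)"
proof -
  define r where "r = sqrt h"
  have r: "0 < r" and rr: "r * r = h" using h by (auto simp: r_def)
  \<comment> \<open>Here \<open>h \<le> 1\<close> enters: squares of the drift are absorbed into the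
    order \<open>h * sqrt h\<close>.\<close>
  have hr: "h\<^sup>2 \<le> h * r"
  proof -
    have "r \<le> 1" using h by (simp add: r_def)
    then have "h \<le> r" using mult_right_mono[of r 1 r] r by (simp add: rr)
    then show ?thesis using h by (simp add: power2_eq_square)
  qed
  have QL: "0 \<le> Q" "0 \<le> L" using ya by (auto simp: yamada_function_def)
  let ?w = "\<lambda>\<omega>. W (s + h) \<omega> - W s \<omega>"
  let ?z = "\<lambda>\<omega>. y \<omega> - x \<omega>" and ?D = "\<lambda>\<omega>. d \<omega> - \<tau> (x \<omega>) * ?w \<omega>" and ?R = "\<lambda>\<omega>. d \<omega> - \<tau> (y \<omega>) * ?w \<omega>"
    and ?A = "\<lambda>\<omega>. a \<omega> - \<mu> (x \<omega>) * h" and ?RA = "\<lambda>\<omega>. a \<omega> - \<mu> (y \<omega>) * h"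
  have sh: "s \<le> s + h" using h by simp
  note Wm = W_mult_expectation[OF s sh] and Wi = W_mult_integrable[OF s sh]
  have \<tau>F: "(\<lambda>\<omega>. \<tau> (f \<omega>)) \<in> borel_measurable (F s)" if "f \<in> borel_measurable (F s)" for f
    using measurable_compose[OF that \<tau>_measurable] .
  have xm: "x \<in> borel_measurable M" "y \<in> borel_measurable M" using F_measurable x(1) y(1) s by auto
  have \<tau>w: "sq_int (\<lambda>\<omega>. \<tau> (f \<omega>) * ?w \<omega>)" if "f \<in> borel_measurable (F s)" for f
    using W_mult_sq_int[OF s sh \<tau>F[OF that] \<tau>_sq_int[OF F_measurable[OF that s]]] .
  have zs: "sq_int ?z" by (rule sq_int_diff[OF y(2) x(2)])
  have Ds: "sq_int ?D" by (rule sq_int_diff[OF d(1) \<tau>w[OF x(1)]])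
  have Rs: "sq_int ?R" by (rule sq_int_diff[OF d(1) \<tau>w[OF y(1)]])
  have \<mu>s: "sq_int (\<lambda>\<omega>. \<mu> (f \<omega>) * h)" if "sq_int f" for f
    using sq_int_cmult[OF \<mu>_sq_int(1)[OF that], of h] by (simp add: mult.commute)
  have As: "sq_int ?A" by (rule sq_int_diff[OF a(1) \<mu>s[OF x(2)]])
  have RAs: "sq_int ?RA" by (rule sq_int_diff[OF a(1) \<mu>s[OF y(2)]])
  have one: "(\<lambda>_. 1) \<in> borel_measurable (F s)" "integrable M (\<lambda>_. 1 :: real)" by auto
  have w2: "integrable M (\<lambda>\<omega>. (?w \<omega>)\<^sup>2)" "expectation (\<lambda>\<omega>. (?w \<omega>)\<^sup>2) = h"
    "integrable M (\<lambda>\<omega>. (?w \<omega>) ^ 4)" "expectation (\<lambda>\<omega>. (?w \<omega>) ^ 4) = 3 * h\<^sup>2"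
    using Wi[OF one, of 2] Wm(2)[OF one] Wi[OF one, of 4] Wm(4)[OF one] by (auto simp: prob_space)
  have e1: "expectation (\<lambda>\<omega>. (?z \<omega>)\<^sup>2) \<le> 4 * K"
    using expectation_sq_add_le[OF y(2) sq_int_uminus[OF x(2)]] x(3) y(3) by simp
  have e4: "expectation (\<lambda>\<omega>. (?D \<omega>)\<^sup>2) \<le> (2 * K + 2 * G\<^sup>2) * h"
  proof -
    have "expectation (\<lambda>\<omega>. (\<tau> (x \<omega>) * ?w \<omega>)\<^sup>2) \<le> expectation (\<lambda>\<omega>. G\<^sup>2 * (?w \<omega>)\<^sup>2)"
    proof (rule integral_mono)
      show "(\<tau> (x \<omega>) * ?w \<omega>)\<^sup>2 \<le> G\<^sup>2 * (?w \<omega>)\<^sup>2" for \<omega>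
        using power_mono[OF \<tau>_bounded[of "x \<omega>"], of 2] by (simp add: power_mult_distrib mult_right_mono)
    qed (use sq_int_square[OF \<tau>w[OF x(1)]] w2 in auto)
    then have "expectation (\<lambda>\<omega>. (\<tau> (x \<omega>) * ?w \<omega>)\<^sup>2) \<le> G\<^sup>2 * h" by (simp add: w2)
    moreover have "(2 * K + 2 * G\<^sup>2) * h = 2 * (K * h) + 2 * (G\<^sup>2 * h)" by (simp add: algebra_simps)
    ultimately show ?thesis using expectation_sq_diff_le[OF d(1) \<tau>w[OF x(1)]] d(2) by linarith
  qed
  have q4: "(u - v) ^ 4 \<le> 8 * u ^ 4 + 8 * v ^ 4" for u v :: real
  proof -
    have a: "(p + q)\<^sup>2 \<le> 2 * p\<^sup>2 + 2 * q\<^sup>2" for p q :: real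
      using zero_le_power2[of "p - q"] by (simp add: power2_sum power2_diff)
    have "(u - v)\<^sup>2 \<le> 2 * u\<^sup>2 + 2 * v\<^sup>2" using a[of u "- v"] by simp
    then have "((u - v)\<^sup>2)\<^sup>2 \<le> (2 * u\<^sup>2 + 2 * v\<^sup>2)\<^sup>2" by (intro power_mono) auto
    also have "\<dots> \<le> 2 * (2 * u\<^sup>2)\<^sup>2 + 2 * (2 * v\<^sup>2)\<^sup>2" by (rule a)
    finally show ?thesis by (simp add: power_mult_distrib)
  qed
  have D4: "integrable M (\<lambda>\<omega>. (?D \<omega>) ^ 4)" and e5: "expectation (\<lambda>\<omega>. (?D \<omega>) ^ 4) \<le> (8 * K + 24 * G ^ 4) * h\<^sup>2"
  proof -
    have le: "(?D \<omega>) ^ 4 \<le> 8 * d \<omega> ^ 4 + 8 * G ^ 4 * (?w \<omega>) ^ 4" for \<omega>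
    proof -
      have "(\<tau> (x \<omega>) * ?w \<omega>) ^ 4 \<le> G ^ 4 * (?w \<omega>) ^ 4"
        using power_mono[OF \<tau>_bounded[of "x \<omega>"], of 4] by (simp add: power_mult_distrib mult_right_mono)
      then show ?thesis using q4[of "d \<omega>" "\<tau> (x \<omega>) * ?w \<omega>"] by linarith
    qed
    have i: "integrable M (\<lambda>\<omega>. 8 * d \<omega> ^ 4 + 8 * G ^ 4 * (?w \<omega>) ^ 4)" using d w2 by simp
    show i2: "integrable M (\<lambda>\<omega>. (?D \<omega>) ^ 4)"
      using sq_int_measurable[OF Ds] le
      by (intro Bochner_Integration.integrable_bound[OF i]) (auto intro: order_trans[OF _ abs_ge_self] intro!: borel_measurable_power)
    have "expectation (\<lambda>\<omega>. (?D \<omega>) ^ 4) \<le> expectation (\<lambda>\<omega>. 8 * d \<omega> ^ 4 + 8 * G ^ 4 * (?w \<omega>) ^ 4)"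
      by (rule integral_mono[OF i2 i le])
    also have "\<dots> = 8 * expectation (\<lambda>\<omega>. d \<omega> ^ 4) + 8 * G ^ 4 * (3 * h\<^sup>2)" using d w2 by simp
    finally show "expectation (\<lambda>\<omega>. (?D \<omega>) ^ 4) \<le> (8 * K + 24 * G ^ 4) * h\<^sup>2" using d(4) by (simp add: algebra_simps)
  qed
  have e6: "expectation (\<lambda>\<omega>. (?A \<omega>)\<^sup>2) \<le> (2 * K + 4 * G\<^sup>2 * (1 + K)) * h\<^sup>2"
  proof -
    have "expectation (\<lambda>\<omega>. (\<mu> (x \<omega>) * h)\<^sup>2) = expectation (\<lambda>\<omega>. (\<mu> (x \<omega>))\<^sup>2) * h\<^sup>2" by (simp add: power_mult_distrib)
    also have "\<dots> \<le> (2 * G\<^sup>2 * (1 + K)) * h\<^sup>2"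
      using order_trans[OF \<mu>_sq_int(2)[OF x(2)]] x(3) by (intro mult_right_mono) (auto simp: mult_left_mono)
    finally show ?thesis using expectation_sq_add_le[OF a(1) sq_int_uminus[OF \<mu>s[OF x(2)]]] a(2) by (simp add: algebra_simps)
  qed
  have \<phi>s: "sq_int (\<lambda>\<omega>. \<phi>1 (?z \<omega>))" and \<phi>i: "integrable M (\<lambda>\<omega>. \<phi> (?z \<omega>))" using yamada_sq_int[OF ya zs] by auto
  have \<phi>F: "(\<lambda>\<omega>. \<phi>1 (?z \<omega>)) \<in> borel_measurable (F s)"
  proof -
    from measurable_compose[OF borel_measurable_diff[OF y(1) x(1)] yamada_measurable(2)[OF ya]] show ?thesis .
  qed
  \<comment> \<open>The factor \<phi>1 is known at time s, so both the noise d and the Euler noise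
    are orthogonal to it.\<close>
  have e7: "integrable M (\<lambda>\<omega>. \<phi>1 (?z \<omega>) * ?D \<omega>)" "expectation (\<lambda>\<omega>. \<phi>1 (?z \<omega>) * ?D \<omega>) = 0"
  proof -
    show "integrable M (\<lambda>\<omega>. \<phi>1 (?z \<omega>) * ?D \<omega>)" by (rule sq_int_mult_integrable[OF \<phi>s Ds])
    have f: "(\<lambda>\<omega>. \<phi>1 (?z \<omega>) * \<tau> (x \<omega>)) \<in> borel_measurable (F s)" "integrable M (\<lambda>\<omega>. \<phi>1 (?z \<omega>) * \<tau> (x \<omega>))"
      using borel_measurable_times[OF \<phi>F \<tau>F[OF x(1)]] sq_int_mult_integrable[OF \<phi>s \<tau>_sq_int[OF xm(1)]] by auto
    have "expectation (\<lambda>\<omega>. \<phi>1 (?z \<omega>) * ?D \<omega>) = expectation (\<lambda>\<omega>. \<phi>1 (?z \<omega>) * d \<omega> - \<phi>1 (?z \<omega>) * \<tau> (x \<omega>) * ?w \<omega>)"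
      by (simp add: algebra_simps)
    also have "\<dots> = expectation (\<lambda>\<omega>. \<phi>1 (?z \<omega>) * d \<omega>) - expectation (\<lambda>\<omega>. \<phi>1 (?z \<omega>) * \<tau> (x \<omega>) * ?w \<omega>)"
      using sq_int_mult_integrable[OF \<phi>s d(1)] Wi[OF f, of 1] by simp
    also have "\<dots> = 0" using mean[OF \<phi>F \<phi>s] Wm(1)[OF f] by simp
    finally show "expectation (\<lambda>\<omega>. \<phi>1 (?z \<omega>) * ?D \<omega>) = 0" .
  qed
  note i = \<phi>i e7(1) w2(1) sq_int_square[OF Rs] sq_int_square[OF zs] sq_int_square[OF RAs] sq_int_square[OF Ds] D4 sq_int_square[OF As]
  let ?rhs = "\<lambda>\<omega>. \<phi> (?z \<omega>) + \<phi>1 (?z \<omega>) * ?D \<omega> + G * \<delta> * (?w \<omega>)\<^sup>2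
     + Q * (?R \<omega>)\<^sup>2 + Q * (h * r * (?z \<omega>)\<^sup>2 + (?RA \<omega>)\<^sup>2 / (h * r)) / 2
     + L * (r * (?D \<omega>)\<^sup>2 + (?D \<omega>) ^ 4 / r) / 2
     + Q * ((?A \<omega>)\<^sup>2 / r + r * (?D \<omega>)\<^sup>2) / 2 + Q * (?A \<omega>)\<^sup>2"
  have ir: "integrable M ?rhs" using i by simp
  have "expectation (\<lambda>\<omega>. \<phi> (y' \<omega> - x' \<omega>)) = expectation (\<lambda>\<omega>. \<phi> ((y \<omega> + a \<omega> + d \<omega>) - x' \<omega>))"
  proof (rule integral_cong_AE)
    note m = yamada_measurable(1)[OF ya]
    have xm': "x' \<in> borel_measurable M"
      using sq_int_measurable[OF sq_int_add[OF sq_int_add[OF x(2) \<mu>s[OF x(2)]] \<tau>w[OF x(1)]]]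
      by (simp add: x'[abs_def])
    show "(\<lambda>\<omega>. \<phi> (y' \<omega> - x' \<omega>)) \<in> borel_measurable M"
      by (rule measurable_compose[OF borel_measurable_diff[OF y'(1) xm'] m])
    show "(\<lambda>\<omega>. \<phi> ((y \<omega> + a \<omega> + d \<omega>) - x' \<omega>)) \<in> borel_measurable M"
      by (rule measurable_compose[OF borel_measurable_diff[OF sq_int_measurable[OF sq_int_add[OF sq_int_add[OF y(2) a(1)] d(1)]] xm'] m])
    show "AE \<omega> in M. \<phi> (y' \<omega> - x' \<omega>) = \<phi> ((y \<omega> + a \<omega> + d \<omega>) - x' \<omega>)" using y'(2) by auto
  qed
  also have "\<dots> \<le> expectation ?rhs"
    unfolding x' by (rule integral_mono'[OF ir]) (auto intro!: yamada_pointwise[OF ya h(1) r] order_trans[OF yamada_bounds(1)[OF ya] yamada_pointwise[OF ya h(1) r]])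
  also have "\<dots> = expectation (\<lambda>\<omega>. \<phi> (?z \<omega>)) + 0 + G * \<delta> * h
     + Q * expectation (\<lambda>\<omega>. (?R \<omega>)\<^sup>2) + Q * (h * r * expectation (\<lambda>\<omega>. (?z \<omega>)\<^sup>2) + expectation (\<lambda>\<omega>. (?RA \<omega>)\<^sup>2) / (h * r)) / 2
     + L * (r * expectation (\<lambda>\<omega>. (?D \<omega>)\<^sup>2) + expectation (\<lambda>\<omega>. (?D \<omega>) ^ 4) / r) / 2
     + Q * (expectation (\<lambda>\<omega>. (?A \<omega>)\<^sup>2) / r + r * expectation (\<lambda>\<omega>. (?D \<omega>)\<^sup>2)) / 2 + Q * expectation (\<lambda>\<omega>. (?A \<omega>)\<^sup>2)"
    using i e7 w2(2) by simp
  also have "\<dots> \<le> expectation (\<lambda>\<omega>. \<phi> (?z \<omega>)) + 0 + G * \<delta> * h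
     + Q * (K * (h * r)) + Q * (h * r * (4 * K) + K * h ^ 3 / (h * r)) / 2
     + L * (r * ((2 * K + 2 * G\<^sup>2) * h) + (8 * K + 24 * G ^ 4) * h\<^sup>2 / r) / 2
     + Q * ((2 * K + 4 * G\<^sup>2 * (1 + K)) * h\<^sup>2 / r + r * ((2 * K + 2 * G\<^sup>2) * h)) / 2 + Q * ((2 * K + 4 * G\<^sup>2 * (1 + K)) * (h * r))"
  proof -
    have "0 \<le> K" using x(3) by (rule order_trans[rotated]) (intro integral_nonneg_AE, auto)
    then have "(2 * K + 4 * G\<^sup>2 * (1 + K)) * h\<^sup>2 \<le> (2 * K + 4 * G\<^sup>2 * (1 + K)) * (h * r)"
      using hr by (intro mult_left_mono) auto
    then have e6': "expectation (\<lambda>\<omega>. (?A \<omega>)\<^sup>2) \<le> (2 * K + 4 * G\<^sup>2 * (1 + K)) * (h * r)" using e6 by linarith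
    show ?thesis
      using QL r h e1 a(3) e4 e5 e6 e6' res
      by (intro add_mono mult_left_mono divide_right_mono order_refl) (auto simp: r_def[symmetric])
  qed
  also have "\<dots> = expectation (\<lambda>\<omega>. \<phi> (?z \<omega>)) + G * \<delta> * h + step_const K Q L * (h * r)"
  proof -
    have 1: "c * h\<^sup>2 / r = c * (h * r)" for c using r by (simp add: rr[symmetric] power2_eq_square field_simps)
    have 2: "K * h ^ 3 / (h * r) = K * (h * r)" using r h 1[of K] by (simp add: power2_eq_square power3_eq_cube)
    show ?thesis unfolding 1 2 step_const_def by (simp add: algebra_simps)
  qed
  finally show ?thesis by (simp add: r_def)
qed

section \<open>Euler polygons\<close>

primrec euler :: "nat \<Rightarrow> nat \<Rightarrow> 'a \<Rightarrow> real" where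
  "euler n 0 \<omega> = x\<^sub>0"
| "euler n (Suc k) \<omega> = euler n k \<omega> + \<mu> (euler n k \<omega>) / 2 ^ n +
     \<tau> (euler n k \<omega>) * (W (real (Suc k) / 2 ^ n) \<omega> - W (real k / 2 ^ n) \<omega>)"

lemma euler_step_measurable_F:
  assumes "x \<in> borel_measurable (F s)" "0 \<le> s" "s \<le> t"
  shows "(\<lambda>\<omega>. x \<omega> + \<mu> (x \<omega>) * u + \<tau> (x \<omega>) * (W t \<omega> - W s \<omega>)) \<in> borel_measurable (F t)"
proof -
  have x: "x \<in> borel_measurable (F t)" by (rule F_measurable_mono[OF assms])
  have "W t \<in> borel_measurable (F t)" "W s \<in> borel_measurable (F t)" using assms by (auto intro!: W_measurable_F)
  with x measurable_compose[OF x \<mu>_measurable] measurable_compose[OF x \<tau>_measurable]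
  show ?thesis by (intro borel_measurable_add borel_measurable_times borel_measurable_diff borel_measurable_const)
qed

lemma euler_Suc: "euler n (Suc k) = (\<lambda>\<omega>. euler n k \<omega> + \<mu> (euler n k \<omega>) * (1 / 2 ^ n) +
     \<tau> (euler n k \<omega>) * (W (real (Suc k) / 2 ^ n) \<omega> - W (real k / 2 ^ n) \<omega>))"
  by (simp add: fun_eq_iff)

lemma euler_measurable_F: "euler n k \<in> borel_measurable (F (real k / 2 ^ n))"
proof (induction k)
  case (Suc k)
  show ?case unfolding euler_Suc
    by (rule euler_step_measurable_F[OF Suc]) (auto simp: divide_right_mono)
qed (simp add: euler.simps(1)[abs_def])

text \<open>The growth rate of 1 plus the second moment in an Euler step. The terms collected in
  \<open>euler_step_second_moment\<close> amount to at most 5 G^2 + 1 times that quantity, so the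
  value is generous.\<close>

definition growth :: real where "growth = 7 * G\<^sup>2 + 1"

text \<open>The noise is orthogonal to the rest, so no term of order \<open>sqrt (t - s)\<close>
  survives and a step costs a factor \<open>1 + growth * (t - s)\<close>. Multiplied over cells,
  these factors stay below an exponential that does not depend on the mesh.\<close>

lemma euler_step_second_moment:
  assumes x: "x \<in> borel_measurable (F s)" "sq_int x" and s: "0 \<le> s" "s \<le> t" "t \<le> s + 1"
  shows "sq_int (\<lambda>\<omega>. x \<omega> + \<mu> (x \<omega>) * (t - s) + \<tau> (x \<omega>) * (W t \<omega> - W s \<omega>))"
    and "1 + expectation (\<lambda>\<omega>. (x \<omega> + \<mu> (x \<omega>) * (t - s) + \<tau> (x \<omega>) * (W t \<omega> - W s \<omega>))\<^sup>2) \<le>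
      (1 + growth * (t - s)) * (1 + expectation (\<lambda>\<omega>. (x \<omega>)\<^sup>2))"
proof -
  define u where "u = t - s"
  have u: "0 \<le> u" "u \<le> 1" using s by (auto simp: u_def)
  let ?w = "\<lambda>\<omega>. W t \<omega> - W s \<omega>"
  have \<tau>F: "(\<lambda>\<omega>. \<tau> (x \<omega>)) \<in> borel_measurable (F s)" by (rule measurable_compose[OF x(1) \<tau>_measurable])
  have \<mu>F: "(\<lambda>\<omega>. \<mu> (x \<omega>)) \<in> borel_measurable (F s)" by (rule measurable_compose[OF x(1) \<mu>_measurable])
  have \<tau>s: "sq_int (\<lambda>\<omega>. \<tau> (x \<omega>))" by (rule \<tau>_sq_int[OF sq_int_measurable[OF x(2)]])
  define p where "p \<omega> = x \<omega> + \<mu> (x \<omega>) * u" for \<omega>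
  have pF: "p \<in> borel_measurable (F s)" unfolding p_def using x(1) \<mu>F by (intro borel_measurable_add borel_measurable_times) auto
  have ps: "sq_int p"
    using sq_int_add[OF x(2) sq_int_cmult[OF \<mu>_sq_int(1)[OF x(2)], of u]] by (simp add: p_def[abs_def] mult.commute)
  have ws: "sq_int (\<lambda>\<omega>. \<tau> (x \<omega>) * ?w \<omega>)" by (rule W_mult_sq_int[OF s(1,2) \<tau>F \<tau>s])
  show "sq_int (\<lambda>\<omega>. x \<omega> + \<mu> (x \<omega>) * (t - s) + \<tau> (x \<omega>) * ?w \<omega>)"
    using sq_int_add[OF ps ws] by (simp add: p_def u_def)
  have f: "(\<lambda>\<omega>. 2 * p \<omega> * \<tau> (x \<omega>)) \<in> borel_measurable (F s)" "integrable M (\<lambda>\<omega>. 2 * p \<omega> * \<tau> (x \<omega>))"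
    using pF \<tau>F sq_int_mult_integrable[OF ps \<tau>s] by (auto simp: mult.assoc intro!: borel_measurable_times)
  have g: "(\<lambda>\<omega>. (\<tau> (x \<omega>))\<^sup>2) \<in> borel_measurable (F s)" "integrable M (\<lambda>\<omega>. (\<tau> (x \<omega>))\<^sup>2)"
    using \<tau>F sq_int_square[OF \<tau>s] by (auto intro!: borel_measurable_power)
  have "expectation (\<lambda>\<omega>. (p \<omega> + \<tau> (x \<omega>) * ?w \<omega>)\<^sup>2) =
    expectation (\<lambda>\<omega>. (p \<omega>)\<^sup>2 + 2 * p \<omega> * \<tau> (x \<omega>) * ?w \<omega> + (\<tau> (x \<omega>))\<^sup>2 * (?w \<omega>)^2)"
    by (rule Bochner_Integration.integral_cong) (auto simp: power2_eq_square algebra_simps)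
  also have "\<dots> = expectation (\<lambda>\<omega>. (p \<omega>)\<^sup>2) + 0 + expectation (\<lambda>\<omega>. (\<tau> (x \<omega>))\<^sup>2) * u"
    using sq_int_square[OF ps] W_mult_integrable[OF s(1,2) f, of 1] W_mult_integrable[OF s(1,2) g, of 2]
      W_mult_expectation(1)[OF s(1,2) f] W_mult_expectation(2)[OF s(1,2) g] by (simp add: u_def)
  also have "\<dots> \<le> expectation (\<lambda>\<omega>. (x \<omega>)\<^sup>2 + u * ((x \<omega>)\<^sup>2 + 2 * (2 * G\<^sup>2 * (1 + (x \<omega>)\<^sup>2)))) + 0 + G\<^sup>2 * u"
  proof (intro add_mono order_refl mult_right_mono u)
    show "expectation (\<lambda>\<omega>. (p \<omega>)\<^sup>2) \<le> expectation (\<lambda>\<omega>. (x \<omega>)\<^sup>2 + u * ((x \<omega>)\<^sup>2 + 2 * (2 * G\<^sup>2 * (1 + (x \<omega>)\<^sup>2))))"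
    proof (rule integral_mono)
      fix \<omega>
      have a: "2 * (x \<omega> * \<mu> (x \<omega>)) \<le> (x \<omega>)\<^sup>2 + (\<mu> (x \<omega>))\<^sup>2"
        using sum_squares_bound[of "x \<omega>" "\<mu> (x \<omega>)"] by simp
      have "(p \<omega>)\<^sup>2 = (x \<omega>)\<^sup>2 + u * (2 * (x \<omega> * \<mu> (x \<omega>)) + u * (\<mu> (x \<omega>))\<^sup>2)"
        by (simp add: p_def power2_eq_square algebra_simps)
      also have "\<dots> \<le> (x \<omega>)\<^sup>2 + u * (((x \<omega>)\<^sup>2 + (\<mu> (x \<omega>))\<^sup>2) + 1 * (\<mu> (x \<omega>))\<^sup>2)"
        using a u by (intro add_mono mult_left_mono mult_right_mono order_refl) auto
      also have "\<dots> \<le> (x \<omega>)\<^sup>2 + u * ((x \<omega>)\<^sup>2 + 2 * (2 * G\<^sup>2 * (1 + (x \<omega>)\<^sup>2)))"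
      proof (intro add_left_mono mult_left_mono u)
        show "((x \<omega>)\<^sup>2 + (\<mu> (x \<omega>))\<^sup>2) + 1 * (\<mu> (x \<omega>))\<^sup>2 \<le> (x \<omega>)\<^sup>2 + 2 * (2 * G\<^sup>2 * (1 + (x \<omega>)\<^sup>2))"
          using \<mu>_square_le[of "x \<omega>"] by linarith
      qed
      finally show "(p \<omega>)\<^sup>2 \<le> (x \<omega>)\<^sup>2 + u * ((x \<omega>)\<^sup>2 + 2 * (2 * G\<^sup>2 * (1 + (x \<omega>)\<^sup>2)))" .
    qed (use sq_int_square[OF ps] sq_int_square[OF x(2)] in auto)
    have "expectation (\<lambda>\<omega>. (\<tau> (x \<omega>))\<^sup>2) \<le> expectation (\<lambda>\<omega>. G\<^sup>2)"
      using g power_mono[OF \<tau>_bounded, of _ 2] by (intro integral_mono) auto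
    then show "expectation (\<lambda>\<omega>. (\<tau> (x \<omega>))\<^sup>2) \<le> G\<^sup>2" by (simp add: prob_space)
  qed
  also have "\<dots> = expectation (\<lambda>\<omega>. (x \<omega>)\<^sup>2) + u * (expectation (\<lambda>\<omega>. (x \<omega>)\<^sup>2) + 4 * G\<^sup>2 * (1 + expectation (\<lambda>\<omega>. (x \<omega>)\<^sup>2))) + G\<^sup>2 * u"
    using sq_int_square[OF x(2)] by (simp add: prob_space)
  finally have *: "1 + expectation (\<lambda>\<omega>. (p \<omega> + \<tau> (x \<omega>) * ?w \<omega>)\<^sup>2) \<le>
    1 + expectation (\<lambda>\<omega>. (x \<omega>)\<^sup>2) + u * (expectation (\<lambda>\<omega>. (x \<omega>)\<^sup>2) + 4 * G\<^sup>2 * (1 + expectation (\<lambda>\<omega>. (x \<omega>)\<^sup>2)) + G\<^sup>2)"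
    by (simp add: algebra_simps)
  have E: "0 \<le> expectation (\<lambda>\<omega>. (x \<omega>)\<^sup>2)" by (intro integral_nonneg_AE) auto
  have "u * (expectation (\<lambda>\<omega>. (x \<omega>)\<^sup>2) + 4 * G\<^sup>2 * (1 + expectation (\<lambda>\<omega>. (x \<omega>)\<^sup>2)) + G\<^sup>2) \<le> u * (growth * (1 + expectation (\<lambda>\<omega>. (x \<omega>)\<^sup>2)))"
    using u E by (intro mult_left_mono) (auto simp: growth_def algebra_simps intro!: add_mono mult_nonneg_nonneg)
  with * have "1 + expectation (\<lambda>\<omega>. (p \<omega> + \<tau> (x \<omega>) * ?w \<omega>)\<^sup>2) \<le> (1 + growth * u) * (1 + expectation (\<lambda>\<omega>. (x \<omega>)\<^sup>2))"
    by (simp add: algebra_simps)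
  then show "1 + expectation (\<lambda>\<omega>. (x \<omega> + \<mu> (x \<omega>) * (t - s) + \<tau> (x \<omega>) * ?w \<omega>)\<^sup>2) \<le>
      (1 + growth * (t - s)) * (1 + expectation (\<lambda>\<omega>. (x \<omega>)\<^sup>2))"
    by (simp add: p_def u_def)
qed

lemma euler_second_moment:
  "sq_int (euler n k)" "1 + expectation (\<lambda>\<omega>. (euler n k \<omega>)\<^sup>2) \<le> exp (growth * (real k / 2 ^ n)) * (1 + x\<^sub>0\<^sup>2)"
proof -
  have g: "0 \<le> growth" by (simp add: growth_def)
  have "sq_int (euler n k) \<and> 1 + expectation (\<lambda>\<omega>. (euler n k \<omega>)\<^sup>2) \<le> exp (growth * (real k / 2 ^ n)) * (1 + x\<^sub>0\<^sup>2)"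
  proof (induction k)
    case 0
    show ?case by (simp add: prob_space sq_int_const euler.simps(1)[abs_def])
  next
    case (Suc k)
    have t: "real (Suc k) / 2 ^ n - real k / 2 ^ n = 1 / 2 ^ n" by (simp add: diff_divide_distrib[symmetric])
    have "(1::real) / 2 ^ n \<le> 1" by simp
    with t have t': "0 \<le> real k / 2 ^ n" "real k / 2 ^ n \<le> real (Suc k) / 2 ^ n" "real (Suc k) / 2 ^ n \<le> real k / 2 ^ n + 1"
      by (simp, simp add: divide_right_mono, linarith)
    note m = euler_step_second_moment[OF euler_measurable_F[of n k] _ t', unfolded t]
    have "1 + expectation (\<lambda>\<omega>. (euler n (Suc k) \<omega>)\<^sup>2) \<le> (1 + growth * (1 / 2 ^ n)) * (1 + expectation (\<lambda>\<omega>. (euler n k \<omega>)\<^sup>2))"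
      unfolding euler_Suc using m(2) Suc by blast
    also have "\<dots> \<le> exp (growth * (1 / 2 ^ n)) * (exp (growth * (real k / 2 ^ n)) * (1 + x\<^sub>0\<^sup>2))"
      using Suc g exp_ge_add_one_self[of "growth * (1 / 2 ^ n)"] by (intro mult_mono) (auto intro!: add_nonneg_nonneg integral_nonneg_AE)
    also have "\<dots> = exp (growth * (real (Suc k) / 2 ^ n)) * (1 + x\<^sub>0\<^sup>2)"
    proof -
      have "growth * (real (Suc k) / 2 ^ n) = growth * (1 / 2 ^ n) + growth * (real k / 2 ^ n)"
        by (simp add: add_divide_distrib distrib_left)
      then show ?thesis by (simp only: exp_add mult.assoc)
    qed
    finally show ?case unfolding euler_Suc using m(1) Suc by blast
  qed
  then show "sq_int (euler n k)" "1 + expectation (\<lambda>\<omega>. (euler n k \<omega>)\<^sup>2) \<le> exp (growth * (real k / 2 ^ n)) * (1 + x\<^sub>0\<^sup>2)" by auto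
qed

text \<open>Both sequences start at \<open>x\<^sub>0\<close>, where \<phi> of the difference is 0,
  and every cell adds at most the increment of \<open>one_step\<close>. The sequence y with its
  increments a and d is kept abstract; it will be sampled from an approximate solution.\<close>

lemma euler_comparison:
  fixes K n N
  defines "h \<equiv> 1 / 2 ^ n" and "t k \<equiv> real k / 2 ^ n"
  assumes ya: "yamada_function \<delta> Q L \<phi> \<phi>1 \<phi>2"
    and E: "\<And>k. k \<le> N \<Longrightarrow> expectation (\<lambda>\<omega>. (euler n k \<omega>)\<^sup>2) \<le> K"
    and y: "\<And>k. k \<le> N \<Longrightarrow> y k \<in> borel_measurable (F (t k)) \<and> sq_int (y k) \<and> expectation (\<lambda>\<omega>. (y k \<omega>)\<^sup>2) \<le> K"
    and a: "\<And>k. k < N \<Longrightarrow> sq_int (a k) \<and> expectation (\<lambda>\<omega>. (a k \<omega>)\<^sup>2) \<le> K * h\<^sup>2 \<and>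
      expectation (\<lambda>\<omega>. (a k \<omega> - \<mu> (y k \<omega>) * h)\<^sup>2) \<le> K * h ^ 3"
    and d: "\<And>k. k < N \<Longrightarrow> sq_int (d k) \<and> expectation (\<lambda>\<omega>. (d k \<omega>)\<^sup>2) \<le> K * h \<and>
      integrable M (\<lambda>\<omega>. d k \<omega> ^ 4) \<and> expectation (\<lambda>\<omega>. d k \<omega> ^ 4) \<le> K * h\<^sup>2"
    and mean: "\<And>k \<xi>. k < N \<Longrightarrow> \<xi> \<in> borel_measurable (F (t k)) \<Longrightarrow> sq_int \<xi> \<Longrightarrow> expectation (\<lambda>\<omega>. \<xi> \<omega> * d k \<omega>) = 0"
    and res: "\<And>k. k < N \<Longrightarrow> expectation (\<lambda>\<omega>. (d k \<omega> - \<tau> (y k \<omega>) * (W (t (Suc k)) \<omega> - W (t k) \<omega>))\<^sup>2) \<le> K * (h * sqrt h)"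
    and y0: "AE \<omega> in M. y 0 \<omega> = x\<^sub>0" and yS: "\<And>k. k < N \<Longrightarrow> AE \<omega> in M. y (Suc k) \<omega> = y k \<omega> + a k \<omega> + d k \<omega>"
    and k: "k \<le> N"
  shows "expectation (\<lambda>\<omega>. \<phi> (y k \<omega> - euler n k \<omega>)) \<le> real k * (G * \<delta> * h + step_const K Q L * (h * sqrt h))"
  using k
proof (induction k)
  case 0
  have "expectation (\<lambda>\<omega>. \<phi> (y 0 \<omega> - euler n 0 \<omega>)) = expectation (\<lambda>\<omega>. 0)"
  proof (rule integral_cong_AE)
    show "(\<lambda>\<omega>. \<phi> (y 0 \<omega> - euler n 0 \<omega>)) \<in> borel_measurable M"
      using y[of 0] by (intro measurable_compose[OF _ yamada_measurable(1)[OF ya]] borel_measurable_diff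
        sq_int_measurable[OF euler_second_moment(1)] sq_int_measurable[of "y 0"]) auto
    show "AE \<omega> in M. \<phi> (y 0 \<omega> - euler n 0 \<omega>) = 0" using y0 ya by (auto simp: yamada_function_def)
  qed simp
  then show ?case by simp
next
  case (Suc k)
  then have k: "k < N" by simp
  have ts: "t (Suc k) = t k + h" by (simp add: t_def h_def add_divide_distrib)
  have "expectation (\<lambda>\<omega>. \<phi> (y (Suc k) \<omega> - euler n (Suc k) \<omega>)) \<le>
    expectation (\<lambda>\<omega>. \<phi> (y k \<omega> - euler n k \<omega>)) + G * \<delta> * h + step_const K Q L * (h * sqrt h)"
  proof (rule one_step[OF ya, where s="t k" and a="a k" and d="d k" and K=K and h=h])
    show "0 \<le> t k" "0 < h" "h \<le> 1" by (auto simp: t_def h_def)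
    show "euler n k \<in> borel_measurable (F (t k))" unfolding t_def by (rule euler_measurable_F)
    show "sq_int (euler n k)" by (rule euler_second_moment)
    show "expectation (\<lambda>\<omega>. (euler n k \<omega>)\<^sup>2) \<le> K" using E k by simp
    show "expectation (\<lambda>\<omega>. (d k \<omega> - \<tau> (y k \<omega>) * (W (t k + h) \<omega> - W (t k) \<omega>))\<^sup>2) \<le> K * (h * sqrt h)"
      using res[OF k] unfolding ts .
    show "y (Suc k) \<in> borel_measurable M" using y[of "Suc k"] Suc.prems sq_int_measurable by auto
    show "euler n (Suc k) \<omega> = euler n k \<omega> + \<mu> (euler n k \<omega>) * h + \<tau> (euler n k \<omega>) * (W (t k + h) \<omega> - W (t k) \<omega>)" for \<omega>
      unfolding ts[symmetric] by (simp add: h_def t_def)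
  qed (use y[of k] a[OF k] d[OF k] mean[OF k] yS[OF k] k in auto)
  also have "\<dots> \<le> real k * (G * \<delta> * h + step_const K Q L * (h * sqrt h)) + G * \<delta> * h + step_const K Q L * (h * sqrt h)"
    using Suc by simp
  finally show ?case by (simp add: algebra_simps)
qed

text \<open>The lag \<rho> tells where the drift is evaluated: it is the identity for an exact
  solution and \<open>dyadic_left m\<close> for the Euler polygon of a finer mesh
  \<open>1 / 2 ^ m\<close>. It lies between s and the left end of the cell of s, so on the grid of
  mesh \<open>1 / 2 ^ n\<close> both kinds have the same local errors. Joint measurability and the
  bound for each \<omega> make the time integral of the drift meaningful.\<close>

definition approx_solution :: "nat \<Rightarrow> real \<Rightarrow> real \<Rightarrow> (real \<Rightarrow> 'a \<Rightarrow> real) \<Rightarrow> (real \<Rightarrow> 'a \<Rightarrow> real) \<Rightarrow> (real \<Rightarrow> real) \<Rightarrow> bool" where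
  "approx_solution n T K Y I \<rho> \<longleftrightarrow>
    adapted F Y \<and> (\<forall>t. 0 \<le> t \<longrightarrow> t \<le> T \<longrightarrow> sq_int (Y t) \<and> expectation (\<lambda>\<omega>. (Y t \<omega>)\<^sup>2) \<le> K) \<and>
    (AE \<omega> in M. Y 0 \<omega> = x\<^sub>0) \<and> ito_like n G (\<lambda>t \<omega>. \<tau> (Y t \<omega>)) I \<and>
    (\<lambda>(\<omega>, s). indicator {0..T} s * Y (\<rho> s) \<omega>) \<in> borel_measurable (M \<Otimes>\<^sub>M lborel) \<and>
    (\<forall>\<omega>\<in>space M. \<exists>c. \<forall>s\<in>{0..T}. \<bar>Y (\<rho> s) \<omega>\<bar> \<le> c) \<and>
    (\<forall>k s. real k / 2 ^ n < s \<longrightarrow> s \<le> T \<longrightarrow> real k / 2 ^ n \<le> \<rho> s \<and> \<rho> s \<le> s) \<and>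
    (\<forall>k t. real k / 2 ^ n \<le> t \<longrightarrow> t \<le> T \<longrightarrow> (AE \<omega> in M. Y t \<omega> =
      Y (real k / 2 ^ n) \<omega> + (LBINT s:{real k / 2 ^ n<..t}. \<mu> (Y (\<rho> s) \<omega>)) + (I t \<omega> - I (real k / 2 ^ n) \<omega>)))"

text \<open>Twice the constants of the second moments of drift and noise, as they are added in
  \<open>approx_modulus\<close>.\<close>

definition modulus_const :: "real \<Rightarrow> real" where "modulus_const K = 4 * G\<^sup>2 * (1 + K) + 2 * G\<^sup>2"

text \<open>For nonnegative T and K the summands are nonnegative, hence the sum lies above each
  single constant that \<open>approx_comparison\<close> has to feed into
  \<open>euler_comparison\<close>.\<close>

definition comp_const :: "real \<Rightarrow> real \<Rightarrow> real" where
  "comp_const T K = K + exp (growth * T) * (1 + x\<^sub>0\<^sup>2) + 2 * G\<^sup>2 * (1 + K) + G\<^sup>2 * modulus_const K + G\<^sup>2 + 3 * G ^ 4 + G * sqrt (modulus_const K)"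

section \<open>Approximate solutions against the Euler polygon\<close>

context
  fixes n T K Y I \<rho>
  assumes Y: "approx_solution n T K Y I \<rho>"
begin

lemma approx_sq_int:
  assumes "0 \<le> t" "t \<le> T"
  shows "sq_int (Y t)" "expectation (\<lambda>\<omega>. (Y t \<omega>)\<^sup>2) \<le> K" "Y t \<in> borel_measurable (F t)"
  using Y assms by (auto simp: approx_solution_def adapted_def)

lemma approx_lag:
  assumes "real k / 2 ^ n < u" "u \<le> T"
  shows "real k / 2 ^ n \<le> \<rho> u" "\<rho> u \<le> u"
  using Y assms unfolding approx_solution_def by blast+

text \<open>Applied with V = 0 for the size of the drift over a cell, and with V =
  \<open>\<mu> (Y s)\<close> for its deviation from the left-point value.\<close>

lemma approx_drift:
  assumes s: "s = real k / 2 ^ n" and st: "s \<le> t" "t \<le> T" and V: "sq_int V" and c: "0 \<le> c"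
    "\<And>u. s < u \<Longrightarrow> u \<le> t \<Longrightarrow> expectation (\<lambda>\<omega>. (\<mu> (Y (\<rho> u) \<omega>) - V \<omega>)\<^sup>2) \<le> c"
  shows "sq_int (\<lambda>\<omega>. (LBINT u:{s<..t}. \<mu> (Y (\<rho> u) \<omega>)) - V \<omega> * (t - s))"
    and "expectation (\<lambda>\<omega>. ((LBINT u:{s<..t}. \<mu> (Y (\<rho> u) \<omega>)) - V \<omega> * (t - s))\<^sup>2) \<le> (t - s)\<^sup>2 * c"
proof -
  have s0: "0 \<le> s" by (simp add: s)
  \<comment> \<open>The inner indicator is there because joint measurability of
    \<open>Y (\<rho> u)\<close> is known on [0, T] only; on (s, t] it equals 1.\<close>
  define f where "f \<omega> u = indicator {s<..t} u * (\<mu> (indicator {0..T} u * Y (\<rho> u) \<omega>) - V \<omega>)" for \<omega> u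
  have Ym: "(\<lambda>x. indicator {0..T} (snd x) * Y (\<rho> (snd x)) (fst x)) \<in> borel_measurable (M \<Otimes>\<^sub>M lborel)"
    using Y by (simp add: approx_solution_def split_beta')
  have [measurable]: "V \<in> borel_measurable M" using V by (rule sq_int_measurable)
  have m: "(\<lambda>x. f (fst x) (snd x)) \<in> borel_measurable (M \<Otimes>\<^sub>M lborel)"
    unfolding f_def using measurable_compose[OF Ym \<mu>_measurable] by measurable
  have feq: "f \<omega> u = indicator {s<..t} u * (\<mu> (Y (\<rho> u) \<omega>) - V \<omega>)" for \<omega> u
    using st s0 by (auto simp: f_def indicator_def)
  have b: "\<exists>K. \<forall>u. \<bar>f \<omega> u\<bar> \<le> K * indicator {s<..t} u" if "\<omega> \<in> space M" for \<omega>
  proof -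
    have "\<exists>c. \<forall>s\<in>{0..T}. \<bar>Y (\<rho> s) \<omega>\<bar> \<le> c" using Y that by (simp add: approx_solution_def)
    then obtain c where c: "\<forall>s\<in>{0..T}. \<bar>Y (\<rho> s) \<omega>\<bar> \<le> c" ..
    have "\<bar>f \<omega> u\<bar> \<le> (G + G * c + \<bar>V \<omega>\<bar>) * indicator {s<..t} u" for u
    proof (cases "u \<in> {s<..t}")
      case True
      then have "u \<in> {0..T}" using st s0 by auto
      with c have "\<bar>Y (\<rho> u) \<omega>\<bar> \<le> c" by (rule bspec)
      have "\<bar>\<mu> (Y (\<rho> u) \<omega>)\<bar> \<le> G + G * c"
      proof -
        have "\<bar>\<mu> (Y (\<rho> u) \<omega>)\<bar> \<le> G + G * \<bar>Y (\<rho> u) \<omega>\<bar>"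
          using \<mu>_lipschitz[of "Y (\<rho> u) \<omega>" 0] \<mu>_zero by simp
        also have "\<dots> \<le> G + G * c"
          using G_ge_1 \<open>\<bar>Y (\<rho> u) \<omega>\<bar> \<le> c\<close> by (intro add_left_mono mult_left_mono) auto
        finally show ?thesis .
      qed
      then show ?thesis using True by (simp add: feq)
    qed (simp add: feq)
    then show ?thesis by blast
  qed
  have q: "sq_int (\<lambda>\<omega>. f \<omega> u) \<and> expectation (\<lambda>\<omega>. (f \<omega> u)\<^sup>2) \<le> c" if u: "s < u" "u \<le> t" for u
  proof -
    have r: "0 \<le> \<rho> u" "\<rho> u \<le> T"
      using approx_lag[of k u] u st s0 unfolding s by linarith+
    have "sq_int (\<lambda>\<omega>. \<mu> (Y (\<rho> u) \<omega>) - V \<omega>)"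
      by (rule sq_int_diff[OF \<mu>_sq_int(1)[OF approx_sq_int(1)[OF r]] V])
    then show ?thesis using c(2)[OF u] u by (simp add: feq)
  qed
  have m': "(\<lambda>(\<omega>, u). f \<omega> u) \<in> borel_measurable (M \<Otimes>\<^sub>M lborel)" using m by (simp add: split_beta')
  have eq: "integral\<^sup>L lborel (f \<omega>) = (LBINT u:{s<..t}. \<mu> (Y (\<rho> u) \<omega>)) - V \<omega> * (t - s)" if \<omega>: "\<omega> \<in> space M" for \<omega>
  proof -
    obtain K where K: "\<forall>u. \<bar>f \<omega> u\<bar> \<le> K * indicator {s<..t} u" using b[OF \<omega>] ..
    have i: "integrable lborel (\<lambda>u. V \<omega> * indicator {s<..t} u)" using st by simp
    have j: "integrable lborel (f \<omega>)"
    proof (rule Bochner_Integration.integrable_bound)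
      show "integrable lborel (\<lambda>u. K * indicator {s<..t} u)" using st by simp
      show "f \<omega> \<in> borel_measurable lborel" using measurable_compose[OF measurable_Pair1'[OF \<omega>] m'] by simp
    qed (use K in \<open>auto intro: order_trans[OF _ abs_ge_self]\<close>)
    have "(LBINT u:{s<..t}. \<mu> (Y (\<rho> u) \<omega>)) = integral\<^sup>L lborel (\<lambda>u. f \<omega> u + V \<omega> * indicator {s<..t} u)"
      unfolding set_lebesgue_integral_def feq by (intro Bochner_Integration.integral_cong) (auto simp: algebra_simps)
    also have "\<dots> = integral\<^sup>L lborel (f \<omega>) + V \<omega> * (t - s)" using i j st by simp
    finally show ?thesis by simp
  qed
  note l = time_integral_sq_int[OF m' st(1) b q c(1)]
  have "expectation (\<lambda>\<omega>. (integral\<^sup>L lborel (f \<omega>))\<^sup>2) = expectation (\<lambda>\<omega>. ((LBINT u:{s<..t}. \<mu> (Y (\<rho> u) \<omega>)) - V \<omega> * (t - s))\<^sup>2)"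
    using eq by (intro Bochner_Integration.integral_cong) auto
  then show "expectation (\<lambda>\<omega>. ((LBINT u:{s<..t}. \<mu> (Y (\<rho> u) \<omega>)) - V \<omega> * (t - s))\<^sup>2) \<le> (t - s)\<^sup>2 * c"
    using l(2) by simp
  have "sq_int (\<lambda>\<omega>. (LBINT u:{s<..t}. \<mu> (Y (\<rho> u) \<omega>)) - V \<omega> * (t - s)) \<longleftrightarrow> sq_int (\<lambda>\<omega>. integral\<^sup>L lborel (f \<omega>))"
    unfolding sq_int_def using eq
    by (intro conj_cong measurable_cong Bochner_Integration.integrable_cong) auto
  then show "sq_int (\<lambda>\<omega>. (LBINT u:{s<..t}. \<mu> (Y (\<rho> u) \<omega>)) - V \<omega> * (t - s))" using l(1) by simp
qed

lemma K_nonneg: "0 \<le> T \<Longrightarrow> 0 \<le> K"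
  using approx_sq_int(2)[of 0] by (rule order_trans[rotated]) (auto intro: integral_nonneg_AE)

lemma approx_drift_bound:
  assumes s: "s = real k / 2 ^ n" and st: "s \<le> t" "t \<le> T"
  shows "sq_int (\<lambda>\<omega>. (LBINT u:{s<..t}. \<mu> (Y (\<rho> u) \<omega>)))"
    and "expectation (\<lambda>\<omega>. (LBINT u:{s<..t}. \<mu> (Y (\<rho> u) \<omega>))\<^sup>2) \<le> (t - s)\<^sup>2 * (2 * G\<^sup>2 * (1 + K))"
proof -
  have s0: "0 \<le> s" by (simp add: s)
  then have K0: "0 \<le> K" using K_nonneg st by simp
  have c: "expectation (\<lambda>\<omega>. (\<mu> (Y (\<rho> u) \<omega>) - 0)\<^sup>2) \<le> 2 * G\<^sup>2 * (1 + K)" if u: "s < u" "u \<le> t" for u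
  proof -
    have r: "0 \<le> \<rho> u" "\<rho> u \<le> T"
      using approx_lag[of k u] u st s0 unfolding s by linarith+
    have "2 * G\<^sup>2 * (1 + expectation (\<lambda>\<omega>. (Y (\<rho> u) \<omega>)\<^sup>2)) \<le> 2 * G\<^sup>2 * (1 + K)"
      using approx_sq_int(2)[OF r] by (intro mult_left_mono) auto
    then show ?thesis using \<mu>_sq_int(2)[OF approx_sq_int(1)[OF r]] by simp
  qed
  show "sq_int (\<lambda>\<omega>. (LBINT u:{s<..t}. \<mu> (Y (\<rho> u) \<omega>)))"
    "expectation (\<lambda>\<omega>. (LBINT u:{s<..t}. \<mu> (Y (\<rho> u) \<omega>))\<^sup>2) \<le> (t - s)\<^sup>2 * (2 * G\<^sup>2 * (1 + K))"
    using approx_drift[OF s st sq_int_const[of 0] _ c] K0 by auto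
qed

text \<open>The drift contributes order (t - s)^2 and the noise order t - s; the bound 1 on t - s
  merges the two.\<close>

lemma approx_modulus:
  assumes s: "s = real k / 2 ^ n" and st: "s \<le> t" "t \<le> T" "t \<le> s + 1"
  shows "sq_int (\<lambda>\<omega>. Y t \<omega> - Y s \<omega>)" "expectation (\<lambda>\<omega>. (Y t \<omega> - Y s \<omega>)\<^sup>2) \<le> modulus_const K * (t - s)"
proof -
  have s0: "0 \<le> s" by (simp add: s)
  have K0: "0 \<le> K" using K_nonneg st s0 by simp
  have I: "ito_like n G (\<lambda>t \<omega>. \<tau> (Y t \<omega>)) I" using Y by (simp add: approx_solution_def)
  note i = ito_like_sq[OF I s st(1) \<tau>_bounded]
  note dr = approx_drift_bound[OF s st(1,2)]
  show ys: "sq_int (\<lambda>\<omega>. Y t \<omega> - Y s \<omega>)" using approx_sq_int(1) s0 st by (intro sq_int_diff) auto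
  have ae: "AE \<omega> in M. Y t \<omega> = Y s \<omega> + (LBINT u:{s<..t}. \<mu> (Y (\<rho> u) \<omega>)) + (I t \<omega> - I s \<omega>)"
    using Y st unfolding approx_solution_def s by blast
  have "expectation (\<lambda>\<omega>. (Y t \<omega> - Y s \<omega>)\<^sup>2) = expectation (\<lambda>\<omega>. ((LBINT u:{s<..t}. \<mu> (Y (\<rho> u) \<omega>)) + (I t \<omega> - I s \<omega>))\<^sup>2)"
    using sq_int_measurable[OF ys] sq_int_measurable[OF sq_int_add[OF dr(1) i(1)]] ae
    by (intro integral_cong_AE) (auto intro!: borel_measurable_power)
  also have "\<dots> \<le> 2 * ((t - s)\<^sup>2 * (2 * G\<^sup>2 * (1 + K))) + 2 * (G\<^sup>2 * (t - s))"
    using expectation_sq_add_le[OF dr(1) i(1)] dr(2) i(2) by simp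
  also have "\<dots> \<le> 2 * ((t - s) * (2 * G\<^sup>2 * (1 + K))) + 2 * (G\<^sup>2 * (t - s))"
    using st K0 mult_left_mono[of "t - s" 1 "t - s"]
    by (intro add_right_mono mult_left_mono mult_right_mono) (auto simp: power2_eq_square)
  finally show "expectation (\<lambda>\<omega>. (Y t \<omega> - Y s \<omega>)\<^sup>2) \<le> modulus_const K * (t - s)"
    by (simp add: modulus_const_def algebra_simps)
qed

text \<open>The first moment is the right quantity here: by \<open>\<tau>_holder\<close> the squared
  difference of \<tau> is linear in the distance, so a bound of order \<open>sqrt h\<close> makes
  the noise residual over a cell of order \<open>h * sqrt h\<close>.\<close>

lemma approx_modulus_abs:
  assumes s: "s = real k / 2 ^ n" and st: "s \<le> t" "t \<le> T" "t \<le> s + 1 / 2 ^ n"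
  shows "expectation (\<lambda>\<omega>. \<bar>Y t \<omega> - Y s \<omega>\<bar>) \<le> sqrt (modulus_const K * (1 / 2 ^ n))"
proof -
  have K0: "0 \<le> K" using K_nonneg st s by (metis divide_nonneg_nonneg of_nat_0_le_iff order_trans zero_le_numeral zero_le_power)
  have "1 / 2 ^ n \<le> (1::real)" by simp
  with st have st1: "t \<le> s + 1" by linarith
  have "modulus_const K * (t - s) \<le> modulus_const K * (1 / 2 ^ n)"
    using st K0 by (intro mult_left_mono) (auto simp: modulus_const_def)
  with approx_modulus[OF s st(1,2) st1] expectation_abs_le_sqrt[OF approx_modulus(1)[OF s st(1,2) st1]]
  show ?thesis by (meson order_trans real_sqrt_le_mono)
qed

text \<open>Y is sampled on the grid, with a and d the drift and the noise collected over a cell.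
  The drift residual is controlled by the Lipschitz drift and the mean square modulus, the noise
  residual by \<open>\<tau>_holder\<close> and the first moment modulus.\<close>

lemma approx_comparison:
  assumes ya: "yamada_function \<delta> Q L \<phi> \<phi>1 \<phi>2" and k: "real k / 2 ^ n \<le> T"
  shows "expectation (\<lambda>\<omega>. \<phi> (Y (real k / 2 ^ n) \<omega> - euler n k \<omega>)) \<le>
    real k * (G * \<delta> * (1 / 2 ^ n) + step_const (comp_const T K) Q L * (1 / 2 ^ n * sqrt (1 / 2 ^ n)))"
proof -
  define h where "h = (1::real) / 2 ^ n"
  have h: "0 < h" "h \<le> 1" by (auto simp: h_def)
  have T0: "0 \<le> T" using k by (metis divide_nonneg_nonneg of_nat_0_le_iff order_trans zero_le_numeral zero_le_power)
  have K0: "0 \<le> K" using K_nonneg T0 by simp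
  have m0: "0 \<le> modulus_const K" using K0 by (simp add: modulus_const_def)
  define c where "c = comp_const T K"
  have G0: "0 \<le> G" using G_ge_1 by simp
  have c: "K \<le> c" "exp (growth * T) * (1 + x\<^sub>0\<^sup>2) \<le> c" "2 * G\<^sup>2 * (1 + K) \<le> c" "G\<^sup>2 * modulus_const K \<le> c" "G\<^sup>2 \<le> c" "3 * G ^ 4 \<le> c" "G * sqrt (modulus_const K) \<le> c"
  proof -
    have "0 \<le> exp (growth * T) * (1 + x\<^sub>0\<^sup>2)" "0 \<le> 2 * G\<^sup>2 * (1 + K)" "0 \<le> G\<^sup>2 * modulus_const K" "0 \<le> G\<^sup>2" "0 \<le> 3 * G ^ 4" "0 \<le> G * sqrt (modulus_const K)"
      using K0 m0 G0 by auto
    then show "K \<le> c" "exp (growth * T) * (1 + x\<^sub>0\<^sup>2) \<le> c" "2 * G\<^sup>2 * (1 + K) \<le> c" "G\<^sup>2 * modulus_const K \<le> c" "G\<^sup>2 \<le> c" "3 * G ^ 4 \<le> c" "G * sqrt (modulus_const K) \<le> c"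
      using K0 unfolding c_def comp_const_def by linarith+
  qed
  let ?t = "\<lambda>k. real k / 2 ^ n"
  have tS: "?t (Suc j) = ?t j + h" for j by (simp add: h_def add_divide_distrib)
  have tm: "?t j \<le> T" if "j \<le> k" for j
    using that k by (meson divide_right_mono of_nat_le_iff order_trans zero_le_numeral zero_le_power)
  have I: "ito_like n G (\<lambda>t \<omega>. \<tau> (Y t \<omega>)) I" using Y by (simp add: approx_solution_def)
  define a where "a j \<omega> = (LBINT u:{?t j<..?t (Suc j)}. \<mu> (Y (\<rho> u) \<omega>))" for j \<omega>
  define d where "d j \<omega> = I (?t (Suc j)) \<omega> - I (?t j) \<omega>" for j \<omega>
  have "expectation (\<lambda>\<omega>. \<phi> (Y (?t k) \<omega> - euler n k \<omega>)) \<le> real k * (G * \<delta> * (1 / 2 ^ n) + step_const c Q L * (1 / 2 ^ n * sqrt (1 / 2 ^ n)))"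
  proof (rule euler_comparison[OF ya, where N=k and a=a and d=d and y="\<lambda>j. Y (?t j)"], unfold h_def[symmetric])
    fix j assume j: "j \<le> k"
    have "exp (growth * ?t j) * (1 + x\<^sub>0\<^sup>2) \<le> exp (growth * T) * (1 + x\<^sub>0\<^sup>2)"
    proof (intro mult_right_mono exp_le_cancel_iff[THEN iffD2])
      show "growth * ?t j \<le> growth * T" by (rule mult_left_mono[OF tm[OF j]]) (simp add: growth_def)
    qed simp
    then show "expectation (\<lambda>\<omega>. (euler n j \<omega>)\<^sup>2) \<le> c" using euler_second_moment(2)[of n j] c(2) by linarith
    have "0 \<le> ?t j" by simp
    note q = approx_sq_int[OF this tm[OF j]]
    then show "Y (?t j) \<in> borel_measurable (F (?t j)) \<and> sq_int (Y (?t j)) \<and> expectation (\<lambda>\<omega>. (Y (?t j) \<omega>)\<^sup>2) \<le> c"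
      using c(1) by auto
  next
    fix j assume j: "j < k"
    have jj: "?t j \<le> ?t (Suc j)" "?t (Suc j) \<le> T" using tm[of "Suc j"] j tS[of j] h by auto
    have t0: "0 \<le> ?t j" "?t j \<le> T" using jj by auto
    have d0: "?t (Suc j) - ?t j = h" using tS by simp
    note dr = approx_drift_bound[OF refl jj, unfolded d0]
    have ys: "sq_int (\<lambda>\<omega>. \<mu> (Y (?t j) \<omega>))" by (rule \<mu>_sq_int(1)[OF approx_sq_int(1)[OF t0]])
    have cc: "expectation (\<lambda>\<omega>. (\<mu> (Y (\<rho> u) \<omega>) - \<mu> (Y (?t j) \<omega>))\<^sup>2) \<le> G\<^sup>2 * (modulus_const K * h)"
      if u: "?t j < u" "u \<le> ?t (Suc j)" for u
    proof -
      have r: "?t j \<le> \<rho> u" "\<rho> u \<le> u" using approx_lag[of j u] u jj by linarith+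
      then have r': "\<rho> u \<le> T" "\<rho> u \<le> ?t j + 1" "\<rho> u - ?t j \<le> h" using u jj tS[of j] h by linarith+
      note mo = approx_modulus[OF refl r(1) r'(1,2)]
      have "expectation (\<lambda>\<omega>. (\<mu> (Y (\<rho> u) \<omega>) - \<mu> (Y (?t j) \<omega>))\<^sup>2) \<le> expectation (\<lambda>\<omega>. G\<^sup>2 * (Y (\<rho> u) \<omega> - Y (?t j) \<omega>)\<^sup>2)"
      proof (rule integral_mono')
        show "(\<mu> (Y (\<rho> u) \<omega>) - \<mu> (Y (?t j) \<omega>))\<^sup>2 \<le> G\<^sup>2 * (Y (\<rho> u) \<omega> - Y (?t j) \<omega>)\<^sup>2" for \<omega>
          using power_mono[OF \<mu>_lipschitz[of "Y (\<rho> u) \<omega>" "Y (?t j) \<omega>"], of 2] by (simp add: power_mult_distrib)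
      qed (use sq_int_square[OF mo(1)] in auto)
      also have "\<dots> = G\<^sup>2 * expectation (\<lambda>\<omega>. (Y (\<rho> u) \<omega> - Y (?t j) \<omega>)\<^sup>2)" by simp
      also have "\<dots> \<le> G\<^sup>2 * (modulus_const K * h)"
        using mo(2) mult_left_mono[OF r'(3) m0] by (intro mult_left_mono) auto
      finally show ?thesis .
    qed
    have "expectation (\<lambda>\<omega>. (a j \<omega> - \<mu> (Y (?t j) \<omega>) * h)\<^sup>2) \<le> h\<^sup>2 * (G\<^sup>2 * (modulus_const K * h))"
      using approx_drift(2)[OF refl jj ys _ cc] m0 h unfolding d0 a_def by simp
    also have "\<dots> = (G\<^sup>2 * modulus_const K) * h ^ 3" by (simp add: power2_eq_square power3_eq_cube)
    also have "\<dots> \<le> c * h ^ 3" using c(4) h by (intro mult_right_mono) auto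
    finally have a3: "expectation (\<lambda>\<omega>. (a j \<omega> - \<mu> (Y (?t j) \<omega>) * h)\<^sup>2) \<le> c * h ^ 3" .
    have "expectation (\<lambda>\<omega>. (a j \<omega>)\<^sup>2) \<le> (2 * G\<^sup>2 * (1 + K)) * h\<^sup>2" using dr(2) by (simp add: a_def mult.commute)
    also have "\<dots> \<le> c * h\<^sup>2" using c(3) by (intro mult_right_mono) auto
    finally show "sq_int (a j) \<and> expectation (\<lambda>\<omega>. (a j \<omega>)\<^sup>2) \<le> c * h\<^sup>2 \<and> expectation (\<lambda>\<omega>. (a j \<omega> - \<mu> (Y (?t j) \<omega>) * h)\<^sup>2) \<le> c * h ^ 3"
      using dr(1) a3 by (simp add: a_def[abs_def])
    note isq = ito_like_sq[OF I refl jj(1) \<tau>_bounded, unfolded d0] and i4 = ito_like_D[OF I refl jj(1), unfolded d0]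
    have "G\<^sup>2 * h \<le> c * h" "3 * G ^ 4 * h\<^sup>2 \<le> c * h\<^sup>2" using c h by (auto intro!: mult_right_mono)
    then show "sq_int (d j) \<and> expectation (\<lambda>\<omega>. (d j \<omega>)\<^sup>2) \<le> c * h \<and> integrable M (\<lambda>\<omega>. d j \<omega> ^ 4) \<and> expectation (\<lambda>\<omega>. d j \<omega> ^ 4) \<le> c * h\<^sup>2"
      using isq i4(1,2) unfolding d_def[abs_def] by (blast intro: order_trans)
    show "expectation (\<lambda>\<omega>. \<xi> \<omega> * d j \<omega>) = 0" if "\<xi> \<in> borel_measurable (F (?t j))" "sq_int \<xi>" for \<xi>
      using i4(3)[OF that] unfolding d_def .
    have rr: "expectation (\<lambda>\<omega>. (\<tau> (Y r \<omega>) - \<tau> (Y (?t j) \<omega>))\<^sup>2) \<le> G * sqrt (modulus_const K * h)"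
      if r: "?t j \<le> r" "r < ?t (Suc j)" for r
    proof -
      have r': "r \<le> T" "r \<le> ?t j + 1 / 2 ^ n" "0 \<le> r"
        using r jj tS[of j] t0(1) unfolding h_def by linarith+
      have ri: "integrable M (\<lambda>\<omega>. \<bar>Y r \<omega> - Y (?t j) \<omega>\<bar>)"
        using sq_int_integrable[OF sq_int_diff[OF approx_sq_int(1)[OF r'(3,1)] approx_sq_int(1)[OF t0]]] by simp
      have "expectation (\<lambda>\<omega>. (\<tau> (Y r \<omega>) - \<tau> (Y (?t j) \<omega>))\<^sup>2) \<le> expectation (\<lambda>\<omega>. G * \<bar>Y r \<omega> - Y (?t j) \<omega>\<bar>)"
        using ri G0 by (intro integral_mono' \<tau>_holder) auto
      also have "\<dots> = G * expectation (\<lambda>\<omega>. \<bar>Y r \<omega> - Y (?t j) \<omega>\<bar>)" by simp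
      also have "\<dots> \<le> G * sqrt (modulus_const K * h)"
        using approx_modulus_abs[OF refl r(1) r'(1,2)] G0 by (intro mult_left_mono) (auto simp: h_def)
      finally show ?thesis .
    qed
    have \<zeta>: "(\<lambda>\<omega>. \<tau> (Y (?t j) \<omega>)) \<in> borel_measurable (F (?t j))"
      by (rule measurable_compose[OF approx_sq_int(3)[OF t0] \<tau>_measurable])
    have "expectation (\<lambda>\<omega>. (d j \<omega> - \<tau> (Y (?t j) \<omega>) * (W (?t (Suc j)) \<omega> - W (?t j) \<omega>))\<^sup>2) \<le> G * sqrt (modulus_const K * h) * h"
      using ito_like_residual(2)[OF I refl jj(1) \<zeta> \<tau>_bounded rr] unfolding d_def d0 .
    also have "\<dots> = (G * sqrt (modulus_const K)) * (h * sqrt h)" by (simp add: real_sqrt_mult)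
    also have "\<dots> \<le> c * (h * sqrt h)" using c(7) h by (intro mult_right_mono) auto
    finally show "expectation (\<lambda>\<omega>. (d j \<omega> - \<tau> (Y (?t j) \<omega>) * (W (?t (Suc j)) \<omega> - W (?t j) \<omega>))\<^sup>2) \<le> c * (h * sqrt h)" .
    show "AE \<omega> in M. Y (?t (Suc j)) \<omega> = Y (?t j) \<omega> + a j \<omega> + d j \<omega>"
      using Y jj unfolding approx_solution_def a_def d_def by blast
  qed (use Y in \<open>auto simp: approx_solution_def\<close>)
  then show ?thesis by (simp add: c_def)
qed

end

text \<open>The order of choices matters: \<delta> from \<epsilon>, then \<phi> with its Q and L,
  and the mesh last, since the step constant depends on Q and L. The index n0 depends on the moment
  bound K but on no particular Y.\<close>

lemma euler_converges:
  assumes \<epsilon>: "0 < \<epsilon>" and T: "0 \<le> T" and K: "0 \<le> K"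
  obtains n0 where "\<And>n Y I \<rho> k. n0 \<le> n \<Longrightarrow> approx_solution n T K Y I \<rho> \<Longrightarrow> real k / 2 ^ n \<le> T \<Longrightarrow>
    expectation (\<lambda>\<omega>. \<bar>Y (real k / 2 ^ n) \<omega> - euler n k \<omega>\<bar>) \<le> \<epsilon>"
proof -
  have G0: "0 < G" using G_ge_1 by simp
  \<comment> \<open>Makes the accumulated term \<open>T * (G * \<delta>)\<close> at most
    \<open>\<epsilon> / 3\<close>; the summand 1 guards against T = 0.\<close>
  define \<delta> where "\<delta> = \<epsilon> / (3 * G * (T + 1))"
  have \<delta>: "0 < \<delta>" using \<epsilon> G0 T by (simp add: \<delta>_def)
  have "0 < \<epsilon> / 3" using \<epsilon> by simp
  from yamada_function_exists[OF \<delta> this] obtain Q L \<phi> \<phi>1 \<phi>2 where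
    ya: "yamada_function \<delta> Q L \<phi> \<phi>1 \<phi>2" and low: "\<And>x. \<bar>x\<bar> \<le> \<phi> x + \<epsilon> / 3" by metis
  have QL: "0 \<le> Q" "0 \<le> L" using ya by (auto simp: yamada_function_def)
  have m0: "0 \<le> modulus_const K" using K by (simp add: modulus_const_def)
  have c0: "0 \<le> comp_const T K" unfolding comp_const_def using K m0 G0 by (intro add_nonneg_nonneg mult_nonneg_nonneg) auto
  define C where "C = step_const (comp_const T K) Q L"
  have C: "0 \<le> C" unfolding C_def step_const_def using QL c0 by (intro add_nonneg_nonneg mult_nonneg_nonneg divide_nonneg_nonneg) auto
  have "(\<lambda>n. sqrt (1 / 2 ^ n)) \<longlonglongrightarrow> sqrt 0" by (intro tendsto_real_sqrt half_power_tendsto_0)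
  then have "(\<lambda>n. T * (C * sqrt (1 / 2 ^ n))) \<longlonglongrightarrow> T * (C * sqrt 0)" by (intro tendsto_mult tendsto_const)
  from LIMSEQ_D[OF this, of "\<epsilon> / 3"] \<epsilon> obtain n0 where
    n0: "\<And>n. n0 \<le> n \<Longrightarrow> \<bar>T * (C * sqrt (1 / 2 ^ n))\<bar> < \<epsilon> / 3" by auto
  show ?thesis
  proof (rule that[of n0])
    fix n Y I \<rho> k assume n: "n0 \<le> n" and Y: "approx_solution n T K Y I \<rho>" and k: "real k / 2 ^ n \<le> T"
    let ?Z = "\<lambda>\<omega>. Y (real k / 2 ^ n) \<omega> - euler n k \<omega>"
    have zs: "sq_int ?Z" using approx_sq_int(1)[OF Y _ k] euler_second_moment(1) by (intro sq_int_diff) auto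
    have "expectation (\<lambda>\<omega>. \<bar>?Z \<omega>\<bar>) \<le> expectation (\<lambda>\<omega>. \<phi> (?Z \<omega>) + \<epsilon> / 3)"
      using yamada_sq_int(1)[OF ya zs] sq_int_integrable[OF zs] by (intro integral_mono low) auto
    also have "\<dots> = expectation (\<lambda>\<omega>. \<phi> (?Z \<omega>)) + \<epsilon> / 3" using yamada_sq_int(1)[OF ya zs] by (simp add: prob_space)
    also have "\<dots> \<le> real k * (G * \<delta> * (1 / 2 ^ n) + C * (1 / 2 ^ n * sqrt (1 / 2 ^ n))) + \<epsilon> / 3"
      using approx_comparison[OF Y ya k] by (simp add: C_def)
    also have "\<dots> = real k / 2 ^ n * (G * \<delta> + C * sqrt (1 / 2 ^ n)) + \<epsilon> / 3" by (simp add: algebra_simps)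
    also have "\<dots> \<le> T * (G * \<delta> + C * sqrt (1 / 2 ^ n)) + \<epsilon> / 3"
      using k C G0 \<delta> by (intro add_right_mono mult_right_mono) auto
    also have "\<dots> = T * (G * \<delta>) + T * (C * sqrt (1 / 2 ^ n)) + \<epsilon> / 3" by (simp add: algebra_simps)
    also have "\<dots> \<le> \<epsilon> / 3 + \<epsilon> / 3 + \<epsilon> / 3"
    proof (intro add_mono order_refl)
      have "T * (G * \<delta>) = T / (T + 1) * (\<epsilon> / 3)" using G0 by (simp add: \<delta>_def)
      also have "\<dots> \<le> 1 * (\<epsilon> / 3)" using T \<epsilon> by (intro mult_right_mono) auto
      finally show "T * (G * \<delta>) \<le> \<epsilon> / 3" by simp
      show "T * (C * sqrt (1 / 2 ^ n)) \<le> \<epsilon> / 3" using n0[OF n] by linarith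
    qed
    finally show "expectation (\<lambda>\<omega>. \<bar>?Z \<omega>\<bar>) \<le> \<epsilon>" by simp
  qed
qed

end

section \<open>Euler polygons in continuous time\<close>

context wiener_space
begin

lemma step_value_integral:
  assumes "\<And>i. i < n \<Longrightarrow> a i \<le> b i"
  shows "integrable lborel (step_value n a b \<xi> \<omega>)"
    and "integral\<^sup>L lborel (step_value n a b \<xi> \<omega>) = (\<Sum>i<n. \<xi> i \<omega> * (b i - a i))"
proof -
  have i: "integrable lborel (\<lambda>s. \<xi> i \<omega> * indicator {a i<..b i} s)" if "i < n" for i
    using assms[OF that] by simp
  show "integrable lborel (step_value n a b \<xi> \<omega>)"
    unfolding step_value_def[abs_def] using i by (intro Bochner_Integration.integrable_sum) auto
  have "integral\<^sup>L lborel (step_value n a b \<xi> \<omega>) = (\<Sum>i<n. integral\<^sup>L lborel (\<lambda>s. \<xi> i \<omega> * indicator {a i<..b i} s))"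
    unfolding step_value_def[abs_def] using i by (intro Bochner_Integration.integral_sum) auto
  also have "\<dots> = (\<Sum>i<n. \<xi> i \<omega> * (b i - a i))"
    using assms by (intro sum.cong refl) auto
  finally show "integral\<^sup>L lborel (step_value n a b \<xi> \<omega>) = (\<Sum>i<n. \<xi> i \<omega> * (b i - a i))" .
qed

text \<open>On (0, t] the function \<open>dyadic_left l\<close> takes finitely many values, so f can
  be arbitrary. In the proof \<open>undefined\<close> is a dummy sample point, since the step
  function is deterministic.\<close>

lemma dyadic_step_integral:
  fixes f :: "real \<Rightarrow> real"
  assumes t: "0 \<le> t"
  shows "set_integrable lborel {0<..t} (\<lambda>s. f (dyadic_left l s))"
    and "(LBINT s:{0<..t}. f (dyadic_left l s)) =
      (\<Sum>i<dyadic_count l t. f (real i / 2 ^ l) * (min t (real (Suc i) / 2 ^ l) - min t (real i / 2 ^ l)))"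
proof -
  let ?v = "step_value (dyadic_count l t) (\<lambda>i. min t (real i / 2 ^ l)) (\<lambda>i. min t (real (Suc i) / 2 ^ l)) (\<lambda>i (_::'a). f (real i / 2 ^ l)) undefined"
  have p: "partition_upto (dyadic_count l t) (\<lambda>i. real i / 2 ^ l)"
    by (auto simp: partition_upto_def divide_right_mono)
  have le: "min t (real i / 2 ^ l) \<le> min t (real (Suc i) / 2 ^ l)" for i
    by (rule min.mono) (auto simp: divide_right_mono)
  have eq: "indicator {0<..t} s * f (dyadic_left l s) = ?v s" for s
  proof (cases "s \<in> {0<..t}")
    case True
    then obtain i where i: "real i / 2 ^ l < s" "s \<le> real (Suc i) / 2 ^ l" "dyadic_left l s = real i / 2 ^ l"
      using dyadic_left_cell[of s l] by auto
    then show ?thesis using True simple_value_dyadic[OF i(1,2), of t "\<lambda>i (_::'a). f (real i / 2 ^ l)" "undefined::'a"]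
      simple_on_eq[OF p, of "\<lambda>i _. f (real i / 2 ^ l)" t undefined s] by (simp add: simple_on_def)
  next
    case False
    then show ?thesis using simple_on_eq[OF p, of "\<lambda>i _. f (real i / 2 ^ l)" t undefined s] by (simp add: simple_on_def)
  qed
  note sv = step_value_integral[of "dyadic_count l t" "\<lambda>i. min t (real i / 2 ^ l)" "\<lambda>i. min t (real (Suc i) / 2 ^ l)", OF le]
  show "set_integrable lborel {0<..t} (\<lambda>s. f (dyadic_left l s))"
    unfolding set_integrable_def real_scaleR_def eq by (rule sv(1))
  show "(LBINT s:{0<..t}. f (dyadic_left l s)) =
      (\<Sum>i<dyadic_count l t. f (real i / 2 ^ l) * (min t (real (Suc i) / 2 ^ l) - min t (real i / 2 ^ l)))"
    unfolding set_lebesgue_integral_def real_scaleR_def eq by (rule sv(2))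
qed

end

context monotone_sde
begin

text \<open>Between grid points the scheme is continued with W itself rather than linearly, so that
  it solves the equation with frozen coefficients at every time. A grid point t > 0 is computed from
  the cell that ends there.\<close>

definition euler_process :: "nat \<Rightarrow> real \<Rightarrow> 'a \<Rightarrow> real" where
  "euler_process n t \<omega> = (let k = nat (\<lceil>t * 2 ^ n\<rceil> - 1) in
     euler n k \<omega> + \<mu> (euler n k \<omega>) * (t - real k / 2 ^ n) + \<tau> (euler n k \<omega>) * (W t \<omega> - W (real k / 2 ^ n) \<omega>))"

lemma euler_process_cell_open:
  assumes "real k / 2 ^ n < t" "t \<le> real (Suc k) / 2 ^ n"
  shows "euler_process n t \<omega> = euler n k \<omega> + \<mu> (euler n k \<omega>) * (t - real k / 2 ^ n) +
    \<tau> (euler n k \<omega>) * (W t \<omega> - W (real k / 2 ^ n) \<omega>)"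
proof -
  have "\<lceil>t * 2 ^ n\<rceil> = int k + 1"
    using assms by (intro ceiling_unique) (auto simp: field_simps)
  then show ?thesis by (simp add: euler_process_def)
qed

lemma euler_process_grid: "euler_process n (real k / 2 ^ n) \<omega> = euler n k \<omega>"
proof (cases k)
  case 0
  then show ?thesis by (simp add: euler_process_def)
next
  case (Suc j)
  have "real j / 2 ^ n < real (Suc j) / 2 ^ n" by (simp add: divide_strict_right_mono)
  then have "euler_process n (real (Suc j) / 2 ^ n) \<omega> = euler n j \<omega> + \<mu> (euler n j \<omega>) * (real (Suc j) / 2 ^ n - real j / 2 ^ n) +
    \<tau> (euler n j \<omega>) * (W (real (Suc j) / 2 ^ n) \<omega> - W (real j / 2 ^ n) \<omega>)"
    by (rule euler_process_cell_open) simp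
  also have "real (Suc j) / 2 ^ n - real j / 2 ^ n = 1 / 2 ^ n" by (simp add: diff_divide_distrib[symmetric])
  finally show ?thesis by (simp add: Suc)
qed

text \<open>The formula of a cell extends to its left end, where the definition uses the preceding
  cell.\<close>

lemma euler_process_cell:
  assumes "real k / 2 ^ n \<le> t" "t \<le> real (Suc k) / 2 ^ n"
  shows "euler_process n t \<omega> = euler n k \<omega> + \<mu> (euler n k \<omega>) * (t - real k / 2 ^ n) +
    \<tau> (euler n k \<omega>) * (W t \<omega> - W (real k / 2 ^ n) \<omega>)"
proof (cases "t = real k / 2 ^ n")
  case True
  then show ?thesis by (simp add: euler_process_grid)
next
  case False
  then show ?thesis using assms by (intro euler_process_cell_open) auto
qed

text \<open>The \<sigma>-algebra N is arbitrary so that one induction serves both the given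
  filtration and the augmented filtration of W; the latter is what makes the limit a strong
  solution.\<close>

lemma euler_measurable_of_W:
  assumes W: "\<And>s. 0 \<le> s \<Longrightarrow> s \<le> t \<Longrightarrow> W s \<in> borel_measurable N" and k: "real k / 2 ^ n \<le> t"
  shows "euler n k \<in> borel_measurable N"
  using k
proof (induction k)
  case (Suc k)
  have le: "real k / 2 ^ n \<le> real (Suc k) / 2 ^ n" by (simp add: divide_right_mono)
  then have [measurable]: "euler n k \<in> borel_measurable N" using Suc by linarith
  have [measurable]: "W (real (Suc k) / 2 ^ n) \<in> borel_measurable N" "W (real k / 2 ^ n) \<in> borel_measurable N"
    using Suc.prems le by (auto intro!: W simp del: of_nat_Suc)
  show ?case unfolding euler_Suc by measurable
qed (simp add: euler.simps(1)[abs_def])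

lemma euler_process_measurable_of_W:
  assumes W: "\<And>s. 0 \<le> s \<Longrightarrow> s \<le> t \<Longrightarrow> W s \<in> borel_measurable N" and t: "0 \<le> t"
  shows "euler_process n t \<in> borel_measurable N"
proof (cases "t = 0")
  case True
  then have "euler_process n t = euler n 0" using euler_process_grid[of n 0] by (simp add: fun_eq_iff)
  then show ?thesis using euler_measurable_of_W[OF W, where k=0 and n=n and t=t] t by simp
next
  case False
  then obtain k where k: "real k / 2 ^ n < t" "t \<le> real (Suc k) / 2 ^ n" using dyadic_left_cell[of t n] t by auto
  have [measurable]: "euler n k \<in> borel_measurable N" using euler_measurable_of_W[OF W, where k=k and n=n and t=t] k by simp
  have [measurable]: "W t \<in> borel_measurable N" "W (real k / 2 ^ n) \<in> borel_measurable N"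
    using k t by (auto intro!: W)
  have "euler_process n t = (\<lambda>\<omega>. euler n k \<omega> + \<mu> (euler n k \<omega>) * (t - real k / 2 ^ n) +
    \<tau> (euler n k \<omega>) * (W t \<omega> - W (real k / 2 ^ n) \<omega>))"
    using euler_process_cell_open[OF k] by (simp add: fun_eq_iff)
  also have "\<dots> \<in> borel_measurable N" by measurable
  finally show ?thesis .
qed

lemma euler_process_adapted: "adapted F (euler_process n)"
  unfolding adapted_def by (intro allI impI euler_process_measurable_of_W W_measurable_F)

lemma euler_process_second_moment:
  assumes t: "0 \<le> t"
  shows "sq_int (euler_process n t)"
    and "expectation (\<lambda>\<omega>. (euler_process n t \<omega>)\<^sup>2) \<le> exp (growth * t) * (1 + x\<^sub>0\<^sup>2)"
proof -
  have g: "0 \<le> growth" by (simp add: growth_def)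
  have "sq_int (euler_process n t) \<and> 1 + expectation (\<lambda>\<omega>. (euler_process n t \<omega>)\<^sup>2) \<le> exp (growth * t) * (1 + x\<^sub>0\<^sup>2)"
  proof (cases "t = 0")
    case True
    then have "euler_process n t = euler n 0" using euler_process_grid[of n 0] by (simp add: fun_eq_iff)
    then show ?thesis using euler_second_moment[of n 0] True by simp
  next
    case False
    then obtain k where k: "real k / 2 ^ n < t" "t \<le> real (Suc k) / 2 ^ n" using dyadic_left_cell[of t n] t by auto
    define s where "s = real k / 2 ^ n"
    have "real (Suc k) / 2 ^ n = s + 1 / 2 ^ n" by (simp add: s_def add_divide_distrib)
    moreover have "(1::real) / 2 ^ n \<le> 1" by simp
    ultimately have st: "0 \<le> s" "s \<le> t" "t \<le> s + 1" using k unfolding s_def by (simp, linarith, linarith)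
    have eq: "euler_process n t = (\<lambda>\<omega>. euler n k \<omega> + \<mu> (euler n k \<omega>) * (t - s) + \<tau> (euler n k \<omega>) * (W t \<omega> - W s \<omega>))"
      using euler_process_cell_open[OF k] by (simp add: fun_eq_iff s_def)
    note m = euler_step_second_moment[OF euler_measurable_F[of n k, folded s_def] euler_second_moment(1) st]
    have "1 + expectation (\<lambda>\<omega>. (euler_process n t \<omega>)\<^sup>2) \<le> (1 + growth * (t - s)) * (1 + expectation (\<lambda>\<omega>. (euler n k \<omega>)\<^sup>2))"
      unfolding eq by (rule m(2))
    also have "\<dots> \<le> exp (growth * (t - s)) * (exp (growth * s) * (1 + x\<^sub>0\<^sup>2))"
      using euler_second_moment(2)[of n k] g st exp_ge_add_one_self[of "growth * (t - s)"]
      by (intro mult_mono) (auto simp: s_def intro!: add_nonneg_nonneg integral_nonneg_AE)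
    also have "\<dots> = exp (growth * t) * (1 + x\<^sub>0\<^sup>2)"
    proof -
      have "growth * t = growth * (t - s) + growth * s" by (simp add: algebra_simps)
      then show ?thesis by (simp only: exp_add mult.assoc)
    qed
    finally show ?thesis unfolding eq using m(1) by blast
  qed
  then show "sq_int (euler_process n t)"
    and "expectation (\<lambda>\<omega>. (euler_process n t \<omega>)\<^sup>2) \<le> exp (growth * t) * (1 + x\<^sub>0\<^sup>2)" by auto
qed

lemma euler_process_sum:
  assumes t: "0 \<le> t"
  shows "x\<^sub>0 + (\<Sum>i<dyadic_count n t. \<mu> (euler n i \<omega>) * (min t (real (Suc i) / 2 ^ n) - min t (real i / 2 ^ n))) +
     (\<Sum>i<dyadic_count n t. \<tau> (euler n i \<omega>) * (W (min t (real (Suc i) / 2 ^ n)) \<omega> - W (min t (real i / 2 ^ n)) \<omega>)) = euler_process n t \<omega>"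
proof -
  have tel: "x\<^sub>0 + (\<Sum>i<k. \<mu> (euler n i \<omega>) * (real (Suc i) / 2 ^ n - real i / 2 ^ n)) +
      (\<Sum>i<k. \<tau> (euler n i \<omega>) * (W (real (Suc i) / 2 ^ n) \<omega> - W (real i / 2 ^ n) \<omega>)) = euler n k \<omega>" for k
  proof (induction k)
    case (Suc k)
    have "real (Suc k) / 2 ^ n - real k / 2 ^ n = 1 / 2 ^ n" by (simp add: diff_divide_distrib[symmetric])
    then show ?case using Suc by (simp del: of_nat_Suc)
  qed simp
  show "x\<^sub>0 + (\<Sum>i<dyadic_count n t. \<mu> (euler n i \<omega>) * (min t (real (Suc i) / 2 ^ n) - min t (real i / 2 ^ n))) +
     (\<Sum>i<dyadic_count n t. \<tau> (euler n i \<omega>) * (W (min t (real (Suc i) / 2 ^ n)) \<omega> - W (min t (real i / 2 ^ n)) \<omega>)) = euler_process n t \<omega>"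
  proof (cases "dyadic_count n t")
    case 0
    then have "t = 0" using t dyadic_count_ge[of n t 0] by simp
    then show ?thesis using 0 euler_process_grid[of n 0 \<omega>] by simp
  next
    case (Suc k)
    have k: "real k / 2 ^ n < t" "t \<le> real (Suc k) / 2 ^ n"
      using dyadic_count_less[of k n t] dyadic_count_ge[of n t "Suc k"] Suc by auto
    have m: "min t (real i / 2 ^ n) = real i / 2 ^ n" if "i \<le> k" for i
    proof -
      have "real i / 2 ^ n \<le> real k / 2 ^ n" using that by (simp add: divide_right_mono)
      then show ?thesis using k by simp
    qed
    have "min t (real (Suc k) / 2 ^ n) = t" using k by simp
    then show ?thesis
      unfolding Suc sum.lessThan_Suc euler_process_cell_open[OF k] using tel[of k] m
      by (simp del: of_nat_Suc add: algebra_simps)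
  qed
qed

text \<open>The polygon solves the equation with coefficients frozen at the preceding grid point,
  and its noise part is exactly a left-point sum of its own diffusion coefficient.\<close>

lemma euler_process_formula:
  assumes t: "0 \<le> t"
  shows "euler_process n t \<omega> = x\<^sub>0 + (LBINT s:{0<..t}. \<mu> (euler_process n (dyadic_left n s) \<omega>)) +
    dyadic_integral n (\<lambda>t \<omega>. \<tau> (euler_process n t \<omega>)) t \<omega>"
  unfolding dyadic_step_integral(2)[OF t, where l=n and f="\<lambda>r. \<mu> (euler_process n r \<omega>)"]
    dyadic_integral_def simple_integral_def euler_process_grid using euler_process_sum[OF t, of n \<omega>]
  by (simp del: of_nat_Suc)

definition euler_moment :: "real \<Rightarrow> real" where "euler_moment T = exp (growth * T) * (1 + x\<^sub>0\<^sup>2)"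

lemma \<tau>_adapted: "adapted F X \<Longrightarrow> adapted F (\<lambda>t \<omega>. \<tau> (X t \<omega>))"
  unfolding adapted_def using measurable_compose[OF _ \<tau>_measurable] by blast

text \<open>The source of the Cauchy property of the scheme: a finer polygon counts as an
  approximate solution on the coarser grid, with a moment bound common to all m.\<close>

lemma euler_process_approx_solution:
  assumes nm: "n \<le> m" and T: "0 \<le> T"
  shows "approx_solution n T (euler_moment T) (euler_process m) (dyadic_integral m (\<lambda>t \<omega>. \<tau> (euler_process m t \<omega>))) (dyadic_left m)"
  unfolding approx_solution_def
proof (intro conjI allI impI ballI)
  show "adapted F (euler_process m)" by (rule euler_process_adapted)
  show "sq_int (euler_process m t)" if "0 \<le> t" for t by (rule euler_process_second_moment[OF that])
  show "expectation (\<lambda>\<omega>. (euler_process m t \<omega>)\<^sup>2) \<le> euler_moment T" if "0 \<le> t" "t \<le> T" for t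
  proof -
    have "growth * t \<le> growth * T" by (rule mult_left_mono[OF that(2)]) (simp add: growth_def)
    then have "exp (growth * t) * (1 + x\<^sub>0\<^sup>2) \<le> euler_moment T" unfolding euler_moment_def by (intro mult_right_mono) auto
    then show ?thesis using euler_process_second_moment(2)[OF that(1), of m] by linarith
  qed
  show "AE \<omega> in M. euler_process m 0 \<omega> = x\<^sub>0" using euler_process_grid[of m 0] by simp
  show "ito_like n G (\<lambda>t \<omega>. \<tau> (euler_process m t \<omega>)) (dyadic_integral m (\<lambda>t \<omega>. \<tau> (euler_process m t \<omega>)))"
    by (rule dyadic_integral_ito_like[OF \<tau>_adapted[OF euler_process_adapted] \<tau>_bounded nm])
  have left: "euler_process m (dyadic_left m s) \<omega> = euler m (nat (\<lceil>s * 2 ^ m\<rceil> - 1)) \<omega>" for s \<omega>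
    unfolding dyadic_left_def by (rule euler_process_grid)
  show "(\<lambda>(\<omega>, s). indicator {0..T} s * euler_process m (dyadic_left m s) \<omega>) \<in> borel_measurable (M \<Otimes>\<^sub>M lborel)"
  proof -
    have [measurable]: "euler m i \<in> borel_measurable M" for i by (rule sq_int_measurable[OF euler_second_moment(1)])
    have [measurable]: "(\<lambda>x :: 'a \<times> real. \<lceil>snd x * 2 ^ m\<rceil>) \<in> M \<Otimes>\<^sub>M lborel \<rightarrow>\<^sub>M count_space UNIV"
      by measurable
    have "(\<lambda>x :: 'a \<times> real. euler m (nat (\<lceil>snd x * 2 ^ m\<rceil> - 1)) (fst x)) \<in> borel_measurable (M \<Otimes>\<^sub>M lborel)"
      by measurable
    then have [measurable]: "(\<lambda>x. euler_process m (dyadic_left m (snd x)) (fst x)) \<in> borel_measurable (M \<Otimes>\<^sub>M lborel)"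
      by (simp add: left)
    show ?thesis unfolding split_beta' by measurable
  qed
  show "\<exists>c. \<forall>s\<in>{0..T}. \<bar>euler_process m (dyadic_left m s) \<omega>\<bar> \<le> c" for \<omega>
  proof (intro exI ballI)
    fix s assume s: "s \<in> {0..T}"
    let ?i = "nat (\<lceil>s * 2 ^ m\<rceil> - 1)"
    have "\<lceil>s * 2 ^ m\<rceil> \<le> \<lceil>T * 2 ^ m\<rceil>" using s by (intro ceiling_mono mult_right_mono) auto
    then have "?i \<le> nat \<lceil>T * 2 ^ m\<rceil>" by (intro nat_mono) simp
    then have i: "?i \<in> {..nat \<lceil>T * 2 ^ m\<rceil>}" by simp
    show "\<bar>euler_process m (dyadic_left m s) \<omega>\<bar> \<le> (\<Sum>i\<le>nat \<lceil>T * 2 ^ m\<rceil>. \<bar>euler m i \<omega>\<bar>)"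
      unfolding left by (rule member_le_sum[OF i, of "\<lambda>i. \<bar>euler m i \<omega>\<bar>"]) auto
  qed
  show "real k / 2 ^ n \<le> dyadic_left m s" "dyadic_left m s \<le> s" if "real k / 2 ^ n < s" for k s
  proof -
    show "real k / 2 ^ n \<le> dyadic_left m s" by (rule dyadic_left_ge[OF nm that])
    have "0 \<le> real k / 2 ^ n" by simp
    then have "0 \<le> s" using that by linarith
    then show "dyadic_left m s \<le> s" by (rule dyadic_left_bounds)
  qed
  show "AE \<omega> in M. euler_process m t \<omega> = euler_process m (real k / 2 ^ n) \<omega> +
      (LBINT s:{real k / 2 ^ n<..t}. \<mu> (euler_process m (dyadic_left m s) \<omega>)) +
      (dyadic_integral m (\<lambda>t \<omega>. \<tau> (euler_process m t \<omega>)) t \<omega> - dyadic_integral m (\<lambda>t \<omega>. \<tau> (euler_process m t \<omega>)) (real k / 2 ^ n) \<omega>)"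
    if kt: "real k / 2 ^ n \<le> t" for k t
  proof (intro AE_I2)
    fix \<omega>
    define s where "s = real k / 2 ^ n"
    have s: "0 \<le> s" "s \<le> t" "0 \<le> t" using kt by (auto simp: s_def intro: order_trans[of 0 "real k / 2 ^ n"])
    have U: "{0<..t} = {0<..s} \<union> {s<..t}" using s by auto
    note i = dyadic_step_integral(1)[OF s(3), where l=m and f="\<lambda>r. \<mu> (euler_process m r \<omega>)"]
    have "(LBINT r:{0<..t}. \<mu> (euler_process m (dyadic_left m r) \<omega>)) =
      (LBINT r:{0<..s}. \<mu> (euler_process m (dyadic_left m r) \<omega>)) + (LBINT r:{s<..t}. \<mu> (euler_process m (dyadic_left m r) \<omega>))"
      unfolding U by (rule set_integral_Un) (use s in \<open>auto intro: set_integrable_subset[OF i]\<close>)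
    then show "euler_process m t \<omega> = euler_process m (real k / 2 ^ n) \<omega> +
      (LBINT s:{real k / 2 ^ n<..t}. \<mu> (euler_process m (dyadic_left m s) \<omega>)) +
      (dyadic_integral m (\<lambda>t \<omega>. \<tau> (euler_process m t \<omega>)) t \<omega> - dyadic_integral m (\<lambda>t \<omega>. \<tau> (euler_process m t \<omega>)) (real k / 2 ^ n) \<omega>)"
      using euler_process_formula[OF s(3), of m \<omega>] euler_process_formula[OF s(1), of m \<omega>]
      unfolding s_def[symmetric] by linarith
  qed
qed

text \<open>Times off the grid are moved to the grid by the modulus of Y. The polygon is taken at
  \<open>dyadic_left n t\<close>, where its coefficients are frozen, because the supremum estimate
  works with exactly these values.\<close>

lemma euler_process_cauchy:
  assumes \<epsilon>: "0 < \<epsilon>" and T: "0 \<le> T" and K: "0 \<le> K"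
  obtains n0 where "\<And>n Y I \<rho> t. n0 \<le> n \<Longrightarrow> approx_solution n T K Y I \<rho> \<Longrightarrow> 0 \<le> t \<Longrightarrow> t \<le> T \<Longrightarrow>
    expectation (\<lambda>\<omega>. \<bar>Y t \<omega> - euler_process n (dyadic_left n t) \<omega>\<bar>) \<le> \<epsilon>"
proof -
  have "0 < \<epsilon> / 2" using \<epsilon> by simp
  from euler_converges[OF this T K] obtain n0 where
    n0: "\<And>n Y I \<rho> k. n0 \<le> n \<Longrightarrow> approx_solution n T K Y I \<rho> \<Longrightarrow> real k / 2 ^ n \<le> T \<Longrightarrow>
      expectation (\<lambda>\<omega>. \<bar>Y (real k / 2 ^ n) \<omega> - euler n k \<omega>\<bar>) \<le> \<epsilon> / 2" by blast
  have "(\<lambda>n. sqrt (modulus_const K * 1 / 2 ^ n)) \<longlonglongrightarrow> sqrt 0" by (intro tendsto_real_sqrt half_power_tendsto_0)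
  from LIMSEQ_D[OF this \<open>0 < \<epsilon> / 2\<close>] obtain n1 where
    n1: "\<And>n. n1 \<le> n \<Longrightarrow> \<bar>sqrt (modulus_const K * 1 / 2 ^ n)\<bar> < \<epsilon> / 2" by auto
  show ?thesis
  proof (rule that[of "max n0 n1"])
    fix n Y I \<rho> t assume n: "max n0 n1 \<le> n" and Y: "approx_solution n T K Y I \<rho>" and t: "0 \<le> t" "t \<le> T"
    define k where "k = nat (\<lceil>t * 2 ^ n\<rceil> - 1)"
    have s: "dyadic_left n t = real k / 2 ^ n" by (simp add: dyadic_left_def k_def)
    have st: "real k / 2 ^ n \<le> t" "t \<le> real k / 2 ^ n + 1 / 2 ^ n" "0 \<le> real k / 2 ^ n"
      using dyadic_left_bounds[OF t(1), of n] unfolding s by linarith+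
    have kT: "real k / 2 ^ n \<le> T" using st t by linarith
    note ys = approx_sq_int(1)[OF Y t] approx_sq_int(1)[OF Y st(3) kT]
    have i: "integrable M (\<lambda>\<omega>. \<bar>Y t \<omega> - Y (real k / 2 ^ n) \<omega>\<bar>)"
      "integrable M (\<lambda>\<omega>. \<bar>Y (real k / 2 ^ n) \<omega> - euler n k \<omega>\<bar>)"
      using sq_int_integrable[OF sq_int_diff[OF ys]] sq_int_integrable[OF sq_int_diff[OF ys(2) euler_second_moment(1)]] by auto
    have "expectation (\<lambda>\<omega>. \<bar>Y t \<omega> - euler n k \<omega>\<bar>) \<le> expectation (\<lambda>\<omega>. \<bar>Y t \<omega> - Y (real k / 2 ^ n) \<omega>\<bar> + \<bar>Y (real k / 2 ^ n) \<omega> - euler n k \<omega>\<bar>)"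
      using i by (intro integral_mono') auto
    also have "\<dots> \<le> sqrt (modulus_const K * (1 / 2 ^ n)) + \<epsilon> / 2"
      using i approx_modulus_abs[OF Y refl st(1) t(2) st(2)] n0[OF _ Y kT] n by simp
    also have "\<dots> \<le> \<epsilon>" using n1[of n] n by simp
    finally show "expectation (\<lambda>\<omega>. \<bar>Y t \<omega> - euler_process n (dyadic_left n t) \<omega>\<bar>) \<le> \<epsilon>"
      unfolding s euler_process_grid .
  qed
qed

end

section \<open>Locally uniform convergence along a subsequence\<close>

lemma continuous_on_halfline:
  fixes f :: "real \<Rightarrow> real"
  assumes c: "\<And>K. continuous_on {0..real K} f"
  shows "continuous_on {0..} f"
  unfolding continuous_on_eq_continuous_within
proof
  fix t :: real assume t: "t \<in> {0..}"
  obtain K where K: "t < real K" using reals_Archimedean2 by blast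
  have "continuous (at t within {0..real K}) f"
    using c[of K] t K by (auto simp: continuous_on_eq_continuous_within)
  moreover have "at t within {0..real K} = at t within {0..}"
    by (rule at_within_nhd[of t "{..<real K}"]) (use K in auto)
  ultimately show "continuous (at t within {0..}) f" by simp
qed

lemma dyadic_grid_le:
  assumes "m \<le> r" "real k / 2 ^ m < real (Suc i) / 2 ^ r"
  shows "real k / 2 ^ m \<le> real i / 2 ^ r"
proof -
  have "real (k * 2 ^ (r - m)) / 2 ^ r < real (Suc i) / 2 ^ r" using assms dyadic_refine[OF assms(1), of k] by simp
  then have "k * 2 ^ (r - m) < Suc i" by (simp add: divide_less_cancel del: of_nat_mult of_nat_Suc)
  then show ?thesis unfolding dyadic_refine[OF assms(1), of k]
    by (intro divide_right_mono) (auto simp: less_Suc_eq_le simp del: of_nat_mult)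
qed

context monotone_sde
begin

text \<open>The value at which the polygon of mesh \<open>1 / 2 ^ m\<close> freezes its coefficients
  during the i-th cell of a finer grid of mesh \<open>1 / 2 ^ r\<close>. It is read off at the right
  end of the fine cell, because cells are closed on the right and the left end may belong to the
  preceding coarse cell.\<close>

definition frozen :: "nat \<Rightarrow> nat \<Rightarrow> nat \<Rightarrow> 'a \<Rightarrow> real" where
  "frozen r m i = euler_process m (dyadic_left m (real (Suc i) / 2 ^ r))"

lemma euler_process_refine:
  assumes mr: "m \<le> r"
  shows "euler_process m (real (Suc i) / 2 ^ r) \<omega> - euler_process m (real i / 2 ^ r) \<omega> =
      \<mu> (frozen r m i \<omega>) * (1 / 2 ^ r) + \<tau> (frozen r m i \<omega>) * (W (real (Suc i) / 2 ^ r) \<omega> - W (real i / 2 ^ r) \<omega>)"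
    and "frozen r m i \<in> borel_measurable (F (real i / 2 ^ r))" "sq_int (frozen r m i)"
proof -
  let ?t = "real (Suc i) / 2 ^ r" and ?s = "real i / 2 ^ r"
  have "0 < ?t" by simp
  from dyadic_left_cell[OF this, of m] obtain k where
    k: "real k / 2 ^ m < ?t" "?t \<le> real (Suc k) / 2 ^ m" "dyadic_left m ?t = real k / 2 ^ m" by blast
  have ks: "real k / 2 ^ m \<le> ?s" by (rule dyadic_grid_le[OF mr k(1)])
  have st: "?t - ?s = 1 / 2 ^ r" by (simp add: diff_divide_distrib[symmetric])
  have "?s \<le> ?t" by (simp add: divide_right_mono)
  then have s': "?s \<le> real (Suc k) / 2 ^ m" using k(2) by linarith
  have fr: "frozen r m i = euler m k" unfolding frozen_def k(3) by (simp add: fun_eq_iff euler_process_grid)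
  have "\<mu> (euler m k \<omega>) * (?t - real k / 2 ^ m) - \<mu> (euler m k \<omega>) * (?s - real k / 2 ^ m) = \<mu> (euler m k \<omega>) * (1 / 2 ^ r)"
    unfolding st[symmetric] by (simp only: right_diff_distrib)
  then show "euler_process m ?t \<omega> - euler_process m ?s \<omega> =
      \<mu> (frozen r m i \<omega>) * (1 / 2 ^ r) + \<tau> (frozen r m i \<omega>) * (W ?t \<omega> - W ?s \<omega>)"
    unfolding euler_process_cell_open[OF k(1,2)] euler_process_cell[OF ks s'] fr right_diff_distrib by linarith
  show "frozen r m i \<in> borel_measurable (F ?s)"
    unfolding fr by (rule F_measurable_mono[OF euler_measurable_F _ ks]) simp
  show "sq_int (frozen r m i)" unfolding fr by (rule euler_second_moment)
qed

text \<open>On a common refinement both polygons move by Euler steps with frozen values, so their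
  difference is a drift sum plus a martingale transform of W.\<close>

lemma euler_process_difference:
  assumes "m \<le> r" "n \<le> r"
  shows "euler_process m (real j / 2 ^ r) \<omega> - euler_process n (real j / 2 ^ r) \<omega> =
    (\<Sum>i<j. (\<mu> (frozen r m i \<omega>) - \<mu> (frozen r n i \<omega>)) * (1 / 2 ^ r)) +
    msum (\<lambda>i. real i / 2 ^ r) (\<lambda>i \<omega>. \<tau> (frozen r m i \<omega>) - \<tau> (frozen r n i \<omega>)) j \<omega>"
proof (induction j)
  case 0
  show ?case using euler_process_grid[of m 0 \<omega>] euler_process_grid[of n 0 \<omega>] by simp
next
  case (Suc j)
  have d: "(a - b) * c = a * c - b * c" for a b c :: real by (simp add: algebra_simps)
  show ?case
    using Suc euler_process_refine(1)[OF assms(1), of j \<omega>] euler_process_refine(1)[OF assms(2), of j \<omega>]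
    unfolding msum_Suc sum.lessThan_Suc d by linarith
qed

text \<open>The drift part stays below a sum D of nonnegative terms, to which Markov's inequality
  applies; the martingale part falls under Kolmogorov's inequality, with a variance linear in q
  thanks to \<open>\<tau>_holder\<close>. The bound does not involve r, the fineness of the grid on
  which the maximum is taken.\<close>

lemma euler_process_grid_sup:
  assumes mr: "m \<le> r" "n \<le> r" and q: "\<And>t. 0 \<le> t \<Longrightarrow> t \<le> real T \<Longrightarrow>
      expectation (\<lambda>\<omega>. \<bar>euler_process m (dyadic_left m t) \<omega> - euler_process n (dyadic_left n t) \<omega>\<bar>) \<le> q"
    and e: "0 < e"
  shows "prob {\<omega> \<in> space M. \<exists>j\<le>T * 2 ^ r. 2 * e \<le> \<bar>euler_process m (real j / 2 ^ r) \<omega> - euler_process n (real j / 2 ^ r) \<omega>\<bar>} \<le>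
    real T * (G * q) / e + real T * (G * q) / e\<^sup>2"
proof -
  define N where "N = T * 2 ^ r"
  define h where "h = (1::real) / 2 ^ r"
  have h: "0 \<le> h" and Nh: "real N * h = real T" by (simp_all add: h_def N_def)
  let ?c = "frozen r m" and ?c' = "frozen r n"
  have qi: "expectation (\<lambda>\<omega>. \<bar>?c i \<omega> - ?c' i \<omega>\<bar>) \<le> q" if "i < N" for i
  proof -
    have "real (Suc i) / 2 ^ r \<le> real N / 2 ^ r" using that by (intro divide_right_mono) auto
    then have "real (Suc i) / 2 ^ r \<le> real T" by (simp add: N_def)
    then show ?thesis unfolding frozen_def by (intro q) auto
  qed
  have cs: "sq_int (\<lambda>\<omega>. ?c i \<omega> - ?c' i \<omega>)" for i
    by (intro sq_int_diff euler_process_refine(3) mr)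
  have ci: "integrable M (\<lambda>\<omega>. \<bar>?c i \<omega> - ?c' i \<omega>\<bar>)" for i
    using sq_int_integrable[OF cs] by simp
  define D where "D \<omega> = (\<Sum>i<N. G * \<bar>?c i \<omega> - ?c' i \<omega>\<bar> * h)" for \<omega>
  have Di: "integrable M D" unfolding D_def using ci by auto
  have D0: "0 \<le> D \<omega>" for \<omega> unfolding D_def using G_ge_1 h by (intro sum_nonneg mult_nonneg_nonneg) auto
  have ED: "expectation D \<le> real T * (G * q)"
  proof -
    have "expectation D = (\<Sum>i<N. G * expectation (\<lambda>\<omega>. \<bar>?c i \<omega> - ?c' i \<omega>\<bar>) * h)"
      unfolding D_def using ci by (subst Bochner_Integration.integral_sum) auto
    also have "\<dots> \<le> (\<Sum>i<N. G * q * h)"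
      using qi G_ge_1 h by (intro sum_mono mult_right_mono mult_left_mono) auto
    also have "\<dots> = (real N * h) * (G * q)" by (simp add: mult.commute mult.left_commute)
    finally show ?thesis unfolding Nh .
  qed
  define \<eta> where "\<eta> i \<omega> = \<tau> (?c i \<omega>) - \<tau> (?c' i \<omega>)" for i \<omega>
  have p: "partition_upto N (\<lambda>i. real i / 2 ^ r)" by (auto simp: partition_upto_def divide_right_mono)
  have \<eta>F: "\<eta> i \<in> borel_measurable (F (real i / 2 ^ r))" for i
    unfolding \<eta>_def using measurable_compose[OF euler_process_refine(2)[OF mr(1)] \<tau>_measurable]
      measurable_compose[OF euler_process_refine(2)[OF mr(2)] \<tau>_measurable] by (rule borel_measurable_diff)
  have \<eta>s: "sq_int (\<eta> i)" for i
    unfolding \<eta>_def by (intro sq_int_diff \<tau>_sq_int sq_int_measurable[OF euler_process_refine(3)] mr)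
  have E\<eta>: "expectation (\<lambda>\<omega>. (\<eta> i \<omega>)\<^sup>2) \<le> G * q" if "i < N" for i
  proof -
    have "expectation (\<lambda>\<omega>. (\<eta> i \<omega>)\<^sup>2) \<le> expectation (\<lambda>\<omega>. G * \<bar>?c i \<omega> - ?c' i \<omega>\<bar>)"
      unfolding \<eta>_def using ci G_ge_1 by (intro integral_mono' \<tau>_holder) auto
    also have "\<dots> \<le> G * q" using qi[OF that] G_ge_1 by simp
    finally show ?thesis .
  qed
  have "prob {\<omega> \<in> space M. \<exists>j\<le>N. e \<le> \<bar>msum (\<lambda>i. real i / 2 ^ r) \<eta> j \<omega>\<bar>} \<le>
    (\<Sum>i<N. expectation (\<lambda>\<omega>. (\<eta> i \<omega>)\<^sup>2) * (real (Suc i) / 2 ^ r - real i / 2 ^ r)) / e\<^sup>2"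
    by (rule msum_maximal[OF p \<eta>F \<eta>s e])
  also have "\<dots> \<le> (\<Sum>i<N. (G * q) * h) / e\<^sup>2"
  proof (intro divide_right_mono sum_mono)
    fix i assume "i \<in> {..<N}"
    moreover have "real (Suc i) / 2 ^ r - real i / 2 ^ r = h" by (simp add: h_def diff_divide_distrib[symmetric])
    ultimately show "expectation (\<lambda>\<omega>. (\<eta> i \<omega>)\<^sup>2) * (real (Suc i) / 2 ^ r - real i / 2 ^ r) \<le> (G * q) * h"
      using mult_right_mono[OF E\<eta> h, of i] by simp
  qed simp
  also have "(\<Sum>i<N. (G * q) * h) = (real N * h) * (G * q)" by (simp add: mult.commute mult.left_commute)
  finally have PM: "prob {\<omega> \<in> space M. \<exists>j\<le>N. e \<le> \<bar>msum (\<lambda>i. real i / 2 ^ r) \<eta> j \<omega>\<bar>} \<le> real T * (G * q) / e\<^sup>2"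
    unfolding Nh .
  have PD: "prob {\<omega> \<in> space M. e \<le> D \<omega>} \<le> real T * (G * q) / e"
  proof -
    have "prob {\<omega> \<in> space M. e \<le> D \<omega>} \<le> expectation D / e"
      using Di D0 e by (intro integral_Markov_inequality_measure[where A="{}"]) auto
    also have "\<dots> \<le> real T * (G * q) / e" using ED e by (intro divide_right_mono) auto
    finally show ?thesis .
  qed
  have mm: "msum (\<lambda>i. real i / 2 ^ r) \<eta> j \<in> borel_measurable M" for j
  proof -
    have "partition_upto j (\<lambda>i. real i / 2 ^ r)" by (auto simp: partition_upto_def divide_right_mono)
    from sq_int_measurable[OF msum_sq_int[OF this \<eta>F \<eta>s]] show ?thesis .
  qed
  have ms: "{\<omega> \<in> space M. \<exists>j\<le>N. e \<le> \<bar>msum (\<lambda>i. real i / 2 ^ r) \<eta> j \<omega>\<bar>} \<in> sets M" "{\<omega> \<in> space M. e \<le> D \<omega>} \<in> sets M"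
    using mm Di by measurable
  have "{\<omega> \<in> space M. \<exists>j\<le>N. 2 * e \<le> \<bar>euler_process m (real j / 2 ^ r) \<omega> - euler_process n (real j / 2 ^ r) \<omega>\<bar>} \<subseteq>
    {\<omega> \<in> space M. e \<le> D \<omega>} \<union> {\<omega> \<in> space M. \<exists>j\<le>N. e \<le> \<bar>msum (\<lambda>i. real i / 2 ^ r) \<eta> j \<omega>\<bar>}"
  proof
    fix \<omega> assume "\<omega> \<in> {\<omega> \<in> space M. \<exists>j\<le>N. 2 * e \<le> \<bar>euler_process m (real j / 2 ^ r) \<omega> - euler_process n (real j / 2 ^ r) \<omega>\<bar>}"
    then obtain j where \<omega>: "\<omega> \<in> space M" and j: "j \<le> N" "2 * e \<le> \<bar>euler_process m (real j / 2 ^ r) \<omega> - euler_process n (real j / 2 ^ r) \<omega>\<bar>" by blast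
    have "\<bar>\<Sum>i<j. (\<mu> (?c i \<omega>) - \<mu> (?c' i \<omega>)) * (1 / 2 ^ r)\<bar> \<le> (\<Sum>i<j. \<bar>(\<mu> (?c i \<omega>) - \<mu> (?c' i \<omega>)) * h\<bar>)"
      unfolding h_def by (rule sum_abs)
    also have "\<dots> \<le> (\<Sum>i<j. G * \<bar>?c i \<omega> - ?c' i \<omega>\<bar> * h)"
      unfolding abs_mult using h G_ge_1 by (intro sum_mono mult_mono \<mu>_lipschitz) auto
    also have "\<dots> \<le> D \<omega>" unfolding D_def using j G_ge_1 h by (intro sum_mono2 mult_nonneg_nonneg) auto
    finally have "\<bar>\<Sum>i<j. (\<mu> (?c i \<omega>) - \<mu> (?c' i \<omega>)) * (1 / 2 ^ r)\<bar> \<le> D \<omega>" .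
    moreover have "2 * e \<le> \<bar>(\<Sum>i<j. (\<mu> (?c i \<omega>) - \<mu> (?c' i \<omega>)) * (1 / 2 ^ r)) + msum (\<lambda>i. real i / 2 ^ r) \<eta> j \<omega>\<bar>"
      using j(2) unfolding euler_process_difference[OF mr] \<eta>_def[abs_def] .
    ultimately have "e \<le> D \<omega> \<or> e \<le> \<bar>msum (\<lambda>i. real i / 2 ^ r) \<eta> j \<omega>\<bar>" by linarith
    then show "\<omega> \<in> {\<omega> \<in> space M. e \<le> D \<omega>} \<union> {\<omega> \<in> space M. \<exists>j\<le>N. e \<le> \<bar>msum (\<lambda>i. real i / 2 ^ r) \<eta> j \<omega>\<bar>}"
      using \<omega> j(1) by blast
  qed
  then have "prob {\<omega> \<in> space M. \<exists>j\<le>N. 2 * e \<le> \<bar>euler_process m (real j / 2 ^ r) \<omega> - euler_process n (real j / 2 ^ r) \<omega>\<bar>} \<le>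
    prob ({\<omega> \<in> space M. e \<le> D \<omega>} \<union> {\<omega> \<in> space M. \<exists>j\<le>N. e \<le> \<bar>msum (\<lambda>i. real i / 2 ^ r) \<eta> j \<omega>\<bar>})"
    by (rule finite_measure_mono[OF _ sets.Un[OF ms(2,1)]])
  also have "\<dots> \<le> real T * (G * q) / e + real T * (G * q) / e\<^sup>2"
    using measure_Un_le[OF ms(2,1)] PM PD by linarith
  finally show ?thesis unfolding N_def .
qed

lemma euler_process_sup_small:
  assumes e: "0 < e" and \<epsilon>: "0 < \<epsilon>"
  obtains n0 where "\<And>n m r. n0 \<le> n \<Longrightarrow> n \<le> m \<Longrightarrow> m \<le> r \<Longrightarrow>
    prob {\<omega> \<in> space M. \<exists>j\<le>T * 2 ^ r. e \<le> \<bar>euler_process m (real j / 2 ^ r) \<omega> - euler_process n (real j / 2 ^ r) \<omega>\<bar>} \<le> \<epsilon>"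
proof -
  have G0: "0 < G" using G_ge_1 by simp
  define e' where "e' = e / 2"
  have e': "0 < e'" using e by (simp add: e'_def)
  \<comment> \<open>The probability is bounded by \<open>(c - 1) * (2 * q)\<close>; the summand 1
    keeps c positive when T = 0, so that q can be obtained by division.\<close>
  define c where "c = real T * G / e' + real T * G / e'\<^sup>2 + 1"
  have c: "0 < c" unfolding c_def using G0 e' by (intro add_nonneg_pos add_nonneg_nonneg) auto
  define q where "q = \<epsilon> / (2 * c)"
  have q: "0 < q" using \<epsilon> c by (simp add: q_def)
  have K: "0 \<le> euler_moment (real T)" by (simp add: euler_moment_def)
  from euler_process_cauchy[OF q _ K, of "real T"] obtain n0 where
    n0: "\<And>n Y I \<rho> t. n0 \<le> n \<Longrightarrow> approx_solution n (real T) (euler_moment (real T)) Y I \<rho> \<Longrightarrow> 0 \<le> t \<Longrightarrow> t \<le> real T \<Longrightarrow>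
      expectation (\<lambda>\<omega>. \<bar>Y t \<omega> - euler_process n (dyadic_left n t) \<omega>\<bar>) \<le> q" by auto
  show ?thesis
  proof (rule that[of n0])
    fix n m r assume n: "n0 \<le> n" and nm: "n \<le> m" and mr: "m \<le> r"
    have Q: "expectation (\<lambda>\<omega>. \<bar>euler_process m (dyadic_left m t) \<omega> - euler_process n (dyadic_left n t) \<omega>\<bar>) \<le> 2 * q"
      if t: "0 \<le> t" "t \<le> real T" for t
    proof -
      have i: "integrable M (\<lambda>\<omega>. \<bar>euler_process m t \<omega> - euler_process k (dyadic_left k t) \<omega>\<bar>)" for k
        using sq_int_integrable[OF sq_int_diff[OF euler_process_second_moment(1)[OF t(1)] euler_process_second_moment(1)[OF dyadic_left_bounds(1)[OF t(1)]]]] by simp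
      have "expectation (\<lambda>\<omega>. \<bar>euler_process m (dyadic_left m t) \<omega> - euler_process n (dyadic_left n t) \<omega>\<bar>) \<le>
        expectation (\<lambda>\<omega>. \<bar>euler_process m t \<omega> - euler_process m (dyadic_left m t) \<omega>\<bar> + \<bar>euler_process m t \<omega> - euler_process n (dyadic_left n t) \<omega>\<bar>)"
        using i by (intro integral_mono') auto
      also have "\<dots> \<le> q + q"
        using i n0[OF _ euler_process_approx_solution[of m m] t] n0[OF n euler_process_approx_solution[OF nm] t] n nm by simp
      finally show ?thesis by simp
    qed
    have "prob {\<omega> \<in> space M. \<exists>j\<le>T * 2 ^ r. 2 * e' \<le> \<bar>euler_process m (real j / 2 ^ r) \<omega> - euler_process n (real j / 2 ^ r) \<omega>\<bar>} \<le>
      real T * (G * (2 * q)) / e' + real T * (G * (2 * q)) / e'\<^sup>2"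
      using nm mr by (intro euler_process_grid_sup[OF mr _ Q e']) auto
    also have "\<dots> = (c - 1) * (2 * q)" by (simp add: c_def algebra_simps)
    also have "\<dots> \<le> c * (2 * q)" using q by (intro mult_right_mono) auto
    also have "\<dots> = \<epsilon>" using c by (simp add: q_def)
    finally show "prob {\<omega> \<in> space M. \<exists>j\<le>T * 2 ^ r. e \<le> \<bar>euler_process m (real j / 2 ^ r) \<omega> - euler_process n (real j / 2 ^ r) \<omega>\<bar>} \<le> \<epsilon>"
      by (simp add: e'_def)
  qed
qed

text \<open>With the number N of cells fixed, the cell-wise formula becomes one continuous
  expression in the times \<open>min t (real i / 2 ^ n)\<close>; cells beyond t contribute
  0.\<close>

lemma euler_process_continuous:
  assumes W: "continuous_on {0..} (\<lambda>t. W t \<omega>)"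
  shows "continuous_on {0..} (\<lambda>t. euler_process n t \<omega>)"
proof -
  have eq: "x\<^sub>0 + (\<Sum>i<N. \<mu> (euler n i \<omega>) * (min t (real (Suc i) / 2 ^ n) - min t (real i / 2 ^ n)) +
      \<tau> (euler n i \<omega>) * (W (min t (real (Suc i) / 2 ^ n)) \<omega> - W (min t (real i / 2 ^ n)) \<omega>)) = euler_process n t \<omega>"
    if t: "0 \<le> t" "t \<le> real N / 2 ^ n" for t N
  proof -
    have "dyadic_count n t \<le> N"
    proof (rule ccontr)
      assume "\<not> dyadic_count n t \<le> N"
      then have "real N / 2 ^ n < t" by (intro dyadic_count_less) simp
      then show False using t by simp
    qed
    then have "(\<Sum>i<N. \<mu> (euler n i \<omega>) * (min t (real (Suc i) / 2 ^ n) - min t (real i / 2 ^ n)) +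
      \<tau> (euler n i \<omega>) * (W (min t (real (Suc i) / 2 ^ n)) \<omega> - W (min t (real i / 2 ^ n)) \<omega>)) =
      (\<Sum>i<dyadic_count n t. \<mu> (euler n i \<omega>) * (min t (real (Suc i) / 2 ^ n) - min t (real i / 2 ^ n)) +
      \<tau> (euler n i \<omega>) * (W (min t (real (Suc i) / 2 ^ n)) \<omega> - W (min t (real i / 2 ^ n)) \<omega>))"
    proof (intro sum.mono_neutral_right ballI)
      fix i assume "i \<in> {..<N} - {..<dyadic_count n t}"
      then have "t \<le> real i / 2 ^ n" "t \<le> real (Suc i) / 2 ^ n"
        using dyadic_count_ge[of n t i] dyadic_count_ge[of n t "Suc i"] by auto
      then show "\<mu> (euler n i \<omega>) * (min t (real (Suc i) / 2 ^ n) - min t (real i / 2 ^ n)) +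
      \<tau> (euler n i \<omega>) * (W (min t (real (Suc i) / 2 ^ n)) \<omega> - W (min t (real i / 2 ^ n)) \<omega>) = 0"
        by (simp add: min_absorb1 del: of_nat_Suc)
    qed auto
    then show ?thesis using euler_process_sum[OF t(1), of n \<omega>] by (simp only: sum.distrib add.assoc)
  qed
  have c: "continuous_on {0..real N / 2 ^ n} (\<lambda>t. euler_process n t \<omega>)" for N
  proof (rule continuous_on_eq)
    have Wm: "continuous_on {0..real N / 2 ^ n} (\<lambda>t. W (min t a) \<omega>)" if "0 \<le> a" for a
      using that by (intro continuous_on_compose2[OF W] continuous_intros) auto
    show "continuous_on {0..real N / 2 ^ n} (\<lambda>t. x\<^sub>0 + (\<Sum>i<N. \<mu> (euler n i \<omega>) * (min t (real (Suc i) / 2 ^ n) - min t (real i / 2 ^ n)) +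
      \<tau> (euler n i \<omega>) * (W (min t (real (Suc i) / 2 ^ n)) \<omega> - W (min t (real i / 2 ^ n)) \<omega>)))"
      by (intro continuous_intros Wm) auto
  qed (use eq in auto)
  show ?thesis
  proof (rule continuous_on_halfline)
    show "continuous_on {0..real K} (\<lambda>t. euler_process n t \<omega>)" for K
      using c[of "K * 2 ^ n"] by simp
  qed
qed

lemma euler_process_measurable: "0 \<le> t \<Longrightarrow> euler_process n t \<in> borel_measurable M"
  by (rule sq_int_measurable[OF euler_process_second_moment(1)])

text \<open>Borel-Cantelli with probabilities at most \<open>1 / 2 ^ k\<close>. The bad event is a
  union over ever finer dyadic grids, which is increasing since the grids are nested, so its
  probability is the limit of the grid probabilities. Continuity of the paths carries the bound from
  dyadic times to all times.\<close>

lemma euler_subsequence: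
  obtains ns :: "nat \<Rightarrow> nat" and N where "N \<in> null_sets M" "\<And>k. k \<le> ns k"
    "\<And>\<omega>. \<omega> \<in> space M \<Longrightarrow> \<omega> \<notin> N \<Longrightarrow> continuous_on {0..} (\<lambda>t. W t \<omega>)"
    "\<And>\<omega>. \<omega> \<in> space M \<Longrightarrow> \<omega> \<notin> N \<Longrightarrow> \<exists>k0. \<forall>k\<ge>k0. \<forall>t\<in>{0..real k}.
      \<bar>euler_process (ns (Suc k)) t \<omega> - euler_process (ns k) t \<omega>\<bar> \<le> 1 / 2 ^ k"
proof -
  define B where "B k n m r = {\<omega> \<in> space M. \<exists>j\<le>k * 2 ^ r. 1 / 2 ^ k \<le> \<bar>euler_process m (real j / 2 ^ r) \<omega> - euler_process n (real j / 2 ^ r) \<omega>\<bar>}"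
    for k n m r :: nat
  have Bm: "B k n m r \<in> sets M" for k n m r
  proof -
    have [measurable]: "euler_process i (real j / 2 ^ r) \<in> borel_measurable M" for i j by (rule euler_process_measurable) simp
    show ?thesis unfolding B_def by measurable
  qed
  have "\<exists>n0. \<forall>n m r. n0 \<le> n \<longrightarrow> n \<le> m \<longrightarrow> m \<le> r \<longrightarrow> prob (B k n m r) \<le> 1 / 2 ^ k" for k
  proof -
    have p: "0 < (1::real) / 2 ^ k" by simp
    obtain n0 where n0: "\<And>n m r. n0 \<le> n \<Longrightarrow> n \<le> m \<Longrightarrow> m \<le> r \<Longrightarrow>
      prob {\<omega> \<in> space M. \<exists>j\<le>k * 2 ^ r. 1 / 2 ^ k \<le> \<bar>euler_process m (real j / 2 ^ r) \<omega> - euler_process n (real j / 2 ^ r) \<omega>\<bar>} \<le> 1 / 2 ^ k"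
      by (rule euler_process_sup_small[OF p p, of k]) (rule that)
    then show ?thesis unfolding B_def by blast
  qed
  then have "\<forall>k. \<exists>n0. \<forall>n m r. n0 \<le> n \<longrightarrow> n \<le> m \<longrightarrow> m \<le> r \<longrightarrow> prob (B k n m r) \<le> 1 / 2 ^ k" ..
  from choice[OF this] obtain f where
    f': "\<forall>k. \<forall>n m r. f k \<le> n \<longrightarrow> n \<le> m \<longrightarrow> m \<le> r \<longrightarrow> prob (B k n m r) \<le> 1 / 2 ^ k" ..
  note f = f'[rule_format]
  \<comment> \<open>Partial sums make the sequence increasing and at least \<open>f k\<close>; the
    summands 1 make it at least k.\<close>
  define ns where "ns k = (\<Sum>i\<le>k. f i + 1)" for k :: nat
  have ns1: "f k \<le> ns k" "ns k \<le> ns (Suc k)" for k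
    unfolding ns_def by (cases k) auto
  have ns2: "k \<le> ns k" for k unfolding ns_def by (induction k) auto
  define A where "A k = (\<Union>i. B k (ns k) (ns (Suc k)) (ns (Suc k) + i))" for k
  have Am: "A k \<in> sets M" for k unfolding A_def using Bm by blast
  have PA: "prob (A k) \<le> 1 / 2 ^ k" for k
  proof (rule LIMSEQ_le_const2)
    show "(\<lambda>i. prob (B k (ns k) (ns (Suc k)) (ns (Suc k) + i))) \<longlonglongrightarrow> prob (A k)"
      unfolding A_def
    proof (rule finite_Lim_measure_incseq)
      show "range (\<lambda>i. B k (ns k) (ns (Suc k)) (ns (Suc k) + i)) \<subseteq> sets M" using Bm by blast
      \<comment> \<open>The point j / 2^r reappears on the next grid as 2 j / 2^(r + 1).\<close>
      show "incseq (\<lambda>i. B k (ns k) (ns (Suc k)) (ns (Suc k) + i))"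
      proof (rule incseq_SucI, rule subsetI)
        fix i \<omega> assume "\<omega> \<in> B k (ns k) (ns (Suc k)) (ns (Suc k) + i)"
        then obtain j where \<omega>: "\<omega> \<in> space M" and j: "j \<le> k * 2 ^ (ns (Suc k) + i)"
          "1 / 2 ^ k \<le> \<bar>euler_process (ns (Suc k)) (real j / 2 ^ (ns (Suc k) + i)) \<omega> - euler_process (ns k) (real j / 2 ^ (ns (Suc k) + i)) \<omega>\<bar>"
          unfolding B_def by blast
        have "real j / 2 ^ (ns (Suc k) + i) = real (2 * j) / 2 ^ (ns (Suc k) + Suc i)" by simp
        moreover have "2 * j \<le> k * 2 ^ (ns (Suc k) + Suc i)" using j(1) by simp
        ultimately show "\<omega> \<in> B k (ns k) (ns (Suc k)) (ns (Suc k) + Suc i)"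
          unfolding B_def using \<omega> j(2) by (intro CollectI conjI exI[of _ "2 * j"]) auto
      qed
    qed
    show "\<exists>N. \<forall>i\<ge>N. prob (B k (ns k) (ns (Suc k)) (ns (Suc k) + i)) \<le> 1 / 2 ^ k"
      using f[OF ns1(1,2)] by auto
  qed
  have sm: "summable (\<lambda>k. prob (A k))"
  proof (rule summable_comparison_test'[of "\<lambda>k. (1 / 2 :: real) ^ k" 0])
    show "summable (\<lambda>k. (1 / 2 :: real) ^ k)" by (rule summable_geometric) simp
    show "norm (prob (A k)) \<le> (1 / 2) ^ k" for k using PA[of k] by (simp add: power_one_over)
  qed
  have "AE \<omega> in M. eventually (\<lambda>k. \<omega> \<in> space M - A k) sequentially"
    by (rule borel_cantelli_AE1[OF Am _ sm]) (simp add: emeasure_eq_measure)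
  moreover have "AE \<omega> in M. continuous_on {0..} (\<lambda>t. W t \<omega>)"
    using W by (simp add: wiener_process_def continuous_paths_def)
  ultimately have "AE \<omega> in M. eventually (\<lambda>k. \<omega> \<in> space M - A k) sequentially \<and> continuous_on {0..} (\<lambda>t. W t \<omega>)"
    by (rule AE_conjI)
  then obtain N where N: "N \<in> null_sets M" and
    good: "{\<omega> \<in> space M. \<not> (eventually (\<lambda>k. \<omega> \<in> space M - A k) sequentially \<and> continuous_on {0..} (\<lambda>t. W t \<omega>))} \<subseteq> N"
    unfolding eventually_ae_filter by blast
  have g: "eventually (\<lambda>k. \<omega> \<in> space M - A k) sequentially" "continuous_on {0..} (\<lambda>t. W t \<omega>)"
    if "\<omega> \<in> space M" "\<omega> \<notin> N" for \<omega> using that good by blast+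
  have main: "\<exists>k0. \<forall>k\<ge>k0. \<forall>t\<in>{0..real k}. \<bar>euler_process (ns (Suc k)) t \<omega> - euler_process (ns k) t \<omega>\<bar> \<le> 1 / 2 ^ k"
    if \<omega>: "\<omega> \<in> space M" "\<omega> \<notin> N" for \<omega>
  proof -
    obtain k0 where k0: "\<And>k. k0 \<le> k \<Longrightarrow> \<omega> \<notin> A k" using g(1)[OF \<omega>] by (auto simp: eventually_sequentially)
    have "\<bar>euler_process (ns (Suc k)) t \<omega> - euler_process (ns k) t \<omega>\<bar> \<le> 1 / 2 ^ k"
      if k: "k0 \<le> k" and t: "0 \<le> t" "t \<le> real k" for k t
    proof (rule LIMSEQ_le_const2)
      have l: "(\<lambda>i. dyadic_left (ns (Suc k) + i) t) \<longlonglongrightarrow> t"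
        using LIMSEQ_ignore_initial_segment[OF dyadic_left_tendsto[OF t(1)], of "ns (Suc k)"] by (simp add: add.commute)
      have c: "(\<lambda>i. euler_process n (dyadic_left (ns (Suc k) + i) t) \<omega>) \<longlonglongrightarrow> euler_process n t \<omega>" for n
        using continuous_on_tendsto_compose[OF euler_process_continuous[OF g(2)[OF \<omega>]] l] t dyadic_left_bounds(1)[OF t(1)] by auto
      show "(\<lambda>i. \<bar>euler_process (ns (Suc k)) (dyadic_left (ns (Suc k) + i) t) \<omega> - euler_process (ns k) (dyadic_left (ns (Suc k) + i) t) \<omega>\<bar>)
        \<longlonglongrightarrow> \<bar>euler_process (ns (Suc k)) t \<omega> - euler_process (ns k) t \<omega>\<bar>"
        by (intro tendsto_rabs tendsto_diff c)
      have "\<bar>euler_process (ns (Suc k)) (dyadic_left (ns (Suc k) + i) t) \<omega> - euler_process (ns k) (dyadic_left (ns (Suc k) + i) t) \<omega>\<bar> \<le> 1 / 2 ^ k" for i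
      proof (rule ccontr)
        let ?r = "ns (Suc k) + i"
        define j where "j = nat (\<lceil>t * 2 ^ ?r\<rceil> - 1)"
        have e: "dyadic_left ?r t = real j / 2 ^ ?r" by (simp add: dyadic_left_def j_def)
        have "real j / 2 ^ ?r \<le> real k" using dyadic_left_bounds(2)[OF t(1), of ?r] t unfolding e by linarith
        then have "real j \<le> real (k * 2 ^ ?r)" by (simp add: divide_le_eq)
        then have jk: "j \<le> k * 2 ^ ?r" by (simp only: of_nat_le_iff)
        assume "\<not> ?thesis"
        then have "\<omega> \<in> B k (ns k) (ns (Suc k)) ?r"
          unfolding B_def e using \<omega>(1) jk by (intro CollectI conjI exI[of _ j]) auto
        then have "\<omega> \<in> A k" unfolding A_def by blast
        then show False using k0[OF k] by blast
      qed
      then show "\<exists>N. \<forall>i\<ge>N. \<bar>euler_process (ns (Suc k)) (dyadic_left (ns (Suc k) + i) t) \<omega> - euler_process (ns k) (dyadic_left (ns (Suc k) + i) t) \<omega>\<bar> \<le> 1 / 2 ^ k" by blast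
    qed
    then show ?thesis by (intro exI[of _ k0]) auto
  qed
  show ?thesis by (rule that[OF N ns2 g(2) main])
qed

text \<open>On the null set N the process is constantly \<open>x\<^sub>0\<close>, so that every path
  is continuous. The measurability clause admits any \<sigma>-algebra that contains N and makes W
  measurable up to t, which covers both the given and the augmented filtration.\<close>

lemma euler_limit:
  obtains X :: "real \<Rightarrow> 'a \<Rightarrow> real" and ns :: "nat \<Rightarrow> nat" and N where "N \<in> null_sets M" "\<And>k. k \<le> ns k"
    "\<And>\<omega>. \<omega> \<in> space M \<Longrightarrow> continuous_on {0..} (\<lambda>t. X t \<omega>)"
    "\<And>\<omega>. \<omega> \<in> space M \<Longrightarrow> \<omega> \<notin> N \<Longrightarrow> \<exists>k0. \<forall>k\<ge>k0. \<forall>t\<in>{0..real k}. \<bar>euler_process (ns k) t \<omega> - X t \<omega>\<bar> \<le> 2 / 2 ^ k"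
    "\<And>t A. 0 \<le> t \<Longrightarrow> space A = space M \<Longrightarrow> N \<in> sets A \<Longrightarrow> (\<And>s. 0 \<le> s \<Longrightarrow> s \<le> t \<Longrightarrow> W s \<in> borel_measurable A) \<Longrightarrow> X t \<in> borel_measurable A"
proof -
  obtain ns :: "nat \<Rightarrow> nat" and N where N: "N \<in> null_sets M" and ns: "\<And>k. k \<le> ns k"
    and Wc: "\<And>\<omega>. \<omega> \<in> space M \<Longrightarrow> \<omega> \<notin> N \<Longrightarrow> continuous_on {0..} (\<lambda>t. W t \<omega>)"
    and step: "\<And>\<omega>. \<omega> \<in> space M \<Longrightarrow> \<omega> \<notin> N \<Longrightarrow> \<exists>k0. \<forall>k\<ge>k0. \<forall>t\<in>{0..real k}.
      \<bar>euler_process (ns (Suc k)) t \<omega> - euler_process (ns k) t \<omega>\<bar> \<le> 1 / 2 ^ k"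
    by (rule euler_subsequence) (rule that)
  define E where "E k t \<omega> = euler_process (ns k) t \<omega>" for k t \<omega>
  define X where "X t \<omega> = (if \<omega> \<in> N then x\<^sub>0 else lim (\<lambda>k. E k t \<omega>))" for t \<omega>
  have good: "\<exists>k0. \<forall>k\<ge>k0. \<forall>t\<in>{0..real k}. (\<lambda>i. E i t \<omega>) \<longlonglongrightarrow> X t \<omega> \<and> \<bar>E k t \<omega> - X t \<omega>\<bar> \<le> 2 / 2 ^ k"
    if \<omega>: "\<omega> \<in> space M" "\<omega> \<notin> N" for \<omega>
  proof -
    from step[OF \<omega>] obtain k0 where k0: "\<And>k t. k0 \<le> k \<Longrightarrow> 0 \<le> t \<Longrightarrow> t \<le> real k \<Longrightarrow> \<bar>E (Suc k) t \<omega> - E k t \<omega>\<bar> \<le> 1 / 2 ^ k"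
      unfolding E_def by fastforce
    \<comment> \<open>The subtracted tail of the geometric series lets the induction on d close; it
      is dropped in \<open>tel'\<close>.\<close>
    have tel: "\<bar>E (k + d) t \<omega> - E k t \<omega>\<bar> \<le> 2 / 2 ^ k - 2 / 2 ^ (k + d)" if k: "k0 \<le> k" "0 \<le> t" "t \<le> real k" for k d t
    proof (induction d)
      case (Suc d)
      have "\<bar>E (Suc (k + d)) t \<omega> - E (k + d) t \<omega>\<bar> \<le> 1 / 2 ^ (k + d)" using k by (intro k0) auto
      moreover have "2 / 2 ^ (k + d) - (1::real) / 2 ^ (k + d) = 2 / 2 ^ (k + Suc d)" by (simp add: field_simps)
      ultimately show ?case using Suc unfolding add_Suc_right by linarith
    qed simp
    have tel': "\<bar>E (k + d) t \<omega> - E k t \<omega>\<bar> \<le> 2 / 2 ^ k" if k: "k0 \<le> k" "0 \<le> t" "t \<le> real k" for k d t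
    proof -
      have "0 \<le> (2::real) / 2 ^ (k + d)" by simp
      with tel[OF k, of d] show ?thesis by linarith
    qed
    have lim: "(\<lambda>i. E i t \<omega>) \<longlonglongrightarrow> X t \<omega>" if t: "0 \<le> t" for t
    proof -
      have "Cauchy (\<lambda>i. E i t \<omega>)"
      proof (rule CauchyI')
        fix e :: real assume e: "0 < e"
        from LIMSEQ_D[OF half_power_tendsto_0[of 2] e] obtain k1 where k1: "\<And>k. k1 \<le> k \<Longrightarrow> \<bar>2 / 2 ^ k\<bar> < e" by auto
        obtain k2 where k2: "t \<le> real k2" using real_arch_simple by blast
        show "\<exists>M. \<forall>m\<ge>M. \<forall>n>m. dist (E m t \<omega>) (E n t \<omega>) < e"
        proof (intro exI[of _ "max k0 (max k1 k2)"] allI impI)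
          fix m n assume m: "max k0 (max k1 k2) \<le> m" "m < n"
          then have "t \<le> real m" using k2 by (simp add: max_def split: if_splits)
          then have "\<bar>E (m + (n - m)) t \<omega> - E m t \<omega>\<bar> \<le> 2 / 2 ^ m" using m t by (intro tel') auto
          also have "\<dots> < e" using k1[of m] m by simp
          finally show "dist (E m t \<omega>) (E n t \<omega>) < e" using m by (simp add: dist_real_def abs_minus_commute)
        qed
      qed
      then have "convergent (\<lambda>i. E i t \<omega>)" by (rule Cauchy_convergent)
      then show ?thesis using \<omega> by (simp add: X_def convergent_LIMSEQ_iff)
    qed
    have "\<bar>E k t \<omega> - X t \<omega>\<bar> \<le> 2 / 2 ^ k" if k: "k0 \<le> k" "0 \<le> t" "t \<le> real k" for k t
    proof (rule LIMSEQ_le_const2)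
      show "(\<lambda>d. \<bar>E k t \<omega> - E (d + k) t \<omega>\<bar>) \<longlonglongrightarrow> \<bar>E k t \<omega> - X t \<omega>\<bar>"
        using LIMSEQ_ignore_initial_segment[OF lim[OF k(2)], of k] by (intro tendsto_rabs tendsto_diff tendsto_const)
      show "\<exists>N. \<forall>d\<ge>N. \<bar>E k t \<omega> - E (d + k) t \<omega>\<bar> \<le> 2 / 2 ^ k"
        using tel'[OF k] by (auto simp: abs_minus_commute add.commute)
    qed
    with lim show ?thesis by (intro exI[of _ k0]) auto
  qed
  have cont: "continuous_on {0..} (\<lambda>t. X t \<omega>)" if \<omega>: "\<omega> \<in> space M" for \<omega>
  proof (cases "\<omega> \<in> N")
    case True
    then show ?thesis by (simp add: X_def)
  next
    case False
    from good[OF \<omega> False] obtain k0 where k0: "\<And>k t. k0 \<le> k \<Longrightarrow> 0 \<le> t \<Longrightarrow> t \<le> real k \<Longrightarrow> \<bar>E k t \<omega> - X t \<omega>\<bar> \<le> 2 / 2 ^ k" by fastforce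
    show ?thesis
    proof (rule continuous_on_halfline)
      fix K :: nat
      have ul: "uniform_limit {0..real K} (\<lambda>k t. E k t \<omega>) (\<lambda>t. X t \<omega>) sequentially"
        unfolding uniform_limit_sequentially_iff
      proof (intro allI impI)
        fix e :: real assume e: "0 < e"
        from LIMSEQ_D[OF half_power_tendsto_0[of 2] e] obtain k1 where k1: "\<And>k. k1 \<le> k \<Longrightarrow> \<bar>2 / 2 ^ k\<bar> < e" by auto
        show "\<exists>N. \<forall>n\<ge>N. \<forall>t\<in>{0..real K}. dist (E n t \<omega>) (X t \<omega>) < e"
        proof (intro exI[of _ "max k0 (max k1 K)"] allI impI ballI)
          fix n t assume n: "max k0 (max k1 K) \<le> n" and t: "t \<in> {0..real K}"
          then have "t \<le> real n" by (simp add: max_def split: if_splits)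
          then have "\<bar>E n t \<omega> - X t \<omega>\<bar> \<le> 2 / 2 ^ n" using n t by (intro k0) auto
          also have "\<dots> < e" using k1[of n] n by simp
          finally show "dist (E n t \<omega>) (X t \<omega>) < e" by (simp add: dist_real_def)
        qed
      qed
      have "continuous_on {0..real K} (\<lambda>t. E k t \<omega>)" for k
        unfolding E_def by (rule continuous_on_subset[OF euler_process_continuous[OF Wc[OF \<omega> False]]]) auto
      then have ev: "\<forall>\<^sub>F k in sequentially. continuous_on {0..real K} (\<lambda>t. E k t \<omega>)" by simp
      show "continuous_on {0..real K} (\<lambda>t. X t \<omega>)"
        by (rule uniform_limit_theorem[OF ev ul]) simp
    qed
  qed
  have meas: "X t \<in> borel_measurable A" if t: "0 \<le> t" and A: "space A = space M" "N \<in> sets A"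
    and WA: "\<And>s. 0 \<le> s \<Longrightarrow> s \<le> t \<Longrightarrow> W s \<in> borel_measurable A" for t A
  proof (rule borel_measurable_LIMSEQ_real)
    show "(\<lambda>\<omega>. if \<omega> \<in> N then x\<^sub>0 else E k t \<omega>) \<in> borel_measurable A" for k
    proof -
      have [measurable]: "N \<in> sets A" by (rule A)
      have [measurable]: "E k t \<in> borel_measurable A" unfolding E_def by (rule euler_process_measurable_of_W[OF WA t])
      show ?thesis by measurable
    qed
    fix \<omega> assume "\<omega> \<in> space A"
    then have \<omega>: "\<omega> \<in> space M" using A by simp
    show "(\<lambda>k. if \<omega> \<in> N then x\<^sub>0 else E k t \<omega>) \<longlonglongrightarrow> X t \<omega>"
    proof (cases "\<omega> \<in> N")
      case False
      from good[OF \<omega> False] obtain k0 where k0: "\<And>k t. k0 \<le> k \<Longrightarrow> 0 \<le> t \<Longrightarrow> t \<le> real k \<Longrightarrow> (\<lambda>i. E i t \<omega>) \<longlonglongrightarrow> X t \<omega>" by fastforce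
      obtain k2 where k2: "t \<le> real k2" using real_arch_simple by blast
      have "(\<lambda>i. E i t \<omega>) \<longlonglongrightarrow> X t \<omega>" using t k2 by (intro k0[of "max k0 k2"]) auto
      then show ?thesis using False by simp
    qed (simp add: X_def)
  qed
  have close: "\<exists>k0. \<forall>k\<ge>k0. \<forall>t\<in>{0..real k}. \<bar>euler_process (ns k) t \<omega> - X t \<omega>\<bar> \<le> 2 / 2 ^ k"
    if "\<omega> \<in> space M" "\<omega> \<notin> N" for \<omega>
    using good[OF that] unfolding E_def by blast
  show ?thesis by (rule that[OF N ns cont close meas])
qed

end

context wiener_space
begin

section \<open>Existence\<close>

text \<open>The step processes frozen at \<open>dyadic_left\<close> look only into the past, so up
  to time t they are measurable for \<open>F t\<close>, and by continuity they converge on every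
  path.\<close>

lemma progressive_of_continuous:
  assumes X: "adapted F X" and c: "\<And>\<omega>. \<omega> \<in> space M \<Longrightarrow> continuous_on {0..} (\<lambda>t. X t \<omega>)"
  shows "progressive F X"
  unfolding progressive_def
proof (intro allI impI)
  fix t :: real assume t: "0 \<le> t"
  let ?N = "restrict_space borel {0..t} \<Otimes>\<^sub>M F t"
  have sp: "space ?N = {0..t} \<times> space M"
    using t by (simp add: space_pair_measure space_filtration)
  show "(\<lambda>(s, \<omega>). X s \<omega>) \<in> borel_measurable ?N"
  proof (rule borel_measurable_LIMSEQ_real)
    fix n
    define g where "g s = nat (\<lceil>s * 2 ^ n\<rceil> - 1)" for s :: real
    \<comment> \<open>The cut-off at t makes \<open>f k\<close> measurable for \<open>F t\<close>
      for every k; at times s in [0, t] the chosen index never exceeds it.\<close>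
    define f where "f k z = (if real k / 2 ^ n \<le> t then X (real k / 2 ^ n) (snd z) else 0)" for k and z :: "real \<times> 'a"
    have "g \<in> borel \<rightarrow>\<^sub>M count_space UNIV" unfolding g_def by measurable
    then have g: "(\<lambda>z. g (fst z)) \<in> ?N \<rightarrow>\<^sub>M count_space UNIV"
      by (rule measurable_compose[OF measurable_fst measurable_restrict_space1])
    have f: "f k \<in> borel_measurable ?N" for k
    proof (cases "real k / 2 ^ n \<le> t")
      case True
      have "X (real k / 2 ^ n) \<in> borel_measurable (F t)"
        by (rule F_measurable_mono[of _ "real k / 2 ^ n", OF _ _ True]) (use X in \<open>auto simp: adapted_def\<close>)
      from measurable_compose[OF measurable_snd this] show ?thesis using True by (simp add: f_def[abs_def])
    qed (simp add: f_def[abs_def])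
    have "(\<lambda>z. f (g (fst z)) z) \<in> borel_measurable ?N"
      by (rule measurable_compose_countable[OF f g])
    moreover have "f (g (fst z)) z = (\<lambda>(s, \<omega>). X (dyadic_left n s) \<omega>) z" if "z \<in> space ?N" for z
    proof -
      have "fst z \<in> {0..t}" using that unfolding sp by auto
      then have "dyadic_left n (fst z) \<le> t" using dyadic_left_bounds(2)[of "fst z" n] by simp
      then show ?thesis by (simp add: f_def g_def dyadic_left_def split_beta')
    qed
    ultimately show "(\<lambda>(s, \<omega>). X (dyadic_left n s) \<omega>) \<in> borel_measurable ?N"
      by (rule measurable_cong[THEN iffD1, rotated])
  next
    fix z assume "z \<in> space ?N"
    then have z: "0 \<le> fst z" "snd z \<in> space M" unfolding sp by auto
    have "(\<lambda>n. X (dyadic_left n (fst z)) (snd z)) \<longlonglongrightarrow> X (fst z) (snd z)"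
      by (rule continuous_on_tendsto_compose[OF c[OF z(2)] dyadic_left_tendsto[OF z(1)]])
        (use z(1) dyadic_left_bounds(1)[OF z(1)] in auto)
    then show "(\<lambda>n. (\<lambda>(s, \<omega>). X (dyadic_left n s) \<omega>) z) \<longlonglongrightarrow> (\<lambda>(s, \<omega>). X s \<omega>) z"
      unfolding split_beta' .
  qed
qed

lemma progressive_time_integral:
  assumes "progressive F H" "0 \<le> t"
  shows "(\<lambda>\<omega>. LBINT s:{0..t}. H s \<omega>) \<in> borel_measurable (F t)"
  using lborel.borel_measurable_lebesgue_integral[OF progressive_measurable[OF assms]]
  by (simp add: set_lebesgue_integral_def)

end

lemma time_integral_continuous:
  fixes f :: "real \<Rightarrow> real"
  assumes f: "continuous_on {0..} f"
  shows "continuous_on {0..} (\<lambda>t. LBINT s:{0..t}. f s)"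
proof (rule continuous_on_halfline)
  fix K :: nat
  have fK: "continuous_on {0..t} f" for t by (rule continuous_on_subset[OF f]) auto
  have "continuous_on {0..real K} (\<lambda>t. integral {0..t} f)"
    by (rule indefinite_integral_continuous_1[OF integrable_continuous_real[OF fK]])
  moreover have "integral {0..t} f = (LBINT s:{0..t}. f s)" for t
    by (rule set_borel_integral_eq_integral(2)[symmetric, OF borel_integrable_atLeastAtMost'[OF fK]])
  ultimately show "continuous_on {0..real K} (\<lambda>t. LBINT s:{0..t}. f s)" by simp
qed

lemma LBINT_Ioc_eq_Icc: "(LBINT s:{0<..t}. f s) = (LBINT s:{0..t}. f (s::real) :: real)"
  unfolding set_lebesgue_integral_def
  by (rule integral_discrete_difference[where X="{0}"]) (auto simp: indicator_def)

lemma continuous_bounded_Icc: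
  fixes f :: "real \<Rightarrow> real"
  assumes "continuous_on {0..} f"
  shows "\<exists>c. \<forall>s\<in>{0..t}. \<bar>f s\<bar> \<le> c"
proof -
  have "compact (f ` {0..t})"
    by (intro compact_continuous_image continuous_on_subset[OF assms]) auto
  from compact_imp_bounded[OF this] show ?thesis unfolding bounded_iff by simp
qed

context monotone_sde
begin

lemma \<mu>_growth: "\<bar>\<mu> x\<bar> \<le> G + G * \<bar>x\<bar>"
  using \<mu>_lipschitz[of x 0] \<mu>_zero by simp

lemma strong_solution_exists:
  obtains X :: "real \<Rightarrow> 'a \<Rightarrow> real" and ns :: "nat \<Rightarrow> nat" where "strong_solution M F W \<mu> \<tau> x\<^sub>0 X" "\<And>k. k \<le> ns k"
    "\<And>\<omega>. \<omega> \<in> space M \<Longrightarrow> continuous_on {0..} (\<lambda>t. X t \<omega>)"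
    "\<And>t. 0 \<le> t \<Longrightarrow> AE \<omega> in M. (\<lambda>k. euler_process (ns k) t \<omega>) \<longlonglongrightarrow> X t \<omega>"
proof -
  obtain X :: "real \<Rightarrow> 'a \<Rightarrow> real" and ns :: "nat \<Rightarrow> nat" and N where N: "N \<in> null_sets M" and ns: "\<And>k. k \<le> ns k"
    and Xc: "\<And>\<omega>. \<omega> \<in> space M \<Longrightarrow> continuous_on {0..} (\<lambda>t. X t \<omega>)"
    and close: "\<And>\<omega>. \<omega> \<in> space M \<Longrightarrow> \<omega> \<notin> N \<Longrightarrow> \<exists>k0. \<forall>k\<ge>k0. \<forall>t\<in>{0..real k}. \<bar>euler_process (ns k) t \<omega> - X t \<omega>\<bar> \<le> 2 / 2 ^ k"
    and Xm: "\<And>t A. 0 \<le> t \<Longrightarrow> space A = space M \<Longrightarrow> N \<in> sets A \<Longrightarrow> (\<And>s. 0 \<le> s \<Longrightarrow> s \<le> t \<Longrightarrow> W s \<in> borel_measurable A) \<Longrightarrow> X t \<in> borel_measurable A"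
    apply (rule euler_limit)
    subgoal premises prems for X ns N by (rule prems(1)[OF prems(2-6)])
    done
  have aeN: "AE \<omega> in M. \<omega> \<in> space M \<and> \<omega> \<notin> N" using AE_not_in[OF N] by auto
  have NF: "N \<in> sets (F t)" if "0 \<le> t" for t
    using N null_sets_filtration filtration_mono[of 0 t] that by auto
  have XF: "adapted F X"
    unfolding adapted_def using NF space_filtration by (intro allI impI Xm W_measurable_F) auto
  have Xg: "adapted (augmented_filtration M W) X"
    unfolding adapted_def
  proof (intro allI impI Xm)
    fix t :: real assume t: "0 \<le> t"
    let ?S = "{W s -` A \<inter> space M |s A. 0 \<le> s \<and> s \<le> t \<and> A \<in> sets borel} \<union> null_sets M"
    have S: "?S \<subseteq> Pow (space M)" using null_sets.sets_into_space by (auto dest: sets.sets_into_space[OF null_setsD2])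
    show sp: "space (augmented_filtration M W t) = space M"
      unfolding augmented_filtration_def using S by (simp add: space_measure_of)
    have st: "sets (augmented_filtration M W t) = sigma_sets (space M) ?S"
      unfolding augmented_filtration_def using S by (simp add: sets_measure_of)
    show "N \<in> sets (augmented_filtration M W t)" unfolding st using N by (auto intro: sigma_sets.Basic)
    show "W s \<in> borel_measurable (augmented_filtration M W t)" if "0 \<le> s" "s \<le> t" for s
      unfolding measurable_def sp st using that by (auto intro!: sigma_sets.Basic)
  qed
  have path: "(\<lambda>k. euler_process (ns k) (dyadic_left (ns k) s) \<omega>) \<longlonglongrightarrow> X s \<omega>"
    "(\<lambda>k. euler_process (ns k) s \<omega>) \<longlonglongrightarrow> X s \<omega>"
    if \<omega>: "\<omega> \<in> space M" "\<omega> \<notin> N" and s: "0 \<le> s" for \<omega> s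
  proof -
    obtain k0 where k0: "\<forall>k\<ge>k0. \<forall>t\<in>{0..real k}. \<bar>euler_process (ns k) t \<omega> - X t \<omega>\<bar> \<le> 2 / 2 ^ k" using close[OF \<omega>] ..
    obtain k1 where k1: "s \<le> real k1" using real_arch_simple by blast
    have b: "\<bar>euler_process (ns k) u \<omega> - X u \<omega>\<bar> \<le> 2 / 2 ^ k" if "max k0 k1 \<le> k" "0 \<le> u" "u \<le> s" for k u
    proof -
      have "real k1 \<le> real k" using that by simp
      then have "u \<in> {0..real k}" using that k1 by auto
      then show ?thesis using k0 that by auto
    qed
    have ev: "eventually (\<lambda>k. max k0 k1 \<le> k) sequentially" by (rule eventually_ge_at_top)
    have z: "(\<lambda>k. euler_process (ns k) (u k) \<omega> - X (u k) \<omega>) \<longlonglongrightarrow> 0" if u: "\<And>k. 0 \<le> u k" "\<And>k. u k \<le> s" for u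
    proof (rule Lim_null_comparison[OF _ half_power_tendsto_0[of 2]])
      show "\<forall>\<^sub>F k in sequentially. norm (euler_process (ns k) (u k) \<omega> - X (u k) \<omega>) \<le> 2 / 2 ^ k"
        using ev by eventually_elim (use b u in auto)
    qed
    show "(\<lambda>k. euler_process (ns k) s \<omega>) \<longlonglongrightarrow> X s \<omega>"
      using tendsto_add[OF z[of "\<lambda>_. s"] tendsto_const[of "X s \<omega>"]] s by simp
    have "(\<lambda>k. dyadic_left (ns k) s) \<longlonglongrightarrow> s"
    proof (rule tendsto_sandwich[of "\<lambda>k. s - 1 / 2 ^ k" _ _ "\<lambda>k. s"])
      show "(\<lambda>k. s - 1 / 2 ^ k) \<longlonglongrightarrow> s" using tendsto_diff[OF tendsto_const half_power_tendsto_0[of 1], of s] by simp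
      have "s - 1 / 2 ^ k \<le> dyadic_left (ns k) s" for k
      proof -
        have "(1::real) / 2 ^ ns k \<le> 1 / 2 ^ k" using ns[of k] by (intro divide_left_mono power_increasing) auto
        then show ?thesis using dyadic_left_bounds(3)[OF s, of "ns k"] by linarith
      qed
      then show "\<forall>\<^sub>F k in sequentially. s - 1 / 2 ^ k \<le> dyadic_left (ns k) s" by simp
    qed (use dyadic_left_bounds(2)[OF s] in auto)
    then have "(\<lambda>k. X (dyadic_left (ns k) s) \<omega>) \<longlonglongrightarrow> X s \<omega>"
      by (rule continuous_on_tendsto_compose[OF Xc[OF \<omega>(1)]]) (use s dyadic_left_bounds(1)[OF s] in auto)
    then show "(\<lambda>k. euler_process (ns k) (dyadic_left (ns k) s) \<omega>) \<longlonglongrightarrow> X s \<omega>"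
      using tendsto_add[OF z[of "\<lambda>k. dyadic_left (ns k) s", OF dyadic_left_bounds(1,2)[OF s]]] by fastforce
  qed
  \<comment> \<open>Eventually the polygons are within 2 of X, which is bounded on [0, t].\<close>
  have bound: "\<exists>K c. \<forall>k\<ge>K. \<forall>s\<in>{0..t}. \<bar>euler_process (ns k) (dyadic_left (ns k) s) \<omega>\<bar> \<le> c"
    if \<omega>: "\<omega> \<in> space M" "\<omega> \<notin> N" for \<omega> t
  proof -
    obtain k0 where k0: "\<forall>k\<ge>k0. \<forall>t\<in>{0..real k}. \<bar>euler_process (ns k) t \<omega> - X t \<omega>\<bar> \<le> 2 / 2 ^ k" using close[OF \<omega>] ..
    obtain k1 where k1: "t \<le> real k1" using real_arch_simple by blast
    obtain c where "\<forall>s\<in>{0..t}. \<bar>X s \<omega>\<bar> \<le> c" using continuous_bounded_Icc[OF Xc[OF \<omega>(1)], of t] ..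
    then have c: "\<bar>X s \<omega>\<bar> \<le> c" if "s \<in> {0..t}" for s using that by simp
    have "\<bar>euler_process (ns k) (dyadic_left (ns k) s) \<omega>\<bar> \<le> c + 2" if k: "max k0 k1 \<le> k" and s: "s \<in> {0..t}" for k s
    proof -
      let ?u = "dyadic_left (ns k) s"
      have u: "0 \<le> ?u" "?u \<le> s" using dyadic_left_bounds[of s "ns k"] s by auto
      have "real k1 \<le> real k" using k by simp
      then have "?u \<in> {0..real k}" using u s k1 by auto
      then have "\<bar>euler_process (ns k) ?u \<omega> - X ?u \<omega>\<bar> \<le> 2 / 2 ^ k" using k0 k by auto
      moreover have "(2::real) / 2 ^ k \<le> 2" by (simp add: divide_le_eq)
      moreover have "\<bar>X ?u \<omega>\<bar> \<le> c" using u s by (intro c) auto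
      ultimately show ?thesis by linarith
    qed
    then show ?thesis by blast
  qed
  have \<mu>c: "continuous_on {0..} (\<lambda>t. \<mu> (X t \<omega>))" and \<tau>c: "continuous_on {0..} (\<lambda>t. \<tau> (X t \<omega>))" if "\<omega> \<in> space M" for \<omega>
    using continuous_on_compose2[OF \<mu>_continuous[of UNIV] Xc[OF that]] continuous_on_compose2[OF \<tau>_continuous[of UNIV] Xc[OF that]] by auto
  have \<mu>a: "adapted F (\<lambda>t \<omega>. \<mu> (X t \<omega>))"
    using XF unfolding adapted_def using measurable_compose[OF _ \<mu>_measurable] by blast
  have p\<mu>: "progressive F (\<lambda>t \<omega>. \<mu> (X t \<omega>))" by (rule progressive_of_continuous[OF \<mu>a \<mu>c])
  have p\<tau>: "progressive F (\<lambda>t \<omega>. \<tau> (X t \<omega>))" by (rule progressive_of_continuous[OF \<tau>_adapted[OF XF] \<tau>c])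
  define I where "I t \<omega> = X t \<omega> - x\<^sub>0 - (LBINT s:{0..t}. \<mu> (X s \<omega>))" for t \<omega>
  have Ia: "adapted F I"
    unfolding adapted_def
  proof (intro allI impI)
    fix t :: real assume t: "0 \<le> t"
    have "X t \<in> borel_measurable (F t)" using XF t by (simp add: adapted_def)
    then show "I t \<in> borel_measurable (F t)" unfolding I_def
      by (intro borel_measurable_diff borel_measurable_const progressive_time_integral[OF p\<mu> t])
  qed
  have Ic: "continuous_paths M I"
    unfolding continuous_paths_def I_def using Xc time_integral_continuous[OF \<mu>c] by (intro AE_I2 continuous_intros) auto
  have ito: "has_ito_integral M F W (\<lambda>s \<omega>. \<tau> (X s \<omega>)) t (I t)" if t: "0 \<le> t" for t
    unfolding has_ito_integral_def
  proof (intro conjI exI allI)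
    show "progressive F (\<lambda>s \<omega>. \<tau> (X s \<omega>))" by (rule p\<tau>)
    show "AE \<omega> in M. set_integrable lborel {0..t} (\<lambda>s. (\<tau> (X s \<omega>))\<^sup>2)"
      by (intro AE_I2 borel_integrable_atLeastAtMost' continuous_on_power continuous_on_subset[OF \<tau>c]) auto
    let ?n = "\<lambda>k. dyadic_count (ns k) t" and ?p = "\<lambda>k i. real i / 2 ^ ns k"
      and ?\<xi> = "\<lambda>k i \<omega>. \<tau> (euler_process (ns k) (real i / 2 ^ ns k) \<omega>)"
    show sp: "simple_process M F (?n k) (?p k) (?\<xi> k)" for k
      by (rule dyadic_simple_process[OF \<tau>_adapted[OF euler_process_adapted] \<tau>_bounded])
    have val: "simple_value (?n k) (?p k) (?\<xi> k) s \<omega> = \<tau> (euler_process (ns k) (dyadic_left (ns k) s) \<omega>)" if st: "0 < s" "s \<le> t" for k s \<omega>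
    proof -
      obtain i where i: "real i / 2 ^ ns k < s" "s \<le> real (Suc i) / 2 ^ ns k" "dyadic_left (ns k) s = real i / 2 ^ ns k"
        by (rule dyadic_left_cell[OF st(1), of "ns k"])
      show ?thesis unfolding i(3) using simple_value_dyadic[OF i(1,2) st(2), of "?\<xi> k" \<omega>] .
    qed
    show "tendsto_in_prob M (\<lambda>k \<omega>. LBINT s:{0..t}. (simple_value (?n k) (?p k) (?\<xi> k) s \<omega> - \<tau> (X s \<omega>))\<^sup>2) (\<lambda>\<omega>. 0)"
    proof (rule tendsto_in_prob_AE)
      fix k
      have [measurable]: "?\<xi> k i \<in> borel_measurable M" for i
        using measurable_compose[OF euler_process_measurable \<tau>_measurable] by simp
      have t1: "(\<lambda>x. indicator {0..t} (snd x) * \<tau> (X (snd x) (fst x))) \<in> borel_measurable (M \<Otimes>\<^sub>M lborel)"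
        using measurable_pair_F[OF progressive_measurable[OF p\<tau> t] t] by (simp add: split_beta')
      have t2: "(\<lambda>x. simple_value (?n k) (?p k) (?\<xi> k) (snd x) (fst x)) \<in> borel_measurable (M \<Otimes>\<^sub>M lborel)"
        unfolding simple_value_def by measurable
      have t3: "(\<lambda>x. indicator {0..t} (snd x) * (simple_value (?n k) (?p k) (?\<xi> k) (snd x) (fst x) - indicator {0..t} (snd x) * \<tau> (X (snd x) (fst x)))\<^sup>2) \<in> borel_measurable (M \<Otimes>\<^sub>M lborel)"
        using t1 t2 by measurable
      have "(\<lambda>(\<omega>, s). indicator {0..t} s * (simple_value (?n k) (?p k) (?\<xi> k) s \<omega> - \<tau> (X s \<omega>))\<^sup>2) \<in> borel_measurable (M \<Otimes>\<^sub>M lborel)"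
        by (rule measurable_cong[THEN iffD1, OF _ t3]) (auto simp: indicator_def)
      from lborel.borel_measurable_lebesgue_integral[OF this]
      show "(\<lambda>\<omega>. LBINT s:{0..t}. (simple_value (?n k) (?p k) (?\<xi> k) s \<omega> - \<tau> (X s \<omega>))\<^sup>2) \<in> borel_measurable M"
        by (simp add: set_lebesgue_integral_def)
    next
      show "AE \<omega> in M. (\<lambda>k. LBINT s:{0..t}. (simple_value (?n k) (?p k) (?\<xi> k) s \<omega> - \<tau> (X s \<omega>))\<^sup>2) \<longlonglongrightarrow> 0"
        using aeN
      proof eventually_elim
        case (elim \<omega>)
        then have \<omega>: "\<omega> \<in> space M" "\<omega> \<notin> N" by auto
        have "(\<lambda>k. LBINT s:{0<..t}. (\<tau> (euler_process (ns k) (dyadic_left (ns k) s) \<omega>) - \<tau> (X s \<omega>))\<^sup>2) \<longlonglongrightarrow> integral\<^sup>L lborel (\<lambda>s::real. 0)"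
          unfolding set_lebesgue_integral_def
        proof (rule integral_dominated_convergence[where w="\<lambda>s. (2 * G)\<^sup>2 * indicator {0..t} s"])
          show "integrable lborel (\<lambda>s. (2 * G)\<^sup>2 * indicator {0..t} s)" using t by simp
          have m1: "(\<lambda>s. indicator {0<..t} s * \<tau> (X s \<omega>)) \<in> borel_measurable borel"
          proof -
            have "continuous_on {0<..t} (\<lambda>s. \<tau> (X s \<omega>))" by (rule continuous_on_subset[OF \<tau>c[OF \<omega>(1)]]) auto
            from borel_measurable_continuous_on_indicator[OF _ this] show ?thesis by simp
          qed
          have m2: "(\<lambda>s. indicator {0<..t} s * \<tau> (euler_process (ns k) (dyadic_left (ns k) s) \<omega>)) \<in> borel_measurable borel" for k
            using dyadic_step_integral(1)[OF t, where l="ns k" and f="\<lambda>r. \<tau> (euler_process (ns k) r \<omega>)"]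
            unfolding set_integrable_def by (auto dest: borel_measurable_integrable)
          have "(\<lambda>s. (indicator {0<..t} s * \<tau> (euler_process (ns k) (dyadic_left (ns k) s) \<omega>) - indicator {0<..t} s * \<tau> (X s \<omega>))\<^sup>2) \<in> borel_measurable borel" for k
            using m1 m2[of k] by measurable
          also have "(\<lambda>s. (indicator {0<..t} s * \<tau> (euler_process (ns k) (dyadic_left (ns k) s) \<omega>) - indicator {0<..t} s * \<tau> (X s \<omega>))\<^sup>2) =
            (\<lambda>s. indicat_real {0<..t} s *\<^sub>R (\<tau> (euler_process (ns k) (dyadic_left (ns k) s) \<omega>) - \<tau> (X s \<omega>))\<^sup>2)" for k
            by (auto simp: fun_eq_iff indicator_def)
          finally show "(\<lambda>s. indicat_real {0<..t} s *\<^sub>R (\<tau> (euler_process (ns k) (dyadic_left (ns k) s) \<omega>) - \<tau> (X s \<omega>))\<^sup>2) \<in> borel_measurable lborel" for k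
            by simp
          show "AE s in lborel. (\<lambda>k. indicat_real {0<..t} s *\<^sub>R (\<tau> (euler_process (ns k) (dyadic_left (ns k) s) \<omega>) - \<tau> (X s \<omega>))\<^sup>2) \<longlonglongrightarrow> 0"
          proof (intro AE_I2)
            fix s :: real
            show "(\<lambda>k. indicat_real {0<..t} s *\<^sub>R (\<tau> (euler_process (ns k) (dyadic_left (ns k) s) \<omega>) - \<tau> (X s \<omega>))\<^sup>2) \<longlonglongrightarrow> 0"
            proof (cases "s \<in> {0<..t}")
              case True
              then have "0 \<le> s" by simp
              from continuous_on_tendsto_compose[OF \<tau>_continuous[of UNIV] path(1)[OF \<omega> this]]
              have "(\<lambda>k. \<tau> (euler_process (ns k) (dyadic_left (ns k) s) \<omega>)) \<longlonglongrightarrow> \<tau> (X s \<omega>)" by simp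
              then have "(\<lambda>k. (\<tau> (euler_process (ns k) (dyadic_left (ns k) s) \<omega>) - \<tau> (X s \<omega>))\<^sup>2) \<longlonglongrightarrow> (\<tau> (X s \<omega>) - \<tau> (X s \<omega>))\<^sup>2"
                by (intro tendsto_power tendsto_diff tendsto_const)
              then show ?thesis using True by simp
            qed simp
          qed
          show "AE s in lborel. norm (indicat_real {0<..t} s *\<^sub>R (\<tau> (euler_process (ns k) (dyadic_left (ns k) s) \<omega>) - \<tau> (X s \<omega>))\<^sup>2) \<le> (2 * G)\<^sup>2 * indicator {0..t} s" for k
          proof (intro AE_I2)
            fix s :: real
            have "\<bar>\<tau> (euler_process (ns k) (dyadic_left (ns k) s) \<omega>) - \<tau> (X s \<omega>)\<bar> \<le> 2 * G"
              using \<tau>_bounded[of "euler_process (ns k) (dyadic_left (ns k) s) \<omega>"] \<tau>_bounded[of "X s \<omega>"] by linarith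
            from power_mono[OF this, of 2]
            show "norm (indicat_real {0<..t} s *\<^sub>R (\<tau> (euler_process (ns k) (dyadic_left (ns k) s) \<omega>) - \<tau> (X s \<omega>))\<^sup>2) \<le> (2 * G)\<^sup>2 * indicator {0..t} s"
              by (auto simp: indicator_def)
          qed
        qed simp
        moreover have "(LBINT s:{0<..t}. (\<tau> (euler_process (ns k) (dyadic_left (ns k) s) \<omega>) - \<tau> (X s \<omega>))\<^sup>2) =
          (LBINT s:{0..t}. (simple_value (?n k) (?p k) (?\<xi> k) s \<omega> - \<tau> (X s \<omega>))\<^sup>2)" for k
          unfolding LBINT_Ioc_eq_Icc[symmetric] unfolding set_lebesgue_integral_def
          by (intro Bochner_Integration.integral_cong refl) (auto simp: indicator_def val)
        ultimately show ?case by simp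
      qed
    qed simp
    have Im: "I t \<in> borel_measurable M" using Ia t F_measurable[of "I t" t] by (simp add: adapted_def)
    have Sm: "simple_integral W (?n k) (?p k) (?\<xi> k) t \<in> borel_measurable M" for k
      using sq_int_measurable[OF dyadic_integral_sq_int[OF \<tau>_adapted[OF euler_process_adapted] \<tau>_bounded t, where l="ns k"]]
      unfolding dyadic_integral_def .
    show "tendsto_in_prob M (\<lambda>k. simple_integral W (?n k) (?p k) (?\<xi> k) t) (I t)"
    proof (rule tendsto_in_prob_AE[OF Sm Im])
      show "AE \<omega> in M. (\<lambda>k. simple_integral W (?n k) (?p k) (?\<xi> k) t \<omega>) \<longlonglongrightarrow> I t \<omega>"
        using aeN
      proof eventually_elim
        case (elim \<omega>)
        then have \<omega>: "\<omega> \<in> space M" "\<omega> \<notin> N" by auto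
        have eq: "simple_integral W (?n k) (?p k) (?\<xi> k) t \<omega> = euler_process (ns k) t \<omega> - x\<^sub>0 -
          (LBINT s:{0<..t}. \<mu> (euler_process (ns k) (dyadic_left (ns k) s) \<omega>))" for k
          using euler_process_formula[OF t, of "ns k" \<omega>] unfolding dyadic_integral_def by simp
        obtain K c where c: "\<forall>k\<ge>K. \<forall>s\<in>{0..t}. \<bar>euler_process (ns k) (dyadic_left (ns k) s) \<omega>\<bar> \<le> c" using bound[OF \<omega>] by blast
        \<comment> \<open>The path bound c holds from index K on, so the sequence is shifted by K to
          obtain a dominating function for the drift, which grows linearly.\<close>
        have "(\<lambda>k. LBINT s:{0<..t}. \<mu> (euler_process (ns (k + K)) (dyadic_left (ns (k + K)) s) \<omega>)) \<longlonglongrightarrow> (LBINT s:{0<..t}. \<mu> (X s \<omega>))"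
          unfolding set_lebesgue_integral_def
        proof (rule integral_dominated_convergence[where w="\<lambda>s. (G + G * c) * indicator {0..t} s"])
          show "integrable lborel (\<lambda>s. (G + G * c) * indicator {0..t} s)" using t by simp
          show "(\<lambda>s. indicat_real {0<..t} s *\<^sub>R \<mu> (X s \<omega>)) \<in> borel_measurable lborel"
          proof -
            have "continuous_on {0<..t} (\<lambda>s. \<mu> (X s \<omega>))" by (rule continuous_on_subset[OF \<mu>c[OF \<omega>(1)]]) auto
            from borel_measurable_continuous_on_indicator[OF _ this] show ?thesis by simp
          qed
          show "(\<lambda>s. indicat_real {0<..t} s *\<^sub>R \<mu> (euler_process (ns (k + K)) (dyadic_left (ns (k + K)) s) \<omega>)) \<in> borel_measurable lborel" for k
            using dyadic_step_integral(1)[OF t, where l="ns (k + K)" and f="\<lambda>r. \<mu> (euler_process (ns (k + K)) r \<omega>)"]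
            unfolding set_integrable_def by (rule borel_measurable_integrable)
          show "AE s in lborel. (\<lambda>k. indicat_real {0<..t} s *\<^sub>R \<mu> (euler_process (ns (k + K)) (dyadic_left (ns (k + K)) s) \<omega>)) \<longlonglongrightarrow> indicat_real {0<..t} s *\<^sub>R \<mu> (X s \<omega>)"
          proof (intro AE_I2)
            fix s :: real
            show "(\<lambda>k. indicat_real {0<..t} s *\<^sub>R \<mu> (euler_process (ns (k + K)) (dyadic_left (ns (k + K)) s) \<omega>)) \<longlonglongrightarrow> indicat_real {0<..t} s *\<^sub>R \<mu> (X s \<omega>)"
            proof (cases "s \<in> {0<..t}")
              case True
              then have "0 \<le> s" by simp
              from continuous_on_tendsto_compose[OF \<mu>_continuous[of UNIV] path(1)[OF \<omega> this]]
              have "(\<lambda>k. \<mu> (euler_process (ns k) (dyadic_left (ns k) s) \<omega>)) \<longlonglongrightarrow> \<mu> (X s \<omega>)" by simp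
              from LIMSEQ_ignore_initial_segment[OF this, of K] show ?thesis using True by simp
            qed simp
          qed
          show "AE s in lborel. norm (indicat_real {0<..t} s *\<^sub>R \<mu> (euler_process (ns (k + K)) (dyadic_left (ns (k + K)) s) \<omega>)) \<le> (G + G * c) * indicator {0..t} s" for k
          proof (intro AE_I2)
            fix s :: real
            show "norm (indicat_real {0<..t} s *\<^sub>R \<mu> (euler_process (ns (k + K)) (dyadic_left (ns (k + K)) s) \<omega>)) \<le> (G + G * c) * indicator {0..t} s"
            proof (cases "s \<in> {0<..t}")
              case True
              then have s: "s \<in> {0..t}" by simp
              have "\<bar>euler_process (ns (k + K)) (dyadic_left (ns (k + K)) s) \<omega>\<bar> \<le> c"
                using c[rule_format, OF le_add2 s] .
              from mult_left_mono[OF this, of G] \<mu>_growth[of "euler_process (ns (k + K)) (dyadic_left (ns (k + K)) s) \<omega>"] G_ge_1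
              have "\<bar>\<mu> (euler_process (ns (k + K)) (dyadic_left (ns (k + K)) s) \<omega>)\<bar> \<le> G + G * c" by linarith
              then show ?thesis using True by simp
            next
              case False
              have "0 \<le> c" using c[rule_format, OF order_refl, of 0] t by simp
              then show ?thesis using False G_ge_1 by (simp add: indicator_def)
            qed
          qed
        qed
        then have "(\<lambda>k. LBINT s:{0<..t}. \<mu> (euler_process (ns k) (dyadic_left (ns k) s) \<omega>)) \<longlonglongrightarrow> (LBINT s:{0<..t}. \<mu> (X s \<omega>))"
          by (rule LIMSEQ_offset)
        then show ?case
          unfolding eq I_def LBINT_Ioc_eq_Icc[of t "\<lambda>s. \<mu> (X s \<omega>)", symmetric]
          by (intro tendsto_diff path(2)[OF \<omega> t] tendsto_const)
      qed
    qed
  qed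
  have "AE \<omega> in M. X 0 \<omega> = x\<^sub>0"
    using aeN
  proof eventually_elim
    case (elim \<omega>)
    then have "(\<lambda>k. euler_process (ns k) 0 \<omega>) \<longlonglongrightarrow> X 0 \<omega>" by (intro path(2)) auto
    moreover have "euler_process (ns k) 0 \<omega> = x\<^sub>0" for k using euler_process_grid[of "ns k" 0 \<omega>] by simp
    ultimately show ?case by (simp add: LIMSEQ_const_iff)
  qed
  moreover have "AE \<omega> in M. \<forall>t\<ge>0. set_integrable lborel {0..t} (\<lambda>s. \<mu> (X s \<omega>))"
    by (intro AE_I2 allI impI borel_integrable_atLeastAtMost' continuous_on_subset[OF \<mu>c]) auto
  moreover have "continuous_paths M X" unfolding continuous_paths_def using Xc by (intro AE_I2)
  ultimately have "strong_solution M F W \<mu> \<tau> x\<^sub>0 X"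
    unfolding strong_solution_def sde_solution_def ito_integral_process_def using XF Xg Ia Ic ito
    by (intro conjI exI[of _ I]) (auto simp: I_def)
  moreover have "AE \<omega> in M. (\<lambda>k. euler_process (ns k) t \<omega>) \<longlonglongrightarrow> X t \<omega>" if "0 \<le> t" for t
    using aeN by eventually_elim (use path(2) that in auto)
  ultimately show ?thesis using that[of X ns] ns Xc by blast
qed

section \<open>Uniqueness\<close>

text \<open>Along \<open>v = y - i\<close>, monotonicity of \<open>\<mu>\<close> gives \<open>v * \<mu> y \<le> v * \<mu> i\<close>.\<close>

lemma monotone_ode_bound:
  fixes y i :: "real \<Rightarrow> real"
  assumes y: "continuous_on {0..} y" and i: "continuous_on {0..} i"
    and eq: "\<And>t. 0 \<le> t \<Longrightarrow> y t = x + (LBINT s:{0..t}. \<mu> (y s)) + i t" and t: "0 \<le> t"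
  shows "\<bar>y t - i t\<bar> \<le> \<bar>x\<bar> + (LBINT s:{0..t}. \<bar>\<mu> (i s)\<bar>)"
proof (cases "t = 0")
  case True
  then have "(LBINT s:{0..t}. f s) = 0" for f :: "real \<Rightarrow> real"
    using LBINT_Ioc_eq_Icc[of t f] by (simp add: set_lebesgue_integral_def)
  then show ?thesis using eq[of 0] True by simp
next
  case False
  have \<mu>y: "continuous_on {0..u} (\<lambda>s. \<mu> (y s))" and \<mu>i: "continuous_on {0..u} (\<lambda>s. \<bar>\<mu> (i s)\<bar>)" for u
    by (intro continuous_intros continuous_on_compose2[OF \<mu>_continuous[of UNIV]] continuous_on_subset[OF y] continuous_on_subset[OF i]; auto)+
  define v where "v u = x + integral {0..u} (\<lambda>s. \<mu> (y s))" for u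
  define w where "w u = integral {0..u} (\<lambda>s. \<bar>\<mu> (i s)\<bar>)" for u
  have v: "v u = y u - i u" if "0 \<le> u" for u
    using eq[OF that] set_borel_integral_eq_integral(2)[OF borel_integrable_atLeastAtMost'[OF \<mu>y[of u]]] by (simp add: v_def)
  have dv: "(v has_real_derivative \<mu> (y u)) (at u)" and dw: "(w has_real_derivative \<bar>\<mu> (i u)\<bar>) (at u)" if u: "0 < u" "u < t" for u
  proof -
    have a: "at u within {0..t} = at u" using u by (intro at_within_Icc_at) auto
    have "((\<lambda>u. integral {0..u} (\<lambda>s. \<mu> (y s))) has_real_derivative \<mu> (y u)) (at u)"
      using integral_has_real_derivative[OF \<mu>y[of t], of u] u by (simp add: a)
    then show "(v has_real_derivative \<mu> (y u)) (at u)"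
      unfolding v_def[abs_def] by (auto intro!: derivative_eq_intros)
    show "(w has_real_derivative \<bar>\<mu> (i u)\<bar>) (at u)"
      unfolding w_def[abs_def] using integral_has_real_derivative[OF \<mu>i[of t], of u] u by (simp add: a)
  qed
  have cv: "continuous_on {0..t} v" "continuous_on {0..t} w"
    unfolding v_def[abs_def] w_def[abs_def]
    by (intro continuous_intros indefinite_integral_continuous_1 integrable_continuous_real \<mu>y \<mu>i)+
  have "\<bar>v t\<bar> \<le> \<bar>x\<bar> + w t"
  proof (rule field_le_epsilon)
    fix e :: real assume e: "0 < e"
    \<comment> \<open>\<open>sqrt ((v u)\<^sup>2 + e\<^sup>2)\<close> is a differentiable substitute
      for the absolute value of \<open>v u\<close>; e is arbitrary and disappears at the
      end.\<close>
    have sp: "0 < sqrt ((v u)\<^sup>2 + e\<^sup>2)" for u using e by (simp add: add_nonneg_pos)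
    have "sqrt ((v t)\<^sup>2 + e\<^sup>2) - w t \<le> sqrt ((v 0)\<^sup>2 + e\<^sup>2) - w 0"
    proof (rule DERIV_nonpos_imp_decreasing_open[OF t])
      fix u assume u: "0 < u" "u < t"
      have d: "((\<lambda>u. sqrt ((v u)\<^sup>2 + e\<^sup>2) - w u) has_real_derivative (v u * \<mu> (y u) / sqrt ((v u)\<^sup>2 + e\<^sup>2) - \<bar>\<mu> (i u)\<bar>)) (at u)"
        using sp[of u] by (auto intro!: derivative_eq_intros dv[OF u] dw[OF u] simp: field_simps)
      have "v u * \<mu> (y u) \<le> v u * \<mu> (i u)"
      proof (cases "0 \<le> v u")
        case True
        then have "\<mu> (y u) \<le> \<mu> (i u)" using v[of u] u by (intro \<mu>_antimono) simp
        then show ?thesis using True by (rule mult_left_mono)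
      next
        case False
        then have "\<mu> (i u) \<le> \<mu> (y u)" using v[of u] u by (intro \<mu>_antimono) simp
        then show ?thesis using False by (intro mult_left_mono_neg) auto
      qed
      also have "\<dots> \<le> sqrt ((v u)\<^sup>2 + e\<^sup>2) * \<bar>\<mu> (i u)\<bar>"
      proof -
        have "\<bar>v u\<bar> \<le> sqrt ((v u)\<^sup>2 + e\<^sup>2)" by (intro real_le_rsqrt) simp
        from mult_right_mono[OF this, of "\<bar>\<mu> (i u)\<bar>"] show ?thesis
          using abs_ge_self[of "v u * \<mu> (i u)"] by (simp add: abs_mult)
      qed
      finally have "v u * \<mu> (y u) / sqrt ((v u)\<^sup>2 + e\<^sup>2) \<le> \<bar>\<mu> (i u)\<bar>"
        using sp[of u] by (simp add: divide_le_eq mult.commute)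
      with d show "\<exists>y. ((\<lambda>u. sqrt ((v u)\<^sup>2 + e\<^sup>2) - w u) has_real_derivative y) (at u) \<and> y \<le> 0" by auto
    next
      show "continuous_on {0..t} (\<lambda>u. sqrt ((v u)\<^sup>2 + e\<^sup>2) - w u)" by (intro continuous_intros cv)
    qed
    moreover have "\<bar>v t\<bar> \<le> sqrt ((v t)\<^sup>2 + e\<^sup>2)" by (intro real_le_rsqrt) simp
    moreover have "sqrt ((v 0)\<^sup>2 + e\<^sup>2) \<le> \<bar>x\<bar> + e"
      using sqrt_sum_squares_le_sum_abs[of x e] e by (simp add: v_def)
    moreover have "w 0 = 0" by (simp add: w_def)
    ultimately show "\<bar>v t\<bar> \<le> \<bar>x\<bar> + w t + e" by linarith
  qed
  moreover have "(LBINT s:{0..t}. \<bar>\<mu> (i s)\<bar>) = w t"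
    unfolding w_def by (rule set_borel_integral_eq_integral(2)[OF borel_integrable_atLeastAtMost'[OF \<mu>i]])
  ultimately show ?thesis using v[OF t] by simp
qed

text \<open>H enters only through second moments at fixed times, which do not see a change on a null
  set.\<close>

lemma ito_like_cong_AE:
  assumes I: "ito_like n B H I" and m: "\<And>r. 0 \<le> r \<Longrightarrow> H r \<in> borel_measurable M" "\<And>r. 0 \<le> r \<Longrightarrow> H' r \<in> borel_measurable M"
    and ae: "\<And>r. 0 \<le> r \<Longrightarrow> AE \<omega> in M. H r \<omega> = H' r \<omega>"
  shows "ito_like n B H' I"
proof -
  have e: "expectation (\<lambda>\<omega>. (H r \<omega> - \<zeta> \<omega>)\<^sup>2) = expectation (\<lambda>\<omega>. (H' r \<omega> - \<zeta> \<omega>)\<^sup>2)"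
    if "\<zeta> \<in> borel_measurable (F (real k / 2 ^ n))" "real k / 2 ^ n \<le> r" for \<zeta> k r
  proof (rule integral_cong_AE)
    have k0: "0 \<le> real k / 2 ^ n" by simp
    then have r: "0 \<le> r" using that by linarith
    have \<zeta>: "\<zeta> \<in> borel_measurable M" by (rule F_measurable[OF that(1) k0])
    show "(\<lambda>\<omega>. (H r \<omega> - \<zeta> \<omega>)\<^sup>2) \<in> borel_measurable M" "(\<lambda>\<omega>. (H' r \<omega> - \<zeta> \<omega>)\<^sup>2) \<in> borel_measurable M"
      using m[OF r] \<zeta> by (auto intro!: borel_measurable_power borel_measurable_diff)
    show "AE \<omega> in M. (H r \<omega> - \<zeta> \<omega>)\<^sup>2 = (H' r \<omega> - \<zeta> \<omega>)\<^sup>2" using ae[OF r] by auto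
  qed
  show ?thesis
    unfolding ito_like_def Let_def
  proof (intro conjI allI impI)
    show "adapted F I" using I by (simp add: ito_like_def)
    fix k t assume st: "real k / 2 ^ n \<le> t"
    note D = ito_like_D[OF I refl st]
    show "integrable M (\<lambda>\<omega>. (I t \<omega> - I (real k / 2 ^ n) \<omega>) ^ 4)"
      "expectation (\<lambda>\<omega>. (I t \<omega> - I (real k / 2 ^ n) \<omega>) ^ 4) \<le> 3 * B ^ 4 * (t - real k / 2 ^ n)\<^sup>2"
      by (rule D)+
    show "expectation (\<lambda>\<omega>. \<xi> \<omega> * (I t \<omega> - I (real k / 2 ^ n) \<omega>)) = 0"
      if "\<xi> \<in> borel_measurable (F (real k / 2 ^ n))" "sq_int \<xi>" for \<xi> using that by (rule D)
    fix \<zeta> K c assume \<zeta>: "\<zeta> \<in> borel_measurable (F (real k / 2 ^ n))" "\<forall>\<omega>\<in>space M. \<bar>\<zeta> \<omega>\<bar> \<le> K"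
      and c: "\<forall>r. real k / 2 ^ n \<le> r \<longrightarrow> r < t \<longrightarrow> expectation (\<lambda>\<omega>. (H' r \<omega> - \<zeta> \<omega>)\<^sup>2) \<le> c"
    have c': "expectation (\<lambda>\<omega>. (H r \<omega> - \<zeta> \<omega>)\<^sup>2) \<le> c" if "real k / 2 ^ n \<le> r" "r < t" for r
      using c that unfolding e[OF \<zeta>(1) that(1)] by blast
    show "sq_int (\<lambda>\<omega>. I t \<omega> - I (real k / 2 ^ n) \<omega> - \<zeta> \<omega> * (W t \<omega> - W (real k / 2 ^ n) \<omega>))"
      "expectation (\<lambda>\<omega>. (I t \<omega> - I (real k / 2 ^ n) \<omega> - \<zeta> \<omega> * (W t \<omega> - W (real k / 2 ^ n) \<omega>))\<^sup>2) \<le> c * (t - real k / 2 ^ n)"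
      using ito_like_residual[OF I refl st \<zeta>(1) \<zeta>(2)[rule_format] c'] by auto
  qed
qed

text \<open>By completeness of the filtration N belongs to every \<open>F t\<close> with t \<ge>
  0.\<close>

lemma continuous_modification_adapted:
  assumes "adapted F X" "N \<in> null_sets M"
  shows "adapted F (\<lambda>t \<omega>. if \<omega> \<in> N then x else X t \<omega>)"
  unfolding adapted_def
proof (intro allI impI)
  fix t :: real assume t: "0 \<le> t"
  have [measurable]: "N \<in> sets (F t)" using assms(2) null_sets_filtration filtration_mono[of 0 t] t by auto
  have [measurable]: "X t \<in> borel_measurable (F t)" using assms(1) t by (simp add: adapted_def)
  show "(\<lambda>\<omega>. if \<omega> \<in> N then x else X t \<omega>) \<in> borel_measurable (F t)" by measurable
qed

text \<open>Being a solution says nothing about moments. The integral I has them because \<tau> is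
  bounded, and \<open>monotone_ode_bound\<close> transfers them to the solution path by path. The
  modification Y' has only continuous paths, from which its joint measurability is deduced.\<close>

lemma sde_solution_approx:
  assumes "sde_solution M F W \<mu> \<tau> x\<^sub>0 Y" and T: "0 \<le> T"
  obtains Y' I K where "\<And>n. approx_solution n T K Y' I (\<lambda>s. s)" "AE \<omega> in M. \<forall>t\<ge>0. Y' t \<omega> = Y t \<omega>"
    "\<And>\<omega>. \<omega> \<in> space M \<Longrightarrow> continuous_on {0..} (\<lambda>t. Y' t \<omega>)" "0 \<le> K"
proof -
  from assms(1) obtain I where YF: "adapted F Y" and Yc: "continuous_paths M Y" and Y0: "AE \<omega> in M. Y 0 \<omega> = x\<^sub>0"
    and I: "ito_integral_process M F W (\<lambda>s \<omega>. \<tau> (Y s \<omega>)) I"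
    and eq: "AE \<omega> in M. \<forall>t\<ge>0. Y t \<omega> = x\<^sub>0 + (LBINT s:{0..t}. \<mu> (Y s \<omega>)) + I t \<omega>"
    unfolding sde_solution_def by blast
  have IF: "adapted F I" and Ic: "continuous_paths M I" and ito: "\<And>t. 0 \<le> t \<Longrightarrow> has_ito_integral M F W (\<lambda>s \<omega>. \<tau> (Y s \<omega>)) t (I t)"
    using I by (auto simp: ito_integral_process_def)
  have Hc: "continuous_paths M (\<lambda>s \<omega>. \<tau> (Y s \<omega>))"
    using Yc unfolding continuous_paths_def
    by eventually_elim (rule continuous_on_compose2[OF \<tau>_continuous[of UNIV]], auto)
  note lim = ito_integral_dyadic_limit[OF \<tau>_adapted[OF YF] \<tau>_bounded Hc _ ito]
  have il: "ito_like n G (\<lambda>s \<omega>. \<tau> (Y s \<omega>)) I" for n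
    by (rule ito_like_limit[OF \<tau>_adapted[OF YF] \<tau>_bounded IF lim])
  have "AE \<omega> in M. continuous_on {0..} (\<lambda>t. Y t \<omega>) \<and> continuous_on {0..} (\<lambda>t. I t \<omega>) \<and> Y 0 \<omega> = x\<^sub>0 \<and>
    (\<forall>t\<ge>0. Y t \<omega> = x\<^sub>0 + (LBINT s:{0..t}. \<mu> (Y s \<omega>)) + I t \<omega>)"
    using Yc Ic Y0 eq unfolding continuous_paths_def by eventually_elim auto
  then obtain N where N: "N \<in> null_sets M" and good: "{\<omega> \<in> space M. \<not> (continuous_on {0..} (\<lambda>t. Y t \<omega>) \<and> continuous_on {0..} (\<lambda>t. I t \<omega>) \<and> Y 0 \<omega> = x\<^sub>0 \<and>
    (\<forall>t\<ge>0. Y t \<omega> = x\<^sub>0 + (LBINT s:{0..t}. \<mu> (Y s \<omega>)) + I t \<omega>))} \<subseteq> N"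
    unfolding eventually_ae_filter by blast
  have g: "continuous_on {0..} (\<lambda>t. Y t \<omega>)" "continuous_on {0..} (\<lambda>t. I t \<omega>)" "Y 0 \<omega> = x\<^sub>0"
    "\<And>t. 0 \<le> t \<Longrightarrow> Y t \<omega> = x\<^sub>0 + (LBINT s:{0..t}. \<mu> (Y s \<omega>)) + I t \<omega>" if "\<omega> \<in> space M" "\<omega> \<notin> N" for \<omega>
    using good that by blast+
  define Y' where "Y' t \<omega> = (if \<omega> \<in> N then x\<^sub>0 else Y t \<omega>)" for t \<omega>
  define I' where "I' t \<omega> = (if \<omega> \<in> N then 0 else I t \<omega>)" for t \<omega>
  have aeN: "AE \<omega> in M. \<omega> \<in> space M \<and> \<omega> \<notin> N" using AE_not_in[OF N] by auto
  have Y'F: "adapted F Y'" and I'F: "adapted F I'"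
    unfolding Y'_def[abs_def] I'_def[abs_def] by (rule continuous_modification_adapted[OF _ N], fact)+
  have Y'c: "continuous_on {0..} (\<lambda>t. Y' t \<omega>)" and I'c: "continuous_on {0..} (\<lambda>t. I' t \<omega>)" if "\<omega> \<in> space M" for \<omega>
    using g(1,2)[OF that] by (cases "\<omega> \<in> N"; simp add: Y'_def I'_def)+
  have Ym: "Y t \<in> borel_measurable M" "Y' t \<in> borel_measurable M" "I t \<in> borel_measurable M" "I' t \<in> borel_measurable M" if "0 \<le> t" for t
    by (rule F_measurable[OF _ that], use YF Y'F IF I'F that in \<open>simp add: adapted_def\<close>)+
  have il': "ito_like n G (\<lambda>s \<omega>. \<tau> (Y' s \<omega>)) I" for n
  proof (rule ito_like_cong_AE[OF il])
    show "(\<lambda>\<omega>. \<tau> (Y r \<omega>)) \<in> borel_measurable M" "(\<lambda>\<omega>. \<tau> (Y' r \<omega>)) \<in> borel_measurable M" if "0 \<le> r" for r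
      using measurable_compose[OF Ym(1)[OF that] \<tau>_measurable] measurable_compose[OF Ym(2)[OF that] \<tau>_measurable] .
    show "AE \<omega> in M. \<tau> (Y r \<omega>) = \<tau> (Y' r \<omega>)" for r using aeN by eventually_elim (simp add: Y'_def)
  qed
  \<comment> \<open>At time 0 the drift integral vanishes and Y equals \<open>x\<^sub>0\<close>, so
    I starts at 0; thus \<open>I' t\<close> is almost surely an increment, to which
    \<open>ito_like_sq\<close> applies.\<close>
  have I0: "I 0 \<omega> = 0" if "\<omega> \<in> space M" "\<omega> \<notin> N" for \<omega>
    using g(3)[OF that] g(4)[OF that, of 0] LBINT_Ioc_eq_Icc[of 0 "\<lambda>s. \<mu> (Y s \<omega>)"] by (simp add: set_lebesgue_integral_def)
  have I2: "sq_int (I' t)" "expectation (\<lambda>\<omega>. (I' t \<omega>)\<^sup>2) \<le> G\<^sup>2 * t" if t: "0 \<le> t" for t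
  proof -
    have t': "real 0 / 2 ^ 0 \<le> t" using t by simp
    note i = ito_like_sq[OF il'[of 0] refl t' \<tau>_bounded]
    have ae: "AE \<omega> in M. I' t \<omega> = I t \<omega> - I (real 0 / 2 ^ 0) \<omega>"
      using aeN by eventually_elim (simp add: I'_def I0)
    have m: "(\<lambda>\<omega>. (I' t \<omega>)\<^sup>2) \<in> borel_measurable M" "(\<lambda>\<omega>. (I t \<omega> - I (real 0 / 2 ^ 0) \<omega>)\<^sup>2) \<in> borel_measurable M"
      using Ym[OF t] Ym[of 0] by (auto intro!: borel_measurable_power)
    have ae2: "AE \<omega> in M. (I' t \<omega>)\<^sup>2 = (I t \<omega> - I (real 0 / 2 ^ 0) \<omega>)\<^sup>2" using ae by eventually_elim simp
    show "expectation (\<lambda>\<omega>. (I' t \<omega>)\<^sup>2) \<le> G\<^sup>2 * t"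
      using integral_cong_AE[OF m ae2] i(2) by simp
    show "sq_int (I' t)" unfolding sq_int_def
      using integrable_cong_AE[OF m ae2] sq_int_square[OF i(1)] Ym[OF t] by simp
  qed
  \<comment> \<open>Bounds the second moment of \<open>\<mu> (I' u)\<close> for u \<le> T, by linear
    growth of \<mu> and the bound \<open>G\<^sup>2 * T\<close> for that of
    \<open>I' u\<close>.\<close>
  define c where "c = 2 * G\<^sup>2 * (1 + G\<^sup>2 * T)"
  have c0: "0 \<le> c" using T by (simp add: c_def)
  have drift: "sq_int (\<lambda>\<omega>. LBINT s:{0..t}. \<bar>\<mu> (I' s \<omega>)\<bar>)" "expectation (\<lambda>\<omega>. (LBINT s:{0..t}. \<bar>\<mu> (I' s \<omega>)\<bar>)\<^sup>2) \<le> T\<^sup>2 * c"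
    if t: "0 \<le> t" "t \<le> T" for t
  proof -
    have \<mu>I: "continuous_on {0..} (\<lambda>s. \<bar>\<mu> (I' s \<omega>)\<bar>)" if "\<omega> \<in> space M" for \<omega>
      by (intro continuous_on_rabs continuous_on_compose2[OF \<mu>_continuous[of UNIV] I'c[OF that]]) auto
    have aI: "adapted F (\<lambda>s \<omega>. \<bar>\<mu> (I' s \<omega>)\<bar>)"
      using I'F unfolding adapted_def using measurable_compose[OF _ \<mu>_measurable] by (auto intro!: borel_measurable_abs)
    note m = measurable_pair_F[OF progressive_measurable[OF progressive_of_continuous[OF aI \<mu>I] t(1)] t(1)]
    have m': "(\<lambda>x. indicator {0<..t} (snd x) * (indicator {0..t} (snd x) * \<bar>\<mu> (I' (snd x) (fst x))\<bar>)) \<in> borel_measurable (M \<Otimes>\<^sub>M lborel)"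
      using m unfolding split_beta' by measurable
    have m2: "(\<lambda>(\<omega>, s). indicator {0<..t} s * \<bar>\<mu> (I' s \<omega>)\<bar>) \<in> borel_measurable (M \<Otimes>\<^sub>M lborel)"
      by (rule measurable_cong[THEN iffD1, OF _ m']) (auto simp: indicator_def)
    have b: "\<exists>K. \<forall>u. \<bar>indicator {0<..t} u * \<bar>\<mu> (I' u \<omega>)\<bar>\<bar> \<le> K * indicator {0<..t} u" if \<omega>: "\<omega> \<in> space M" for \<omega>
    proof -
      obtain K where "\<forall>s\<in>{0..t}. \<bar>\<bar>\<mu> (I' s \<omega>)\<bar>\<bar> \<le> K" using continuous_bounded_Icc[OF \<mu>I[OF \<omega>], of t] ..
      then have K: "\<bar>\<mu> (I' s \<omega>)\<bar> \<le> K" if "0 < s" "s \<le> t" for s using that by simp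
      show ?thesis by (intro exI[of _ K]) (auto simp: indicator_def K)
    qed
    have q: "sq_int (\<lambda>\<omega>. indicator {0<..t} u * \<bar>\<mu> (I' u \<omega>)\<bar>) \<and> expectation (\<lambda>\<omega>. (indicator {0<..t} u * \<bar>\<mu> (I' u \<omega>)\<bar>)\<^sup>2) \<le> c"
      if u: "0 < u" "u \<le> t" for u
    proof -
      have u0: "0 \<le> u" using u by simp
      have "expectation (\<lambda>\<omega>. (\<mu> (I' u \<omega>))\<^sup>2) \<le> 2 * G\<^sup>2 * (1 + expectation (\<lambda>\<omega>. (I' u \<omega>)\<^sup>2))" by (rule \<mu>_sq_int[OF I2(1)[OF u0]])
      also have "\<dots> \<le> c"
      proof -
        have "G\<^sup>2 * u \<le> G\<^sup>2 * T" using u t by (intro mult_left_mono) auto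
        then show ?thesis unfolding c_def using I2(2)[OF u0] by (intro mult_left_mono) auto
      qed
      finally show ?thesis using u sq_int_abs[OF \<mu>_sq_int(1)[OF I2(1)[OF u0]]] by simp
    qed
    note l = time_integral_sq_int[OF m2 t(1) b q c0]
    have L: "(LBINT s:{0..t}. \<bar>\<mu> (I' s \<omega>)\<bar>) = integral\<^sup>L lborel (\<lambda>u. indicator {0<..t} u * \<bar>\<mu> (I' u \<omega>)\<bar>)" for \<omega>
      unfolding LBINT_Ioc_eq_Icc[symmetric] by (simp add: set_lebesgue_integral_def)
    show "sq_int (\<lambda>\<omega>. LBINT s:{0..t}. \<bar>\<mu> (I' s \<omega>)\<bar>)" unfolding L by (rule l(1))
    have "(t - 0)\<^sup>2 * c \<le> T\<^sup>2 * c" using t c0 by (intro mult_right_mono power_mono) auto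
    then show "expectation (\<lambda>\<omega>. (LBINT s:{0..t}. \<bar>\<mu> (I' s \<omega>)\<bar>)\<^sup>2) \<le> T\<^sup>2 * c" unfolding L using l(2) by linarith
  qed
  \<comment> \<open>Comes from applying (u + v)^2 \<le> 2 u^2 + 2 v^2 twice to the sum of initial
    value, drift integral and stochastic integral that dominates Y'.\<close>
  define K where "K = 2 * (2 * x\<^sub>0\<^sup>2 + 2 * (T\<^sup>2 * c)) + 2 * (G\<^sup>2 * T)"
  have K0: "0 \<le> K" using c0 T by (simp add: K_def)
  have Y2: "sq_int (Y' t) \<and> expectation (\<lambda>\<omega>. (Y' t \<omega>)\<^sup>2) \<le> K" if t: "0 \<le> t" "t \<le> T" for t
  proof -
    let ?D = "\<lambda>\<omega>. LBINT s:{0..t}. \<bar>\<mu> (I' s \<omega>)\<bar>"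
    let ?B = "\<lambda>\<omega>. (\<bar>x\<^sub>0\<bar> + ?D \<omega>) + \<bar>I' t \<omega>\<bar>"
    have s1: "sq_int (\<lambda>\<omega>. \<bar>x\<^sub>0\<bar> + ?D \<omega>)" by (rule sq_int_add[OF sq_int_const drift(1)[OF t]])
    have sB: "sq_int ?B" by (rule sq_int_add[OF s1 sq_int_abs[OF I2(1)[OF t(1)]]])
    have D0: "0 \<le> ?D \<omega>" for \<omega> unfolding set_lebesgue_integral_def by (intro integral_nonneg_AE) auto
    have le: "\<bar>Y' t \<omega>\<bar> \<le> ?B \<omega>" if \<omega>: "\<omega> \<in> space M" for \<omega>
    proof (cases "\<omega> \<in> N")
      case True
      then show ?thesis using D0[of \<omega>] by (simp add: Y'_def)
    next
      case False
      have "\<bar>Y t \<omega> - I t \<omega>\<bar> \<le> \<bar>x\<^sub>0\<bar> + (LBINT s:{0..t}. \<bar>\<mu> (I s \<omega>)\<bar>)"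
        by (rule monotone_ode_bound[OF g(1,2,4)[OF \<omega> False] t(1)])
      then show ?thesis using False by (simp add: Y'_def I'_def)
    qed
    have "expectation (\<lambda>\<omega>. (Y' t \<omega>)\<^sup>2) \<le> expectation (\<lambda>\<omega>. (?B \<omega>)\<^sup>2)"
    proof (rule integral_mono'[OF sq_int_square[OF sB]])
      show "(Y' t \<omega>)\<^sup>2 \<le> (?B \<omega>)\<^sup>2" if "\<omega> \<in> space M" for \<omega>
        using power_mono[OF le[OF that], of 2] by simp
    qed simp
    also have "\<dots> \<le> 2 * expectation (\<lambda>\<omega>. (\<bar>x\<^sub>0\<bar> + ?D \<omega>)\<^sup>2) + 2 * expectation (\<lambda>\<omega>. \<bar>I' t \<omega>\<bar>\<^sup>2)"
      by (rule expectation_sq_add_le[OF s1 sq_int_abs[OF I2(1)[OF t(1)]]])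
    also have "\<dots> \<le> K"
    proof -
      have e1: "expectation (\<lambda>\<omega>. (\<bar>x\<^sub>0\<bar> + ?D \<omega>)\<^sup>2) \<le> 2 * x\<^sub>0\<^sup>2 + 2 * (T\<^sup>2 * c)"
        using expectation_sq_add_le[OF sq_int_const[of "\<bar>x\<^sub>0\<bar>"] drift(1)[OF t]] drift(2)[OF t] by (simp add: prob_space)
      have e2: "expectation (\<lambda>\<omega>. \<bar>I' t \<omega>\<bar>\<^sup>2) \<le> G\<^sup>2 * T"
        using I2(2)[OF t(1)] mult_left_mono[OF t(2), of "G\<^sup>2"] by simp
      show ?thesis unfolding K_def by (rule add_mono[OF mult_left_mono[OF e1] mult_left_mono[OF e2]]) simp_all
    qed
    finally have "expectation (\<lambda>\<omega>. (Y' t \<omega>)\<^sup>2) \<le> K" .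
    moreover have "sq_int (Y' t)"
      using le by (intro sq_int_le[OF sB Ym(2)[OF t(1)]]) (auto intro: order_trans[OF _ abs_ge_self])
    ultimately show ?thesis by blast
  qed
  have "approx_solution n T K Y' I (\<lambda>s. s)" for n
    unfolding approx_solution_def
  proof (intro conjI allI impI ballI)
    show "adapted F Y'" by fact
    show "sq_int (Y' t)" "expectation (\<lambda>\<omega>. (Y' t \<omega>)\<^sup>2) \<le> K" if "0 \<le> t" "t \<le> T" for t using Y2[OF that] by auto
    show "AE \<omega> in M. Y' 0 \<omega> = x\<^sub>0" using aeN by eventually_elim (use g(3) in \<open>auto simp: Y'_def\<close>)
    show "ito_like n G (\<lambda>t \<omega>. \<tau> (Y' t \<omega>)) I" by (rule il')
    show "(\<lambda>(\<omega>, s). indicator {0..T} s * Y' s \<omega>) \<in> borel_measurable (M \<Otimes>\<^sub>M lborel)"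
      by (rule measurable_pair_F[OF progressive_measurable[OF progressive_of_continuous[OF Y'F Y'c] T] T])
    show "\<exists>c. \<forall>s\<in>{0..T}. \<bar>Y' s \<omega>\<bar> \<le> c" if "\<omega> \<in> space M" for \<omega>
      by (rule continuous_bounded_Icc[OF Y'c[OF that]])
    show "AE \<omega> in M. Y' t \<omega> = Y' (real k / 2 ^ n) \<omega> + (LBINT s:{real k / 2 ^ n<..t}. \<mu> (Y' s \<omega>)) + (I t \<omega> - I (real k / 2 ^ n) \<omega>)"
      if kt: "real k / 2 ^ n \<le> t" for k t
      using aeN
    proof eventually_elim
      case (elim \<omega>)
      then have \<omega>: "\<omega> \<in> space M" "\<omega> \<notin> N" by auto
      define s where "s = real k / 2 ^ n"
      have s: "0 \<le> s" "s \<le> t" "0 \<le> t" using kt by (auto simp: s_def intro: order_trans[of 0 "real k / 2 ^ n"])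
      have i: "set_integrable lborel {0..t} (\<lambda>s. \<mu> (Y s \<omega>))"
        by (intro borel_integrable_atLeastAtMost' continuous_on_compose2[OF \<mu>_continuous[of UNIV] continuous_on_subset[OF g(1)[OF \<omega>]]]) auto
      have U: "{0..t} = {0..s} \<union> {s<..t}" using s by auto
      have "(LBINT r:{0..t}. \<mu> (Y r \<omega>)) = (LBINT r:{0..s}. \<mu> (Y r \<omega>)) + (LBINT r:{s<..t}. \<mu> (Y r \<omega>))"
        unfolding U by (rule set_integral_Un) (use s in \<open>auto intro: set_integrable_subset[OF i]\<close>)
      then show ?case
        using g(4)[OF \<omega> s(3)] g(4)[OF \<omega> s(1)] \<omega>(2) unfolding s_def[symmetric] by (simp add: Y'_def)
    qed
  qed auto
  moreover have "AE \<omega> in M. \<forall>t\<ge>0. Y' t \<omega> = Y t \<omega>" using aeN by eventually_elim (simp add: Y'_def)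
  ultimately show ?thesis using that Y'c K0 by blast
qed

text \<open>A dyadic time is a grid point of all sufficiently fine polygons, where
  \<open>euler_converges\<close> applies; so X and any solution Y are limits of the same sequence
  there and agree almost surely. Countability of the dyadic times and continuity then give all times
  at once.\<close>

lemma unique_strong_solution: "has_unique_strong_solution M F W \<mu> \<tau> x\<^sub>0"
proof -
  obtain X :: "real \<Rightarrow> 'a \<Rightarrow> real" and ns :: "nat \<Rightarrow> nat" where X: "strong_solution M F W \<mu> \<tau> x\<^sub>0 X" and ns: "\<And>k. k \<le> ns k"
    and Xc: "\<And>\<omega>. \<omega> \<in> space M \<Longrightarrow> continuous_on {0..} (\<lambda>t. X t \<omega>)"
    and lim: "\<And>t. 0 \<le> t \<Longrightarrow> AE \<omega> in M. (\<lambda>k. euler_process (ns k) t \<omega>) \<longlonglongrightarrow> X t \<omega>"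
    apply (rule strong_solution_exists)
    subgoal premises prems for X ns by (rule prems(1)[OF prems(2-5)])
    done
  have XF: "adapted F X" using X by (simp add: strong_solution_def sde_solution_def)
  have "indistinguishable M X Y" if Y: "sde_solution M F W \<mu> \<tau> x\<^sub>0 Y" for Y
  proof -
    have YF: "adapted F Y" using Y by (simp add: sde_solution_def)
    have eq: "AE \<omega> in M. X (real j / 2 ^ m) \<omega> = Y (real j / 2 ^ m) \<omega>" for j m
    proof -
      define t where "t = real j / 2 ^ m"
      have t: "0 \<le> t" by (simp add: t_def)
      obtain Y' I K where Y': "\<And>n. approx_solution n t K Y' I (\<lambda>s. s)" "AE \<omega> in M. \<forall>t\<ge>0. Y' t \<omega> = Y t \<omega>" "0 \<le> K"
        apply (rule sde_solution_approx[OF Y t])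
        subgoal premises prems for Y' I K by (rule prems(1)[OF prems(2,3,5)])
        done
      have Y's: "sq_int (Y' t)" using approx_sq_int(1)[OF Y'(1) t] by simp
      let ?V = "\<lambda>k \<omega>. euler_process (ns k) t \<omega> - Y' t \<omega>"
      have Vs: "sq_int (?V k)" for k by (rule sq_int_diff[OF euler_process_second_moment(1)[OF t] Y's])
      have c: "(\<lambda>k. expectation (\<lambda>\<omega>. \<bar>?V k \<omega>\<bar>)) \<longlonglongrightarrow> 0"
      proof (rule LIMSEQ_I)
        fix e :: real assume e: "0 < e"
        then have e2: "0 < e / 2" by simp
        obtain n0 where
          n0: "\<And>n Y I \<rho> k. n0 \<le> n \<Longrightarrow> approx_solution n t K Y I \<rho> \<Longrightarrow> real k / 2 ^ n \<le> t \<Longrightarrow>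
            expectation (\<lambda>\<omega>. \<bar>Y (real k / 2 ^ n) \<omega> - euler n k \<omega>\<bar>) \<le> e / 2"
          apply (rule euler_converges[OF e2 t Y'(3)])
          subgoal premises prems for n0
            apply (rule prems(1)[of n0])
            subgoal premises q for n Y I \<rho> k by (rule prems(2)[OF q])
            done
          done
        have "expectation (\<lambda>\<omega>. \<bar>?V k \<omega>\<bar>) < e" if k: "max n0 m \<le> k" for k
        proof -
          have n: "n0 \<le> ns k" "m \<le> ns k" using k ns[of k] by auto
          have tk: "t = real (j * 2 ^ (ns k - m)) / 2 ^ ns k" unfolding t_def by (rule dyadic_refine[OF n(2)])
          have "expectation (\<lambda>\<omega>. \<bar>Y' t \<omega> - euler (ns k) (j * 2 ^ (ns k - m)) \<omega>\<bar>) \<le> e / 2"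
            using n0[OF n(1) Y'(1), of "j * 2 ^ (ns k - m)"] unfolding tk[symmetric] by simp
          moreover have "euler_process (ns k) t \<omega> = euler (ns k) (j * 2 ^ (ns k - m)) \<omega>" for \<omega>
            unfolding tk by (rule euler_process_grid)
          ultimately show ?thesis using e by (simp add: abs_minus_commute)
        qed
        moreover have "0 \<le> expectation (\<lambda>\<omega>. \<bar>?V k \<omega>\<bar>)" for k by (intro integral_nonneg_AE) auto
        ultimately show "\<exists>N. \<forall>k\<ge>N. norm (expectation (\<lambda>\<omega>. \<bar>?V k \<omega>\<bar>) - 0) < e"
          by (intro exI[of _ "max n0 m"]) auto
      qed
      have Xm: "X t \<in> borel_measurable M" using XF t F_measurable[of "X t" t] by (simp add: adapted_def)
      have "tendsto_in_prob M (\<lambda>k. euler_process (ns k) t) (X t)"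
        by (rule tendsto_in_prob_AE[OF euler_process_measurable[OF t] Xm lim[OF t]])
      from tendsto_in_prob_diff_const[OF this sq_int_measurable[OF Y's]]
      have tp: "tendsto_in_prob M ?V (\<lambda>\<omega>. X t \<omega> - Y' t \<omega>)" .
      have ca: "continuous_on UNIV (\<lambda>x::real. \<bar>x\<bar>)" by (intro continuous_intros)
      have i: "integrable M (\<lambda>\<omega>. \<bar>?V k \<omega>\<bar>)" for k using sq_int_integrable[OF Vs] by simp
      \<comment> \<open>The polygons tend to Y' in mean and to X almost surely; Fatou for the
        absolute value makes the mean distance of X and Y' vanish.\<close>
      note fa = fatou_in_prob[OF tp ca abs_ge_zero i order_refl c]
      have "expectation (\<lambda>\<omega>. \<bar>X t \<omega> - Y' t \<omega>\<bar>) = 0"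
        using fa(2) by (intro antisym integral_nonneg_AE) auto
      then have "AE \<omega> in M. \<bar>X t \<omega> - Y' t \<omega>\<bar> = 0"
        using integral_nonneg_eq_0_iff_AE[OF fa(1)] by simp
      with Y'(2) show ?thesis unfolding t_def[symmetric] by eventually_elim (use t in auto)
    qed
    have "AE \<omega> in M. \<forall>m j. X (real j / 2 ^ m) \<omega> = Y (real j / 2 ^ m) \<omega>"
      unfolding AE_all_countable using eq by blast
    moreover have "AE \<omega> in M. continuous_on {0..} (\<lambda>t. Y t \<omega>)" using Y by (simp add: sde_solution_def continuous_paths_def)
    moreover have "AE \<omega> in M. continuous_on {0..} (\<lambda>t. X t \<omega>)" using Xc by (rule AE_I2)
    ultimately show ?thesis
      unfolding indistinguishable_def
    proof eventually_elim
      case (elim \<omega>)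
      show ?case
      proof (intro allI impI)
        fix t :: real assume t: "0 \<le> t"
        have X: "(\<lambda>l. X (dyadic_left l t) \<omega>) \<longlonglongrightarrow> X t \<omega>" and Y: "(\<lambda>l. Y (dyadic_left l t) \<omega>) \<longlonglongrightarrow> Y t \<omega>"
          by (rule continuous_on_tendsto_compose[OF _ dyadic_left_tendsto[OF t]], use elim t dyadic_left_bounds(1)[OF t] in auto)+
        have "X (dyadic_left l t) \<omega> = Y (dyadic_left l t) \<omega>" for l unfolding dyadic_left_def using elim by blast
        with X have "(\<lambda>l. Y (dyadic_left l t) \<omega>) \<longlonglongrightarrow> X t \<omega>" by simp
        with Y show "X t \<omega> = Y t \<omega>" by (rule LIMSEQ_unique[rotated])
      qed
    qed
  qed
  with X show ?thesis unfolding has_unique_strong_solution_def by blast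
qed

end

section \<open>The truncated square-root equation\<close>

lemma sqrt_diff_square_le:
  assumes "0 \<le> u" "0 \<le> v"
  shows "(sqrt u - sqrt v)\<^sup>2 \<le> \<bar>u - v\<bar>"
proof -
  have p: "0 \<le> sqrt u" "0 \<le> sqrt v" using assms by auto
  have "(sqrt u - sqrt v)\<^sup>2 = \<bar>sqrt u - sqrt v\<bar> * \<bar>sqrt u - sqrt v\<bar>"
    by (simp add: power2_eq_square)
  \<comment> \<open>One factor is enlarged from the difference of the roots to their sum, which
    completes the product to \<open>u - v\<close>.\<close>
  also have "\<dots> \<le> \<bar>sqrt u - sqrt v\<bar> * \<bar>sqrt u + sqrt v\<bar>"
    using p by (intro mult_left_mono) linarith+
  also have "\<dots> = \<bar>(sqrt u)\<^sup>2 - (sqrt v)\<^sup>2\<bar>"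
    unfolding power2_eq_square square_diff_square_factored by (simp add: abs_mult mult.commute)
  finally show ?thesis using assms by simp
qed

text \<open>Truncation at C keeps the drift decreasing and 1-Lipschitz and bounds the diffusion
  coefficient by \<open>\<sigma> * sqrt C\<close>; the square root is Hoelder of exponent 1/2 by
  \<open>sqrt_diff_square_le\<close>. So the equation is an instance of
  \<open>monotone_sde\<close>.\<close>

theorem lemma2p1:
  fixes M :: "'a measure" and F :: "real \<Rightarrow> 'a measure" and W :: "real \<Rightarrow> 'a \<Rightarrow> real"
    and b \<sigma> x\<^sub>0 C :: real
  assumes "complete_filtered_prob_space M F"
    and "wiener_process M F W"
    and "b > 0" and "\<sigma> > 0" and "x\<^sub>0 > 0" and "\<sigma>\<^sup>2 \<le> 2 * b"
    and "C > 0"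
  shows "has_unique_strong_solution M F W
    (\<lambda>x. b - min x C) (\<lambda>x. \<sigma> * sqrt (min (max x 0) C)) x\<^sub>0"
proof -
  interpret wiener_space M F W
    using assms(1,2) by (intro wiener_space.intro wiener_space_axioms.intro)
  \<comment> \<open>One summand for each bound that the locale demands: Lipschitz constant 1, drift
    b at 0, Hoelder constant \<open>\<sigma>\<^sup>2\<close> and supremum
    \<open>\<sigma> * sqrt C\<close>.\<close>
  define G where "G = 1 + b + \<sigma>\<^sup>2 + \<sigma> * sqrt C"
  have \<sigma>C: "0 \<le> \<sigma> * sqrt C" using assms by simp
  have G: "1 \<le> G" "b \<le> G" "\<sigma>\<^sup>2 \<le> G" "\<sigma> * sqrt C \<le> G"
    using assms \<sigma>C unfolding G_def by simp_all
  interpret monotone_sde M F W "\<lambda>x. b - min x C" "\<lambda>x. \<sigma> * sqrt (min (max x 0) C)" G x\<^sub>0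
  proof unfold_locales
    fix x y :: real
    show "b - min y C \<le> b - min x C" if "x \<le> y" using that by simp
    have "\<bar>(b - min x C) - (b - min y C)\<bar> \<le> 1 * \<bar>x - y\<bar>" by (auto simp: min_def abs_if)
    also have "\<dots> \<le> G * \<bar>x - y\<bar>" using G(1) by (intro mult_right_mono) auto
    finally show "\<bar>(b - min x C) - (b - min y C)\<bar> \<le> G * \<bar>x - y\<bar>" .
    show "\<bar>b - min 0 C\<bar> \<le> G" using G(2) assms by simp
    have "\<sigma> * sqrt (min (max x 0) C) \<le> \<sigma> * sqrt C" using assms by (intro mult_left_mono) auto
    moreover have "0 \<le> \<sigma> * sqrt (min (max x 0) C)" using assms by (intro mult_nonneg_nonneg) auto
    ultimately show "\<bar>\<sigma> * sqrt (min (max x 0) C)\<bar> \<le> G" using G(4) by linarith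
    let ?u = "min (max x 0) C" and ?v = "min (max y 0) C"
    have "(sqrt ?u - sqrt ?v)\<^sup>2 \<le> \<bar>?u - ?v\<bar>"
      using assms by (intro sqrt_diff_square_le) auto
    also have "\<dots> \<le> \<bar>x - y\<bar>" by (auto simp: min_def max_def abs_if)
    finally have "\<sigma>\<^sup>2 * (sqrt ?u - sqrt ?v)\<^sup>2 \<le> \<sigma>\<^sup>2 * \<bar>x - y\<bar>"
      by (intro mult_left_mono) auto
    also have "\<dots> \<le> G * \<bar>x - y\<bar>" using G(3) by (intro mult_right_mono) auto
    finally show "(\<sigma> * sqrt ?u - \<sigma> * sqrt ?v)\<^sup>2 \<le> G * \<bar>x - y\<bar>"
      by (simp add: power_mult_distrib[symmetric] right_diff_distrib)
  qed (use G(1) in auto)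
  show ?thesis by (rule unique_strong_solution)
qed

end
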